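(* Let $m_1,\dots,m_n$ be non-negative integers, not all zero, and let $A=A(m_1,\dots,m_n)$ be the basic Gorenstein tiled order over $R=k[x]$ with exponent matrix $[d(i,j)]_{1\le i,j\le n}$ given by $d(i,i)=0$, $d(i,j)=\sum_{l=i}^{j-1}m_l$ if $i<j$, and $d(i,j)=\sum_{l=i}^{n}m_l+\sum_{l=1}^{j-1}m_l$ if $i>j$. Then the algebra $\Gamma_A$ has global dimension less than or equal to $2$.
   Context: Let $k$ be a field, $R=k[x]$, $K=k[x,x^{-1}]$, graded by $\deg x=1$. Modules are right modules. For a $\mathbb{Z}$-graded vector space $M$, $M(1)_n=M_{n+1}$ and $M_{\ge 0}=\bigoplus_{n\ge 0}M_n$. A tiled order (over $R$) of size $n\geq 1$ is an $R$-subalgebra $A=[Rx^{d(i,j)}]_{1\le i,j\le n}\subseteq \mathrm{M}_n(K)$ with integers $d(i,j)$ satisfying $d(i,i)=0$ and $d(i,l)+d(l,j)\ge d(i,j)$ for all $i,j,l$; $[d(i,j)]$ is its exponent matrix. It is $\mathbb{Z}$-graded by $\mathrm{M}_n(K)_j=\mathrm{M}_n(k)x^j$; it is $\mathbb{N}$-graded iff all $d(i,j)\ge 0$, and basic iff $d(i,j)+d(j,i)>0$ for all $i\ne j$. Let $e_i$ be the diagonal matrix units and put $\mathbb{I}=\{1,\dots,n\}$. A basic tiled order is Gorenstein iff there is a (unique) bijection $\nu:\mathbb{I}\to\mathbb{I}$ with $d(\nu i,j)+d(j,i)=d(\nu i,i)$ for all $i,j\in\mathbb{I}$. Put $p_i=1-d(\nu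 i,i)$. $\mathrm{CM}^{\mathbb{Z}}A$ is the Frobenius category of finitely generated graded $A$-modules that are projective over $R$, with degree-$0$ homomorphisms, and $\underline{\mathrm{CM}}^{\mathbb{Z}}A$ is its stable category (modulo maps factoring through graded projectives). For $A$ basic $\mathbb{N}$-graded Gorenstein put $V=[R\ \cdots\ R]\oplus\bigoplus_{i\in\mathbb{I}}\bigoplus_{j=1}^{-p_i}e_{\nu i}A(j)_{\ge 0}$ ($n$ entries in the row module $[R\ \cdots\ R]$; empty sums are zero) and $\Gamma_A=\mathrm{End}_{\underline{\mathrm{CM}}^{\mathbb{Z}}A}(V)$. *)

theory Defs
  imports
    "Jordan_Normal_Form.Matrix"
    "HOL-Algebra.QuotRing"
    "HOL-Library.Poly_Mapping"
    "HOL-Library.Extended_Nat"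
    "HOL-Library.FSet"
begin

section \<open>Right modules, projective dimension, global dimension\<close>

text \<open>The record \<open>module\<close> of HOL-Algebra is reused for right modules over arbitrary rings:
  the term \<open>a \<odot>\<^bsub>M\<^esub> m\<close> stands for the right action \<open>m\<cdot>a\<close>, hence the order of the factors in
  the associativity law below. The multiplicative fields of the record carry no meaning.\<close>

locale right_module = R?: ring R + M?: abelian_group M
  for R :: "('a, 'x) ring_scheme" and M :: "('a, 'b, 'y) module_scheme" (structure) +
  assumes act_closed: "\<lbrakk>a \<in> carrier R; m \<in> carrier M\<rbrakk> \<Longrightarrow> a \<odot>\<^bsub>M\<^esub> m \<in> carrier M"
    and act_add_scalar: "\<lbrakk>a \<in> carrier R; b \<in> carrier R; m \<in> carrier M\<rbrakk>
          \<Longrightarrow> (a \<oplus>\<^bsub>R\<^esub> b) \<odot>\<^bsub>M\<^esub> m = a \<odot>\<^bsub>M\<^esub> m \<oplus>\<^bsub>M\<^esub> b \<odot>\<^bsub>M\<^esub> m"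
    and act_add: "\<lbrakk>a \<in> carrier R; m \<in> carrier M; m' \<in> carrier M\<rbrakk>
          \<Longrightarrow> a \<odot>\<^bsub>M\<^esub> (m \<oplus>\<^bsub>M\<^esub> m') = a \<odot>\<^bsub>M\<^esub> m \<oplus>\<^bsub>M\<^esub> a \<odot>\<^bsub>M\<^esub> m'"
    and act_mult: "\<lbrakk>a \<in> carrier R; b \<in> carrier R; m \<in> carrier M\<rbrakk>
          \<Longrightarrow> (a \<otimes>\<^bsub>R\<^esub> b) \<odot>\<^bsub>M\<^esub> m = b \<odot>\<^bsub>M\<^esub> (a \<odot>\<^bsub>M\<^esub> m)"
    and act_one: "m \<in> carrier M \<Longrightarrow> \<one>\<^bsub>R\<^esub> \<odot>\<^bsub>M\<^esub> m = m"

definition rhom ::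
  "('a, 'x) ring_scheme \<Rightarrow> ('a, 'b, 'y) module_scheme \<Rightarrow> ('a, 'c, 'z) module_scheme \<Rightarrow> ('b \<Rightarrow> 'c) set"
  where "rhom R M N = {f \<in> carrier M \<rightarrow>\<^sub>E carrier N.
      (\<forall>m\<in>carrier M. \<forall>m'\<in>carrier M. f (m \<oplus>\<^bsub>M\<^esub> m') = f m \<oplus>\<^bsub>N\<^esub> f m') \<and>
      (\<forall>a\<in>carrier R. \<forall>m\<in>carrier M. f (a \<odot>\<^bsub>M\<^esub> m) = a \<odot>\<^bsub>N\<^esub> f m)}"

definition free_rmodule :: "('a, 'x) ring_scheme \<Rightarrow> 'i set \<Rightarrow> ('a, 'i \<Rightarrow> 'a) module"
  where "free_rmodule R X =
    \<lparr>carrier = {f. (\<forall>x. f x \<in> carrier R) \<and> (\<forall>x. x \<notin> X \<longrightarrow> f x = \<zero>\<^bsub>R\<^esub>) \<and> finite {x. f x \<noteq> \<zero>\<^bsub>R\<^esub>}},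
     mult = undefined, one = undefined,
     zero = (\<lambda>x. \<zero>\<^bsub>R\<^esub>), add = (\<lambda>f g x. f x \<oplus>\<^bsub>R\<^esub> g x),
     smult = (\<lambda>a f x. f x \<otimes>\<^bsub>R\<^esub> a)\<rparr>"

text \<open>Projective: direct summand of a free module. Bases inside the type \<open>'b\<close> of the elements
  of \<open>P\<close> suffice, since \<open>P\<close> is a quotient of the free module on \<open>carrier P\<close>.\<close>

definition projective_rmodule :: "('a, 'x) ring_scheme \<Rightarrow> ('a, 'b, 'y) module_scheme \<Rightarrow> bool"
  where "projective_rmodule R P \<longleftrightarrow> right_module R P \<and>
    (\<exists>(X :: 'b set) i p. i \<in> rhom R P (free_rmodule R X) \<and> p \<in> rhom R (free_rmodule R X) P \<and>
       (\<forall>m\<in>carrier P. p (i m) = m))"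

text \<open>The modules of a projective resolution of a module with elements in \<open>'m\<close> are taken with
  elements in the following type, which contains \<open>'m\<close> and is closed under forming free modules (a finitely
  supported function \<open>f\<close> on it is encoded by \<open>Comb\<close> applied to the finite set of all \<open>(x, f x)\<close>
  with \<open>f x \<noteq> 0\<close>). Hence every module has a resolution by iterated free covers within
  this type, and every projective resolution can be replaced, without increasing its length,
  by one within this type.\<close>

datatype ('r, 'm) formal_comb = Gen 'm | Comb "(('r, 'm) formal_comb \<times> 'r) fset"

text \<open>A projective resolution \<open>\<dots> \<rightarrow> P 1 \<rightarrow> P 0 \<rightarrow> M \<rightarrow> 0\<close> with \<open>P i = 0\<close> for \<open>i > l\<close>;
  \<open>\<delta> i\<close> is the differential from \<open>P (i + 1)\<close> to \<open>P i\<close> and \<open>\<epsilon>\<close> the augmentation.\<close>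

definition has_proj_resolution ::
  "('r, 'x) ring_scheme \<Rightarrow> ('r, 'm, 'y) module_scheme \<Rightarrow> nat \<Rightarrow> bool"
  where "has_proj_resolution R M l \<longleftrightarrow>
    (\<exists>(P :: nat \<Rightarrow> ('r, ('r, 'm) formal_comb) module) \<delta> \<epsilon>.
       (\<forall>i. projective_rmodule R (P i)) \<and>
       (\<forall>i>l. carrier (P i) = {\<zero>\<^bsub>P i\<^esub>}) \<and>
       \<epsilon> \<in> rhom R (P 0) M \<and> (\<forall>i. \<delta> i \<in> rhom R (P (Suc i)) (P i)) \<and>
       \<epsilon> ` carrier (P 0) = carrier M \<and>
       \<delta> 0 ` carrier (P 1) = {u \<in> carrier (P 0). \<epsilon> u = \<zero>\<^bsub>M\<^esub>} \<and>
       (\<forall>i. \<delta> (Suc i) ` carrier (P (Suc (Suc i))) = {u \<in> carrier (P (Suc i)). \<delta> i u = \<zero>\<^bsub>P i\<^esub>}))"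

definition proj_dim :: "('r, 'x) ring_scheme \<Rightarrow> ('r, 'm, 'y) module_scheme \<Rightarrow> enat"
  where "proj_dim R M = Inf (enat ` {l. has_proj_resolution R M l})"

text \<open>Right global dimension, as seen by the modules with elements in the type \<open>'m\<close>; it is to be
  used with an arbitrary type \<open>'m\<close>.\<close>

definition gl_dim :: "'m itself \<Rightarrow> ('r, 'x) ring_scheme \<Rightarrow> enat"
  where "gl_dim _ R = (SUP M \<in> {M :: ('r, 'm) module. right_module R M}. proj_dim R M)"


section \<open>Graded modules\<close>

record 'a graded_ring = "'a ring" +
  rcomp :: "int \<Rightarrow> 'a set"

record ('a, 'b) graded_module = "('a, 'b) module" +
  mcomp :: "int \<Rightarrow> 'b set"

locale graded_right_module = right_module A M
  for A :: "('a, 'x) graded_ring_scheme" and M :: "('a, 'b, 'y) graded_module_scheme" (structure) +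
  assumes comp_subgroup: "additive_subgroup (mcomp M i) M"
    and decomposition: "m \<in> carrier M \<Longrightarrow>
      \<exists>!f. (\<forall>i. f i \<in> mcomp M i) \<and> finite {i. f i \<noteq> \<zero>\<^bsub>M\<^esub>} \<and> m = finsum M f {i. f i \<noteq> \<zero>\<^bsub>M\<^esub>}"
    and act_comp: "\<lbrakk>m \<in> mcomp M i; a \<in> rcomp A j\<rbrakk> \<Longrightarrow> a \<odot>\<^bsub>M\<^esub> m \<in> mcomp M (i + j)"

definition ghom ::
  "('a, 'x) graded_ring_scheme \<Rightarrow> ('a, 'b, 'y) graded_module_scheme \<Rightarrow>
   ('a, 'c, 'z) graded_module_scheme \<Rightarrow> ('b \<Rightarrow> 'c) set"
  where "ghom A M N = {f \<in> rhom A M N. \<forall>i. f ` mcomp M i \<subseteq> mcomp N i}"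

definition fin_gen :: "('a, 'x) ring_scheme \<Rightarrow> ('a, 'b, 'y) module_scheme \<Rightarrow> bool"
  where "fin_gen R M \<longleftrightarrow> (\<exists>S. finite S \<and> S \<subseteq> carrier M \<and>
    (\<forall>m\<in>carrier M. \<exists>c \<in> S \<rightarrow> carrier R. m = (\<Oplus>\<^bsub>M\<^esub>s\<in>S. c s \<odot>\<^bsub>M\<^esub> s)))"

definition regular_gmod :: "('a, 'x) graded_ring_scheme \<Rightarrow> ('a, 'a) graded_module"
  where "regular_gmod A = \<lparr>carrier = carrier A, mult = undefined, one = undefined,
     zero = \<zero>\<^bsub>A\<^esub>, add = add A, smult = (\<lambda>a m. m \<otimes>\<^bsub>A\<^esub> a), mcomp = rcomp A\<rparr>"

definition gshift :: "int \<Rightarrow> ('a, 'b) graded_module \<Rightarrow> ('a, 'b) graded_module"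
  where "gshift j M = M\<lparr>mcomp := (\<lambda>i. mcomp M (i + j))\<rparr>"

definition gtrunc :: "('a, 'b) graded_module \<Rightarrow> ('a, 'b) graded_module"
  where "gtrunc M = M\<lparr>
     carrier := {finsum M f I | f I. finite I \<and> I \<subseteq> {0..} \<and> (\<forall>i\<in>I. f i \<in> mcomp M i)},
     mcomp := (\<lambda>i. if i \<ge> 0 then mcomp M i else {\<zero>\<^bsub>M\<^esub>})\<rparr>"

text \<open>Direct sum; only used for finite index sets \<open>I\<close>.\<close>

definition gdsum :: "'i set \<Rightarrow> ('i \<Rightarrow> ('a, 'b) graded_module) \<Rightarrow> ('a, 'i \<Rightarrow> 'b) graded_module"
  where "gdsum I M = \<lparr>carrier = (\<Pi>\<^sub>E t\<in>I. carrier (M t)), mult = undefined, one = undefined,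
     zero = (\<lambda>t\<in>I. \<zero>\<^bsub>M t\<^esub>), add = (\<lambda>f g. \<lambda>t\<in>I. f t \<oplus>\<^bsub>M t\<^esub> g t),
     smult = (\<lambda>a f. \<lambda>t\<in>I. a \<odot>\<^bsub>M t\<^esub> f t),
     mcomp = (\<lambda>i. \<Pi>\<^sub>E t\<in>I. mcomp (M t) i)\<rparr>"

text \<open>Finitely generated graded projective modules: graded direct summands of finite direct sums
  of shifts of the graded ring.\<close>

definition graded_projective :: "('a, 'x) graded_ring_scheme \<Rightarrow> ('a, 'b, 'y) graded_module_scheme \<Rightarrow> bool"
  where "graded_projective A P \<longleftrightarrow> graded_right_module A P \<and>
    (\<exists>(r :: nat) j. let F = gdsum {..<r} (\<lambda>s. gshift (j s) (regular_gmod A)) in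
       \<exists>i \<in> ghom A P F. \<exists>p \<in> ghom A F P. \<forall>m\<in>carrier P. p (i m) = m)"

definition gEnd :: "('a, 'x) graded_ring_scheme \<Rightarrow> ('a, 'b, 'y) graded_module_scheme \<Rightarrow> ('b \<Rightarrow> 'b) ring"
  where "gEnd A M = \<lparr>carrier = ghom A M M,
     mult = (\<lambda>f g. compose (carrier M) f g), one = (\<lambda>m\<in>carrier M. m),
     zero = (\<lambda>m\<in>carrier M. \<zero>\<^bsub>M\<^esub>), add = (\<lambda>f g. \<lambda>m\<in>carrier M. f m \<oplus>\<^bsub>M\<^esub> g m)\<rparr>"


section \<open>Tiled orders\<close>

text \<open>\<open>K = k[x, x\<^sup>-\<^sup>1]\<close> is the group algebra of the integers; \<open>x\<^sup>j\<close> is \<open>single j 1\<close>.\<close>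

type_synonym 'k laurent = "int \<Rightarrow>\<^sub>0 'k"

definition polyR :: "'k::field laurent set"
  where "polyR = {p. \<forall>j<0. Poly_Mapping.lookup p j = 0}"

definition polyR_ring :: "'k::field laurent ring"
  where "polyR_ring = \<lparr>carrier = polyR, mult = (*), one = 1, zero = 0, add = (+)\<rparr>"

definition Rx :: "int \<Rightarrow> 'k::field laurent set"
  where "Rx a = (\<lambda>p. p * Poly_Mapping.single a 1) ` polyR"

text \<open>\<open>M(k) x\<^sup>j\<close>, for \<open>r \<times> c\<close> matrices:\<close>

definition mat_comp :: "nat \<Rightarrow> nat \<Rightarrow> int \<Rightarrow> 'k::field laurent mat set"
  where "mat_comp r c j = map_mat (\<lambda>a. Poly_Mapping.single j a) ` carrier_mat r c"

text \<open>Rows and columns are indexed by \<open>{0..<n}\<close> instead of \<open>{1..n}\<close>.\<close>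

definition exponent_matrix :: "nat \<Rightarrow> (nat \<Rightarrow> nat \<Rightarrow> int) \<Rightarrow> bool"
  where "exponent_matrix n d \<longleftrightarrow> n \<ge> 1 \<and> (\<forall>i<n. d i i = 0) \<and>
     (\<forall>i<n. \<forall>l<n. \<forall>j<n. d i l + d l j \<ge> d i j)"

definition basic_exponent :: "nat \<Rightarrow> (nat \<Rightarrow> nat \<Rightarrow> int) \<Rightarrow> bool"
  where "basic_exponent n d \<longleftrightarrow> (\<forall>i<n. \<forall>j<n. i \<noteq> j \<longrightarrow> d i j + d j i > 0)"

definition is_nakayama :: "nat \<Rightarrow> (nat \<Rightarrow> nat \<Rightarrow> int) \<Rightarrow> (nat \<Rightarrow> nat) \<Rightarrow> bool"
  where "is_nakayama n d \<nu> \<longleftrightarrow> bij_betw \<nu> {..<n} {..<n} \<and>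
     (\<forall>i<n. \<forall>j<n. d (\<nu> i) j + d j i = d (\<nu> i) i)"

definition gorenstein_exponent :: "nat \<Rightarrow> (nat \<Rightarrow> nat \<Rightarrow> int) \<Rightarrow> bool"
  where "gorenstein_exponent n d \<longleftrightarrow> (\<exists>\<nu>. is_nakayama n d \<nu>)"

definition nakayama :: "nat \<Rightarrow> (nat \<Rightarrow> nat \<Rightarrow> int) \<Rightarrow> nat \<Rightarrow> nat"
  where "nakayama n d = (THE \<nu>. \<nu> \<in> extensional {..<n} \<and> is_nakayama n d \<nu>)"

definition gor_param :: "nat \<Rightarrow> (nat \<Rightarrow> nat \<Rightarrow> int) \<Rightarrow> nat \<Rightarrow> int"
  where "gor_param n d i = 1 - d (nakayama n d i) i"

definition tiled_order :: "nat \<Rightarrow> (nat \<Rightarrow> nat \<Rightarrow> int) \<Rightarrow> 'k::field laurent mat graded_ring"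
  where "tiled_order n d =
    (let C = {X \<in> carrier_mat n n. \<forall>i<n. \<forall>j<n. X $$ (i, j) \<in> Rx (d i j)} in
     \<lparr>carrier = C, mult = (*), one = 1\<^sub>m n, zero = 0\<^sub>m n n, add = (+),
      rcomp = (\<lambda>j. C \<inter> mat_comp n n j)\<rparr>)"

definition diag_unit :: "nat \<Rightarrow> nat \<Rightarrow> 'k::field laurent mat"
  where "diag_unit n i = mat n n (\<lambda>(a, b). if a = i \<and> b = i then 1 else 0)"

definition idem_proj ::
  "nat \<Rightarrow> (nat \<Rightarrow> nat \<Rightarrow> int) \<Rightarrow> nat \<Rightarrow> ('k::field laurent mat, 'k laurent mat) graded_module"
  where "idem_proj n d i =
    (let A = tiled_order n d; C = (\<lambda>X. diag_unit n i * X) ` carrier A in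
     (regular_gmod A)\<lparr>carrier := C, mcomp := (\<lambda>j. C \<inter> rcomp A j)\<rparr>)"

definition row_module :: "nat \<Rightarrow> ('k::field laurent mat, 'k laurent mat) graded_module"
  where "row_module n =
    (let C = {v \<in> carrier_mat 1 n. \<forall>j<n. v $$ (0, j) \<in> polyR} in
     \<lparr>carrier = C, mult = undefined, one = undefined, zero = 0\<^sub>m 1 n, add = (+),
      smult = (\<lambda>X v. v * X), mcomp = (\<lambda>j. C \<inter> mat_comp 1 n j)\<rparr>)"


section \<open>Cohen-Macaulay modules, the stable category, and the algebra\<close>

text \<open>A module over the tiled order is a module over \<open>R = k[x]\<close> via the scalar matrices.\<close>

definition restrict_R :: "nat \<Rightarrow> ('k::field laurent mat, 'b, 'y) module_scheme \<Rightarrow> ('k laurent, 'b) module"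
  where "restrict_R n M = \<lparr>carrier = carrier M, mult = undefined, one = undefined,
     zero = \<zero>\<^bsub>M\<^esub>, add = add M, smult = (\<lambda>p m. (p \<cdot>\<^sub>m 1\<^sub>m n) \<odot>\<^bsub>M\<^esub> m)\<rparr>"

definition CM :: "nat \<Rightarrow> (nat \<Rightarrow> nat \<Rightarrow> int) \<Rightarrow> ('k::field laurent mat, 'b) graded_module \<Rightarrow> bool"
  where "CM n d M \<longleftrightarrow> graded_right_module (tiled_order n d) M \<and> fin_gen (tiled_order n d) M \<and>
     projective_rmodule polyR_ring (restrict_R n M)"

text \<open>Endomorphisms in \<open>CM\<close> factoring through a graded projective. Every finitely generated graded
  projective module is isomorphic to a submodule of a finite direct sum of shifts of the order,
  so the elements of \<open>P\<close> may be taken in \<open>nat \<Rightarrow> 'k laurent mat\<close>.\<close>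

definition proj_null ::
  "nat \<Rightarrow> (nat \<Rightarrow> nat \<Rightarrow> int) \<Rightarrow> ('k::field laurent mat, 'b) graded_module \<Rightarrow> ('b \<Rightarrow> 'b) set"
  where "proj_null n d M =
    {f \<in> ghom (tiled_order n d) M M.
       \<exists>(P :: ('k laurent mat, nat \<Rightarrow> 'k laurent mat) graded_module).
         CM n d P \<and> graded_projective (tiled_order n d) P \<and>
         (\<exists>g \<in> ghom (tiled_order n d) M P. \<exists>h \<in> ghom (tiled_order n d) P M.
            f = compose (carrier M) h g)}"

definition stable_End ::
  "nat \<Rightarrow> (nat \<Rightarrow> nat \<Rightarrow> int) \<Rightarrow> ('k::field laurent mat, 'b) graded_module \<Rightarrow> ('b \<Rightarrow> 'b) set ring"
  where "stable_End n d M = gEnd (tiled_order n d) M Quot proj_null n d M"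

text \<open>The index \<open>None\<close> is the summand \<open>[R \<dots> R]\<close>; \<open>Some (i, j)\<close> is the summand
  \<open>e\<^bsub>\<nu> i\<^esub>A(j)\<^sub>\<ge>\<^sub>0\<close>.\<close>

definition tilting_V ::
  "nat \<Rightarrow> (nat \<Rightarrow> nat \<Rightarrow> int) \<Rightarrow> ('k::field laurent mat, (nat \<times> int) option \<Rightarrow> 'k laurent mat) graded_module"
  where "tilting_V n d =
    gdsum (insert None (Some ` (SIGMA i:{..<n}. {1..- gor_param n d i})))
      (\<lambda>t. case t of None \<Rightarrow> row_module n
         | Some (i, j) \<Rightarrow> gtrunc (gshift j (idem_proj n d (nakayama n d i))))"

definition Gamma_alg ::
  "'k::field itself \<Rightarrow> nat \<Rightarrow> (nat \<Rightarrow> nat \<Rightarrow> int) \<Rightarrow>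
   (((nat \<times> int) option \<Rightarrow> 'k laurent mat) \<Rightarrow> ((nat \<times> int) option \<Rightarrow> 'k laurent mat)) set ring"
  where "Gamma_alg _ n d = stable_End n d (tilting_V n d)"


section \<open>The orders \<open>A(m\<^sub>1, \<dots>, m\<^sub>n)\<close>\<close>

text \<open>With indices shifted to start at 0, the parameters are \<open>m 0, \<dots>, m (n - 1)\<close>.\<close>

definition cyc_exponent :: "nat \<Rightarrow> (nat \<Rightarrow> nat) \<Rightarrow> nat \<Rightarrow> nat \<Rightarrow> int"
  where "cyc_exponent n m i j =
    (if i = j then 0
     else if i < j then int (\<Sum>l = i..<j. m l)
     else int ((\<Sum>l = i..<n. m l) + (\<Sum>l = 0..<j. m l)))"

lemma cyc_exponent_partial_sums:
  assumes "i < n" "j < n"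
  shows "cyc_exponent n m i j =
    (\<Sum>l<j. int (m l)) - (\<Sum>l<i. int (m l)) + (if i \<le> j then 0 else (\<Sum>l<n. int (m l)))"
proof -
  have split: "(\<Sum>l<b. int (m l)) = (\<Sum>l<a. int (m l)) + (\<Sum>l = a..<b. int (m l))" if "a \<le> b" for a b
    using sum.atLeastLessThan_concat[of 0 a b "\<lambda>l. int (m l)"] that
    by (simp add: lessThan_atLeast0)
  consider "i = j" | "i < j" | "j < i" by linarith
  then show ?thesis
  proof cases
    case 2
    then have "cyc_exponent n m i j = (\<Sum>l = i..<j. int (m l))" by (simp add: cyc_exponent_def)
    with split[OF less_imp_le[OF 2]] 2 show ?thesis by simp
  next
    case 3
    then have "cyc_exponent n m i j = (\<Sum>l = i..<n. int (m l)) + (\<Sum>l<j. int (m l))"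
      by (simp add: cyc_exponent_def atLeast0LessThan)
    with split[OF less_imp_le[OF assms(1)]] 3 show ?thesis by simp
  qed (simp add: cyc_exponent_def)
qed

lemma cyc_exponent_matrix:
  assumes "n \<ge> 1"
  shows "exponent_matrix n (cyc_exponent n m)"
  unfolding exponent_matrix_def
proof (intro conjI allI impI)
  fix i l j assume *: "i < n" "l < n" "j < n"
  have "(\<Sum>l<n. int (m l)) \<ge> 0" by (simp add: sum_nonneg)
  then show "cyc_exponent n m i l + cyc_exponent n m l j \<ge> cyc_exponent n m i j"
    using * by (auto simp: cyc_exponent_partial_sums)
qed (use assms in \<open>auto simp: cyc_exponent_def\<close>)

lemma cyc_exponent_nonneg: "cyc_exponent n m i j \<ge> 0"
  by (simp add: cyc_exponent_def del: of_nat_sum of_nat_add)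

lemma cyc_exponent_basic:
  assumes "\<exists>i<n. m i \<noteq> 0"
  shows "basic_exponent n (cyc_exponent n m)"
proof -
  obtain a where a: "a < n" "m a > 0" using assms by auto
  then have "(\<Sum>l<n. int (m l)) > 0" by (auto intro!: sum_pos2[where i = a])
  then show ?thesis by (auto simp: basic_exponent_def cyc_exponent_partial_sums)
qed

lemma cyc_exponent_nakayama:
  "is_nakayama n (cyc_exponent n m) (\<lambda>i. if Suc i < n then Suc i else 0)" (is "is_nakayama n _ ?\<nu>")
  unfolding is_nakayama_def
proof
  have inj: "inj_on ?\<nu> {..<n}" by (auto simp: inj_on_def)
  have "?\<nu> ` {..<n} = {..<n}" by (rule endo_inj_surj[OF _ _ inj]) auto
  with inj show "bij_betw ?\<nu> {..<n} {..<n}" by (simp add: bij_betw_def)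
  show "\<forall>i<n. \<forall>j<n. cyc_exponent n m (?\<nu> i) j + cyc_exponent n m j i = cyc_exponent n m (?\<nu> i) i"
    by (auto simp: cyc_exponent_partial_sums)
qed

lemma nakayama_unique:
  assumes "basic_exponent n d" "exponent_matrix n d" "is_nakayama n d \<nu>"
  shows "nakayama n d = restrict \<nu> {..<n}"
proof -
  have lt: "\<rho> i < n" if "is_nakayama n d \<rho>" "i < n" for \<rho> i
    using that by (auto simp: is_nakayama_def bij_betw_def)
  have uniq: "\<rho> i = \<sigma> i" if \<rho>: "is_nakayama n d \<rho>" and \<sigma>: "is_nakayama n d \<sigma>" and i: "i < n" for \<rho> \<sigma> i
  proof (rule ccontr)
    assume ne: "\<rho> i \<noteq> \<sigma> i"
    have "d (\<rho> i) (\<sigma> i) + d (\<sigma> i) i = d (\<rho> i) i" "d (\<sigma> i) (\<rho> i) + d (\<rho> i) i = d (\<sigma> i) i"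
    proof -
      have 1: "d (\<rho> i) j + d j i = d (\<rho> i) i" "d (\<sigma> i) j + d j i = d (\<sigma> i) i" if "j < n" for j
        using \<rho> \<sigma> i that unfolding is_nakayama_def by blast+
      show "d (\<rho> i) (\<sigma> i) + d (\<sigma> i) i = d (\<rho> i) i" "d (\<sigma> i) (\<rho> i) + d (\<rho> i) i = d (\<sigma> i) i"
        using 1 lt[OF \<rho> i] lt[OF \<sigma> i] by blast+
    qed
    moreover have "d (\<rho> i) (\<sigma> i) + d (\<sigma> i) (\<rho> i) > 0"
      using assms(1) ne lt[OF \<rho> i] lt[OF \<sigma> i] unfolding basic_exponent_def by blast
    ultimately show False by linarith
  qed
  have res: "is_nakayama n d (restrict \<nu> {..<n})"
    using assms(3) bij_betw_cong[of "{..<n}" \<nu> "restrict \<nu> {..<n}" "{..<n}"]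
    by (simp add: is_nakayama_def)
  show ?thesis
    unfolding nakayama_def
  proof (rule the_equality)
    fix \<rho> assume "\<rho> \<in> extensional {..<n} \<and> is_nakayama n d \<rho>"
    then show "\<rho> = restrict \<nu> {..<n}"
      using uniq[OF _ res] by (intro extensionalityI[of _ "{..<n}"]) auto
  qed (use res in auto)
qed

lemma gorenstein_cyc_exponent: "gorenstein_exponent n (cyc_exponent n m)"
  unfolding gorenstein_exponent_def using cyc_exponent_nakayama by blast

lemma nakayama_cyc_exponent:
  assumes "\<exists>i<n. m i \<noteq> 0" and "i < n"
  shows "nakayama n (cyc_exponent n m) i = (if Suc i < n then Suc i else 0)"
  using nakayama_unique[OF cyc_exponent_basic cyc_exponent_matrix cyc_exponent_nakayama] assms
  by simp

end

theory Submission
  imports Defs "HOL-Library.Function_Algebras"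
begin

text \<open>
  Why the theorem holds: \<open>\<Gamma>\<^sub>A\<close> is the incidence algebra of a finite poset made of Young diagrams, and over such an
  algebra every module has an explicit projective resolution of length two.

  Up to a shift, every summand of \<open>V\<close> is a row module \<open>[R x\<^bsup>a\<^sub>1\<^esup> \<dots> R x\<^bsup>a\<^sub>n\<^esup>]\<close> with
  exponents \<open>a\<^sub>l \<ge> 0\<close>: all are zero for \<open>[R \<dots> R]\<close>, and \<open>a\<^sub>l = max 0 (d(\<nu> i, l) - j)\<close> for \<open>e\<^bsub>\<nu> i\<^esub>A(j)\<^sub>\<ge>\<^sub>0\<close>. A homomorphism
  of degree zero between two such modules is multiplication by a scalar, and a nonzero scalar is possible if and
  only if the exponents of the target are at most those of the source. So the endomorphism algebra of \<open>V\<close> is the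
  incidence algebra of the summands, ordered by comparing exponents (\<open>scalar_endo_ring_iso\<close>); the bottom element is \<open>[R \<dots> R]\<close>. A
  nonzero component factors through a graded projective only if it ends in \<open>[R \<dots> R]\<close> and \<open>[R \<dots> R]\<close> is itself projective:
  a degree argument confines the factorisation to an indecomposable projective \<open>e\<^sub>rA\<close> whose exponents are at most those of the
  source, and the Nakayama permutation forces all of these to vanish (\<open>row_below_summand\<close>,
  \<open>factor_through_free\<close>). Therefore \<open>\<Gamma>\<^sub>A\<close> is the incidence algebra of the same poset, with the bottom element
  removed if \<open>[R \<dots> R]\<close> is projective (\<open>stable_End_iso\<close>).

  For the exponent matrices given by \<open>m\<^sub>1, \<dots>, m\<^sub>n\<close> the order is generated by two commuting steps down,
  \<open>\<alpha> (i, j) = (i - 1, j + m\<^sub>i)\<close> (with cyclic indices) and \<open>\<beta> (i, j) = (i, j + 1)\<close>, where an index out of range stands for the bottom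
  element (\<open>below_iff\<close>). The elements below \<open>u\<close> are the \<open>\<alpha>\<^sup>a \<beta>\<^sup>b u\<close>, with unique \<open>(a, b)\<close> unless the result is the bottom: a Young
  diagram with its outside collapsed to one point.

  Let \<open>N\<close> be a module over the incidence algebra, seen as a representation with maps from \<open>N t\<close> to \<open>N s\<close> for \<open>t \<le> s\<close>, and
  let \<open>P\<^sub>q\<close> be the projective at the vertex \<open>q\<close>. In the sequence
  \<open>0 \<rightarrow> \<Oplus>\<^sub>q N(\<alpha>\<beta>q) \<otimes> P\<^sub>q \<rightarrow> \<Oplus>\<^sub>q (N(\<alpha>q) \<oplus> N(\<beta>q)) \<otimes> P\<^sub>q \<rightarrow> \<Oplus>\<^sub>q N(q) \<otimes> P\<^sub>q \<rightarrow> N \<rightarrow> 0\<close>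
  the vertex \<open>q\<close> runs over all elements but the bottom in the first two terms, and over all elements in the third.
  It says that \<open>N\<close> is generated by its components, that the relations are generated by those for single steps, and
  that the relations among these come from the squares \<open>\<alpha>\<beta> = \<beta>\<alpha>\<close>. Exactness is checked at each vertex \<open>u\<close> by
  solving linear equations along the columns of the Young diagram below \<open>u\<close> (\<open>d2_injective\<close>, \<open>exact_1\<close>,
  \<open>exact_0\<close>). When the bottom element is removed, its component of \<open>N\<close> is zero and the sequence remains exact. This gives
  \<open>incidence_gl_dim\<close>.
\<close>

section \<open>Staircase posets and their representations\<close>

text \<open>The vertices strictly above the bottom element \<open>bot\<close> form staircases: the cells
  \<open>\<alpha>\<^sup>a \<beta>\<^sup>b u\<close> that are different from \<open>bot\<close> have unique coordinates \<open>(a, b)\<close>, and since they are closed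
  under decreasing \<open>a\<close> or \<open>b\<close>, they form a Young diagram. A step out of the diagram leads to \<open>bot\<close>.\<close>

locale grid_poset =
  fixes W :: "'w set" and bot :: 'w and \<alpha> \<beta> :: "'w \<Rightarrow> 'w" and le :: "'w \<Rightarrow> 'w \<Rightarrow> bool"
  assumes finite_W: "finite W" and bot_notin: "bot \<notin> W"
    and alpha_closed: "q \<in> W \<Longrightarrow> \<alpha> q \<in> insert bot W"
    and beta_closed: "q \<in> W \<Longrightarrow> \<beta> q \<in> insert bot W"
    and alpha_bot [simp]: "\<alpha> bot = bot" and beta_bot [simp]: "\<beta> bot = bot"
    and alpha_beta: "q \<in> W \<Longrightarrow> \<beta> (\<alpha> q) = \<alpha> (\<beta> q)"
    and le_iff: "\<lbrakk>t \<in> insert bot W; u \<in> insert bot W\<rbrakk>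
        \<Longrightarrow> le t u \<longleftrightarrow> (\<exists>a b. t = (\<alpha> ^^ a) ((\<beta> ^^ b) u))"
    and coords_unique: "\<lbrakk>u \<in> W; (\<alpha> ^^ a) ((\<beta> ^^ b) u) \<in> W;
        (\<alpha> ^^ a) ((\<beta> ^^ b) u) = (\<alpha> ^^ a') ((\<beta> ^^ b') u)\<rbrakk> \<Longrightarrow> a = a' \<and> b = b'"
    and nilpotent: "u \<in> W \<Longrightarrow> \<exists>K. (\<alpha> ^^ K) u = bot \<and> (\<beta> ^^ K) u = bot"
begin

definition T :: "'w set" where "T = insert bot W"

lemma W_T [simp, intro]: "q \<in> W \<Longrightarrow> q \<in> T" and bot_T [simp, intro]: "bot \<in> T"
  and finite_T [simp]: "finite T"
  by (auto simp: T_def finite_W)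

definition pt :: "'w \<Rightarrow> nat \<Rightarrow> nat \<Rightarrow> 'w"
  where "pt u a b = (\<alpha> ^^ a) ((\<beta> ^^ b) u)"

lemma alpha_T: "q \<in> T \<Longrightarrow> \<alpha> q \<in> T" and beta_T: "q \<in> T \<Longrightarrow> \<beta> q \<in> T"
  using alpha_closed beta_closed by (auto simp: T_def)

lemma commute_T: "q \<in> T \<Longrightarrow> \<beta> (\<alpha> q) = \<alpha> (\<beta> q)"
  using alpha_beta by (auto simp: T_def)

lemma beta_pow_T: "u \<in> T \<Longrightarrow> (\<beta> ^^ b) u \<in> T"
  by (induction b) (auto intro: beta_T)

lemma pt_T: "u \<in> T \<Longrightarrow> pt u a b \<in> T"
  unfolding pt_def by (induction a) (auto intro: beta_pow_T alpha_T)

lemma pt_0 [simp]: "pt u 0 0 = u"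
  by (simp add: pt_def)

lemma pt_Suc_left: "pt u (Suc a) b = \<alpha> (pt u a b)"
  by (simp add: pt_def)

lemma beta_alpha_pow: "q \<in> T \<Longrightarrow> \<beta> ((\<alpha> ^^ a) q) = (\<alpha> ^^ a) (\<beta> q)"
proof (induction a arbitrary: q)
  case (Suc a)
  then have "\<beta> ((\<alpha> ^^ a) (\<alpha> q)) = (\<alpha> ^^ a) (\<beta> (\<alpha> q))" using alpha_T by blast
  then show ?case using Suc.prems commute_T by (simp add: funpow_swap1)
qed simp

lemma pt_Suc_right: "u \<in> T \<Longrightarrow> pt u a (Suc b) = \<beta> (pt u a b)"
  using beta_alpha_pow[OF beta_pow_T, of u a b] by (simp add: pt_def)

lemma le_pt_iff: "\<lbrakk>t \<in> T; u \<in> T\<rbrakk> \<Longrightarrow> le t u \<longleftrightarrow> (\<exists>a b. t = pt u a b)"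
  unfolding pt_def using le_iff by (simp add: T_def)

lemma pt_pt: "u \<in> T \<Longrightarrow> pt (pt u a b) a' b' = pt u (a' + a) (b' + b)"
proof (induction b')
  case 0 show ?case by (simp add: pt_def funpow_add)
next
  case (Suc b') then show ?case by (simp add: pt_Suc_right pt_T)
qed

lemma pt_le_pt: "u \<in> T \<Longrightarrow> a \<le> a' \<Longrightarrow> b \<le> b' \<Longrightarrow> le (pt u a' b') (pt u a b)"
  using le_pt_iff[OF pt_T pt_T, of u u a' b' a b] pt_pt[of u a b "a' - a" "b' - b"]
  by (metis le_add_diff_inverse2)

lemma pt_le: "u \<in> T \<Longrightarrow> le (pt u a b) u"
  using pt_le_pt[of u 0 a 0 b] by simp

lemma le_refl: "u \<in> T \<Longrightarrow> le u u"
  using pt_le[of u 0 0] by simp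

lemma le_trans: "\<lbrakk>t \<in> T; u \<in> T; v \<in> T; le t u; le u v\<rbrakk> \<Longrightarrow> le t v"
  by (metis le_pt_iff pt_pt)

lemma alpha_le: "q \<in> T \<Longrightarrow> le (\<alpha> q) q" and beta_le: "q \<in> T \<Longrightarrow> le (\<beta> q) q"
  using pt_le[of q 1 0] pt_le[of q 0 1] by (auto simp: pt_def)

lemma alpha_beta_le_alpha: "q \<in> T \<Longrightarrow> le (\<alpha> (\<beta> q)) (\<alpha> q)"
  using pt_le_pt[of q 1 1 0 1] by (simp add: pt_def)

lemma alpha_beta_le_beta: "q \<in> T \<Longrightarrow> le (\<alpha> (\<beta> q)) (\<beta> q)"
  using pt_le_pt[of q 0 1 1 1] by (simp add: pt_def)

lemma pt_bot [simp]: "pt bot a b = bot"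
proof -
  have "(\<beta> ^^ b) bot = bot" by (induction b) auto
  moreover have "(\<alpha> ^^ a) bot = bot" by (induction a) auto
  ultimately show ?thesis by (simp add: pt_def)
qed

lemma pt_mono_bot: "u \<in> T \<Longrightarrow> pt u a b = bot \<Longrightarrow> a \<le> a' \<Longrightarrow> b \<le> b' \<Longrightarrow> pt u a' b' = bot"
  using pt_pt[of u a b "a' - a" "b' - b"] by simp

lemma pt_not_bot: "u \<in> T \<Longrightarrow> pt u a b \<noteq> bot \<longleftrightarrow> pt u a b \<in> W"
  using pt_T[of u a b] bot_notin by (auto simp: T_def)

lemma pt_smaller_W:
  assumes "u \<in> T" "pt u a b \<in> W" "a' \<le> a" "b' \<le> b"
  shows "pt u a' b' \<in> W"
proof (rule ccontr)
  assume "pt u a' b' \<notin> W"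
  then have "pt u a b = bot" using assms pt_not_bot pt_mono_bot by blast
  then show False using assms(2) bot_notin by simp
qed

lemma pt_eventually_bot: "u \<in> T \<Longrightarrow> \<exists>K. \<forall>a b. a \<ge> K \<or> b \<ge> K \<longrightarrow> pt u a b = bot"
proof (cases "u = bot")
  case False
  assume "u \<in> T"
  with False obtain K where K: "pt u K 0 = bot" "pt u 0 K = bot"
    using nilpotent[of u] by (auto simp: pt_def T_def)
  have "pt u a b = bot" if "a \<ge> K \<or> b \<ge> K" for a b
    using that pt_mono_bot[OF \<open>u \<in> T\<close> K(1), of a b] pt_mono_bot[OF \<open>u \<in> T\<close> K(2), of a b] by auto
  then show ?thesis by blast
qed simp

lemma bot_le: "u \<in> T \<Longrightarrow> le bot u"
  using pt_eventually_bot[of u] le_pt_iff[of bot u] by (metis bot_T order_refl)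

lemma le_bot: "u \<in> T \<Longrightarrow> le u bot \<Longrightarrow> u = bot"
  using le_pt_iff[of u bot] by auto

lemma pt_unique: "\<lbrakk>u \<in> W; pt u a b \<in> W; pt u a' b' = pt u a b\<rbrakk> \<Longrightarrow> a' = a \<and> b' = b"
  by (drule (1) coords_unique[folded pt_def], erule sym, blast)

text \<open>The number of cells in the column \<open>a\<close> of the diagram below \<open>u\<close>.\<close>

definition height :: "'w \<Rightarrow> nat \<Rightarrow> nat"
  where "height u a = (LEAST b. pt u a b = bot)"

lemma pt_height: "u \<in> T \<Longrightarrow> pt u a (height u a) = bot"
proof -
  assume "u \<in> T"
  then obtain K where "pt u a K = bot" using pt_eventually_bot[of u] by blast
  then show ?thesis unfolding height_def by (rule LeastI)
qed

lemma less_height: "u \<in> T \<Longrightarrow> b < height u a \<longleftrightarrow> pt u a b \<in> W"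
  using pt_height[of u a] pt_mono_bot[of u a "height u a" a b] pt_not_bot[of u a b]
    not_less_Least[of b "\<lambda>b. pt u a b = bot"] bot_notin
  unfolding height_def[symmetric] by (cases "b < height u a") auto

text \<open>In the diagram below \<open>u\<close>, a cell has at most one neighbour from which \<open>\<alpha>\<close> leads to it. The
  sum over all such neighbours, which appears in the differentials because it is meaningful at \<open>bot\<close>, too,
  therefore has at most one nonzero term.\<close>

lemma sum_over_alpha:
  fixes x :: "'w \<Rightarrow> 'v::comm_monoid_add"
  assumes u: "u \<in> W" and q: "pt u a b \<in> W" and x: "\<And>q. \<not> (q \<in> W \<and> le q u) \<Longrightarrow> x q = 0"
  shows "(\<Sum>q'\<in>{q' \<in> W. \<alpha> q' = pt u a b}. x q') = (if a = 0 then 0 else x (pt u (a - 1) b))"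
proof -
  have eq: "q' = pt u (a - 1) b \<and> a \<noteq> 0" if q': "q' \<in> W" "\<alpha> q' = pt u a b" "le q' u" for q'
  proof -
    obtain a' b' where q'': "q' = pt u a' b'"
      using le_pt_iff[OF W_T[OF q'(1)] W_T[OF u]] q'(3) by auto
    then have "pt u (Suc a') b' = pt u a b" using q' by (simp add: pt_Suc_left)
    then have "Suc a' = a \<and> b' = b"
      by (rule pt_unique[OF u q])
    with q'' show ?thesis by auto
  qed
  have mem: "pt u (a - 1) b \<in> W" "\<alpha> (pt u (a - 1) b) = pt u a b" if "a \<noteq> 0"
  proof -
    show "\<alpha> (pt u (a - 1) b) = pt u a b" using that pt_Suc_left[of u "a - 1" b] by simp
    show "pt u (a - 1) b \<in> W" using q by (rule pt_smaller_W[OF W_T[OF u]]) auto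
  qed
  have "(\<Sum>q'\<in>{q' \<in> W. \<alpha> q' = pt u a b}. x q') = (\<Sum>q'\<in>(if a = 0 then {} else {pt u (a - 1) b}). x q')"
    using finite_W by (intro sum.mono_neutral_right) (use mem eq x in \<open>auto split: if_splits\<close>)
  then show ?thesis by simp
qed

lemma sum_over_beta:
  fixes x :: "'w \<Rightarrow> 'v::comm_monoid_add"
  assumes u: "u \<in> W" and q: "pt u a b \<in> W" and x: "\<And>q. \<not> (q \<in> W \<and> le q u) \<Longrightarrow> x q = 0"
  shows "(\<Sum>q'\<in>{q' \<in> W. \<beta> q' = pt u a b}. x q') = (if b = 0 then 0 else x (pt u a (b - 1)))"
proof -
  have eq: "q' = pt u a (b - 1) \<and> b \<noteq> 0" if q': "q' \<in> W" "\<beta> q' = pt u a b" "le q' u" for q'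
  proof -
    obtain a' b' where q'': "q' = pt u a' b'"
      using le_pt_iff[OF W_T[OF q'(1)] W_T[OF u]] q'(3) by auto
    then have "pt u a' (Suc b') = pt u a b" using q' u by (simp add: pt_Suc_right)
    then have "a' = a \<and> Suc b' = b"
      by (rule pt_unique[OF u q])
    with q'' show ?thesis by auto
  qed
  have mem: "pt u a (b - 1) \<in> W" "\<beta> (pt u a (b - 1)) = pt u a b" if "b \<noteq> 0"
  proof -
    show "\<beta> (pt u a (b - 1)) = pt u a b" using that pt_Suc_right[of u a "b - 1"] u by simp
    show "pt u a (b - 1) \<in> W" using q by (rule pt_smaller_W[OF W_T[OF u]]) auto
  qed
  have "(\<Sum>q'\<in>{q' \<in> W. \<beta> q' = pt u a b}. x q') = (\<Sum>q'\<in>(if b = 0 then {} else {pt u a (b - 1)}). x q')"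
    using finite_W by (intro sum.mono_neutral_right) (use mem eq x in \<open>auto split: if_splits\<close>)
  then show ?thesis by simp
qed

end

text \<open>A representation of the poset: vector spaces \<open>N t\<close> with maps \<open>\<rho> t s\<close> from \<open>N t\<close> to \<open>N s\<close> for
  \<open>t \<le> s\<close>. All \<open>N t\<close> stable_indices in one ambient space, and \<open>\<rho> t s\<close> is defined and linear on all of it; this
  saves every side condition about domains in the computations with sums.\<close>

locale grid_rep = grid_poset W bot \<alpha> \<beta> le + vector_space scale
  for W :: "'w set" and bot \<alpha> \<beta> le and scale :: "'k::field \<Rightarrow> 'v::ab_group_add \<Rightarrow> 'v" (infixr "*s" 75) +
  fixes N :: "'w \<Rightarrow> 'v set" and \<rho> :: "'w \<Rightarrow> 'w \<Rightarrow> 'v \<Rightarrow> 'v"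
  assumes subspace_N: "subspace (N t)"
    and rho_add: "\<rho> t s (x + y) = \<rho> t s x + \<rho> t s y"
    and rho_scale: "\<rho> t s (c *s x) = c *s \<rho> t s x"
    and rho_closed: "\<lbrakk>t \<in> T; s \<in> T; le t s; x \<in> N t\<rbrakk> \<Longrightarrow> \<rho> t s x \<in> N s"
    and rho_id: "t \<in> T \<Longrightarrow> x \<in> N t \<Longrightarrow> \<rho> t t x = x"
    and rho_comp: "\<lbrakk>t \<in> T; s \<in> T; r \<in> T; le t s; le s r; x \<in> N t\<rbrakk> \<Longrightarrow> \<rho> s r (\<rho> t s x) = \<rho> t r x"
begin

lemma N_0 [simp]: "0 \<in> N t" and N_add: "x \<in> N t \<Longrightarrow> y \<in> N t \<Longrightarrow> x + y \<in> N t"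
  and N_diff: "x \<in> N t \<Longrightarrow> y \<in> N t \<Longrightarrow> x - y \<in> N t"
  and N_sum: "(\<And>i. i \<in> I \<Longrightarrow> f i \<in> N t) \<Longrightarrow> sum f I \<in> N t"
  using subspace_N by (auto intro: subspace_add subspace_diff subspace_0 subspace_sum subspace_neg)

lemma rho_0 [simp]: "\<rho> t s 0 = 0"
  using rho_add[of t s 0 0] by simp

lemma rho_minus: "\<rho> t s (- x) = - \<rho> t s x"
  using rho_add[of t s x "- x"] by (simp add: minus_unique)

lemma rho_diff: "\<rho> t s (x - y) = \<rho> t s x - \<rho> t s y"
  using rho_add[of t s x "- y"] by (simp add: rho_minus)

lemma rho_sum: "\<rho> t s (sum f I) = (\<Sum>i\<in>I. \<rho> t s (f i))"
  by (induction I rule: infinite_finite_induct) (auto simp: rho_add)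

text \<open>The complex at a vertex \<open>u\<close>. In degree 0 there is one copy of \<open>N q\<close> for every \<open>q \<le> u\<close>. In degree 1
  there are, for every \<open>q \<le> u\<close> other than \<open>bot\<close>, a copy of \<open>N (\<alpha> q)\<close> (component \<open>x\<close>) and one of
  \<open>N (\<beta> q)\<close> (component \<open>y\<close>), and in degree 2 a copy of \<open>N (\<alpha> (\<beta> q))\<close>. The differential \<open>d1\<close>
  compares an element of \<open>N (\<alpha> q)\<close> placed at \<open>\<alpha> q\<close> with its image placed at \<open>q\<close>, so that the cokernel
  of \<open>d1\<close> is \<open>N u\<close>; \<open>d2x\<close> and \<open>d2y\<close> are the components of the relation that comes from the two paths
  around the square \<open>q, \<alpha> q, \<beta> q, \<alpha> (\<beta> q)\<close>.\<close>

definition chain2 :: "'w \<Rightarrow> ('w \<Rightarrow> 'v) \<Rightarrow> bool"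
  where "chain2 u z \<longleftrightarrow> (\<forall>q. if q \<in> W \<and> le q u then z q \<in> N (\<alpha> (\<beta> q)) else z q = 0)"

definition chain1 :: "'w \<Rightarrow> ('w \<Rightarrow> 'v) \<Rightarrow> ('w \<Rightarrow> 'v) \<Rightarrow> bool"
  where "chain1 u x y \<longleftrightarrow>
    (\<forall>q. if q \<in> W \<and> le q u then x q \<in> N (\<alpha> q) \<and> y q \<in> N (\<beta> q) else x q = 0 \<and> y q = 0)"

definition chain0 :: "'w \<Rightarrow> ('w \<Rightarrow> 'v) \<Rightarrow> bool"
  where "chain0 u w \<longleftrightarrow> (\<forall>q. if q \<in> T \<and> le q u then w q \<in> N q else w q = 0)"

definition d2x :: "('w \<Rightarrow> 'v) \<Rightarrow> 'w \<Rightarrow> 'v"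
  where "d2x z q = (if q \<in> W then (\<Sum>q'\<in>{q' \<in> W. \<beta> q' = q}. z q') - \<rho> (\<alpha> (\<beta> q)) (\<alpha> q) (z q) else 0)"

definition d2y :: "('w \<Rightarrow> 'v) \<Rightarrow> 'w \<Rightarrow> 'v"
  where "d2y z q = (if q \<in> W then \<rho> (\<alpha> (\<beta> q)) (\<beta> q) (z q) - (\<Sum>q'\<in>{q' \<in> W. \<alpha> q' = q}. z q') else 0)"

definition d1 :: "('w \<Rightarrow> 'v) \<Rightarrow> ('w \<Rightarrow> 'v) \<Rightarrow> 'w \<Rightarrow> 'v"
  where "d1 x y q = (if q \<in> T then (\<Sum>q'\<in>{q' \<in> W. \<alpha> q' = q}. x q') + (\<Sum>q'\<in>{q' \<in> W. \<beta> q' = q}. y q')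
     - (if q \<in> W then \<rho> (\<alpha> q) q (x q) + \<rho> (\<beta> q) q (y q) else 0) else 0)"

definition d0 :: "'w \<Rightarrow> ('w \<Rightarrow> 'v) \<Rightarrow> 'v"
  where "d0 u w = (\<Sum>q\<in>T. \<rho> q u (w q))"

lemma le_alphaD: "q' \<in> W \<Longrightarrow> u \<in> T \<Longrightarrow> le q' u \<Longrightarrow> le (\<alpha> q') u"
  using le_trans[of "\<alpha> q'" q' u] alpha_le alpha_T by blast
lemma le_betaD: "q' \<in> W \<Longrightarrow> u \<in> T \<Longrightarrow> le q' u \<Longrightarrow> le (\<beta> q') u"
  using le_trans[of "\<beta> q'" q' u] beta_le beta_T by blast

lemma chain2_d2:
  assumes u: "u \<in> T" and z: "chain2 u z"
  shows "chain1 u (d2x z) (d2y z)"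
  unfolding chain1_def
proof (intro allI)
  fix q
  have zz: "z q' \<in> N (\<alpha> (\<beta> q'))" if "q' \<in> W" for q'
    using z that unfolding chain2_def by (metis N_0)
  have z0: "z q' = 0" if "\<not> le q' u" for q' using z that unfolding chain2_def by metis
  have "d2x z q \<in> N (\<alpha> q)" if q: "q \<in> W"
  proof -
    have "\<rho> (\<alpha> (\<beta> q)) (\<alpha> q) (z q) \<in> N (\<alpha> q)"
      using q by (intro rho_closed zz alpha_beta_le_alpha alpha_T beta_T) auto
    moreover have "(\<Sum>q'\<in>{q' \<in> W. \<beta> q' = q}. z q') \<in> N (\<alpha> q)"
      using zz by (intro N_sum) auto
    ultimately show ?thesis using q by (simp add: d2x_def N_diff)
  qed
  moreover have "d2y z q \<in> N (\<beta> q)" if q: "q \<in> W"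
  proof -
    have "\<rho> (\<alpha> (\<beta> q)) (\<beta> q) (z q) \<in> N (\<beta> q)"
      using q by (intro rho_closed zz alpha_beta_le_beta alpha_T beta_T) auto
    moreover have "z q' \<in> N (\<beta> (\<alpha> q'))" if "q' \<in> W" for q'
      using zz[OF that] alpha_beta[OF that] by simp
    then have "(\<Sum>q'\<in>{q' \<in> W. \<alpha> q' = q}. z q') \<in> N (\<beta> q)"
      by (intro N_sum) auto
    ultimately show ?thesis using q by (simp add: d2y_def N_diff)
  qed
  moreover have "d2x z q = 0 \<and> d2y z q = 0" if q: "\<not> le q u"
  proof -
    have "z q' = 0" if "q' \<in> W" "\<beta> q' = q \<or> \<alpha> q' = q" for q'
      using that q z0 le_alphaD[OF _ u] le_betaD[OF _ u] by blast
    then have "(\<Sum>q'\<in>{q' \<in> W. \<beta> q' = q}. z q') = 0" "(\<Sum>q'\<in>{q' \<in> W. \<alpha> q' = q}. z q') = 0"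
      by (intro sum.neutral; simp)+
    then show ?thesis using z0[OF q] by (simp add: d2x_def d2y_def)
  qed
  ultimately show "if q \<in> W \<and> le q u then d2x z q \<in> N (\<alpha> q) \<and> d2y z q \<in> N (\<beta> q)
      else d2x z q = 0 \<and> d2y z q = 0"
    by (auto simp: d2x_def d2y_def)
qed

lemma chain1_d1:
  assumes u: "u \<in> T" and xy: "chain1 u x y"
  shows "chain0 u (d1 x y)"
  unfolding chain0_def
proof (intro allI)
  fix q
  have xx: "x q' \<in> N (\<alpha> q')" "y q' \<in> N (\<beta> q')" if "q' \<in> W" for q'
    using xy that unfolding chain1_def by (metis N_0)+
  have z0: "x q' = 0" "y q' = 0" if "\<not> le q' u" for q' using xy that unfolding chain1_def by metis+
  have "d1 x y q \<in> N q" if q: "q \<in> T"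
  proof -
    have "(\<Sum>q'\<in>{q' \<in> W. \<alpha> q' = q}. x q') \<in> N q" "(\<Sum>q'\<in>{q' \<in> W. \<beta> q' = q}. y q') \<in> N q"
      using xx by (intro N_sum; auto)+
    moreover have "\<rho> (\<alpha> q) q (x q) \<in> N q" "\<rho> (\<beta> q) q (y q) \<in> N q" if "q \<in> W"
      using that by (intro rho_closed xx alpha_le beta_le alpha_T beta_T; auto)+
    ultimately show ?thesis using q by (simp add: d1_def N_diff N_add)
  qed
  moreover have "d1 x y q = 0" if q: "\<not> le q u"
  proof -
    have "x q' = 0" if "q' \<in> W" "\<alpha> q' = q" for q'
      using that q z0 le_alphaD[OF _ u] by blast
    moreover have "y q' = 0" if "q' \<in> W" "\<beta> q' = q" for q'
      using that q z0 le_betaD[OF _ u] by blast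
    ultimately have "(\<Sum>q'\<in>{q' \<in> W. \<alpha> q' = q}. x q') = 0" "(\<Sum>q'\<in>{q' \<in> W. \<beta> q' = q}. y q') = 0"
      by (intro sum.neutral; simp)+
    then show ?thesis using z0[OF q] by (simp add: d1_def)
  qed
  moreover have "d1 x y q = 0" if "q \<notin> T" using that by (simp add: d1_def)
  ultimately show "if q \<in> T \<and> le q u then d1 x y q \<in> N q else d1 x y q = 0" by auto
qed

lemma d2x_pt:
  assumes u: "u \<in> W" and z: "chain2 u z" and q: "pt u a b \<in> W"
  shows "d2x z (pt u a b) = (if b = 0 then 0 else z (pt u a (b - 1)))
    - \<rho> (pt u (Suc a) (Suc b)) (pt u (Suc a) b) (z (pt u a b))"
proof -
  have z0: "z q = 0" if "\<not> (q \<in> W \<and> le q u)" for q using z that unfolding chain2_def by metis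
  show ?thesis
    using q sum_over_beta[OF u q z0] pt_Suc_right[OF W_T[OF u], of a b] by (simp add: d2x_def pt_Suc_left)
qed

lemma d2y_pt:
  assumes u: "u \<in> W" and z: "chain2 u z" and q: "pt u a b \<in> W"
  shows "d2y z (pt u a b) = \<rho> (pt u (Suc a) (Suc b)) (pt u a (Suc b)) (z (pt u a b))
    - (if a = 0 then 0 else z (pt u (a - 1) b))"
proof -
  have z0: "z q = 0" if "\<not> (q \<in> W \<and> le q u)" for q using z that unfolding chain2_def by metis
  show ?thesis
    using q sum_over_alpha[OF u q z0] pt_Suc_right[OF W_T[OF u], of a b] by (simp add: d2y_def pt_Suc_left)
qed

lemma d1_pt:
  assumes u: "u \<in> W" and xy: "chain1 u x y" and q: "pt u a b \<in> W"
  shows "d1 x y (pt u a b) = (if a = 0 then 0 else x (pt u (a - 1) b)) + (if b = 0 then 0 else y (pt u a (b - 1)))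
    - (\<rho> (pt u (Suc a) b) (pt u a b) (x (pt u a b)) + \<rho> (pt u a (Suc b)) (pt u a b) (y (pt u a b)))"
proof -
  have x0: "x q = 0" "y q = 0" if "\<not> (q \<in> W \<and> le q u)" for q using xy that unfolding chain1_def by metis+
  show ?thesis
    using q sum_over_alpha[OF u q x0(1)] sum_over_beta[OF u q x0(2)] pt_Suc_right[OF W_T[OF u], of a b]
    by (simp add: d1_def pt_Suc_left)
qed

text \<open>A family along a column whose members are successive images of each other is determined by its
  last member, which lies over \<open>bot\<close>.\<close>

lemma column:
  assumes u: "u \<in> W" and h: "pt u c h = bot" and b: "b < h"
    and v: "\<And>b. b < h \<Longrightarrow> v b \<in> N (pt u c (Suc b))"
    and step: "\<And>b. 0 < b \<Longrightarrow> b < h \<Longrightarrow> v (b - 1) = \<rho> (pt u c (Suc b)) (pt u c b) (v b)"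
  shows "v b = \<rho> bot (pt u c (Suc b)) (v (h - 1))"
  using b
proof (induction "h - 1 - b" arbitrary: b)
  case 0
  then have "Suc b = h" "b = h - 1" by auto
  moreover have "v b \<in> N bot" using v[OF 0(2)] h \<open>Suc b = h\<close> by simp
  ultimately show ?case using h rho_id[of bot "v b"] by simp
next
  case (Suc k)
  then have b: "Suc b < h" "k = h - 1 - Suc b" by auto
  have top: "v (h - 1) \<in> N bot" using v[of "h - 1"] b h by simp
  have "v b = \<rho> (pt u c (Suc (Suc b))) (pt u c (Suc b)) (v (Suc b))"
    using step[of "Suc b"] b by simp
  also have "v (Suc b) = \<rho> bot (pt u c (Suc (Suc b))) (v (h - 1))"
    using Suc(1)[OF b(2) b(1)] .
  also have "\<rho> (pt u c (Suc (Suc b))) (pt u c (Suc b)) (\<rho> bot (pt u c (Suc (Suc b))) (v (h - 1)))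
      = \<rho> bot (pt u c (Suc b)) (v (h - 1))"
    using u top by (intro rho_comp pt_T bot_T bot_le pt_le_pt) auto
  finally show ?case .
qed

lemma chain_eqI:
  assumes "u \<in> T" "\<And>q. \<not> (q \<in> W \<and> le q u) \<Longrightarrow> f q = g q"
    and "\<And>a b. pt u a b \<in> W \<Longrightarrow> f (pt u a b) = g (pt u a b)"
  shows "f = g"
proof
  fix q
  show "f q = g q"
  proof (cases "q \<in> W \<and> le q u")
    case True
    then show ?thesis using le_pt_iff[of q u] assms(1,3) by auto
  qed (use assms(2) in auto)
qed

text \<open>The \<open>x\<close>-component of the equation says that along each column \<open>z\<close> is determined by its last
  value. These last values vanish by induction on the column: at the last cell of a column, the
  \<open>y\<close>-component equates the value of \<open>z\<close> there with its value in the preceding column.\<close>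

lemma d2_injective:
  assumes u: "u \<in> T" and z: "chain2 u z" and dx: "d2x z = (\<lambda>_. 0)" and dy: "d2y z = (\<lambda>_. 0)"
  shows "z = (\<lambda>_. 0)"
proof (cases "u = bot")
  case True
  then have "\<not> (q \<in> W \<and> le q u)" for q using le_bot bot_notin by blast
  then show ?thesis using z unfolding chain2_def by metis
next
  case False
  with u have uW: "u \<in> W" by (auto simp: T_def)
  let ?h = "height u"
  have zN: "z (pt u a b) \<in> N (pt u (Suc a) (Suc b))" if "b < ?h a" for a b
    using z that less_height[OF u, of b a] pt_le[OF u, of a b] pt_Suc_right[OF u]
    unfolding chain2_def by (metis pt_Suc_left)
  have col: "z (pt u a b) = \<rho> bot (pt u (Suc a) (Suc b)) (z (pt u a (?h a - 1)))" if "b < ?h a" for a b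
  proof (rule column[OF uW _ that, where v = "\<lambda>b. z (pt u a b)"])
    show "pt u (Suc a) (?h a) = bot" using pt_height[OF u, of a] by (simp add: pt_Suc_left)
    show "z (pt u a (b - 1)) = \<rho> (pt u (Suc a) (Suc b)) (pt u (Suc a) b) (z (pt u a b))"
      if "0 < b" "b < ?h a" for b
      using d2x_pt[OF uW z, of a b] that less_height[OF u, of b a] dx by simp
  qed (use zN in auto)
  have top: "z (pt u a (?h a - 1)) = 0" if "0 < ?h a" for a
    using that
  proof (induction a)
    case 0
    let ?b = "?h 0 - 1"
    have b: "?b < ?h 0" "Suc ?b = ?h 0" using 0 by auto
    have bot: "pt u 0 (Suc ?b) = bot" "pt u 1 (Suc ?b) = bot"
      using pt_height[OF u, of 0] b pt_Suc_left[of u 0] by auto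
    have "z (pt u 0 ?b) \<in> N bot" using zN[OF b(1)] bot by simp
    then show ?case
      using d2y_pt[OF uW z, of 0 ?b] less_height[OF u, of ?b 0] b dy bot rho_id[of bot] by simp
  next
    case (Suc a)
    let ?b = "?h (Suc a) - 1"
    have b: "?b < ?h (Suc a)" "Suc ?b = ?h (Suc a)" using Suc by auto
    have bot: "pt u (Suc a) (Suc ?b) = bot" "pt u (Suc (Suc a)) (Suc ?b) = bot"
      using pt_height[OF u, of "Suc a"] b pt_Suc_left[of u "Suc a"] by auto
    have "pt u (Suc a) ?b \<in> W" using less_height[OF u, of ?b "Suc a"] b by simp
    then have "pt u a ?b \<in> W" by (rule pt_smaller_W[OF u]) auto
    then have b': "?b < ?h a" using less_height[OF u] by simp
    then have "z (pt u a ?b) = 0" using col[OF b'] Suc by simp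
    moreover have "z (pt u (Suc a) ?b) \<in> N bot" using zN[OF b(1)] bot by simp
    ultimately show ?case
      using d2y_pt[OF uW z, of "Suc a" ?b] less_height[OF u, of ?b "Suc a"] b dy bot rho_id[of bot] by simp
  qed
  show ?thesis
  proof (rule chain_eqI[OF u])
    fix a b assume "pt u a b \<in> W"
    then have "b < ?h a" using less_height[OF u] by simp
    then show "z (pt u a b) = 0" using col[of b a] top[of a] by simp
  qed (use z in \<open>auto simp: chain2_def\<close>)
qed

definition bdry1 :: "'w \<Rightarrow> ('w \<Rightarrow> 'v) set"
  where "bdry1 u = {d1 f g | f g. chain1 u f g}"

lemma push_alpha:
  assumes u: "u \<in> T" and q: "q \<in> W" "le q u" and x: "x \<in> N (\<alpha> q)"
  shows "(\<lambda>p. (if p = \<alpha> q then x else 0) - (if p = q then \<rho> (\<alpha> q) q x else 0)) \<in> bdry1 u"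
  unfolding bdry1_def mem_Collect_eq
proof (intro exI conjI)
  let ?f = "\<lambda>p. if p = q then x else 0"
  show "chain1 u ?f (\<lambda>_. 0)" using q x by (auto simp: chain1_def)
  have "(\<Sum>q'\<in>{q' \<in> W. \<alpha> q' = p}. ?f q') = (if p = \<alpha> q then x else 0)" for p
    using q finite_W by (simp add: sum.delta)
  moreover have "\<alpha> q \<in> T" using q alpha_T by auto
  ultimately show "(\<lambda>p. (if p = \<alpha> q then x else 0) - (if p = q then \<rho> (\<alpha> q) q x else 0)) = d1 ?f (\<lambda>_. 0)"
    using q by (auto simp: d1_def fun_eq_iff)
qed

lemma push_beta:
  assumes u: "u \<in> T" and q: "q \<in> W" "le q u" and x: "x \<in> N (\<beta> q)"
  shows "(\<lambda>p. (if p = \<beta> q then x else 0) - (if p = q then \<rho> (\<beta> q) q x else 0)) \<in> bdry1 u"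
  unfolding bdry1_def mem_Collect_eq
proof (intro exI conjI)
  let ?f = "\<lambda>p. if p = q then x else 0"
  show "chain1 u (\<lambda>_. 0) ?f" using q x by (auto simp: chain1_def)
  have "(\<Sum>q'\<in>{q' \<in> W. \<beta> q' = p}. ?f q') = (if p = \<beta> q then x else 0)" for p
    using q finite_W by (simp add: sum.delta)
  moreover have "\<beta> q \<in> T" using q beta_T by auto
  ultimately show "(\<lambda>p. (if p = \<beta> q then x else 0) - (if p = q then \<rho> (\<beta> q) q x else 0)) = d1 (\<lambda>_. 0) ?f"
    using q by (auto simp: d1_def fun_eq_iff)
qed

lemma chain1_add: "chain1 u x y \<Longrightarrow> chain1 u x' y' \<Longrightarrow> chain1 u (\<lambda>q. x q + x' q) (\<lambda>q. y q + y' q)"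
  unfolding chain1_def by (metis N_add add_0)

lemma chain1_diff: "chain1 u x y \<Longrightarrow> chain1 u x' y' \<Longrightarrow> chain1 u (\<lambda>q. x q - x' q) (\<lambda>q. y q - y' q)"
  unfolding chain1_def by (metis N_diff diff_0_right)

lemma d1_add: "d1 (\<lambda>q. x q + x' q) (\<lambda>q. y q + y' q) = (\<lambda>q. d1 x y q + d1 x' y' q)"
  by (auto simp: d1_def fun_eq_iff sum.distrib rho_add)

lemma d1_diff: "d1 (\<lambda>q. x q - x' q) (\<lambda>q. y q - y' q) = (\<lambda>q. d1 x y q - d1 x' y' q)"
  by (auto simp: d1_def fun_eq_iff sum_subtractf rho_diff)

lemma bdry1_add: "f \<in> bdry1 u \<Longrightarrow> g \<in> bdry1 u \<Longrightarrow> (\<lambda>p. f p + g p) \<in> bdry1 u"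
  unfolding bdry1_def using chain1_add d1_add[symmetric] by blast

lemma bdry1_0: "(\<lambda>p. 0) \<in> bdry1 u"
  unfolding bdry1_def by (auto intro!: exI[of _ "\<lambda>_. 0"] simp: chain1_def d1_def fun_eq_iff)

lemma bdry1_sum: "finite I \<Longrightarrow> (\<And>i. i \<in> I \<Longrightarrow> f i \<in> bdry1 u) \<Longrightarrow> (\<lambda>p. \<Sum>i\<in>I. f i p) \<in> bdry1 u"
  by (induction I rule: finite_induct) (auto intro: bdry1_0 bdry1_add)

text \<open>Modulo boundaries an element can be pushed up to \<open>u\<close> one step at a time.\<close>

lemma push_to_top:
  assumes u: "u \<in> T" and x: "x \<in> N (pt u a b)"
  shows "(\<lambda>p. (if p = pt u a b then x else 0) - (if p = u then \<rho> (pt u a b) u x else 0)) \<in> bdry1 u"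
proof -
  have trans: "(\<lambda>p. (if p = q' then x else 0) - (if p = u then \<rho> q' u x else 0)) \<in> bdry1 u"
    if s: "(\<lambda>p. (if p = q' then x else 0) - (if p = q then \<rho> q' q x else 0)) \<in> bdry1 u"
      and h: "(\<lambda>p. (if p = q then \<rho> q' q x else 0) - (if p = u then \<rho> q u (\<rho> q' q x) else 0)) \<in> bdry1 u"
      and q: "q \<in> T" "q' \<in> T" "le q' q" "le q u" "x \<in> N q'" for q q' x
    using bdry1_add[OF s h] unfolding rho_comp[OF q(2,1) u q(3,4,5)] by simp
  have left: "(\<lambda>p. (if p = pt u a 0 then x else 0) - (if p = u then \<rho> (pt u a 0) u x else 0)) \<in> bdry1 u"
    if "x \<in> N (pt u a 0)" for x a
    using that
  proof (induction a arbitrary: x)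
    case 0
    then show ?case using rho_id[of u x] u bdry1_0 by (simp cong: if_cong)
  next
    case (Suc a)
    let ?q = "pt u a 0"
    have r: "\<rho> (pt u (Suc a) 0) ?q x \<in> N ?q"
      using u Suc.prems by (intro rho_closed pt_T pt_le_pt) auto
    show ?case
    proof (cases "?q \<in> W")
      case True
      show ?thesis
      proof (rule trans[where q = ?q, OF _ Suc.IH[OF r]])
        show "(\<lambda>p. (if p = pt u (Suc a) 0 then x else 0) - (if p = ?q then \<rho> (pt u (Suc a) 0) ?q x else 0)) \<in> bdry1 u"
          using push_alpha[OF u True pt_le[OF u], of x] Suc.prems unfolding pt_Suc_left by simp
      qed (use Suc.prems u in \<open>auto intro!: pt_T pt_le_pt pt_le\<close>)
    next
      case False
      then have "?q = bot" using pt_not_bot[OF u] by blast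
      then have e: "pt u (Suc a) 0 = ?q" by (simp add: pt_Suc_left)
      show ?thesis using Suc.IH[of x] Suc.prems unfolding e by simp
    qed
  qed
  show ?thesis using x
  proof (induction b arbitrary: x)
    case 0
    then show ?case using left by simp
  next
    case (Suc b)
    let ?q = "pt u a b"
    have r: "\<rho> (pt u a (Suc b)) ?q x \<in> N ?q"
      using u Suc.prems by (intro rho_closed pt_T pt_le_pt) auto
    show ?case
    proof (cases "?q \<in> W")
      case True
      show ?thesis
      proof (rule trans[where q = ?q, OF _ Suc.IH[OF r]])
        show "(\<lambda>p. (if p = pt u a (Suc b) then x else 0) - (if p = ?q then \<rho> (pt u a (Suc b)) ?q x else 0)) \<in> bdry1 u"
          using push_beta[OF u True pt_le[OF u], of x] Suc.prems unfolding pt_Suc_right[OF u] by simp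
      qed (use Suc.prems u in \<open>auto intro!: pt_T pt_le_pt pt_le\<close>)
    next
      case False
      then have "?q = bot" using pt_not_bot[OF u] by blast
      then have e: "pt u a (Suc b) = ?q" by (simp add: pt_Suc_right[OF u])
      show ?thesis using Suc.IH[of x] Suc.prems unfolding e by simp
    qed
  qed
qed

text \<open>Pushing all entries of \<open>w\<close> to \<open>u\<close> shows that \<open>w\<close> is homologous to the element \<open>d0 u w\<close>
  placed at \<open>u\<close>.\<close>

lemma exact_0:
  assumes u: "u \<in> T" and w: "chain0 u w" and d: "d0 u w = 0"
  shows "\<exists>x y. chain1 u x y \<and> d1 x y = w"
proof -
  let ?f = "\<lambda>q p. (if p = q then w q else 0) - (if p = u then \<rho> q u (w q) else 0)"
  have "?f q \<in> bdry1 u" if q: "q \<in> T" for q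
  proof (cases "le q u")
    case True
    then obtain a b where "q = pt u a b" using le_pt_iff[OF q u] by auto
    then show ?thesis using push_to_top[OF u] w True q unfolding chain0_def by auto
  next
    case False
    then have "w q = 0" using w unfolding chain0_def by metis
    then show ?thesis using bdry1_0[of u] by (simp cong: if_cong)
  qed
  then have "(\<lambda>p. \<Sum>q\<in>T. ?f q p) \<in> bdry1 u" by (intro bdry1_sum) auto
  moreover have "(\<lambda>p. \<Sum>q\<in>T. ?f q p) = w"
  proof
    fix p
    have "(\<Sum>q\<in>T. ?f q p) = (\<Sum>q\<in>T. if p = q then w q else 0) - (if p = u then d0 u w else 0)"
      by (auto simp: sum_subtractf d0_def)
    also have "\<dots> = w p"
      using d w finite_T unfolding chain0_def by (auto simp: sum.delta')
    finally show "(\<Sum>q\<in>T. ?f q p) = w p" .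
  qed
  ultimately show ?thesis unfolding bdry1_def by auto
qed

lemma d2_add: "d2x (\<lambda>q. z q + z' q) = (\<lambda>q. d2x z q + d2x z' q)"
    "d2y (\<lambda>q. z q + z' q) = (\<lambda>q. d2y z q + d2y z' q)"
  by (auto simp: d2x_def d2y_def fun_eq_iff sum.distrib rho_add)

lemma chain2_add: "chain2 u z \<Longrightarrow> chain2 u z' \<Longrightarrow> chain2 u (\<lambda>q. z q + z' q)"
  unfolding chain2_def by (metis N_add add_0)

lemma sum_sum_fibre:
  fixes h :: "'w \<Rightarrow> 'v"
  shows "(\<Sum>q'\<in>{q' \<in> W. f q' = q}. \<Sum>p\<in>{p \<in> W. g p = q'}. h p) = (\<Sum>p\<in>{p \<in> W. g p \<in> W \<and> f (g p) = q}. h p)"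
proof -
  have "(\<Sum>p\<in>{p \<in> W. g p \<in> W \<and> f (g p) = q}. h p) = (\<Sum>q'\<in>{q' \<in> W. f q' = q}.
      \<Sum>p\<in>{p \<in> {p \<in> W. g p \<in> W \<and> f (g p) = q}. g p = q'}. h p)"
    using finite_W by (intro sum.group[symmetric]) auto
  also have "\<dots> = (\<Sum>q'\<in>{q' \<in> W. f q' = q}. \<Sum>p\<in>{p \<in> W. g p = q'}. h p)"
    by (intro sum.cong refl) auto
  finally show ?thesis by simp
qed

lemma sum_split_bot:
  fixes h :: "'w \<Rightarrow> 'v"
  assumes f: "\<And>p. p \<in> W \<Longrightarrow> f p \<in> insert bot W" and P: "\<And>p. p \<in> W \<Longrightarrow> f p = bot \<Longrightarrow> P p"
  shows "(\<Sum>p\<in>{p \<in> W. f p \<in> W \<and> P p}. h p) + (\<Sum>p\<in>{p \<in> W. f p = bot}. h p) = (\<Sum>p\<in>{p \<in> W. P p}. h p)"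
proof -
  have "{p \<in> W. P p} = {p \<in> W. f p \<in> W \<and> P p} \<union> {p \<in> W. f p = bot}" using f P by blast
  moreover have "{p \<in> W. f p \<in> W \<and> P p} \<inter> {p \<in> W. f p = bot} = {}" using bot_notin by force
  ultimately show ?thesis using finite_W by (simp add: sum.union_disjoint)
qed

text \<open>At a vertex other than \<open>bot\<close> the terms cancel in pairs because the squares commute. At \<open>bot\<close> the sums
  run over the cells that leave the diagram, and the cells whose diagonal neighbour is \<open>bot\<close> are
  counted in two ways.\<close>

lemma d1_d2:
  assumes u: "u \<in> T" and z: "chain2 u z"
  shows "d1 (d2x z) (d2y z) = (\<lambda>_. 0)"
proof
  fix q
  have zz: "z q' \<in> N (\<alpha> (\<beta> q'))" if "q' \<in> W" for q'
    using z that unfolding chain2_def by (metis N_0)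
  let ?ab = "\<Sum>p\<in>{p \<in> W. \<beta> p \<in> W \<and> \<alpha> (\<beta> p) = q}. z p"
  let ?ba = "\<Sum>p\<in>{p \<in> W. \<alpha> p \<in> W \<and> \<beta> (\<alpha> p) = q}. z p"
  let ?a = "\<Sum>p\<in>{p \<in> W. \<alpha> p = q}. z p" and ?b = "\<Sum>p\<in>{p \<in> W. \<beta> p = q}. z p"
  have A: "(\<Sum>q'\<in>{q' \<in> W. \<alpha> q' = q}. d2x z q') = ?ab - \<rho> (\<beta> q) q ?a"
  proof -
    have "(\<Sum>q'\<in>{q' \<in> W. \<alpha> q' = q}. d2x z q')
        = (\<Sum>q'\<in>{q' \<in> W. \<alpha> q' = q}. (\<Sum>p\<in>{p \<in> W. \<beta> p = q'}. z p) - \<rho> (\<beta> q) q (z q'))"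
      by (intro sum.cong refl) (auto simp: d2x_def alpha_beta)
    then show ?thesis by (simp add: sum_subtractf sum_sum_fibre rho_sum)
  qed
  have B: "(\<Sum>q'\<in>{q' \<in> W. \<beta> q' = q}. d2y z q') = \<rho> (\<alpha> q) q ?b - ?ba"
  proof -
    have "(\<Sum>q'\<in>{q' \<in> W. \<beta> q' = q}. d2y z q')
        = (\<Sum>q'\<in>{q' \<in> W. \<beta> q' = q}. \<rho> (\<alpha> q) q (z q') - (\<Sum>p\<in>{p \<in> W. \<alpha> p = q'}. z p))"
      by (intro sum.cong refl) (auto simp: d2y_def)
    then show ?thesis by (simp add: sum_subtractf sum_sum_fibre rho_sum)
  qed
  consider "q \<in> W" | "q = bot" | "q \<notin> T" by (auto simp: T_def)
  then show "d1 (d2x z) (d2y z) q = 0"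
  proof cases
    case 1
    have w: "\<alpha> p \<in> W \<and> \<beta> p \<in> W" if "p \<in> W" "\<alpha> (\<beta> p) \<in> W" for p
      using that alpha_closed[of p] beta_closed[of p] alpha_beta[of p] bot_notin
      by (metis alpha_bot beta_bot insertE)
    have "{p \<in> W. \<beta> p \<in> W \<and> \<alpha> (\<beta> p) = q} = {p \<in> W. \<alpha> p \<in> W \<and> \<beta> (\<alpha> p) = q}"
      by (rule Collect_cong) (use w 1 alpha_beta in metis)
    then have "?ab = ?ba" by simp
    moreover have "\<rho> (\<alpha> q) q (\<rho> (\<alpha> (\<beta> q)) (\<alpha> q) (z q)) = \<rho> (\<beta> q) q (\<rho> (\<alpha> (\<beta> q)) (\<beta> q) (z q))"
      using 1 by (subst (1 2) rho_comp) (auto intro: alpha_T beta_T alpha_le beta_le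
          alpha_beta_le_alpha alpha_beta_le_beta zz)
    ultimately show ?thesis
      using 1 A B by (simp add: d1_def) (simp add: d2x_def d2y_def rho_diff)
  next
    case 2
    have "z p \<in> N bot" if "p \<in> W" "\<alpha> p = bot \<or> \<beta> p = bot" for p
      using that zz[OF that(1)] alpha_beta[OF that(1)] by (metis alpha_bot beta_bot)
    then have a: "?a \<in> N bot" and b: "?b \<in> N bot"
      unfolding 2 by (intro N_sum; blast)+
    have "?ab + ?b = (\<Sum>p\<in>{p \<in> W. \<alpha> (\<beta> p) = bot}. z p)"
      unfolding 2 by (rule sum_split_bot[OF beta_closed]) (metis alpha_bot)+
    moreover have "?ba + ?a = (\<Sum>p\<in>{p \<in> W. \<beta> (\<alpha> p) = bot}. z p)"
      unfolding 2 by (rule sum_split_bot[OF alpha_closed]) (metis beta_bot)+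
    moreover have "{p \<in> W. \<alpha> (\<beta> p) = bot} = {p \<in> W. \<beta> (\<alpha> p) = bot}" using alpha_beta by force
    ultimately have "?ab + ?b = ?ba + ?a" by simp
    have "d1 (d2x z) (d2y z) q = (?ab - ?a) + (?b - ?ba)"
      using 2 A B rho_id[OF bot_T a] rho_id[OF bot_T b] bot_notin by (simp add: d1_def)
    also have "\<dots> = (?ab + ?b) - (?ba + ?a)" by (simp add: algebra_simps)
    finally show ?thesis using \<open>?ab + ?b = ?ba + ?a\<close> by simp
  qed (simp add: d1_def)
qed

lemma d0_d1:
  assumes u: "u \<in> T" and xy: "chain1 u x y"
  shows "d0 u (d1 x y) = 0"
proof -
  have A: "(\<Sum>q\<in>T. \<rho> q u (\<Sum>q'\<in>{q' \<in> W. f q' = q}. x q')) = (\<Sum>q\<in>W. \<rho> (f q) u (x q))"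
    if f: "\<And>q. q \<in> W \<Longrightarrow> f q \<in> T" for f x
  proof -
    have "(\<Sum>q\<in>W. \<rho> (f q) u (x q)) = (\<Sum>q\<in>T. \<Sum>q'\<in>{q' \<in> W. f q' = q}. \<rho> (f q') u (x q'))"
      using f finite_W by (intro sum.group[symmetric]) auto
    also have "\<dots> = (\<Sum>q\<in>T. \<rho> q u (\<Sum>q'\<in>{q' \<in> W. f q' = q}. x q'))"
      by (auto simp: rho_sum intro!: sum.cong)
    finally show ?thesis by simp
  qed
  have B: "\<rho> q u (\<rho> (\<alpha> q) q (x q)) = \<rho> (\<alpha> q) u (x q) \<and> \<rho> q u (\<rho> (\<beta> q) q (y q)) = \<rho> (\<beta> q) u (y q)"
    if q: "q \<in> W" for q
  proof (cases "le q u")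
    case True
    then have "x q \<in> N (\<alpha> q)" "y q \<in> N (\<beta> q)" using xy q unfolding chain1_def by metis+
    then show ?thesis using q True u by (auto intro!: rho_comp alpha_T beta_T alpha_le beta_le)
  next
    case False
    then have "x q = 0" "y q = 0" using xy unfolding chain1_def by metis+
    then show ?thesis by simp
  qed
  have "d0 u (d1 x y) = (\<Sum>q\<in>T. \<rho> q u (\<Sum>q'\<in>{q' \<in> W. \<alpha> q' = q}. x q') + \<rho> q u (\<Sum>q'\<in>{q' \<in> W. \<beta> q' = q}. y q')
      - (if q \<in> W then \<rho> q u (\<rho> (\<alpha> q) q (x q)) + \<rho> q u (\<rho> (\<beta> q) q (y q)) else 0))"
    unfolding d0_def d1_def by (intro sum.cong refl) (auto simp: rho_add rho_diff)
  also have "\<dots> = (\<Sum>q\<in>W. \<rho> (\<alpha> q) u (x q)) + (\<Sum>q\<in>W. \<rho> (\<beta> q) u (y q))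
      - (\<Sum>q\<in>T. if q \<in> W then \<rho> q u (\<rho> (\<alpha> q) q (x q)) + \<rho> q u (\<rho> (\<beta> q) q (y q)) else 0)"
    using A[of \<alpha> x] A[of \<beta> y] alpha_T beta_T by (simp add: sum.distrib sum_subtractf)
  also have "(\<Sum>q\<in>T. if q \<in> W then \<rho> q u (\<rho> (\<alpha> q) q (x q)) + \<rho> q u (\<rho> (\<beta> q) q (y q)) else 0)
      = (\<Sum>q\<in>W. \<rho> (\<alpha> q) u (x q) + \<rho> (\<beta> q) u (y q))"
    by (rule sum.mono_neutral_cong_right) (auto simp: T_def finite_W B)
  finally show ?thesis by (simp add: sum.distrib)
qed

text \<open>A chain given by its values in the coordinates of the diagram below \<open>u\<close>.\<close>

definition of_coords :: "'w \<Rightarrow> (nat \<Rightarrow> nat \<Rightarrow> 'v) \<Rightarrow> 'w \<Rightarrow> 'v"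
  where "of_coords u Z q = (if q \<in> W \<and> le q u then (case SOME (a, b). pt u a b = q of (a, b) \<Rightarrow> Z a b) else 0)"

lemma of_coords_pt: "u \<in> W \<Longrightarrow> pt u a b \<in> W \<Longrightarrow> of_coords u Z (pt u a b) = Z a b"
proof -
  assume u: "u \<in> W" and q: "pt u a b \<in> W"
  have "(SOME (a', b'). pt u a' b' = pt u a b) = (a, b)"
  proof (rule some_equality)
    show "case p of (a', b') \<Rightarrow> pt u a' b' = pt u a b \<Longrightarrow> p = (a, b)" for p
      using pt_unique[OF u q, of "fst p" "snd p"] by (cases p) auto
  qed simp
  moreover have "le (pt u a b) u" using pt_le[OF W_T[OF u]] .
  ultimately show ?thesis using q by (simp only: of_coords_def simp_thms if_True prod.case)
qed

lemma chain2_of_coords: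
  assumes u: "u \<in> W" and Z: "\<And>a b. pt u a b \<in> W \<Longrightarrow> Z a b \<in> N (pt u (Suc a) (Suc b))"
  shows "chain2 u (of_coords u Z)"
  unfolding chain2_def
proof (intro allI)
  fix q
  show "if q \<in> W \<and> le q u then of_coords u Z q \<in> N (\<alpha> (\<beta> q)) else of_coords u Z q = 0"
  proof (cases "q \<in> W \<and> le q u")
    case True
    then obtain a b where "q = pt u a b" using le_pt_iff[OF W_T W_T, of q u] u by auto
    then show ?thesis
      using True Z[of a b] of_coords_pt[OF u] u by (simp add: pt_Suc_left pt_Suc_right)
  qed (simp only: of_coords_def if_False simp_thms)
qed

text \<open>The differential \<open>d2x\<close> reaches every value of \<open>x\<close> outside the row \<open>b = 0\<close>. A cycle can therefore
  be moved into a position where \<open>x\<close> is concentrated in that row.\<close>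

lemma chain1_straighten:
  assumes u: "u \<in> W" and xy: "chain1 u x y"
  shows "\<exists>z. chain2 u z \<and> (\<forall>a b. pt u a b \<in> W \<longrightarrow> b > 0 \<longrightarrow> d2x z (pt u a b) = x (pt u a b))"
proof -
  let ?h = "height u"
  \<comment> \<open>Solving \<open>d2x z = x\<close> for \<open>z\<close> from the far end of the column \<open>a\<close> towards the cell \<open>(a, 0)\<close>.\<close>
  define Z where "Z a b = (\<Sum>j\<in>{b<..<?h a}. \<rho> (pt u (Suc a) j) (pt u (Suc a) (Suc b)) (x (pt u a j)))" for a b
  have uT: "u \<in> T" using u by simp
  have xN: "x (pt u a j) \<in> N (pt u (Suc a) j)" for a j
    using xy pt_le[OF uT, of a j] unfolding chain1_def pt_Suc_left by (metis N_0)
  have ZN: "Z a b \<in> N (pt u (Suc a) (Suc b))" for a b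
    unfolding Z_def by (intro N_sum rho_closed pt_T pt_le_pt xN uT) auto
  have z: "chain2 u (of_coords u Z)" by (rule chain2_of_coords[OF u ZN])
  have "d2x (of_coords u Z) (pt u a b) = x (pt u a b)" if q: "pt u a b \<in> W" and b: "b > 0" for a b
  proof -
    have q': "pt u a (b - 1) \<in> W" using pt_smaller_W[OF uT q, of a "b - 1"] by simp
    have "\<rho> (pt u (Suc a) (Suc b)) (pt u (Suc a) b) (Z a b)
        = (\<Sum>j\<in>{b<..<?h a}. \<rho> (pt u (Suc a) j) (pt u (Suc a) b) (x (pt u a j)))"
      unfolding Z_def rho_sum by (intro sum.cong refl rho_comp pt_T uT pt_le_pt xN) auto
    moreover have "{b - 1<..<?h a} = insert b {b<..<?h a}"
      using b less_height[OF uT, of b a] q by auto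
    then have "Z a (b - 1) = \<rho> (pt u (Suc a) b) (pt u (Suc a) b) (x (pt u a b))
        + (\<Sum>j\<in>{b<..<?h a}. \<rho> (pt u (Suc a) j) (pt u (Suc a) b) (x (pt u a j)))"
      using b by (simp add: Z_def)
    ultimately show ?thesis
      using d2x_pt[OF u z q] b q q' of_coords_pt[OF u] rho_id[OF pt_T[OF uT] xN] by simp
  qed
  with z show ?thesis by blast
qed

text \<open>When \<open>x\<close> is concentrated in the row \<open>b = 0\<close>, the cycle condition says that in every column \<open>y\<close> is the
  image of its last value \<open>eta a\<close>, and that \<open>x\<close> is the negative image of the partial sum
  \<open>zeta a = eta 0 + \<dots> + eta a\<close>. The chain \<open>z\<close> with the value \<open>zeta a\<close> all along the column \<open>a\<close> then
  has the boundary \<open>(x, y)\<close>: horizontally its differences are the \<open>eta a\<close>, vertically it is constant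
  and leaves a contribution at \<open>b = 0\<close> only.\<close>

lemma exact_1_straight:
  assumes u: "u \<in> W" and xy: "chain1 u x y" and d: "d1 x y = (\<lambda>_. 0)"
    and x0: "\<And>a b. pt u a b \<in> W \<Longrightarrow> b > 0 \<Longrightarrow> x (pt u a b) = 0"
  shows "\<exists>z. chain2 u z \<and> d2x z = x \<and> d2y z = y"
proof -
  let ?h = "height u"
  have uT: "u \<in> T" using u by simp
  have xN: "x (pt u a b) \<in> N (pt u (Suc a) b)" "y (pt u a b) \<in> N (pt u a (Suc b))" for a b
    using xy pt_le[OF uT, of a b] unfolding chain1_def pt_Suc_left pt_Suc_right[OF uT] by (metis N_0)+
  \<comment> \<open>The last value of \<open>y\<close> in the column \<open>a\<close>; it lies over \<open>bot\<close>.\<close>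
  define eta where "eta a = (if ?h a = 0 then 0 else y (pt u a (?h a - 1)))" for a
  define zeta where "zeta a = (\<Sum>i\<le>a. eta i)" for a
  define Z where "Z a b = \<rho> bot (pt u (Suc a) (Suc b)) (zeta a)" for a b
  have etaN: "eta a \<in> N bot" for a
    using xN(2)[of a "?h a - 1"] pt_height[OF uT, of a] by (auto simp: eta_def)
  have zetaN: "zeta a \<in> N bot" for a
    unfolding zeta_def by (intro N_sum etaN)
  have yy: "y (pt u a b) = \<rho> bot (pt u a (Suc b)) (eta a)" if "pt u a b \<in> W" for a b
  proof -
    have b: "b < ?h a" using that less_height[OF uT] by simp
    have "y (pt u a (b - 1)) = \<rho> (pt u a (Suc b)) (pt u a b) (y (pt u a b))" if "0 < b" "b < ?h a" for b
    proof -
      have q: "pt u a b \<in> W" using that less_height[OF uT] by simp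
      have "x (pt u (a - 1) b) = 0" if "a \<noteq> 0"
        using x0[of "a - 1" b] \<open>0 < b\<close> pt_smaller_W[OF uT q, of "a - 1" b] by simp
      then show ?thesis
        using d1_pt[OF u xy q] d x0[OF q] that by (auto split: if_splits)
    qed
    then show ?thesis
      using column[OF u pt_height[OF uT] b, of "\<lambda>b. y (pt u a b)"] xN b by (simp add: eta_def)
  qed
  define r where "r = (LEAST a. pt u a 0 = bot)"
  have r: "a < r \<longleftrightarrow> pt u a 0 \<in> W" for a
  proof -
    obtain K where "pt u K 0 = bot" using pt_eventually_bot[OF uT] by blast
    then have "pt u r 0 = bot" unfolding r_def by (rule LeastI)
    then show ?thesis
      using pt_mono_bot[OF uT, of r 0 a 0] pt_not_bot[OF uT, of a 0] not_less_Least[of a "\<lambda>a. pt u a 0 = bot"] bot_notin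
      unfolding r_def[symmetric] by (cases "a < r") auto
  qed
  have r0: "r > 0" using r[of 0] u by simp
  have pr: "pt u r 0 = bot" using r[of r] pt_not_bot[OF uT] by auto
  have xs: "(\<Sum>q\<in>{q \<in> W. \<alpha> q = bot}. x q) = x (pt u (r - 1) 0)"
  proof -
    have "q = pt u (r - 1) 0" if q: "q \<in> W" "\<alpha> q = bot" "x q \<noteq> 0" for q
    proof -
      have "le q u" using xy q(3) unfolding chain1_def by metis
      then obtain a b where ab: "q = pt u a b" using le_pt_iff[OF W_T[OF q(1)] uT] by auto
      then have b: "b = 0" using x0[of a b] q by auto
      then have "pt u (Suc a) 0 = bot" "pt u a 0 \<in> W" using ab q by (auto simp: pt_Suc_left)
      then have "a = r - 1" using r[of a] r[of "Suc a"] bot_notin by auto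
      then show ?thesis using ab b by simp
    qed
    moreover have "pt u (r - 1) 0 \<in> W" "\<alpha> (pt u (r - 1) 0) = bot"
      using r[of "r - 1"] r0 pr pt_Suc_left[of u "r - 1" 0] by auto
    ultimately have "(\<Sum>q\<in>{q \<in> W. \<alpha> q = bot}. x q) = (\<Sum>q\<in>{pt u (r - 1) 0}. x q)"
      by (intro sum.mono_neutral_right) (simp add: finite_W, blast, blast)
    then show ?thesis by simp
  qed
  have ys: "(\<Sum>q\<in>{q \<in> W. \<beta> q = bot}. y q) = zeta (r - 1)"
  proof -
    let ?f = "\<lambda>a. pt u a (?h a - 1)"
    have h: "?h a > 0" if "a < r" for a using that r less_height[OF uT, of 0 a] by simp
    have fW: "?f a \<in> W" "\<beta> (?f a) = bot" if "a < r" for a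
      using h[OF that] less_height[OF uT, of "?h a - 1" a] pt_height[OF uT, of a]
        pt_Suc_right[OF uT, of a "?h a - 1"] by auto
    have inj: "inj_on ?f {..<r}"
      using pt_unique[OF u fW(1)] unfolding inj_on_def by blast
    have surj: "q \<in> ?f ` {..<r}" if q: "q \<in> W" "\<beta> q = bot" "y q \<noteq> 0" for q
    proof -
      have "le q u" using xy q(3) unfolding chain1_def by metis
      then obtain a b where ab: "q = pt u a b" using le_pt_iff[OF W_T[OF q(1)] uT] by auto
      then have b: "b < ?h a" "\<not> Suc b < ?h a"
        using q less_height[OF uT, of b a] less_height[OF uT, of "Suc b" a] pt_Suc_right[OF uT, of a b] bot_notin by auto
      then have "b = ?h a - 1" "0 < ?h a" by auto
      moreover have "a < r" using r[of a] less_height[OF uT, of 0 a] \<open>0 < ?h a\<close> by simp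
      ultimately show ?thesis using ab by auto
    qed
    have "(\<Sum>q\<in>{q \<in> W. \<beta> q = bot}. y q) = (\<Sum>q\<in>?f ` {..<r}. y q)"
      using fW surj by (intro sum.mono_neutral_right) (simp add: finite_W, blast, blast)
    also have "\<dots> = (\<Sum>a<r. y (?f a))" using inj by (simp add: sum.reindex)
    also have "\<dots> = (\<Sum>a<r. eta a)" by (intro sum.cong refl) (auto simp: eta_def dest: h)
    also have "{..<r} = {..r - 1}" using r0 by auto
    finally show ?thesis by (simp add: zeta_def)
  qed
  \<comment> \<open>Downward induction on \<open>a\<close>: the cycle condition at \<open>bot\<close> gives the last column,
    the one at the cell \<open>(a + 1, 0)\<close> leads from the column \<open>a + 1\<close> to the column \<open>a\<close>.\<close>
  have e: "x (pt u a 0) = - \<rho> bot (pt u (Suc a) 0) (zeta a)" if "a < r" for a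
    using that
  proof (induction "r - 1 - a" arbitrary: a)
    case 0
    then have a: "a = r - 1" "Suc a = r" by auto
    have "x (pt u a 0) + zeta a = 0"
      using fun_cong[OF d, of bot] xs ys bot_notin a by (simp add: d1_def)
    then have "x (pt u a 0) = - zeta a" by (simp add: add_eq_0_iff2)
    then show ?case using a pr rho_id[OF bot_T zetaN] by simp
  next
    case (Suc k)
    then have a: "Suc a < r" "k = r - 1 - Suc a" by auto
    have q: "pt u (Suc a) 0 \<in> W" using r a by simp
    have IH: "x (pt u (Suc a) 0) = - \<rho> bot (pt u (Suc (Suc a)) 0) (zeta (Suc a))"
      using Suc(1)[OF a(2,1)] .
    have "x (pt u a 0) = \<rho> (pt u (Suc (Suc a)) 0) (pt u (Suc a) 0) (x (pt u (Suc a) 0))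
        + \<rho> (pt u (Suc a) (Suc 0)) (pt u (Suc a) 0) (y (pt u (Suc a) 0))"
      using d1_pt[OF u xy q] d by simp
    also have "\<dots> = - \<rho> bot (pt u (Suc a) 0) (zeta (Suc a)) + \<rho> bot (pt u (Suc a) 0) (eta (Suc a))"
      unfolding IH yy[OF q] rho_minus
      using etaN zetaN by (subst (1 2) rho_comp) (auto intro!: pt_T pt_le_pt bot_le uT)
    also have "\<dots> = - \<rho> bot (pt u (Suc a) 0) (zeta a)"
      by (simp add: zeta_def rho_add)
    finally show ?case .
  qed
  have ZN: "Z a b \<in> N (pt u (Suc a) (Suc b))" for a b
    unfolding Z_def using zetaN by (intro rho_closed pt_T bot_le bot_T uT) auto
  let ?z = "of_coords u Z"
  have z: "chain2 u ?z" by (rule chain2_of_coords[OF u ZN])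
  have "d2x ?z = x"
  proof (rule chain_eqI[OF uT])
    fix a b assume q: "pt u a b \<in> W"
    have q': "pt u a (b - 1) \<in> W" using pt_smaller_W[OF uT q, of a "b - 1"] by simp
    have "\<rho> (pt u (Suc a) (Suc b)) (pt u (Suc a) b) (Z a b) = \<rho> bot (pt u (Suc a) b) (zeta a)"
      unfolding Z_def using zetaN by (intro rho_comp pt_T bot_le bot_T uT pt_le_pt) auto
    then have dz: "d2x ?z (pt u a b) = (if b = 0 then 0 else Z a (b - 1)) - \<rho> bot (pt u (Suc a) b) (zeta a)"
      using d2x_pt[OF u z q] of_coords_pt[OF u] q q' by simp
    show "d2x ?z (pt u a b) = x (pt u a b)"
    proof (cases "b = 0")
      case True
      then show ?thesis using dz e[of a] r[of a] q by simp
    next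
      case False
      then show ?thesis using dz x0[OF q] by (simp add: Z_def)
    qed
  next
    fix q assume "\<not> (q \<in> W \<and> le q u)"
    then show "d2x ?z q = x q" using chain2_d2[OF uT z] xy unfolding chain1_def by metis
  qed
  moreover have "d2y ?z = y"
  proof (rule chain_eqI[OF uT])
    fix a b assume q: "pt u a b \<in> W"
    have q': "pt u (a - 1) b \<in> W" using pt_smaller_W[OF uT q, of "a - 1" b] by simp
    have "\<rho> (pt u (Suc a) (Suc b)) (pt u a (Suc b)) (Z a b) = \<rho> bot (pt u a (Suc b)) (zeta a)"
      unfolding Z_def using zetaN by (intro rho_comp pt_T bot_le bot_T uT pt_le_pt) auto
    then have dz: "d2y ?z (pt u a b) = \<rho> bot (pt u a (Suc b)) (zeta a) - (if a = 0 then 0 else Z (a - 1) b)"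
      using d2y_pt[OF u z q] of_coords_pt[OF u] q q' by simp
    show "d2y ?z (pt u a b) = y (pt u a b)"
    proof (cases a)
      case 0
      then show ?thesis using dz yy[OF q] by (simp add: zeta_def)
    next
      case (Suc a')
      then show ?thesis using dz yy[OF q] by (simp add: zeta_def Z_def rho_add)
    qed
  next
    fix q assume "\<not> (q \<in> W \<and> le q u)"
    then show "d2y ?z q = y q" using chain2_d2[OF uT z] xy unfolding chain1_def by metis
  qed
  ultimately show ?thesis using z by blast
qed

lemma exact_1:
  assumes u: "u \<in> T" and xy: "chain1 u x y" and d: "d1 x y = (\<lambda>_. 0)"
  shows "\<exists>z. chain2 u z \<and> d2x z = x \<and> d2y z = y"
proof (cases "u = bot")
  case True
  then have "\<not> (q \<in> W \<and> le q u)" for q using le_bot bot_notin by blast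
  then have "x = (\<lambda>_. 0)" "y = (\<lambda>_. 0)" using xy unfolding chain1_def by metis+
  then show ?thesis
    by (intro exI[of _ "\<lambda>_. 0"]) (auto simp: chain2_def d2x_def d2y_def fun_eq_iff)
next
  case False
  with u have uW: "u \<in> W" by (auto simp: T_def)
  obtain z1 where z1: "chain2 u z1" "\<And>a b. pt u a b \<in> W \<Longrightarrow> b > 0 \<Longrightarrow> d2x z1 (pt u a b) = x (pt u a b)"
    using chain1_straighten[OF uW xy] by blast
  let ?x = "\<lambda>q. x q - d2x z1 q" and ?y = "\<lambda>q. y q - d2y z1 q"
  have "chain1 u ?x ?y" by (rule chain1_diff[OF xy chain2_d2[OF u z1(1)]])
  moreover have "d1 ?x ?y = (\<lambda>_. 0)"
    using d d1_d2[OF u z1(1)] by (simp add: d1_diff)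
  ultimately obtain z2 where z2: "chain2 u z2" "d2x z2 = ?x" "d2y z2 = ?y"
    using exact_1_straight[OF uW, of ?x ?y] z1(2) by auto
  have "d2x (\<lambda>q. z1 q + z2 q) = x" "d2y (\<lambda>q. z1 q + z2 q) = y"
    unfolding d2_add z2(2,3) by auto
  with chain2_add[OF z1(1) z2(1)] show ?thesis by blast
qed

end

section \<open>Incidence rings\<close>

text \<open>Matrices indexed by \<open>L\<close> with zeros off the relation. They act on rows, so a right module over this ring
  has a map from its component at \<open>t\<close> to its component at \<open>s\<close> whenever \<open>P t s\<close>.\<close>

definition inc_ring :: "'w set \<Rightarrow> ('w \<Rightarrow> 'w \<Rightarrow> bool) \<Rightarrow> ('w \<Rightarrow> 'w \<Rightarrow> 'k::field) ring"
  where "inc_ring L P = \<lparr>carrier = {c. \<forall>t s. c t s \<noteq> 0 \<longrightarrow> t \<in> L \<and> s \<in> L \<and> P t s},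
     mult = (\<lambda>c c' t s. \<Sum>r\<in>L. c t r * c' r s),
     one = (\<lambda>t s. if t = s \<and> t \<in> L then 1 else 0), zero = 0, add = (+)\<rparr>"

locale finite_preorder =
  fixes L :: "'w set" and le :: "'w \<Rightarrow> 'w \<Rightarrow> bool"
  assumes finite_L: "finite L" and refl_L: "t \<in> L \<Longrightarrow> le t t"
    and trans_L: "\<lbrakk>t \<in> L; s \<in> L; r \<in> L; le t s; le s r\<rbrakk> \<Longrightarrow> le t r"
begin

abbreviation "Inc \<equiv> carrier (inc_ring L le)"

lemma Inc_iff: "c \<in> Inc \<longleftrightarrow> (\<forall>t s. c t s \<noteq> 0 \<longrightarrow> t \<in> L \<and> s \<in> L \<and> le t s)"
  by (simp add: inc_ring_def)

lemma Inc_outside: "c \<in> Inc \<Longrightarrow> \<not> (t \<in> L \<and> s \<in> L \<and> le t s) \<Longrightarrow> c t s = 0"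
  by (auto simp: Inc_iff)

lemma inc_mult: "c \<otimes>\<^bsub>inc_ring L le\<^esub> c' = (\<lambda>t s. \<Sum>r\<in>L. c t r * c' r s)"
  by (simp add: inc_ring_def)

lemma inc_mult_closed:
  assumes "c \<in> Inc" "c' \<in> Inc"
  shows "c \<otimes>\<^bsub>inc_ring L le\<^esub> c' \<in> Inc"
  unfolding Inc_iff
proof (intro allI impI)
  fix t s assume "(c \<otimes>\<^bsub>inc_ring L le\<^esub> c') t s \<noteq> 0"
  then have "(\<Sum>r\<in>L. c t r * c' r s) \<noteq> 0" by (simp add: inc_ring_def)
  then obtain r where "r \<in> L" "c t r * c' r s \<noteq> 0"
    by (rule sum.not_neutral_contains_not_neutral)
  then show "t \<in> L \<and> s \<in> L \<and> le t s" using assms trans_L[of t r s] by (auto simp: Inc_iff)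
qed

lemma inc_add_closed: "c \<in> Inc \<Longrightarrow> c' \<in> Inc \<Longrightarrow> c + c' \<in> Inc"
  unfolding Inc_iff by (metis add_0 plus_fun_apply)

lemma sum_delta_L: "(\<Sum>r\<in>L. (if t = r \<and> t \<in> L then 1 else 0) * f r) = (if t \<in> L then f t else (0::'k::field))"
proof -
  have "(\<Sum>r\<in>L. (if t = r \<and> t \<in> L then 1 else 0) * f r) = (\<Sum>r\<in>L. if t = r then f r else 0)"
    by (intro sum.cong) auto
  then show ?thesis using finite_L by (simp add: sum.delta)
qed

lemma sum_delta_L': "(\<Sum>r\<in>L. f r * (if r = s \<and> r \<in> L then 1 else 0)) = (if s \<in> L then f s else (0::'k::field))"
proof -
  have "(\<Sum>r\<in>L. f r * (if r = s \<and> r \<in> L then 1 else 0)) = (\<Sum>r\<in>L. if r = s then f r else 0)"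
    by (intro sum.cong) auto
  then show ?thesis using finite_L by (simp add: sum.delta')
qed

lemma ring_inc_ring: "ring (inc_ring L le :: ('w \<Rightarrow> 'w \<Rightarrow> 'k::field) ring)"
proof (rule ringI)
  let ?I = "inc_ring L le :: ('w \<Rightarrow> 'w \<Rightarrow> 'k) ring"
  show "abelian_group ?I"
  proof (rule abelian_groupI)
    fix x assume "x \<in> carrier ?I"
    then show "\<exists>y\<in>carrier ?I. y \<oplus>\<^bsub>?I\<^esub> x = \<zero>\<^bsub>?I\<^esub>"
      by (intro bexI[of _ "- x"]) (auto simp: inc_ring_def)
  next
    show "\<And>x y. x \<in> carrier ?I \<Longrightarrow> y \<in> carrier ?I \<Longrightarrow> x \<oplus>\<^bsub>?I\<^esub> y \<in> carrier ?I"
      using inc_add_closed by (simp add: inc_ring_def)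
  qed (auto simp: inc_ring_def ac_simps)
  show "Group.monoid ?I"
  proof (rule monoidI)
    fix x y z assume xyz: "x \<in> carrier ?I" "y \<in> carrier ?I" "z \<in> carrier ?I"
    have assoc: "(\<Sum>r\<in>L. (\<Sum>q\<in>L. x t q * y q r) * z r s) = (\<Sum>q\<in>L. x t q * (\<Sum>r\<in>L. y q r * z r s))" for t s
      unfolding sum_distrib_left sum_distrib_right mult.assoc by (rule sum.swap)
    show "x \<otimes>\<^bsub>?I\<^esub> y \<otimes>\<^bsub>?I\<^esub> z = x \<otimes>\<^bsub>?I\<^esub> (y \<otimes>\<^bsub>?I\<^esub> z)"
      unfolding inc_mult by (rule ext, rule ext, rule assoc)
  next
    fix x assume x: "x \<in> carrier ?I"
    have o: "\<one>\<^bsub>?I\<^esub> = (\<lambda>t s. if t = s \<and> t \<in> L then 1 else 0)" by (simp add: inc_ring_def)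
    have "(if t \<in> L then x t s else 0) = x t s" "(if s \<in> L then x t s else 0) = x t s" for t s
      using Inc_outside[OF x, of t s] by auto
    then show "\<one>\<^bsub>?I\<^esub> \<otimes>\<^bsub>?I\<^esub> x = x" "x \<otimes>\<^bsub>?I\<^esub> \<one>\<^bsub>?I\<^esub> = x"
      unfolding inc_mult o sum_delta_L sum_delta_L' by auto
  next
    show "\<one>\<^bsub>?I\<^esub> \<in> carrier ?I" by (auto simp: inc_ring_def refl_L)
  qed (rule inc_mult_closed)
qed (auto simp: inc_ring_def fun_eq_iff sum.distrib distrib_left distrib_right)

end

locale incidence_iso = finite_preorder L le + R?: ring R
  for L :: "'w set" and le and R :: "('r, 'x) ring_scheme" (structure) +
  fixes \<chi> :: "'r \<Rightarrow> 'w \<Rightarrow> 'w \<Rightarrow> 'k::field"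
  assumes chi_iso: "\<chi> \<in> ring_iso R (inc_ring L le)"
begin

definition \<psi> :: "('w \<Rightarrow> 'w \<Rightarrow> 'k) \<Rightarrow> 'r"
  where "\<psi> = inv_into (carrier R) \<chi>"

lemma chi_closed: "g \<in> carrier R \<Longrightarrow> \<chi> g \<in> Inc"
  using ring_iso_memE(1)[OF chi_iso] .

lemma chi_mult: "g \<in> carrier R \<Longrightarrow> h \<in> carrier R \<Longrightarrow> \<chi> (g \<otimes> h) t s = (\<Sum>r\<in>L. \<chi> g t r * \<chi> h r s)"
  using ring_iso_memE(2)[OF chi_iso, of g h] by (simp add: inc_ring_def)

lemma chi_add: "g \<in> carrier R \<Longrightarrow> h \<in> carrier R \<Longrightarrow> \<chi> (g \<oplus> h) t s = \<chi> g t s + \<chi> h t s"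
  using ring_iso_memE(3)[OF chi_iso, of g h] by (simp add: inc_ring_def)

lemma chi_one: "\<chi> \<one> t s = (if t = s \<and> t \<in> L then 1 else 0)"
  using ring_iso_memE(4)[OF chi_iso] by (simp add: inc_ring_def)

lemma chi_inj: "g \<in> carrier R \<Longrightarrow> h \<in> carrier R \<Longrightarrow> \<chi> g = \<chi> h \<Longrightarrow> g = h"
  using ring_iso_memE(5)[OF chi_iso] by (auto simp: bij_betw_def inj_on_def)

lemma psi_closed: "c \<in> Inc \<Longrightarrow> \<psi> c \<in> carrier R" and chi_psi: "c \<in> Inc \<Longrightarrow> \<chi> (\<psi> c) = c"
  using ring_iso_memE(5)[OF chi_iso] unfolding \<psi>_def bij_betw_def
  by (auto simp: inv_into_into f_inv_into_f)

lemma psi_chi: "g \<in> carrier R \<Longrightarrow> \<psi> (\<chi> g) = g"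
  using chi_inj psi_closed chi_psi chi_closed by metis

lemma psi_add: "c \<in> Inc \<Longrightarrow> c' \<in> Inc \<Longrightarrow> \<psi> (c + c') = \<psi> c \<oplus> \<psi> c'"
  by (rule chi_inj) (auto simp: psi_closed inc_add_closed chi_psi chi_add fun_eq_iff)

lemma psi_mult: "c \<in> Inc \<Longrightarrow> c' \<in> Inc \<Longrightarrow> \<psi> (c \<otimes>\<^bsub>inc_ring L le\<^esub> c') = \<psi> c \<otimes> \<psi> c'"
  by (rule chi_inj)
    (auto simp: psi_closed inc_mult_closed chi_psi chi_mult fun_eq_iff, simp add: inc_ring_def)

lemma zero_Inc: "0 \<in> Inc"
  by (auto simp: Inc_iff)

lemma psi_0: "\<psi> 0 = \<zero>"
  using psi_add[OF zero_Inc zero_Inc] psi_closed[OF zero_Inc] by (simp add: R.add.l_cancel_one')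

lemma chi_0: "\<chi> \<zero> = 0"
  using chi_psi[OF zero_Inc] by (simp add: psi_0)

end

section \<open>Transport along injections\<close>

text \<open>Homomorphisms that may take any value off the carrier, so that they compose without
  restriction; \<open>rhom\<close> demands a fixed value there.\<close>

definition rlinear :: "('a, 'x) ring_scheme \<Rightarrow> ('a, 'b, 'y) module_scheme \<Rightarrow> ('a, 'c, 'z) module_scheme \<Rightarrow> ('b \<Rightarrow> 'c) \<Rightarrow> bool"
  where "rlinear R M N f \<longleftrightarrow> f \<in> carrier M \<rightarrow> carrier N \<and>
      (\<forall>m\<in>carrier M. \<forall>m'\<in>carrier M. f (m \<oplus>\<^bsub>M\<^esub> m') = f m \<oplus>\<^bsub>N\<^esub> f m') \<and>
      (\<forall>a\<in>carrier R. \<forall>m\<in>carrier M. f (a \<odot>\<^bsub>M\<^esub> m) = a \<odot>\<^bsub>N\<^esub> f m)"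

text \<open>The copy of a module along an injection. Resolutions are built from families of functions and then
  copied into the type in which the terms of a resolution have to stable_indices.\<close>

definition transport :: "('b \<Rightarrow> 'c) \<Rightarrow> ('a, 'b, 'y) module_scheme \<Rightarrow> ('a, 'c) module"
  where "transport e M = (let d = inv_into (carrier M) e in
    \<lparr>carrier = e ` carrier M, mult = undefined, one = undefined, zero = e \<zero>\<^bsub>M\<^esub>,
     add = (\<lambda>x y. e (d x \<oplus>\<^bsub>M\<^esub> d y)), smult = (\<lambda>a x. e (a \<odot>\<^bsub>M\<^esub> d x))\<rparr>)"

lemma transport_simps:
  assumes "inj_on e (carrier M)"
  shows "carrier (transport e M) = e ` carrier M" "\<zero>\<^bsub>transport e M\<^esub> = e \<zero>\<^bsub>M\<^esub>"
    "x \<in> carrier M \<Longrightarrow> y \<in> carrier M \<Longrightarrow> e x \<oplus>\<^bsub>transport e M\<^esub> e y = e (x \<oplus>\<^bsub>M\<^esub> y)"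
    "x \<in> carrier M \<Longrightarrow> a \<odot>\<^bsub>transport e M\<^esub> e x = e (a \<odot>\<^bsub>M\<^esub> x)"
  using assms by (auto simp: transport_def Let_def)

lemma right_module_transport:
  assumes M: "right_module R M" and e: "inj_on e (carrier M)"
  shows "right_module R (transport e M)"
proof -
  interpret right_module R M by (rule M)
  note t = transport_simps[OF e]
  have "abelian_group (transport e M)"
  proof (rule abelian_groupI)
    fix x assume "x \<in> carrier (transport e M)"
    then obtain m where m: "m \<in> carrier M" "x = e m" by (auto simp: t)
    then show "\<exists>y\<in>carrier (transport e M). y \<oplus>\<^bsub>transport e M\<^esub> x = \<zero>\<^bsub>transport e M\<^esub>"
      by (intro bexI[of _ "e (\<ominus>\<^bsub>M\<^esub> m)"]) (auto simp: t M.l_neg)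
  qed (auto simp: t M.add.m_ac)
  then show ?thesis
    by (intro right_module.intro right_module_axioms.intro)
      (auto simp: t act_closed act_add_scalar act_add act_mult act_one R.ring_axioms)
qed

lemma free_rmodule_simps:
  "f \<in> carrier (free_rmodule R X) \<longleftrightarrow>
     (\<forall>x. f x \<in> carrier R) \<and> (\<forall>x. x \<notin> X \<longrightarrow> f x = \<zero>\<^bsub>R\<^esub>) \<and> finite {x. f x \<noteq> \<zero>\<^bsub>R\<^esub>}"
  "f \<oplus>\<^bsub>free_rmodule R X\<^esub> g = (\<lambda>x. f x \<oplus>\<^bsub>R\<^esub> g x)"
  "a \<odot>\<^bsub>free_rmodule R X\<^esub> f = (\<lambda>x. f x \<otimes>\<^bsub>R\<^esub> a)"
  by (simp_all add: free_rmodule_def)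

lemma (in ring) free_rmodule_pullback:
  assumes h: "inj_on h X"
  shows "rlinear R (free_rmodule R (h ` X)) (free_rmodule R X) (\<lambda>g x. if x \<in> X then g (h x) else \<zero>)"
  unfolding rlinear_def
proof (intro conjI ballI Pi_I)
  fix g assume g: "g \<in> carrier (free_rmodule R (h ` X))"
  have "{x. (if x \<in> X then g (h x) else \<zero>) \<noteq> \<zero>} = {x \<in> X. h x \<in> {y. g y \<noteq> \<zero>}}" by auto
  moreover have "finite {x \<in> X. h x \<in> {y. g y \<noteq> \<zero>}}"
    using g h finite_vimage_IntI[of "{y. g y \<noteq> \<zero>}" h X]
    by (simp add: free_rmodule_simps vimage_def Int_def conj_commute)
  ultimately show "(\<lambda>x. if x \<in> X then g (h x) else \<zero>) \<in> carrier (free_rmodule R X)"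
    using g by (simp add: free_rmodule_simps)
qed (auto simp: free_rmodule_simps fun_eq_iff)

lemma (in ring) free_rmodule_pushforward:
  assumes h: "inj_on h X"
  shows "rlinear R (free_rmodule R X) (free_rmodule R (h ` X))
    (\<lambda>f y. if y \<in> h ` X then f (inv_into X h y) else \<zero>)"
  unfolding rlinear_def
proof (intro conjI ballI Pi_I)
  fix f assume f: "f \<in> carrier (free_rmodule R X)"
  have "{y. (if y \<in> h ` X then f (inv_into X h y) else \<zero>) \<noteq> \<zero>} \<subseteq> h ` {x. f x \<noteq> \<zero>}"
    using h by auto
  then have "finite {y. (if y \<in> h ` X then f (inv_into X h y) else \<zero>) \<noteq> \<zero>}"
    using f finite_surj[of "{x. f x \<noteq> \<zero>}" _ h] by (simp add: free_rmodule_simps)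
  then show "(\<lambda>y. if y \<in> h ` X then f (inv_into X h y) else \<zero>) \<in> carrier (free_rmodule R (h ` X))"
    using f by (simp add: free_rmodule_simps)
qed (auto simp: free_rmodule_simps fun_eq_iff)

lemma rlinear_comp:
  assumes "rlinear R M N f" "rlinear R N P g"
  shows "rlinear R M P (\<lambda>x. g (f x))"
proof -
  have "f m \<in> carrier N" if "m \<in> carrier M" for m using assms(1) that by (auto simp: rlinear_def)
  then show ?thesis using assms unfolding rlinear_def by (auto simp: Pi_iff)
qed

lemma restrict_rlinear:
  assumes "rlinear R M N f" "right_module R M"
  shows "restrict f (carrier M) \<in> rhom R M N"
proof -
  interpret right_module R M by (rule assms(2))
  show ?thesis using assms(1) by (auto simp: rhom_def rlinear_def act_closed)
qed

lemma rlinear_transport: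
  assumes "right_module R M" "inj_on e (carrier M)"
  shows "rlinear R M (transport e M) e" "rlinear R (transport e M) M (inv_into (carrier M) e)"
proof -
  interpret right_module R M by (rule assms(1))
  show "rlinear R M (transport e M) e" "rlinear R (transport e M) M (inv_into (carrier M) e)"
    using assms(2) by (auto simp: rlinear_def transport_simps act_closed)
qed

lemma (in ring) free_rmodule_rhom:
  assumes P: "rlinear R (free_rmodule R X) M p"
  shows "restrict p (carrier (free_rmodule R X)) \<in> rhom R (free_rmodule R X) M"
  unfolding rhom_def
proof (intro CollectI conjI ballI)
  let ?F = "free_rmodule R X"
  show "restrict p (carrier ?F) \<in> carrier ?F \<rightarrow>\<^sub>E carrier M"
    using P unfolding rlinear_def by auto
next
  let ?F = "free_rmodule R X"
  fix f g assume fg: "f \<in> carrier ?F" "g \<in> carrier ?F"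
  have "{x. f x \<oplus> g x \<noteq> \<zero>} \<subseteq> {x. f x \<noteq> \<zero>} \<union> {x. g x \<noteq> \<zero>}" by auto
  then have "f \<oplus>\<^bsub>?F\<^esub> g \<in> carrier ?F"
    using fg by (auto simp: free_rmodule_simps intro: finite_subset)
  then show "restrict p (carrier ?F) (f \<oplus>\<^bsub>?F\<^esub> g) = restrict p (carrier ?F) f \<oplus>\<^bsub>M\<^esub> restrict p (carrier ?F) g"
    using P fg unfolding rlinear_def restrict_def by simp
next
  let ?F = "free_rmodule R X"
  fix a f assume af: "a \<in> carrier R" "f \<in> carrier ?F"
  have "{x. f x \<otimes> a \<noteq> \<zero>} \<subseteq> {x. f x \<noteq> \<zero>}" using af by auto
  then have "a \<odot>\<^bsub>?F\<^esub> f \<in> carrier ?F"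
    using af by (auto simp: free_rmodule_simps intro: finite_subset)
  then show "restrict p (carrier ?F) (a \<odot>\<^bsub>?F\<^esub> f) = a \<odot>\<^bsub>M\<^esub> restrict p (carrier ?F) f"
    using P af unfolding rlinear_def restrict_def by simp
qed

text \<open>Both the module and the basis of the free module are moved into the new type.\<close>

lemma projective_transport:
  fixes M :: "('r, 'b, 'y) module_scheme" and X :: "'x set" and h :: "'x \<Rightarrow> 'c" and e :: "'b \<Rightarrow> 'c"
  assumes M: "right_module R M" and e: "inj_on e (carrier M)" and h: "inj_on h X"
    and i: "rlinear R M (free_rmodule R X) i" and p: "rlinear R (free_rmodule R X) M p"
    and pi: "\<And>m. m \<in> carrier M \<Longrightarrow> p (i m) = m"
  shows "projective_rmodule R (transport e M)"
  unfolding projective_rmodule_def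
proof (intro conjI exI bexI ballI)
  interpret right_module R M by (rule M)
  note [simp] = transport_simps[OF e]
  let ?push = "\<lambda>f y. if y \<in> h ` X then f (inv_into X h y) else \<zero>\<^bsub>R\<^esub>"
  let ?pull = "\<lambda>g x. if x \<in> X then g (h x) else \<zero>\<^bsub>R\<^esub>"
  let ?d = "inv_into (carrier M) e"
  let ?i = "\<lambda>x. ?push (i (?d x))" and ?p = "\<lambda>g. e (p (?pull g))"
  show "right_module R (transport e M)" by (rule right_module_transport[OF M e])
  have I: "rlinear R (transport e M) (free_rmodule R (h ` X)) ?i"
    using rlinear_comp[OF rlinear_comp[OF rlinear_transport(2)[OF M e] i] R.free_rmodule_pushforward[OF h]] .
  have P: "rlinear R (free_rmodule R (h ` X)) (transport e M) ?p"
    using rlinear_comp[OF rlinear_comp[OF R.free_rmodule_pullback[OF h] p] rlinear_transport(1)[OF M e]] .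
  show "restrict ?i (carrier (transport e M)) \<in> rhom R (transport e M) (free_rmodule R (h ` X))"
    by (rule restrict_rlinear[OF I right_module_transport[OF M e]])
  show "restrict ?p (carrier (free_rmodule R (h ` X))) \<in> rhom R (free_rmodule R (h ` X)) (transport e M)"
    by (rule R.free_rmodule_rhom[OF P])
  fix x assume x: "x \<in> carrier (transport e M)"
  then obtain m where m: "m \<in> carrier M" "x = e m" by auto
  then have dx: "?d x = m" using e by simp
  have im: "i m \<in> carrier (free_rmodule R X)" using i m by (auto simp: rlinear_def)
  have pp: "?pull (?push (i m)) = i m"
    using im h by (auto simp: free_rmodule_simps fun_eq_iff)
  have "?push (i m) \<in> carrier (free_rmodule R (h ` X))"
    using R.free_rmodule_pushforward[OF h] im by (auto simp: rlinear_def simp del: if_image_distrib)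
  then have "restrict ?p (carrier (free_rmodule R (h ` X))) (?push (i m)) = e (p (i m))"
    by (simp only: restrict_apply if_True pp)
  moreover have "restrict ?i (carrier (transport e M)) x = ?push (i m)"
    using x by (simp only: restrict_apply if_True dx)
  ultimately show "restrict ?p (carrier (free_rmodule R (h ` X))) (restrict ?i (carrier (transport e M)) x) = x"
    using m pi[OF m(1)] by (simp only:)
qed

lemma has_proj_resolution_transport:
  fixes Q :: "nat \<Rightarrow> ('r, 'b) module" and e :: "'b \<Rightarrow> ('r, 'm) formal_comb"
    and M :: "('r, 'm, 'y) module_scheme"
  assumes M: "right_module R M" and Q: "\<And>i. right_module R (Q i)"
    and e: "\<And>i. inj_on e (carrier (Q i))"
    and proj: "\<And>i. projective_rmodule R (transport e (Q i))"
    and zero: "\<And>i. i > l \<Longrightarrow> carrier (Q i) = {\<zero>\<^bsub>Q i\<^esub>}"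
    and eps: "rlinear R (Q 0) M \<epsilon>" and delta: "\<And>i. rlinear R (Q (Suc i)) (Q i) (\<delta> i)"
    and surj: "\<epsilon> ` carrier (Q 0) = carrier M"
    and exact_0: "\<delta> 0 ` carrier (Q 1) = {x \<in> carrier (Q 0). \<epsilon> x = \<zero>\<^bsub>M\<^esub>}"
    and exact_Suc: "\<And>i. \<delta> (Suc i) ` carrier (Q (Suc (Suc i))) = {x \<in> carrier (Q (Suc i)). \<delta> i x = \<zero>\<^bsub>Q i\<^esub>}"
  shows "has_proj_resolution R M l"
  unfolding has_proj_resolution_def
proof (intro exI conjI allI impI)
  let ?P = "\<lambda>i. transport e (Q i)" and ?d = "\<lambda>i. inv_into (carrier (Q i)) e"
  let ?\<delta> = "\<lambda>i. restrict (\<lambda>x. e (\<delta> i (?d (Suc i) x))) (carrier (?P (Suc i)))"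
  let ?\<epsilon> = "restrict (\<lambda>x. \<epsilon> (?d 0 x)) (carrier (?P 0))"
  note [simp] = transport_simps[OF e]
  show "projective_rmodule R (?P i)" for i by (rule proj)
  show "carrier (?P i) = {\<zero>\<^bsub>?P i\<^esub>}" if "l < i" for i using zero[OF that] by simp
  show "?\<epsilon> \<in> rhom R (?P 0) M"
    by (rule restrict_rlinear[OF rlinear_comp[OF rlinear_transport(2)[OF Q e] eps] right_module_transport[OF Q e]])
  show "?\<delta> i \<in> rhom R (?P (Suc i)) (?P i)" for i
    by (rule restrict_rlinear[OF rlinear_comp[OF rlinear_comp[OF rlinear_transport(2)[OF Q e] delta]
        rlinear_transport(1)[OF Q e]] right_module_transport[OF Q e]])
  have E: "?\<epsilon> (e x) = \<epsilon> x" if "x \<in> carrier (Q 0)" for x using that e by simp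
  have D: "?\<delta> i (e x) = e (\<delta> i x)" if "x \<in> carrier (Q (Suc i))" for x i using that e by simp
  show "?\<epsilon> ` carrier (?P 0) = carrier M" using surj E by (simp add: image_image)
  have D_image: "?\<delta> i ` carrier (?P (Suc i)) = e ` \<delta> i ` carrier (Q (Suc i))" for i
    unfolding transport_simps(1)[OF e] image_image by (intro image_cong refl) (simp only: D transport_simps(1)[OF e, symmetric])
  have "?\<delta> 0 ` carrier (?P 1) = e ` \<delta> 0 ` carrier (Q 1)" using D_image[of 0] by simp
  also have "\<dots> = {u \<in> carrier (?P 0). ?\<epsilon> u = \<zero>\<^bsub>M\<^esub>}"
    unfolding exact_0 using E by (auto dest: inj_onD[OF e])
  finally show "?\<delta> 0 ` carrier (?P 1) = {u \<in> carrier (?P 0). ?\<epsilon> u = \<zero>\<^bsub>M\<^esub>}" .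
  fix i
  have z: "\<zero>\<^bsub>Q i\<^esub> \<in> carrier (Q i)"
  proof -
    interpret right_module R "Q i" by (rule Q)
    show ?thesis by simp
  qed
  have "e (\<delta> i x) = e \<zero>\<^bsub>Q i\<^esub> \<longleftrightarrow> \<delta> i x = \<zero>\<^bsub>Q i\<^esub>" if "x \<in> carrier (Q (Suc i))" for x
    using inj_on_eq_iff[OF e z, of "\<delta> i x" for x] inj_on_eq_iff[OF e _ z, of "\<delta> i x"] delta[of i] that
    unfolding rlinear_def by auto
  then show "?\<delta> (Suc i) ` carrier (?P (Suc (Suc i))) = {u \<in> carrier (?P (Suc i)). ?\<delta> i u = \<zero>\<^bsub>?P i\<^esub>}"
    unfolding D_image exact_Suc using D by (auto dest: inj_onD[OF e])
qed

section \<open>Induced modules over an incidence ring\<close>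

locale incidence_vs = incidence_iso L le R \<chi> + vector_space scale
  for L :: "'w set" and le and R :: "('r, 'x) ring_scheme" (structure)
    and \<chi> :: "'r \<Rightarrow> 'w \<Rightarrow> 'w \<Rightarrow> 'k::field"
    and scale :: "'k \<Rightarrow> 'v::ab_group_add \<Rightarrow> 'v" (infixr "*s" 75)
begin

text \<open>The right module of all families \<open>\<phi> u j \<in> S u j\<close>, with \<open>u\<close> a vertex and \<open>j\<close> the index of a
  summand: for fixed \<open>j\<close> the family is a row vector, on which the matrix \<open>\<chi> g\<close> acts from the right.\<close>

definition family_module :: "('w \<Rightarrow> 'j \<Rightarrow> 'v set) \<Rightarrow> ('r, 'w \<Rightarrow> 'j \<Rightarrow> 'v) module"
  where "family_module S = \<lparr>carrier = {\<phi>. \<forall>u j. \<phi> u j \<in> S u j}, mult = undefined, one = undefined,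
     zero = (\<lambda>_ _. 0), add = (\<lambda>\<phi> \<phi>' u j. \<phi> u j + \<phi>' u j),
     smult = (\<lambda>g \<phi> v j. \<Sum>u\<in>L. \<chi> g u v *s \<phi> u j)\<rparr>"

lemma family_module_simps [simp]:
  "\<phi> \<in> carrier (family_module S) \<longleftrightarrow> (\<forall>u j. \<phi> u j \<in> S u j)"
  "\<zero>\<^bsub>family_module S\<^esub> = (\<lambda>_ _. 0)" "\<phi> \<oplus>\<^bsub>family_module S\<^esub> \<phi>' = (\<lambda>u j. \<phi> u j + \<phi>' u j)"
  "g \<odot>\<^bsub>family_module S\<^esub> \<phi> = (\<lambda>v j. \<Sum>u\<in>L. \<chi> g u v *s \<phi> u j)"
  by (simp_all add: family_module_def)

definition admissible :: "('w \<Rightarrow> 'j \<Rightarrow> 'v set) \<Rightarrow> bool"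
  where "admissible S \<longleftrightarrow> (\<forall>u j. subspace (S u j)) \<and> (\<forall>u j. u \<notin> L \<longrightarrow> S u j = {0}) \<and>
    (\<forall>u\<in>L. \<forall>v\<in>L. \<forall>j. le u v \<longrightarrow> S u j \<subseteq> S v j)"

lemma chi_outside: "g \<in> carrier R \<Longrightarrow> \<not> (u \<in> L \<and> v \<in> L \<and> le u v) \<Longrightarrow> \<chi> g u v = 0"
  using Inc_outside[OF chi_closed] by blast

lemma cmod_act_closed:
  assumes S: "admissible S" and g: "g \<in> carrier R" and \<phi>: "\<forall>u j. \<phi> u j \<in> S u j"
  shows "(\<Sum>u\<in>L. \<chi> g u v *s \<phi> u j) \<in> S v j"
proof (rule subspace_sum)
  show "subspace (S v j)" using S by (simp add: admissible_def)
  fix u assume u: "u \<in> L"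
  show "\<chi> g u v *s \<phi> u j \<in> S v j"
  proof (cases "\<chi> g u v = 0")
    case True
    then show ?thesis using subspace_0[OF \<open>subspace (S v j)\<close>] by simp
  next
    case False
    then have "v \<in> L" "le u v" using chi_outside[OF g] by blast+
    then have "\<phi> u j \<in> S v j" using S u \<phi> unfolding admissible_def by blast
    then show ?thesis using subspace_scale[OF \<open>subspace (S v j)\<close>] by blast
  qed
qed

lemma right_module_cmod:
  assumes S: "admissible S"
  shows "right_module R (family_module S)"
proof -
  have sub: "subspace (S u j)" for u j using S by (simp add: admissible_def)
  have out: "S u j = {0}" if "u \<notin> L" for u j using S that by (simp add: admissible_def)
  show ?thesis
  proof (intro right_module.intro right_module_axioms.intro R.ring_axioms)
  show "abelian_group (family_module S)"
  proof (rule abelian_groupI)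
    fix \<phi> assume "\<phi> \<in> carrier (family_module S)"
    then show "\<exists>\<phi>'\<in>carrier (family_module S). \<phi>' \<oplus>\<^bsub>family_module S\<^esub> \<phi> = \<zero>\<^bsub>family_module S\<^esub>"
      by (intro bexI[of _ "\<lambda>u j. - \<phi> u j"]) (auto simp: subspace_neg[OF sub])
  qed (auto simp: subspace_add[OF sub] subspace_0[OF sub] ac_simps)
next
  fix g \<phi> assume "g \<in> carrier R" "\<phi> \<in> carrier (family_module S)"
  then show "g \<odot>\<^bsub>family_module S\<^esub> \<phi> \<in> carrier (family_module S)" using cmod_act_closed[OF S] by simp
next
  fix g h \<phi> assume gh: "g \<in> carrier R" "h \<in> carrier R" "\<phi> \<in> carrier (family_module S)"
  show "(g \<oplus> h) \<odot>\<^bsub>family_module S\<^esub> \<phi> = g \<odot>\<^bsub>family_module S\<^esub> \<phi> \<oplus>\<^bsub>family_module S\<^esub> h \<odot>\<^bsub>family_module S\<^esub> \<phi>"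
    using gh by (simp add: chi_add scale_left_distrib sum.distrib)
  have "(\<Sum>u\<in>L. (\<Sum>w\<in>L. \<chi> g u w * \<chi> h w v) *s \<phi> u j) = (\<Sum>w\<in>L. \<chi> h w v *s (\<Sum>u\<in>L. \<chi> g u w *s \<phi> u j))" for v j
    unfolding scale_sum_left scale_sum_right scale_scale by (subst sum.swap) (simp add: mult.commute)
  then show "(g \<otimes> h) \<odot>\<^bsub>family_module S\<^esub> \<phi> = h \<odot>\<^bsub>family_module S\<^esub> (g \<odot>\<^bsub>family_module S\<^esub> \<phi>)"
    using gh by (simp add: chi_mult)
next
  fix g \<phi> \<phi>' assume "g \<in> carrier R" "\<phi> \<in> carrier (family_module S)" "\<phi>' \<in> carrier (family_module S)"
  show "g \<odot>\<^bsub>family_module S\<^esub> (\<phi> \<oplus>\<^bsub>family_module S\<^esub> \<phi>') = g \<odot>\<^bsub>family_module S\<^esub> \<phi> \<oplus>\<^bsub>family_module S\<^esub> g \<odot>\<^bsub>family_module S\<^esub> \<phi>'"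
    by (simp add: scale_right_distrib sum.distrib)
next
  fix \<phi> assume \<phi>: "\<phi> \<in> carrier (family_module S)"
  have "(\<Sum>u\<in>L. \<chi> \<one> u v *s \<phi> u j) = \<phi> v j" for v j
  proof -
    have "(\<Sum>u\<in>L. \<chi> \<one> u v *s \<phi> u j) = (\<Sum>u\<in>L. if u = v then \<phi> u j else 0)"
      by (intro sum.cong refl) (simp add: chi_one)
    also have "\<dots> = (if v \<in> L then \<phi> v j else 0)" using finite_L by (simp add: sum.delta')
    also have "\<dots> = \<phi> v j" using \<phi> out[of v j] by (cases "v \<in> L") auto
    finally show ?thesis .
  qed
  then show "\<one> \<odot>\<^bsub>family_module S\<^esub> \<phi> = \<phi>" by simp
qed
qed

lemma rlinear_cmod:
  assumes S: "admissible S"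
    and closed: "\<And>u f. (\<forall>j. f j \<in> S u j) \<Longrightarrow> (\<forall>j. D f j \<in> S' u j)"
    and add: "\<And>f g. D (\<lambda>j. f j + g j) = (\<lambda>j. D f j + D g j)"
    and scale: "\<And>c f. D (\<lambda>j. c *s f j) = (\<lambda>j. c *s D f j)"
  shows "rlinear R (family_module S) (family_module S') (\<lambda>\<phi> u. D (\<phi> u))"
proof -
  have 0: "D (\<lambda>j. 0) = (\<lambda>j. 0)" using scale[of 0] by simp
  have D_sum: "D (\<lambda>j. \<Sum>i\<in>I. f i j) = (\<lambda>j. \<Sum>i\<in>I. D (f i) j)" if "finite I" for I :: "'w set" and f
    using that by (induction I rule: finite_induct) (simp_all add: 0 add)
  show ?thesis
    using closed by (auto simp: rlinear_def add D_sum[OF finite_L] scale)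
qed

text \<open>The direct sum over \<open>j\<close> of \<open>N (a j) \<otimes> e\<^bsub>b j\<^esub> R\<close>: at the vertex \<open>u\<close> the summand \<open>j\<close> is \<open>N (a j)\<close>
  if \<open>b j \<le> u\<close>, and zero otherwise.\<close>

definition induced :: "('w \<Rightarrow> 'v set) \<Rightarrow> 'j set \<Rightarrow> ('j \<Rightarrow> 'w) \<Rightarrow> ('j \<Rightarrow> 'w) \<Rightarrow> 'w \<Rightarrow> 'j \<Rightarrow> 'v set"
  where "induced N J a b u j = (if u \<in> L \<and> j \<in> J \<and> b j \<in> L \<and> le (b j) u then N (a j) else {0})"

lemma admissible_ind:
  assumes "\<And>t. subspace (N t)"
  shows "admissible (induced N J a b)"
  unfolding admissible_def
proof (intro conjI allI ballI impI)
  fix u j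
  show "subspace (induced N J a b u j)" using assms by (simp add: induced_def)
  show "induced N J a b u j = {0}" if "u \<notin> L" using that by (simp add: induced_def)
  fix v assume uv: "u \<in> L" "v \<in> L" "le u v"
  show "induced N J a b u j \<subseteq> induced N J a b v j"
  proof (cases "j \<in> J \<and> b j \<in> L \<and> le (b j) u")
    case True
    then have "le (b j) v" using trans_L[of "b j" u v] uv by blast
    then show ?thesis using True uv by (simp add: induced_def)
  next
    case False
    then have "induced N J a b u j = {0}" by (auto simp: induced_def)
    moreover have "0 \<in> induced N J a b v j" using subspace_0[OF assms] by (simp add: induced_def)
    ultimately show ?thesis by simp
  qed
qed

text \<open>Projectivity: a basis \<open>B (a j)\<close> of \<open>N (a j)\<close> splits \<open>N (a j) \<otimes> e\<^bsub>b j\<^esub> R\<close> into copies of \<open>e\<^bsub>b j\<^esub> R\<close>,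
  which is a direct summand of \<open>R\<close>.\<close>

lemma ind_basis:
  fixes N :: "'w \<Rightarrow> 'v set" and B :: "'w \<Rightarrow> 'v set"
  assumes induced: "\<And>t. independent (B t)" and span: "\<And>t. span (B t) = N t"
    and finJ: "finite J"
  shows "\<exists>i p. rlinear R (family_module (induced N J a b)) (free_rmodule R {(j, x). j \<in> J \<and> x \<in> B (a j)}) i \<and>
    rlinear R (free_rmodule R {(j, x). j \<in> J \<and> x \<in> B (a j)}) (family_module (induced N J a b)) p \<and>
    (\<forall>\<phi>\<in>carrier (family_module (induced N J a b)). p (i \<phi>) = \<phi>)"
proof -
  let ?X = "{(j, x). j \<in> J \<and> x \<in> B (a j)}" and ?Q = "family_module (induced N J a b)"
  let ?ok = "\<lambda>j u. u \<in> L \<and> j \<in> J \<and> b j \<in> L \<and> le (b j) u"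
  \<comment> \<open>The \<open>x\<close>-coordinates of \<open>\<phi> _ j\<close>, as a matrix with a single row at \<open>b j\<close>.\<close>
  define row where "row \<phi> j x = (\<lambda>t s. if t = b j \<and> ?ok j s then representation (B (a j)) (\<phi> s j) x else 0)" for \<phi> j x
  define i where "i \<phi> = (\<lambda>(j, x). if j \<in> J \<and> x \<in> B (a j) then \<psi> (row \<phi> j x) else \<zero>)" for \<phi>
  define p where "p f = (\<lambda>u j. if ?ok j u then \<Sum>x | x \<in> B (a j) \<and> f (j, x) \<noteq> \<zero>. \<chi> (f (j, x)) (b j) u *s x else 0)" for f
  have row_Inc: "row \<phi> j x \<in> Inc" for \<phi> j x
    by (auto simp: Inc_iff row_def)
  have QN: "\<phi> u j \<in> span (B (a j))" if "\<phi> \<in> carrier ?Q" for \<phi> u j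
  proof -
    have "\<phi> u j \<in> induced N J a b u j" using that by simp
    moreover have "0 \<in> N (a j)" using span_zero[of "B (a j)"] by (simp add: span)
    ultimately show ?thesis by (auto simp: induced_def span split: if_splits)
  qed
  have Q0: "\<phi> u j = 0" if "\<phi> \<in> carrier ?Q" "\<not> ?ok j u" for \<phi> u j
    using that by (auto simp: induced_def split: if_splits)
  have fin: "finite {x. row \<phi> j x \<noteq> 0}" for \<phi> j
  proof (rule finite_subset)
    show "{x. row \<phi> j x \<noteq> 0} \<subseteq> (\<Union>u\<in>L. {x. representation (B (a j)) (\<phi> u j) x \<noteq> 0})"
      by (auto simp: row_def fun_eq_iff split: if_splits)
  qed (use finite_L finite_representation in auto)
  have I: "i \<phi> \<in> carrier (free_rmodule R ?X)" for \<phi>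
  proof -
    have "{y. i \<phi> y \<noteq> \<zero>} \<subseteq> (SIGMA j:J. {x. row \<phi> j x \<noteq> 0})"
      by (auto simp: i_def psi_0 split: if_splits)
    then have "finite {y. i \<phi> y \<noteq> \<zero>}" by (rule finite_subset) (intro finite_SigmaI finJ fin)
    then show ?thesis by (auto simp: free_rmodule_simps i_def psi_closed[OF row_Inc])
  qed
  have i_lin: "rlinear R ?Q (free_rmodule R ?X) i"
    unfolding rlinear_def
  proof (intro conjI ballI Pi_I I)
    fix \<phi> \<phi>' assume q: "\<phi> \<in> carrier ?Q" "\<phi>' \<in> carrier ?Q"
    have "row (\<phi> \<oplus>\<^bsub>?Q\<^esub> \<phi>') j x = row \<phi> j x + row \<phi>' j x" for j x
      using representation_add[OF induced QN[OF q(2)] QN[OF q(1)]]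
      by (auto simp: row_def fun_eq_iff add.commute)
    then have "\<psi> (row (\<phi> \<oplus>\<^bsub>?Q\<^esub> \<phi>') j x) = \<psi> (row \<phi> j x) \<oplus> \<psi> (row \<phi>' j x)" for j x
      by (simp only: psi_add[OF row_Inc row_Inc])
    then show "i (\<phi> \<oplus>\<^bsub>?Q\<^esub> \<phi>') = i \<phi> \<oplus>\<^bsub>free_rmodule R ?X\<^esub> i \<phi>'"
      by (auto simp: i_def free_rmodule_simps fun_eq_iff simp del: family_module_simps)
  next
    fix g \<phi> assume g: "g \<in> carrier R" and q: "\<phi> \<in> carrier ?Q"
    have "row (g \<odot>\<^bsub>?Q\<^esub> \<phi>) j x = row \<phi> j x \<otimes>\<^bsub>inc_ring L le\<^esub> \<chi> g" for j x
    proof (intro ext)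
      fix t s
      have A: "(\<Sum>r\<in>L. row \<phi> j x (b j) r * \<chi> g r s) = (\<Sum>u\<in>L. \<chi> g u s * representation (B (a j)) (\<phi> u j) x)"
        if "j \<in> J" "b j \<in> L"
        using that Q0[OF q] by (intro sum.cong refl) (auto simp: row_def representation_zero)
      have B: "representation (B (a j)) (\<Sum>u\<in>L. \<chi> g u s *s \<phi> u j) x = (\<Sum>u\<in>L. \<chi> g u s * representation (B (a j)) (\<phi> u j) x)"
        using QN[OF q] span_scale by (subst representation_sum[OF induced]) (auto simp: representation_scale[OF induced])
      have C: "(\<Sum>r\<in>L. row \<phi> j x t r * \<chi> g r s) = 0" if "\<not> (t = b j \<and> ?ok j s)"
      proof (intro sum.neutral ballI)
        fix r assume "r \<in> L"
        show "row \<phi> j x t r * \<chi> g r s = 0"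
          using that trans_L[of "b j" r s] chi_outside[OF g, of r s] by (auto simp: row_def)
      qed
      show "row (g \<odot>\<^bsub>?Q\<^esub> \<phi>) j x t s = (row \<phi> j x \<otimes>\<^bsub>inc_ring L le\<^esub> \<chi> g) t s"
        unfolding inc_mult
      proof (cases "t = b j \<and> ?ok j s")
        case True
        then have "row (g \<odot>\<^bsub>?Q\<^esub> \<phi>) j x t s = representation (B (a j)) (\<Sum>u\<in>L. \<chi> g u s *s \<phi> u j) x"
          by (simp add: row_def)
        then show "row (g \<odot>\<^bsub>?Q\<^esub> \<phi>) j x t s = (\<Sum>r\<in>L. row \<phi> j x t r * \<chi> g r s)"
          using True A B by simp
      next
        case False
        show "row (g \<odot>\<^bsub>?Q\<^esub> \<phi>) j x t s = (\<Sum>r\<in>L. row \<phi> j x t r * \<chi> g r s)"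
          unfolding C[OF False] unfolding row_def by (rule if_not_P[OF False])
      qed
    qed
    then have "\<psi> (row (g \<odot>\<^bsub>?Q\<^esub> \<phi>) j x) = \<psi> (row \<phi> j x) \<otimes> g" for j x
      using psi_mult[OF row_Inc chi_closed[OF g]] psi_chi[OF g] by simp
    then show "i (g \<odot>\<^bsub>?Q\<^esub> \<phi>) = g \<odot>\<^bsub>free_rmodule R ?X\<^esub> i \<phi>"
      using g by (auto simp: i_def free_rmodule_simps fun_eq_iff simp del: family_module_simps)
  qed
  have p_eq: "p f u j = (\<Sum>x\<in>F. \<chi> (f (j, x)) (b j) u *s x)"
    if "?ok j u" "finite F" "F \<subseteq> B (a j)" "{x \<in> B (a j). f (j, x) \<noteq> \<zero>} \<subseteq> F" for f u j F
  proof -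
    have "p f u j = (\<Sum>x | x \<in> B (a j) \<and> f (j, x) \<noteq> \<zero>. \<chi> (f (j, x)) (b j) u *s x)"
      using that(1) by (simp add: p_def)
    also have "\<dots> = (\<Sum>x\<in>F. \<chi> (f (j, x)) (b j) u *s x)"
      using that by (intro sum.mono_neutral_left) (auto simp: chi_0)
    finally show ?thesis .
  qed
  have supp: "finite {x \<in> B (a j). f (j, x) \<noteq> \<zero>}" if "f \<in> carrier (free_rmodule R ?X)" for f j
  proof (rule finite_subset)
    show "{x \<in> B (a j). f (j, x) \<noteq> \<zero>} \<subseteq> snd ` {y. f y \<noteq> \<zero>}" by force
  qed (use that in \<open>simp add: free_rmodule_simps\<close>)
  have p_lin: "rlinear R (free_rmodule R ?X) ?Q p"
    unfolding rlinear_def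
  proof (intro conjI ballI Pi_I)
    fix f assume f: "f \<in> carrier (free_rmodule R ?X)"
    have "p f u j \<in> induced N J a b u j" for u j
    proof (cases "?ok j u")
      case True
      have "(\<Sum>x | x \<in> B (a j) \<and> f (j, x) \<noteq> \<zero>. \<chi> (f (j, x)) (b j) u *s x) \<in> span (B (a j))"
        by (intro span_sum span_scale) (auto intro: span_base)
      then show ?thesis using True by (simp add: p_def induced_def span)
    next
      case False
      then show ?thesis unfolding p_def induced_def by (simp only: False if_False insertI1)
    qed
    then show "p f \<in> carrier ?Q" by simp
  next
    fix f g assume fg: "f \<in> carrier (free_rmodule R ?X)" "g \<in> carrier (free_rmodule R ?X)"
    have "p (f \<oplus>\<^bsub>free_rmodule R ?X\<^esub> g) u j = p f u j + p g u j" for u j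
    proof (cases "?ok j u")
      case True
      let ?F = "{x \<in> B (a j). f (j, x) \<noteq> \<zero>} \<union> {x \<in> B (a j). g (j, x) \<noteq> \<zero>}"
      have F: "finite ?F" "?F \<subseteq> B (a j)" using supp fg by auto
      show ?thesis
        using fg by (subst (1 2 3) p_eq[OF True F])
          (auto simp: free_rmodule_simps chi_add scale_left_distrib sum.distrib)
    qed (auto simp: p_def)
    then show "p (f \<oplus>\<^bsub>free_rmodule R ?X\<^esub> g) = p f \<oplus>\<^bsub>?Q\<^esub> p g" by (simp add: fun_eq_iff)
  next
    fix g f assume g: "g \<in> carrier R" and f: "f \<in> carrier (free_rmodule R ?X)"
    have "p (g \<odot>\<^bsub>free_rmodule R ?X\<^esub> f) v j = (\<Sum>u\<in>L. \<chi> g u v *s p f u j)" for v j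
    proof (cases "?ok j v")
      case True
      let ?F = "{x \<in> B (a j). f (j, x) \<noteq> \<zero>}"
      have F: "finite ?F" "?F \<subseteq> B (a j)" using supp f by auto
      have fR: "f y \<in> carrier R" for y using f by (cases y) (simp add: free_rmodule_simps)
      have summand: "\<chi> g u v *s p f u j = (\<Sum>x\<in>?F. (\<chi> (f (j, x)) (b j) u * \<chi> g u v) *s x)" if u: "u \<in> L" for u
      proof (cases "le (b j) u")
        case le: True
        show ?thesis
          using True u le by (subst p_eq[OF _ F]) (auto simp: scale_sum_right mult.commute)
      next
        case False
        then show ?thesis using chi_outside[OF fR] by (simp add: p_def)
      qed
      have "p (g \<odot>\<^bsub>free_rmodule R ?X\<^esub> f) v j = (\<Sum>x\<in>?F. \<chi> (f (j, x) \<otimes> g) (b j) v *s x)"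
        using f g by (subst p_eq[OF True F]) (auto simp: free_rmodule_simps)
      also have "\<dots> = (\<Sum>x\<in>?F. \<Sum>u\<in>L. (\<chi> (f (j, x)) (b j) u * \<chi> g u v) *s x)"
        using g fR by (simp add: chi_mult scale_sum_left)
      also have "\<dots> = (\<Sum>u\<in>L. \<chi> g u v *s p f u j)"
        using summand by (subst sum.swap) simp
      finally show ?thesis .
    next
      case False
      have "\<chi> g u v *s p f u j = 0" if "u \<in> L" for u
      proof (cases "\<chi> g u v = 0")
        case nz: False
        then have "v \<in> L" "le u v" using chi_outside[OF g] by blast+
        then have "\<not> ?ok j u" using False trans_L[of "b j" u v] by blast
        then show ?thesis by (auto simp: p_def)
      qed simp
      then have "(\<Sum>u\<in>L. \<chi> g u v *s p f u j) = 0" by (rule sum.neutral[OF ballI])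
      moreover have "p (g \<odot>\<^bsub>free_rmodule R ?X\<^esub> f) v j = 0" unfolding p_def by (rule if_not_P[OF False])
      ultimately show ?thesis by simp
    qed
    then show "p (g \<odot>\<^bsub>free_rmodule R ?X\<^esub> f) = g \<odot>\<^bsub>?Q\<^esub> p f" by (simp add: fun_eq_iff)
  qed
  have "p (i \<phi>) u j = \<phi> u j" if q: "\<phi> \<in> carrier ?Q" for \<phi> u j
  proof (cases "?ok j u")
    case True
    let ?F = "{x \<in> B (a j). i \<phi> (j, x) \<noteq> \<zero>}" and ?r = "representation (B (a j)) (\<phi> u j)"
    have F: "finite ?F" "?F \<subseteq> B (a j)" using supp[OF I] by auto
    have val: "\<chi> (i \<phi> (j, x)) (b j) u = ?r x" if "x \<in> B (a j)" for x
      using that True by (simp add: i_def chi_psi[OF row_Inc]) (simp add: row_def)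
    have "p (i \<phi>) u j = (\<Sum>x\<in>?F. ?r x *s x)"
      using val by (subst p_eq[OF True F]) auto
    also have "\<dots> = (\<Sum>x | ?r x \<noteq> 0. ?r x *s x)"
    proof (rule sum.mono_neutral_right[OF F(1)])
      show "{x. ?r x \<noteq> 0} \<subseteq> ?F"
        using val representation_ne_zero[of "B (a j)" "\<phi> u j"] chi_0 by force
    qed auto
    also have "\<dots> = \<phi> u j" by (rule sum_nonzero_representation_eq[OF induced QN[OF q]])
    finally show ?thesis .
  next
    case False
    then show ?thesis using Q0[OF q False] by (auto simp: p_def)
  qed
  then show ?thesis using i_lin p_lin by (intro exI[of _ i] exI[of _ p]) (auto simp: fun_eq_iff)
qed

end

section \<open>Embedding a module into a function space\<close>

definition fscale :: "'k::field \<Rightarrow> ('m \<Rightarrow> 'k) \<Rightarrow> 'm \<Rightarrow> 'k"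
  where "fscale c f = (\<lambda>x. c * f x)"

lemma vector_space_fscale: "vector_space (fscale :: 'k::field \<Rightarrow> ('m \<Rightarrow> 'k) \<Rightarrow> _)"
  by unfold_locales (auto simp: fscale_def fun_eq_iff algebra_simps)

lemma projection_onto_subspace:
  fixes V :: "('m \<Rightarrow> 'k::field) set"
  assumes "module.subspace fscale V"
  obtains g where "\<And>x y. g (x + y) = g x + g y" "\<And>c x. g (fscale c x) = fscale c (g x)"
    "\<And>x. g x \<in> V" "\<And>x. x \<in> V \<Longrightarrow> g x = x"
proof -
  interpret vector_space "fscale :: 'k \<Rightarrow> ('m \<Rightarrow> 'k) \<Rightarrow> _" by (rule vector_space_fscale)
  interpret vector_space_pair "fscale :: 'k \<Rightarrow> ('m \<Rightarrow> 'k) \<Rightarrow> _" "fscale :: 'k \<Rightarrow> ('m \<Rightarrow> 'k) \<Rightarrow> _" ..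
  have "Vector_Spaces.linear fscale fscale (\<lambda>x :: 'm \<Rightarrow> 'k. x)" by (rule linear_ident)
  then obtain g where g: "g ` UNIV \<subseteq> V" "Vector_Spaces.linear fscale fscale g" "\<forall>v\<in>V. g v = v"
    using linear_exists_left_inverse_on[of "\<lambda>x. x" V] assms by auto
  interpret g: Vector_Spaces.linear fscale fscale g by (rule g)
  show ?thesis using that[of g] g g.add g.scale by auto
qed

text \<open>The linear combination map from the finitely supported functions on the carrier of \<open>M\<close> onto \<open>M\<close> has a kernel with
  a complement in the space of all functions; composing the projection along the kernel with the
  delta functions embeds \<open>M\<close>. In this way the components of \<open>M\<close> become subspaces of a type of
  vectors that depends on the type of the elements of \<open>M\<close> only.\<close>

lemma embed_vector_space:
  fixes M :: "('m, 'y) ring_scheme" and sm :: "'k::field \<Rightarrow> 'm \<Rightarrow> 'm"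
  assumes M: "abelian_group M"
    and closed: "\<And>c x. x \<in> carrier M \<Longrightarrow> sm c x \<in> carrier M"
    and distrib_l: "\<And>c x y. x \<in> carrier M \<Longrightarrow> y \<in> carrier M \<Longrightarrow> sm c (x \<oplus>\<^bsub>M\<^esub> y) = sm c x \<oplus>\<^bsub>M\<^esub> sm c y"
    and distrib_r: "\<And>c d x. x \<in> carrier M \<Longrightarrow> sm (c + d) x = sm c x \<oplus>\<^bsub>M\<^esub> sm d x"
    and assoc: "\<And>c d x. x \<in> carrier M \<Longrightarrow> sm (c * d) x = sm c (sm d x)"
    and one: "\<And>x. x \<in> carrier M \<Longrightarrow> sm 1 x = x"
  obtains \<sigma> :: "'m \<Rightarrow> 'm \<Rightarrow> 'k"
  where "inj_on \<sigma> (carrier M)"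
    "\<And>x y. x \<in> carrier M \<Longrightarrow> y \<in> carrier M \<Longrightarrow> \<sigma> (x \<oplus>\<^bsub>M\<^esub> y) = \<sigma> x + \<sigma> y"
    "\<And>c x. x \<in> carrier M \<Longrightarrow> \<sigma> (sm c x) = fscale c (\<sigma> x)"
proof -
  interpret M: abelian_group M by (rule M)
  define E where "E S f = finsum M (\<lambda>x. sm (f x) x) S" for S and f :: "'m \<Rightarrow> 'k"
  have sm_0: "sm 0 x = \<zero>\<^bsub>M\<^esub>" if "x \<in> carrier M" for x
    using distrib_r[OF that, of 0 0] closed[OF that, of 0] by (simp add: M.add.l_cancel_one')
  have sm_z: "sm c \<zero>\<^bsub>M\<^esub> = \<zero>\<^bsub>M\<^esub>" for c
    using distrib_l[of "\<zero>\<^bsub>M\<^esub>" "\<zero>\<^bsub>M\<^esub>" c] closed[of "\<zero>\<^bsub>M\<^esub>" c] by (simp add: M.add.l_cancel_one')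
  have E_closed: "E S f \<in> carrier M" if "S \<subseteq> carrier M" for S f
    unfolding E_def using closed that by (intro M.finsum_closed) auto
  have E_add: "E S (f + g) = E S f \<oplus>\<^bsub>M\<^esub> E S g" if "S \<subseteq> carrier M" for S f g
  proof -
    have "finsum M (\<lambda>x. sm ((f + g) x) x) S = finsum M (\<lambda>x. sm (f x) x \<oplus>\<^bsub>M\<^esub> sm (g x) x) S"
      using that closed by (intro M.finsum_cong') (auto simp: distrib_r subset_iff)
    then show ?thesis unfolding E_def using that closed by (subst (asm) M.finsum_addf) auto
  qed
  have E_scale: "E S (fscale c f) = sm c (E S f)" if "finite S" "S \<subseteq> carrier M" for S c f
    using that
  proof (induction S rule: finite_induct)
    case (insert x S)
    then show ?case
      using closed by (simp add: E_def fscale_def M.finsum_insert assoc distrib_l Pi_iff subset_iff M.finsum_closed)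
  qed (simp add: E_def sm_z)
  have E_super: "E S' f = E S f" if "finite S'" "S' \<subseteq> carrier M" "S \<subseteq> S'" "\<And>x. f x \<noteq> 0 \<Longrightarrow> x \<in> S" for S S' f
  proof -
    have "sm (f x) x = \<zero>\<^bsub>M\<^esub>" if "x \<in> S' - S" for x
    proof -
      have "f x = 0" using that \<open>f x \<noteq> 0 \<Longrightarrow> x \<in> S\<close> by auto
      then show ?thesis using sm_0[of x] that \<open>S' \<subseteq> carrier M\<close> by auto
    qed
    then show ?thesis
      unfolding E_def using that(1-3) closed by (intro M.add.finprod_mono_neutral_cong_right) (auto simp: subset_iff)
  qed
  \<comment> \<open>The relations: finitely supported coefficient functions whose linear combination vanishes.\<close>
  define N where "N = {f :: 'm \<Rightarrow> 'k. \<exists>S. finite S \<and> S \<subseteq> carrier M \<and> (\<forall>x. f x \<noteq> 0 \<longrightarrow> x \<in> S) \<and> E S f = \<zero>\<^bsub>M\<^esub>}"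
  have N_iff: "f \<in> N \<longleftrightarrow> E S f = \<zero>\<^bsub>M\<^esub>"
    if "finite S" "S \<subseteq> carrier M" "\<And>x. f x \<noteq> 0 \<Longrightarrow> x \<in> S" for f S
  proof
    assume "f \<in> N"
    then obtain S' where S': "finite S'" "S' \<subseteq> carrier M" "\<forall>x. f x \<noteq> 0 \<longrightarrow> x \<in> S'" "E S' f = \<zero>\<^bsub>M\<^esub>"
      by (auto simp: N_def)
    then show "E S f = \<zero>\<^bsub>M\<^esub>"
      using E_super[of "S \<union> S'" S f] E_super[of "S \<union> S'" S' f] that by auto
  qed (use that in \<open>auto simp: N_def\<close>)
  interpret vs: vector_space "fscale :: 'k \<Rightarrow> ('m \<Rightarrow> 'k) \<Rightarrow> _" by (rule vector_space_fscale)
  have "vs.subspace N"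
  proof (rule vs.subspaceI)
    show "0 \<in> N" using N_iff[of "{}" 0] by (auto simp: E_def)
  next
    fix f g assume "f \<in> N" "g \<in> N"
    then obtain S S' where S: "finite S" "S \<subseteq> carrier M" "\<forall>x. f x \<noteq> 0 \<longrightarrow> x \<in> S"
      and S': "finite S'" "S' \<subseteq> carrier M" "\<forall>x. g x \<noteq> 0 \<longrightarrow> x \<in> S'" by (auto simp: N_def)
    let ?U = "S \<union> S'"
    have U: "finite ?U" "?U \<subseteq> carrier M" using S S' by auto
    have "E ?U f = \<zero>\<^bsub>M\<^esub>" "E ?U g = \<zero>\<^bsub>M\<^esub>"
      using \<open>f \<in> N\<close> \<open>g \<in> N\<close> S S' N_iff[OF U, of f] N_iff[OF U, of g] by auto
    moreover have "x \<in> ?U" if "(f + g) x \<noteq> 0" for x using that S S' by (cases "f x = 0") auto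
    ultimately show "f + g \<in> N" using N_iff[OF U, of "f + g"] E_add[OF U(2), of f g] by simp
  next
    fix c f assume "f \<in> N"
    then obtain S where S: "finite S" "S \<subseteq> carrier M" "\<forall>x. f x \<noteq> 0 \<longrightarrow> x \<in> S" "E S f = \<zero>\<^bsub>M\<^esub>" by (auto simp: N_def)
    then show "fscale c f \<in> N"
      using N_iff[OF S(1,2), of "fscale c f"] E_scale[OF S(1,2), of c f] by (auto simp: fscale_def sm_z)
  qed
  then obtain g where g: "\<And>x y. g (x + y) = g x + g y" "\<And>c x. g (fscale c x) = fscale c (g x)"
    "\<And>x. g x \<in> N" "\<And>x. x \<in> N \<Longrightarrow> g x = x" by (rule projection_onto_subspace) metis
  define \<pi> where "\<pi> x = x - g x" for x
  have \<pi>_add: "\<pi> (x + y) = \<pi> x + \<pi> y" for x y by (simp add: \<pi>_def g)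
  have \<pi>_scale: "\<pi> (fscale c x) = fscale c (\<pi> x)" for c x by (simp add: \<pi>_def g vs.scale_right_diff_distrib)
  have \<pi>_diff: "\<pi> x = \<pi> y \<longleftrightarrow> x - y \<in> N" for x y
  proof -
    have "\<pi> x - \<pi> y = \<pi> (x - y)" using \<pi>_add[of "x - y" y] by simp
    moreover have "\<pi> z = 0 \<longleftrightarrow> z \<in> N" for z using g(3,4)[of z] by (auto simp: \<pi>_def)
    ultimately show ?thesis by (metis eq_iff_diff_eq_0)
  qed
  have \<pi>_eq: "\<pi> f = \<pi> h \<longleftrightarrow> E S f = E S h"
    if S: "finite S" "S \<subseteq> carrier M" "\<And>x. f x \<noteq> 0 \<Longrightarrow> x \<in> S" "\<And>x. h x \<noteq> 0 \<Longrightarrow> x \<in> S" for f h S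
  proof -
    have "x \<in> S" if "(f - h) x \<noteq> 0" for x using that S(3,4)[of x] by (cases "f x = 0") auto
    then have "f - h \<in> N \<longleftrightarrow> E S (f - h) = \<zero>\<^bsub>M\<^esub>" using N_iff[OF S(1,2)] by blast
    moreover have "E S f = E S (f - h) \<oplus>\<^bsub>M\<^esub> E S h" using E_add[OF S(2), of "f - h" h] by simp
    ultimately show ?thesis using \<pi>_diff E_closed[OF S(2)] by (simp add: M.add.r_cancel_one)
  qed
  define \<delta> :: "'m \<Rightarrow> 'm \<Rightarrow> 'k" where "\<delta> m = (\<lambda>x. if x = m then 1 else 0)" for m
  have E_delta: "E S (\<delta> m) = m" if "finite S" "S \<subseteq> carrier M" "m \<in> S" for S m
  proof -
    have "E S (\<delta> m) = E {m} (\<delta> m)" using that by (intro E_super) (auto simp: \<delta>_def split: if_splits)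
    then show ?thesis using that one by (auto simp: E_def \<delta>_def subset_iff)
  qed
  show ?thesis
  proof (rule that[of "\<lambda>m. \<pi> (\<delta> m)"])
    show "inj_on (\<lambda>m. \<pi> (\<delta> m)) (carrier M)"
    proof (rule inj_onI)
      fix x y assume xy: "x \<in> carrier M" "y \<in> carrier M" "\<pi> (\<delta> x) = \<pi> (\<delta> y)"
      then have "E {x, y} (\<delta> x) = E {x, y} (\<delta> y)" by (subst \<pi>_eq[symmetric]) (auto simp: \<delta>_def split: if_splits)
      then show "x = y" using xy by (simp add: E_delta)
    qed
  next
    fix x y assume xy: "x \<in> carrier M" "y \<in> carrier M"
    let ?S = "{x, y, x \<oplus>\<^bsub>M\<^esub> y}"
    have S: "finite ?S" "?S \<subseteq> carrier M" using xy by auto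
    have "E ?S (\<delta> (x \<oplus>\<^bsub>M\<^esub> y)) = E ?S (\<delta> x + \<delta> y)" using E_add[OF S(2)] E_delta[OF S] by simp
    then have "\<pi> (\<delta> (x \<oplus>\<^bsub>M\<^esub> y)) = \<pi> (\<delta> x + \<delta> y)"
      by (subst \<pi>_eq[OF S]) (auto simp: \<delta>_def split: if_splits)
    then show "\<pi> (\<delta> (x \<oplus>\<^bsub>M\<^esub> y)) = \<pi> (\<delta> x) + \<pi> (\<delta> y)" by (simp add: \<pi>_add)
  next
    fix c x assume x: "x \<in> carrier M"
    let ?S = "{x, sm c x}"
    have S: "finite ?S" "?S \<subseteq> carrier M" using x closed by auto
    have "E ?S (\<delta> (sm c x)) = E ?S (fscale c (\<delta> x))" using E_scale[OF S] E_delta[OF S] by simp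
    then have "\<pi> (\<delta> (sm c x)) = \<pi> (fscale c (\<delta> x))"
      by (subst \<pi>_eq[OF S]) (auto simp: \<delta>_def fscale_def split: if_splits)
    then show "\<pi> (\<delta> (sm c x)) = fscale c (\<pi> (\<delta> x))" by (simp add: \<pi>_scale)
  qed
qed

text \<open>The element \<open>x\<close> labelled with the number \<open>k\<close>.\<close>

fun nest :: "'r \<Rightarrow> nat \<Rightarrow> ('r, 'm) formal_comb \<Rightarrow> ('r, 'm) formal_comb"
  where "nest r 0 x = x" | "nest r (Suc k) x = Comb {|(nest r k x, r)|}"

lemma nest_Gen_inject: "nest r k (Gen x) = nest r l (Gen y) \<longleftrightarrow> k = l \<and> x = y"
proof (induction k arbitrary: l)
  case 0 then show ?case by (cases l) auto
next
  case (Suc k) then show ?case by (cases l) auto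
qed

text \<open>A module over the incidence ring, embedded into a function space by \<open>\<sigma>\<close>, together with a linear projection
  \<open>\<gamma>\<close> of that space onto the image. By means of \<open>\<gamma>\<close> the ring acts on all functions (\<open>act\<close> below),
  although only the action on the image is unital.\<close>

locale embedded_module = incidence_iso L le R \<chi> + M: right_module R M
  for L :: "'w set" and le and R :: "('r, 'x) ring_scheme" and \<chi> :: "'r \<Rightarrow> 'w \<Rightarrow> 'w \<Rightarrow> 'k::field"
    and M :: "('r, 'm, 'y) module_scheme" +
  fixes \<sigma> :: "'m \<Rightarrow> 'm \<Rightarrow> 'k" and \<gamma> :: "('m \<Rightarrow> 'k) \<Rightarrow> 'm \<Rightarrow> 'k"
  assumes sigma_inj: "inj_on \<sigma> (carrier M)"
    and sigma_add: "\<lbrakk>x \<in> carrier M; y \<in> carrier M\<rbrakk> \<Longrightarrow> \<sigma> (x \<oplus>\<^bsub>M\<^esub> y) = \<sigma> x + \<sigma> y"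
    and sigma_scale: "x \<in> carrier M \<Longrightarrow> \<sigma> (\<psi> (\<lambda>t s. if t = s \<and> t \<in> L then c else 0) \<odot>\<^bsub>M\<^esub> x) = fscale c (\<sigma> x)"
    and gamma_add: "\<gamma> (v + w) = \<gamma> v + \<gamma> w" and gamma_scale: "\<gamma> (fscale c v) = fscale c (\<gamma> v)"
    and gamma_mem: "\<gamma> v \<in> \<sigma> ` carrier M" and gamma_id: "v \<in> \<sigma> ` carrier M \<Longrightarrow> \<gamma> v = v"
begin

sublocale incidence_vs L le R \<chi> fscale
  by (intro incidence_vs.intro incidence_iso_axioms vector_space_fscale)

definition \<tau> :: "('m \<Rightarrow> 'k) \<Rightarrow> 'm" where "\<tau> v = inv_into (carrier M) \<sigma> (\<gamma> v)"

lemma tau_closed: "\<tau> v \<in> carrier M" and sigma_tau: "\<sigma> (\<tau> v) = \<gamma> v"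
  unfolding \<tau>_def using gamma_mem[of v] by (auto intro: inv_into_into f_inv_into_f)

lemma tau_sigma: "x \<in> carrier M \<Longrightarrow> \<tau> (\<sigma> x) = x"
  by (intro inj_onD[OF sigma_inj]) (auto simp: sigma_tau gamma_id tau_closed)

lemma tau_add: "\<tau> (v + w) = \<tau> v \<oplus>\<^bsub>M\<^esub> \<tau> w"
  by (intro inj_onD[OF sigma_inj]) (auto simp: sigma_tau sigma_add tau_closed gamma_add)

definition act :: "('w \<Rightarrow> 'w \<Rightarrow> 'k) \<Rightarrow> ('m \<Rightarrow> 'k) \<Rightarrow> 'm \<Rightarrow> 'k"
  where "act c v = \<sigma> (\<psi> c \<odot>\<^bsub>M\<^esub> \<tau> v)"

definition const :: "'k \<Rightarrow> 'w \<Rightarrow> 'w \<Rightarrow> 'k" where "const c t s = (if t = s \<and> t \<in> L then c else 0)"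

definition unit :: "'k \<Rightarrow> 'w \<Rightarrow> 'w \<Rightarrow> 'w \<Rightarrow> 'w \<Rightarrow> 'k"
  where "unit c t s t' s' = (if t' = t \<and> s' = s \<and> t \<in> L \<and> s \<in> L \<and> le t s then c else 0)"

lemma const_Inc: "const c \<in> Inc" and unit_Inc: "unit c t s \<in> Inc"
  by (auto simp: Inc_iff const_def unit_def refl_L)

lemma tau_act: "c \<in> Inc \<Longrightarrow> \<tau> (act c v) = \<psi> c \<odot>\<^bsub>M\<^esub> \<tau> v"
  unfolding act_def by (rule tau_sigma) (simp add: M.act_closed psi_closed tau_closed)

lemma act_add_right: "c \<in> Inc \<Longrightarrow> act c (v + w) = act c v + act c w"
  unfolding act_def by (simp add: tau_add M.act_add psi_closed tau_closed sigma_add M.act_closed)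

lemma act_add_left: "c \<in> Inc \<Longrightarrow> d \<in> Inc \<Longrightarrow> act (c + d) v = act c v + act d v"
  unfolding act_def by (simp add: psi_add M.act_add_scalar psi_closed tau_closed sigma_add M.act_closed)

lemma act_mult: "c \<in> Inc \<Longrightarrow> d \<in> Inc \<Longrightarrow> act d (act c v) = act (c \<otimes>\<^bsub>inc_ring L le\<^esub> d) v"
  by (subst (1 3) act_def) (simp add: tau_act psi_mult M.act_mult psi_closed tau_closed)

lemma act_const: "act (const c) v = fscale c (\<gamma> v)"
  using sigma_scale[OF tau_closed, of c v] unfolding act_def const_def[abs_def] by (simp add: sigma_tau)

lemma act_mem: "c \<in> Inc \<Longrightarrow> act c v \<in> \<sigma> ` carrier M"
  unfolding act_def by (simp add: M.act_closed psi_closed tau_closed)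

lemma gamma_act: "c \<in> Inc \<Longrightarrow> \<gamma> (act c v) = act c v"
  by (rule gamma_id[OF act_mem])

lemma const_mult: "c \<in> Inc \<Longrightarrow> const k \<otimes>\<^bsub>inc_ring L le\<^esub> c = (\<lambda>t s. k * c t s)"
    "c \<in> Inc \<Longrightarrow> c \<otimes>\<^bsub>inc_ring L le\<^esub> const k = (\<lambda>t s. k * c t s)"
proof -
  assume c: "c \<in> Inc"
  have "(\<Sum>r\<in>L. const k t r * c r s) = k * c t s" "(\<Sum>r\<in>L. c t r * const k r s) = k * c t s" for t s
  proof -
    have "(\<Sum>r\<in>L. const k t r * c r s) = (\<Sum>r\<in>L. if t = r then k * c r s else 0)"
      by (intro sum.cong) (auto simp: const_def)
    also have "\<dots> = k * c t s"
      using finite_L Inc_outside[OF c, of t s] by (simp add: sum.delta)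
    finally show "(\<Sum>r\<in>L. const k t r * c r s) = k * c t s" .
    have "(\<Sum>r\<in>L. c t r * const k r s) = (\<Sum>r\<in>L. if r = s then k * c t r else 0)"
      by (intro sum.cong) (auto simp: const_def)
    also have "\<dots> = k * c t s"
      using finite_L Inc_outside[OF c, of t s] by (simp add: sum.delta')
    finally show "(\<Sum>r\<in>L. c t r * const k r s) = k * c t s" .
  qed
  then show "const k \<otimes>\<^bsub>inc_ring L le\<^esub> c = (\<lambda>t s. k * c t s)"
    "c \<otimes>\<^bsub>inc_ring L le\<^esub> const k = (\<lambda>t s. k * c t s)"
    unfolding inc_mult by auto
qed

lemma act_fscale:
  assumes "c \<in> Inc"
  shows "act c (fscale k v) = fscale k (act c v)" "act (\<lambda>t s. k * c t s) v = fscale k (act c v)"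
proof -
  show 1: "act (\<lambda>t s. k * c t s) v = fscale k (act c v)"
    unfolding const_mult(2)[OF assms, of k, symmetric]
    by (simp add: act_mult[OF assms const_Inc, symmetric] act_const gamma_act[OF assms])
  have "\<gamma> (fscale k (\<gamma> v)) = \<gamma> (fscale k v)" by (metis gamma_id gamma_mem gamma_scale)
  then have "\<tau> (fscale k v) = \<tau> (act (const k) v)" unfolding act_const \<tau>_def by simp
  then have "act c (fscale k v) = act c (act (const k) v)" by (simp add: act_def)
  also have "\<dots> = act (\<lambda>t s. k * c t s) v"
    unfolding const_mult(1)[OF assms, of k, symmetric] by (rule act_mult[OF const_Inc assms])
  finally show "act c (fscale k v) = fscale k (act c v)" using 1 by simp
qed

definition N :: "'w \<Rightarrow> ('m \<Rightarrow> 'k) set" where "N t = range (act (unit 1 t t))"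

definition \<rho> :: "'w \<Rightarrow> 'w \<Rightarrow> ('m \<Rightarrow> 'k) \<Rightarrow> 'm \<Rightarrow> 'k" where "\<rho> t s = act (unit 1 t s)"

lemma subspace_N: "subspace (N t)"
proof (rule subspaceI)
  have "act (unit 1 t t) 0 = 0" using act_fscale(1)[OF unit_Inc, of 1 t t 0 0] by simp
  then show "0 \<in> N t" unfolding N_def by (metis rangeI)
  show "x + y \<in> N t" if "x \<in> N t" "y \<in> N t" for x y
    using that act_add_right[OF unit_Inc, of 1 t t, symmetric] by (auto simp: N_def)
  show "fscale c x \<in> N t" if "x \<in> N t" for c x
    using that act_fscale(1)[OF unit_Inc, of 1 t t, symmetric] by (auto simp: N_def)
qed

lemma unit_mult: "unit c t s \<otimes>\<^bsub>inc_ring L le\<^esub> unit d s' r = (if s = s' \<and> s \<in> L \<and> le t s \<and> le s r then unit (c * d) t r else 0)"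
  unfolding inc_mult
proof (intro ext)
  fix x y
  have "(\<Sum>q\<in>L. unit c t s x q * unit d s' r q y) = (\<Sum>q\<in>L. if q = s then unit c t s x s * unit d s' r s y else 0)"
    by (intro sum.cong) (auto simp: unit_def)
  also have "\<dots> = (if s \<in> L then unit c t s x s * unit d s' r s y else 0)"
    using finite_L by (simp add: sum.delta')
  also have "\<dots> = (if s = s' \<and> s \<in> L \<and> le t s \<and> le s r then unit (c * d) t r else 0) x y"
    using trans_L[of t s r] by (auto simp: unit_def)
  finally show "(\<Sum>q\<in>L. unit c t s x q * unit d s' r q y) = \<dots>" .
qed

lemma act_0: "act 0 v = 0"
  using act_add_left[OF zero_Inc zero_Inc, of v] by simp

lemma rho_N: "x \<in> N t \<Longrightarrow> \<rho> t t x = x"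
  by (auto simp: N_def \<rho>_def act_mult[OF unit_Inc unit_Inc] unit_mult act_0)
    (auto simp: unit_def[abs_def] refl_L act_0[unfolded zero_fun_def])

lemma rho_mem: "\<rho> t s x \<in> N s"
proof (cases "t \<in> L \<and> s \<in> L \<and> le t s")
  case True
  then have "\<rho> t s x = act (unit 1 s s) (\<rho> t s x)"
    by (simp add: \<rho>_def act_mult[OF unit_Inc unit_Inc] unit_mult refl_L)
  then show ?thesis unfolding N_def by (metis rangeI)
next
  case False
  then have "unit 1 t s = 0" by (auto simp: unit_def fun_eq_iff)
  then show ?thesis using subspace_0[OF subspace_N] by (simp add: \<rho>_def act_0)
qed

lemma N_dead: "t \<notin> L \<Longrightarrow> N t = {0}"
proof -
  assume "t \<notin> L"
  then have "unit 1 t t = 0" by (auto simp: unit_def fun_eq_iff)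
  then show ?thesis by (auto simp: N_def act_0)
qed

lemma N_sub: "N t \<subseteq> \<sigma> ` carrier M"
  using act_mem[OF unit_Inc] by (auto simp: N_def)

lemma rho_rho: "\<lbrakk>s \<in> L; le t s; le s r\<rbrakk> \<Longrightarrow> \<rho> s r (\<rho> t s x) = \<rho> t r x"
  by (simp add: \<rho>_def act_mult[OF unit_Inc unit_Inc] unit_mult)

lemma rho_0: "\<rho> t s 0 = 0"
  using act_add_right[OF unit_Inc, of 1 t s 0 0] by (simp add: \<rho>_def)

text \<open>A matrix is the sum of its entries times matrix units, and \<open>\<rho> t s\<close> is the action of a matrix unit.\<close>

lemma act_expand:
  assumes "c \<in> Inc"
  shows "act c v = (\<Sum>t\<in>L. \<Sum>s\<in>L. fscale (c t s) (\<rho> t s v))"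
proof -
  have cu: "fscale (c t s) (\<rho> t s v) = act (unit (c t s) t s) v" for t s
  proof -
    have "unit (c t s) t s = (\<lambda>t' s'. c t s * unit 1 t s t' s')" by (auto simp: unit_def fun_eq_iff)
    then show ?thesis by (simp add: \<rho>_def act_fscale(2)[OF unit_Inc])
  qed
  have sum_act: "(\<Sum>i\<in>I. act (f i) v) = act (\<Sum>i\<in>I. f i) v \<and> (\<Sum>i\<in>I. f i) \<in> Inc"
    if "finite I" "\<And>i. i \<in> I \<Longrightarrow> f i \<in> Inc" for I :: "'w set" and f
    using that by (induction I rule: finite_induct) (auto simp: act_0 zero_Inc act_add_left inc_add_closed)
  have "(\<Sum>t\<in>L. \<Sum>s\<in>L. fscale (c t s) (\<rho> t s v)) = act (\<Sum>t\<in>L. \<Sum>s\<in>L. unit (c t s) t s) v"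
    unfolding cu using sum_act[OF finite_L] unit_Inc by (simp cong: sum.cong)
  also have "(\<Sum>t\<in>L. \<Sum>s\<in>L. unit (c t s) t s) = c"
  proof (intro ext)
    fix x y
    have sum_apply: "(\<Sum>i\<in>L. f i) x y = (\<Sum>i\<in>L. f i x y)" for f :: "'w \<Rightarrow> 'w \<Rightarrow> 'w \<Rightarrow> 'k"
      using finite_L by (induction L rule: finite_induct) auto
    have "(\<Sum>t\<in>L. \<Sum>s\<in>L. unit (c t s) t s) x y = (\<Sum>t\<in>L. \<Sum>s\<in>L. if s = y then if t = x then c x y else 0 else 0)"
      unfolding sum_apply using Inc_outside[OF assms, of x y] by (intro sum.cong refl) (auto simp: unit_def)
    also have "\<dots> = (if x \<in> L \<and> y \<in> L then c x y else 0)"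
      using finite_L by (cases "y \<in> L") (simp_all add: sum.delta')
    also have "\<dots> = c x y" using Inc_outside[OF assms, of x y] by auto
    finally show "(\<Sum>t\<in>L. \<Sum>s\<in>L. unit (c t s) t s) x y = c x y" .
  qed
  finally show ?thesis by simp
qed

end

section \<open>The resolution of a module over the incidence ring of a staircase poset\<close>

text \<open>The incidence ring of a staircase poset, with or without its bottom element. If \<open>bot\<close> is missing,
  the component \<open>N bot\<close> of the module is zero.\<close>

locale incidence_grid = embedded_module L le R \<chi> M \<sigma> \<gamma> + G: grid_poset W bot \<alpha> \<beta> le
  for L :: "'w set" and le and R :: "('r, 'x) ring_scheme" and \<chi> :: "'r \<Rightarrow> 'w \<Rightarrow> 'w \<Rightarrow> 'k::field"
    and M :: "('r, 'm, 'y) module_scheme" and \<sigma> \<gamma> and W :: "'w set" and bot \<alpha> \<beta> +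
  assumes W_L: "W \<subseteq> L" and L_T: "L \<subseteq> insert bot W"
begin

lemma L_GT: "u \<in> L \<Longrightarrow> u \<in> G.T"
  using L_T by (auto simp: G.T_def)

sublocale C: grid_rep W bot \<alpha> \<beta> le fscale N \<rho>
proof (intro grid_rep.intro grid_rep_axioms.intro G.grid_poset_axioms vector_space_fscale)
  show "subspace (N t)" for t by (rule subspace_N)
  show "\<rho> t s (x + y) = \<rho> t s x + \<rho> t s y" for t s x y
    unfolding \<rho>_def by (rule act_add_right[OF unit_Inc])
  show "\<rho> t s (fscale c x) = fscale c (\<rho> t s x)" for t s c x
    unfolding \<rho>_def by (rule act_fscale(1)[OF unit_Inc])
  show "\<rho> t s x \<in> N s" for t s x by (rule rho_mem)
  show "\<rho> t t x = x" if "x \<in> N t" for t x using rho_N[OF that] .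
  show "\<rho> s r (\<rho> t s x) = \<rho> t r x" if *: "t \<in> G.T" "s \<in> G.T" "r \<in> G.T" "le t s" "le s r" "x \<in> N t" for t s r x
  proof (cases "s \<in> L")
    case False
    then have "s = bot" using W_L * by (auto simp: G.T_def)
    then have "t = s" using * G.le_bot by blast
    then have "x = 0" using N_dead[OF False] * by simp
    then show ?thesis by (simp add: rho_0)
  qed (use * rho_rho in blast)
qed

lemma tau_eq_zero: "\<tau> x = \<zero>\<^bsub>M\<^esub> \<Longrightarrow> \<rho> t s x = 0"
proof -
  assume "\<tau> x = \<zero>\<^bsub>M\<^esub>"
  moreover have "\<tau> 0 = \<zero>\<^bsub>M\<^esub>" using tau_add[of 0 0] tau_closed[of 0] by (simp add: M.M.add.l_cancel_one')
  ultimately have "\<rho> t s x = \<rho> t s 0" by (simp add: \<rho>_def act_def)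
  then show ?thesis by (simp add: rho_0)
qed

lemma rho_orthogonal: "u \<noteq> t \<Longrightarrow> x \<in> N u \<Longrightarrow> \<rho> t s x = 0"
  by (auto simp: N_def \<rho>_def act_mult[OF unit_Inc unit_Inc] unit_mult act_0)

lemma rho_component:
  assumes "t \<in> L" "\<And>u. u \<in> L \<Longrightarrow> f u \<in> N u"
  shows "\<rho> t s (\<Sum>u\<in>L. f u) = \<rho> t s (f t)"
proof -
  have "\<rho> t s (\<Sum>u\<in>L. f u) = (\<Sum>u\<in>L. if u = t then \<rho> t s (f t) else 0)"
    unfolding C.rho_sum using assms rho_orthogonal by (intro sum.cong refl) auto
  then show ?thesis using assms finite_L by (simp add: sum.delta')
qed

lemma d1_scale: "C.d1 (\<lambda>q. fscale c (x q)) (\<lambda>q. fscale c (y q)) = (\<lambda>q. fscale c (C.d1 x y q))"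
  by (auto simp: C.d1_def fun_eq_iff C.rho_scale scale_sum_right scale_right_distrib scale_right_diff_distrib)

lemma d2_scale: "C.d2x (\<lambda>q. fscale c (z q)) = (\<lambda>q. fscale c (C.d2x z q))"
    "C.d2y (\<lambda>q. fscale c (z q)) = (\<lambda>q. fscale c (C.d2y z q))"
  by (auto simp: C.d2x_def C.d2y_def fun_eq_iff C.rho_scale scale_sum_right scale_right_diff_distrib)

lemma d0_add: "C.d0 u (\<lambda>q. w q + w' q) = C.d0 u w + C.d0 u w'"
  by (simp add: C.d0_def C.rho_add sum.distrib)

lemma d0_scale: "C.d0 u (\<lambda>q. fscale c (w q)) = fscale c (C.d0 u w)"
  by (simp add: C.d0_def C.rho_scale scale_sum_right)

lemma d0_sum: "C.d0 u (\<lambda>q. \<Sum>i\<in>I. w i q) = (\<Sum>i\<in>I. C.d0 u (w i))"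
  unfolding C.d0_def C.rho_sum by (rule sum.swap)

lemma d0_mem: "C.d0 u w \<in> N u"
  unfolding C.d0_def by (intro C.N_sum rho_mem)

text \<open>The summands in degree \<open>i\<close> of the resolution. In degree 1 the flag distinguishes the summand
  \<open>N (\<alpha> q) \<otimes> e\<^sub>q R\<close> (\<open>True\<close>) from \<open>N (\<beta> q) \<otimes> e\<^sub>q R\<close> (\<open>False\<close>).\<close>

definition resolution_index :: "nat \<Rightarrow> ('w \<times> bool) set"
  where "resolution_index i = (if i = 0 then G.T \<times> {False} else if i = 1 then W \<times> UNIV else if i = 2 then W \<times> {False} else {})"

definition resolution_coeff :: "nat \<Rightarrow> 'w \<times> bool \<Rightarrow> 'w"
  where "resolution_coeff i = (\<lambda>(q, c). if i = 0 then q else if i = 1 then (if c then \<alpha> q else \<beta> q) else \<alpha> (\<beta> q))"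

definition resolution_space :: "nat \<Rightarrow> 'w \<Rightarrow> 'w \<times> bool \<Rightarrow> ('m \<Rightarrow> 'k) set"
  where "resolution_space i = induced N (resolution_index i) (resolution_coeff i) fst"

definition differential :: "nat \<Rightarrow> ('w \<times> bool \<Rightarrow> 'm \<Rightarrow> 'k) \<Rightarrow> 'w \<times> bool \<Rightarrow> 'm \<Rightarrow> 'k"
  where "differential i f = (if i = 0 then (\<lambda>(q, c). if c then 0 else C.d1 (\<lambda>q. f (q, True)) (\<lambda>q. f (q, False)) q)
     else if i = 1 then (\<lambda>(q, c). if c then C.d2x (\<lambda>q. f (q, False)) q else C.d2y (\<lambda>q. f (q, False)) q)
     else (\<lambda>_. 0))"

text \<open>At every vertex the terms of the resolution are the chains of the complex studied above, so
  exactness can be checked vertex by vertex.\<close>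

lemma spc_0: "u \<in> L \<Longrightarrow> (\<forall>j. f j \<in> resolution_space 0 u j) \<longleftrightarrow> C.chain0 u (\<lambda>q. f (q, False)) \<and> (\<forall>q. f (q, True) = 0)"
proof -
  assume u: "u \<in> L"
  have "f (q, False) \<in> resolution_space 0 u (q, False) \<longleftrightarrow> (if q \<in> G.T \<and> le q u then f (q, False) \<in> N q else f (q, False) = 0)" for q
    using u N_dead[of q] by (auto simp: resolution_space_def induced_def resolution_index_def resolution_coeff_def)
  moreover have "f (q, True) \<in> resolution_space 0 u (q, True) \<longleftrightarrow> f (q, True) = 0" for q
    by (auto simp: resolution_space_def induced_def resolution_index_def)
  ultimately show ?thesis unfolding C.chain0_def by (auto simp: all_bool_eq)
qed

lemma spc_1: "u \<in> L \<Longrightarrow> (\<forall>j. f j \<in> resolution_space 1 u j) \<longleftrightarrow> C.chain1 u (\<lambda>q. f (q, True)) (\<lambda>q. f (q, False))"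
proof -
  assume u: "u \<in> L"
  have "f (q, c) \<in> resolution_space 1 u (q, c) \<longleftrightarrow> (if q \<in> W \<and> le q u then f (q, c) \<in> N (if c then \<alpha> q else \<beta> q) else f (q, c) = 0)" for q c
    using u W_L by (auto simp: resolution_space_def induced_def resolution_index_def resolution_coeff_def)
  then show ?thesis unfolding C.chain1_def by (auto simp: all_bool_eq split: if_splits)
qed

lemma spc_2: "u \<in> L \<Longrightarrow> (\<forall>j. f j \<in> resolution_space 2 u j) \<longleftrightarrow> C.chain2 u (\<lambda>q. f (q, False)) \<and> (\<forall>q. f (q, True) = 0)"
proof -
  assume u: "u \<in> L"
  have "f (q, False) \<in> resolution_space 2 u (q, False) \<longleftrightarrow> (if q \<in> W \<and> le q u then f (q, False) \<in> N (\<alpha> (\<beta> q)) else f (q, False) = 0)" for q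
    using u W_L by (auto simp: resolution_space_def induced_def resolution_index_def resolution_coeff_def)
  moreover have "f (q, True) \<in> resolution_space 2 u (q, True) \<longleftrightarrow> f (q, True) = 0" for q
    by (auto simp: resolution_space_def induced_def resolution_index_def)
  ultimately show ?thesis unfolding C.chain2_def by (auto simp: all_bool_eq)
qed

lemma spc_big: "i > 2 \<Longrightarrow> resolution_space i u j = {0}" and spc_dead: "u \<notin> L \<Longrightarrow> resolution_space i u j = {0}"
  by (auto simp: resolution_space_def induced_def resolution_index_def)

lemma spc_zero: "0 \<in> resolution_space i u j"
  using C.N_0 by (auto simp: resolution_space_def induced_def)

lemma bd_add: "differential i (\<lambda>j. f j + g j) = (\<lambda>j. differential i f j + differential i g j)"
  by (auto simp: differential_def fun_eq_iff C.d1_add C.d2_add)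

lemma bd_scale: "differential i (\<lambda>j. fscale c (f j)) = (\<lambda>j. fscale c (differential i f j))"
  by (auto simp: differential_def fun_eq_iff d1_scale d2_scale fscale_def[of c 0])

lemma bd_zero: "differential i (\<lambda>j. 0) = (\<lambda>j. 0)"
  using bd_scale[of i 0 "\<lambda>_. 0"] by simp

lemma bd_closed:
  assumes f: "\<forall>j. f j \<in> resolution_space (Suc i) u j"
  shows "\<forall>j. differential i f j \<in> resolution_space i u j"
proof (cases "u \<in> L")
  case False
  then have "f = (\<lambda>j. 0)" using f spc_dead by auto
  then show ?thesis by (simp add: bd_zero spc_zero)
next
  case True
  note uT = L_GT[OF True]
  consider "i = 0" | "i = 1" | "i > 1" by linarith
  then show ?thesis
  proof cases
    case 1
    then have "C.chain1 u (\<lambda>q. f (q, True)) (\<lambda>q. f (q, False))" using f spc_1[OF True] by simp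
    from C.chain1_d1[OF uT this] show ?thesis unfolding 1 spc_0[OF True] by (simp add: differential_def)
  next
    case 2
    then have "C.chain2 u (\<lambda>q. f (q, False))" using f spc_2[OF True] by (simp add: numeral_2_eq_2)
    from C.chain2_d2[OF uT this] show ?thesis unfolding 2 spc_1[OF True] by (simp add: differential_def)
  qed (simp add: differential_def spc_zero)
qed

lemma bd_bd:
  assumes f: "\<forall>j. f j \<in> resolution_space 2 u j"
  shows "differential 0 (differential 1 f) = (\<lambda>_. 0)"
proof (cases "u \<in> L")
  case False
  then have "f = (\<lambda>j. 0)" using f spc_dead by auto
  then show ?thesis by (simp add: bd_zero)
next
  case True
  then have "C.chain2 u (\<lambda>q. f (q, False))" using f spc_2[OF True] by simp
  from C.d1_d2[OF L_GT[OF True] this] show ?thesis by (auto simp: differential_def fun_eq_iff)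
qed

lemma bd_exact:
  assumes f: "\<forall>j. f j \<in> resolution_space (Suc i) u j" and d: "differential i f = (\<lambda>_. 0)"
  shows "\<exists>g. (\<forall>j. g j \<in> resolution_space (Suc (Suc i)) u j) \<and> differential (Suc i) g = f"
proof (cases "u \<in> L")
  case False
  then have "f = (\<lambda>j. 0)" using f spc_dead by auto
  then show ?thesis by (intro exI[of _ "\<lambda>_. 0"]) (simp add: bd_zero spc_zero)
next
  case True
  note uT = L_GT[OF True]
  consider "i = 0" | "i = 1" | "i > 1" by linarith
  then show ?thesis
  proof cases
    case 1
    have "C.chain1 u (\<lambda>q. f (q, True)) (\<lambda>q. f (q, False))" using f spc_1[OF True] 1 by simp
    moreover have "C.d1 (\<lambda>q. f (q, True)) (\<lambda>q. f (q, False)) = (\<lambda>_. 0)"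
    proof (rule ext)
      fix q show "C.d1 (\<lambda>q. f (q, True)) (\<lambda>q. f (q, False)) q = 0"
        using fun_cong[OF d, of "(q, False)"] 1 by (simp add: differential_def)
    qed
    ultimately obtain z where z: "C.chain2 u z" "C.d2x z = (\<lambda>q. f (q, True))" "C.d2y z = (\<lambda>q. f (q, False))"
      using C.exact_1[OF uT] by blast
    let ?g = "\<lambda>(q, c). if c then 0 else z q"
    have "\<forall>j. ?g j \<in> resolution_space (Suc (Suc i)) u j" using spc_2[OF True, of ?g] z(1) 1 by (simp add: numeral_2_eq_2)
    moreover have "differential (Suc i) ?g = f" using z 1 by (auto simp: differential_def fun_eq_iff)
    ultimately show ?thesis by blast
  next
    case 2
    have z: "C.chain2 u (\<lambda>q. f (q, False))" "\<forall>q. f (q, True) = 0" using f spc_2[OF True] 2 by (auto simp: numeral_2_eq_2)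
    have "C.d2x (\<lambda>q. f (q, False)) = (\<lambda>_. 0)" "C.d2y (\<lambda>q. f (q, False)) = (\<lambda>_. 0)"
      using d 2 by (auto simp: differential_def fun_eq_iff all_bool_eq)
    then have "(\<lambda>q. f (q, False)) = (\<lambda>_. 0)" using C.d2_injective[OF uT z(1)] by blast
    then have "f = (\<lambda>_. 0)" using z(2) by (auto simp: fun_eq_iff all_bool_eq)
    then show ?thesis by (intro exI[of _ "\<lambda>_. 0"]) (simp add: bd_zero spc_zero)
  next
    case 3
    then have "f = (\<lambda>_. 0)" using f spc_big[of "Suc i"] by auto
    then show ?thesis by (intro exI[of _ "\<lambda>_. 0"]) (simp add: bd_zero spc_zero)
  qed
qed

definition augmentation :: "('w \<Rightarrow> 'w \<times> bool \<Rightarrow> 'm \<Rightarrow> 'k) \<Rightarrow> 'm"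
  where "augmentation \<phi> = \<tau> (\<Sum>u\<in>L. C.d0 u (\<lambda>q. \<phi> u (q, False)))"

text \<open>The augmentation multiplies \<open>N q\<close> into \<open>N u\<close> along \<open>q \<le> u\<close> and sums up; it commutes with the action because the
  maps \<open>\<rho>\<close> compose.\<close>

lemma rlinear_aug: "rlinear R (family_module (resolution_space 0)) M augmentation"
  unfolding rlinear_def
proof (intro conjI ballI Pi_I)
  show "augmentation \<phi> \<in> carrier M" for \<phi> by (simp add: augmentation_def tau_closed)
  show "augmentation (\<phi> \<oplus>\<^bsub>family_module (resolution_space 0)\<^esub> \<phi>') = augmentation \<phi> \<oplus>\<^bsub>M\<^esub> augmentation \<phi>'" for \<phi> \<phi>'
    by (simp add: augmentation_def d0_add sum.distrib tau_add)
  fix g \<phi> assume g: "g \<in> carrier R" and \<phi>: "\<phi> \<in> carrier (family_module (resolution_space 0))"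
  let ?e = "\<lambda>u. C.d0 u (\<lambda>q. \<phi> u (q, False))"
  have step: "fscale (\<chi> g u v) (C.d0 v (\<lambda>q. \<phi> u (q, False))) = fscale (\<chi> g u v) (\<rho> u v (?e u))"
    if "u \<in> L" "v \<in> L" for u v
  proof (cases "le u v")
    case True
    have c: "C.chain0 u (\<lambda>q. \<phi> u (q, False))"
      using \<phi> spc_0[OF that(1), of "\<phi> u"] unfolding family_module_simps by blast
    have "\<rho> u v (\<rho> q u (\<phi> u (q, False))) = \<rho> q v (\<phi> u (q, False))" if "q \<in> G.T" for q
    proof (cases "le q u")
      case le: True
      show ?thesis by (rule rho_rho[OF \<open>u \<in> L\<close> le True])
    next
      case False
      then have "\<phi> u (q, False) = 0" using c unfolding C.chain0_def by meson
      then show ?thesis by (simp add: rho_0)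
    qed
    then show ?thesis by (simp add: C.d0_def C.rho_sum)
  next
    case False
    then show ?thesis using chi_outside[OF g] by simp
  qed
  have "(\<Sum>v\<in>L. C.d0 v (\<lambda>q. \<Sum>u\<in>L. fscale (\<chi> g u v) (\<phi> u (q, False))))
      = (\<Sum>v\<in>L. \<Sum>u\<in>L. fscale (\<chi> g u v) (C.d0 v (\<lambda>q. \<phi> u (q, False))))"
    by (simp add: d0_sum d0_scale)
  also have "\<dots> = (\<Sum>u\<in>L. \<Sum>v\<in>L. fscale (\<chi> g u v) (\<rho> u v (?e u)))"
    by (subst sum.swap) (intro sum.cong refl step)
  also have "\<dots> = (\<Sum>u\<in>L. \<Sum>v\<in>L. fscale (\<chi> g u v) (\<rho> u v (\<Sum>w\<in>L. ?e w)))"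
    using rho_component[of _ ?e] d0_mem by (intro sum.cong refl) auto
  also have "\<dots> = act (\<chi> g) (\<Sum>w\<in>L. ?e w)" by (rule act_expand[OF chi_closed[OF g], symmetric])
  finally have "augmentation (g \<odot>\<^bsub>family_module (resolution_space 0)\<^esub> \<phi>) = \<tau> (act (\<chi> g) (\<Sum>w\<in>L. ?e w))"
    by (simp add: augmentation_def)
  then show "augmentation (g \<odot>\<^bsub>family_module (resolution_space 0)\<^esub> \<phi>) = g \<odot>\<^bsub>M\<^esub> augmentation \<phi>"
    by (simp add: tau_act[OF chi_closed[OF g]] psi_chi[OF g] augmentation_def)
qed

lemma aug_surj: "augmentation ` carrier (family_module (resolution_space 0)) = carrier M"
proof
  show "augmentation ` carrier (family_module (resolution_space 0)) \<subseteq> carrier M" by (auto simp: augmentation_def tau_closed)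
  show "carrier M \<subseteq> augmentation ` carrier (family_module (resolution_space 0))"
  proof
    fix m assume m: "m \<in> carrier M"
    let ?v = "\<sigma> m"
    define \<phi> where "\<phi> u j = (if j = (u, False) \<and> u \<in> L then \<rho> u u ?v else 0)" for u j
    have "\<phi> u j \<in> resolution_space 0 u j" for u j
      using rho_mem spc_zero L_GT refl_L unfolding \<phi>_def
      by (auto simp: resolution_space_def induced_def resolution_index_def resolution_coeff_def)
    then have \<phi>: "\<phi> \<in> carrier (family_module (resolution_space 0))" by simp
    have e: "C.d0 u (\<lambda>q. \<phi> u (q, False)) = \<rho> u u ?v" if u: "u \<in> L" for u
    proof -
      have "C.d0 u (\<lambda>q. \<phi> u (q, False)) = (\<Sum>q\<in>G.T. if q = u then \<rho> u u ?v else 0)"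
        unfolding C.d0_def \<phi>_def using u rho_N[OF rho_mem] rho_0 by (intro sum.cong refl) auto
      then show ?thesis using L_GT[OF u] by (simp add: sum.delta')
    qed
    have "(\<Sum>u\<in>L. \<rho> u u ?v) = (\<Sum>t\<in>L. \<Sum>s\<in>L. fscale (const 1 t s) (\<rho> t s ?v))"
    proof (intro sum.cong refl)
      fix t assume t: "t \<in> L"
      have "(\<Sum>s\<in>L. fscale (const 1 t s) (\<rho> t s ?v)) = (\<Sum>s\<in>L. if t = s then \<rho> t s ?v else 0)"
        using t by (intro sum.cong refl) (auto simp: const_def fscale_def zero_fun_def)
      then show "\<rho> t t ?v = (\<Sum>s\<in>L. fscale (const 1 t s) (\<rho> t s ?v))"
        using t finite_L by (simp add: sum.delta)
    qed
    also have "\<dots> = act (const 1) ?v" by (rule act_expand[OF const_Inc, symmetric])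
    also have "\<dots> = ?v" using m by (simp add: act_const gamma_id)
    finally have "augmentation \<phi> = m" using e m by (simp add: augmentation_def tau_sigma)
    then show "m \<in> augmentation ` carrier (family_module (resolution_space 0))" using \<phi> by blast
  qed
qed

lemma aug_kernel:
  assumes "augmentation \<phi> = \<zero>\<^bsub>M\<^esub>" "u \<in> L"
  shows "C.d0 u (\<lambda>q. \<phi> u (q, False)) = 0"
proof -
  let ?e = "\<lambda>u. C.d0 u (\<lambda>q. \<phi> u (q, False))"
  have "?e u = \<rho> u u (?e u)" using rho_N[OF d0_mem] by simp
  also have "\<dots> = \<rho> u u (\<Sum>u\<in>L. ?e u)" using rho_component[OF assms(2), of ?e] d0_mem by simp
  also have "\<dots> = 0" using tau_eq_zero assms(1) unfolding augmentation_def by blast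
  finally show ?thesis .
qed

lemma admissible_spc: "admissible (resolution_space i)"
  unfolding resolution_space_def by (rule admissible_ind[OF subspace_N])

lemma aug_exact: "(\<lambda>\<phi> u. differential 0 (\<phi> u)) ` carrier (family_module (resolution_space 1)) = {\<phi> \<in> carrier (family_module (resolution_space 0)). augmentation \<phi> = \<zero>\<^bsub>M\<^esub>}"
proof (intro equalityI subsetI)
  fix \<phi> assume "\<phi> \<in> (\<lambda>\<phi> u. differential 0 (\<phi> u)) ` carrier (family_module (resolution_space 1))"
  then obtain f where f: "\<forall>u j. f u j \<in> resolution_space 1 u j" "\<phi> = (\<lambda>u. differential 0 (f u))" by auto
  have "\<forall>u j. \<phi> u j \<in> resolution_space 0 u j" using f bd_closed[of _ 0] by simp
  moreover have "C.d0 u (\<lambda>q. \<phi> u (q, False)) = 0" if "u \<in> L" for u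
    using C.d0_d1[OF L_GT[OF that], of "\<lambda>q. f u (q, True)" "\<lambda>q. f u (q, False)"] f spc_1[OF that, of "f u"]
    by (simp add: differential_def)
  then have "augmentation \<phi> = \<tau> 0" by (simp add: augmentation_def)
  then have "augmentation \<phi> = \<zero>\<^bsub>M\<^esub>"
    using tau_add[of 0 0] tau_closed[of 0] by (simp add: M.M.add.l_cancel_one')
  ultimately show "\<phi> \<in> {\<phi> \<in> carrier (family_module (resolution_space 0)). augmentation \<phi> = \<zero>\<^bsub>M\<^esub>}" by simp
next
  fix \<phi> assume "\<phi> \<in> {\<phi> \<in> carrier (family_module (resolution_space 0)). augmentation \<phi> = \<zero>\<^bsub>M\<^esub>}"
  then have \<phi>: "\<forall>u j. \<phi> u j \<in> resolution_space 0 u j" "augmentation \<phi> = \<zero>\<^bsub>M\<^esub>" by auto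
  have "\<exists>g. (\<forall>j. g j \<in> resolution_space 1 u j) \<and> differential 0 g = \<phi> u" for u
  proof (cases "u \<in> L")
    case False
    have "\<phi> u = (\<lambda>j. 0)" using \<phi>(1) spc_dead[OF False] by (metis singletonD)
    then show ?thesis by (intro exI[of _ "\<lambda>_. 0"]) (simp add: bd_zero spc_zero)
  next
    case True
    have c: "C.chain0 u (\<lambda>q. \<phi> u (q, False))" "\<forall>q. \<phi> u (q, True) = 0"
      using \<phi>(1) spc_0[OF True, of "\<phi> u"] by blast+
    obtain x y where xy: "C.chain1 u x y" "C.d1 x y = (\<lambda>q. \<phi> u (q, False))"
      using C.exact_0[OF L_GT[OF True] c(1) aug_kernel[OF \<phi>(2) True]] by blast
    let ?g = "\<lambda>(q, c). if c then x q else y q"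
    have "\<forall>j. ?g j \<in> resolution_space 1 u j" using spc_1[OF True, of ?g] xy(1) by simp
    moreover have "differential 0 ?g = \<phi> u" using xy(2) c(2) by (auto simp: differential_def fun_eq_iff)
    ultimately show ?thesis by blast
  qed
  then obtain g where "\<forall>u. (\<forall>j. g u j \<in> resolution_space 1 u j) \<and> differential 0 (g u) = \<phi> u" by metis
  then show "\<phi> \<in> (\<lambda>\<phi> u. differential 0 (\<phi> u)) ` carrier (family_module (resolution_space 1))"
    by (intro image_eqI[of _ _ g]) auto
qed

lemma cmod_exact:
  "(\<lambda>\<phi> u. differential (Suc i) (\<phi> u)) ` carrier (family_module (resolution_space (Suc (Suc i))))
    = {\<phi> \<in> carrier (family_module (resolution_space (Suc i))). (\<lambda>u. differential i (\<phi> u)) = \<zero>\<^bsub>family_module (resolution_space i)\<^esub>}"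
proof (intro equalityI subsetI)
  fix \<phi> assume "\<phi> \<in> (\<lambda>\<phi> u. differential (Suc i) (\<phi> u)) ` carrier (family_module (resolution_space (Suc (Suc i))))"
  then obtain f where f: "\<forall>u j. f u j \<in> resolution_space (Suc (Suc i)) u j" "\<phi> = (\<lambda>u. differential (Suc i) (f u))" by auto
  have "\<forall>u j. \<phi> u j \<in> resolution_space (Suc i) u j" using f bd_closed by simp
  moreover have "differential i (\<phi> u) = (\<lambda>_. 0)" for u
  proof (cases "i = 0")
    case True
    then show ?thesis using bd_bd[of "f u" u] f by (simp add: numeral_2_eq_2)
  next
    case False
    then have "\<phi> u = (\<lambda>_. 0)" unfolding f(2) by (simp add: differential_def)
    then show ?thesis by (simp add: bd_zero)
  qed
  ultimately show "\<phi> \<in> {\<phi> \<in> carrier (family_module (resolution_space (Suc i))). (\<lambda>u. differential i (\<phi> u)) = \<zero>\<^bsub>family_module (resolution_space i)\<^esub>}" by simp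
next
  fix \<phi> assume "\<phi> \<in> {\<phi> \<in> carrier (family_module (resolution_space (Suc i))). (\<lambda>u. differential i (\<phi> u)) = \<zero>\<^bsub>family_module (resolution_space i)\<^esub>}"
  then have \<phi>: "\<forall>j. \<phi> u j \<in> resolution_space (Suc i) u j" "differential i (\<phi> u) = (\<lambda>_. 0)" for u by (auto simp: fun_eq_iff)
  have "\<exists>g. (\<forall>j. g j \<in> resolution_space (Suc (Suc i)) u j) \<and> differential (Suc i) g = \<phi> u" for u
    by (rule bd_exact[OF \<phi>])
  then obtain g where "\<forall>u. (\<forall>j. g u j \<in> resolution_space (Suc (Suc i)) u j) \<and> differential (Suc i) (g u) = \<phi> u" by metis
  then show "\<phi> \<in> (\<lambda>\<phi> u. differential (Suc i) (\<phi> u)) ` carrier (family_module (resolution_space (Suc (Suc i))))"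
    by (intro image_eqI[of _ _ g]) auto
qed

theorem resolution: "has_proj_resolution R M 2"
proof -
  let ?J = "G.T \<times> (UNIV :: bool set)"
  have finJ: "finite ?J" by simp
  \<comment> \<open>A family is encoded by the finite set of its entries, each labelled with its position.\<close>
  obtain code :: "'w \<times> 'w \<times> bool \<Rightarrow> nat" where code: "inj_on code (L \<times> ?J)"
    using finite_imp_inj_to_nat_seg[of "L \<times> ?J"] finite_L finJ by (metis finite_cartesian_product)
  obtain code' :: "'w \<times> bool \<Rightarrow> nat" where code': "inj_on code' ?J"
    using finite_imp_inj_to_nat_seg[OF finJ] by metis
  define e :: "('w \<Rightarrow> 'w \<times> bool \<Rightarrow> 'm \<Rightarrow> 'k) \<Rightarrow> ('r, 'm) formal_comb"
    where "e \<phi> = Comb (Abs_fset ((\<lambda>p. (nest undefined (code p) (Gen (\<tau> (\<phi> (fst p) (snd p)))), undefined)) ` (L \<times> ?J)))" for \<phi>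
  have idx_J: "resolution_index i \<subseteq> ?J" for i by (auto simp: resolution_index_def)
  have spc_sub: "resolution_space i u j \<subseteq> \<sigma> ` carrier M" for i u j
  proof -
    have "0 \<in> \<sigma> ` carrier M" using N_sub[of u] C.N_0 by blast
    then show ?thesis using N_sub by (auto simp: resolution_space_def induced_def)
  qed
  have tau_inj: "v = w" if "v \<in> \<sigma> ` carrier M" "w \<in> \<sigma> ` carrier M" "\<tau> v = \<tau> w" for v w
    using that by (auto simp: tau_sigma)
  have e_inj: "inj_on e (carrier (family_module (resolution_space i)))" for i
  proof (rule inj_onI, intro ext)
    fix \<phi> \<phi>' u j x assume *: "\<phi> \<in> carrier (family_module (resolution_space i))" "\<phi>' \<in> carrier (family_module (resolution_space i))" "e \<phi> = e \<phi>'"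
    show "\<phi> u j x = \<phi>' u j x"
    proof (cases "u \<in> L \<and> j \<in> ?J")
      case False
      then have "resolution_space i u j = {0}" using idx_J[of i] by (auto simp: resolution_space_def induced_def)
      then show ?thesis using *(1,2) by (metis family_module_simps(1) singletonD)
    next
      case True
      let ?f = "\<lambda>\<phi> p. (nest undefined (code p) (Gen (\<tau> (\<phi> (fst p) (snd p)))), undefined) :: ('r, 'm) formal_comb \<times> 'r"
      have "?f \<phi> ` (L \<times> ?J) = ?f \<phi>' ` (L \<times> ?J)"
        using *(3) finite_L finJ unfolding e_def by (simp add: Abs_fset_inject)
      then have "?f \<phi> (u, j) \<in> ?f \<phi>' ` (L \<times> ?J)" using True by blast
      then obtain p where p: "p \<in> L \<times> ?J" "?f \<phi> (u, j) = ?f \<phi>' p" by blast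
      then have "code (u, j) = code p" "\<tau> (\<phi> u j) = \<tau> (\<phi>' (fst p) (snd p))"
        by (simp_all add: nest_Gen_inject)
      moreover from this have "p = (u, j)" using inj_onD[OF code _ _ p(1), of "(u, j)"] True by auto
      ultimately have "\<tau> (\<phi> u j) = \<tau> (\<phi>' u j)" by simp
      moreover have "\<phi> u j \<in> \<sigma> ` carrier M" "\<phi>' u j \<in> \<sigma> ` carrier M"
        using *(1,2) spc_sub unfolding family_module_simps by blast+
      ultimately show ?thesis using tau_inj by metis
    qed
  qed
  have "\<exists>B. independent B \<and> span B = N t" for t
    using maximal_independent_subset[of "N t"] span_minimal[OF _ subspace_N] by (metis subset_antisym)
  then obtain B where B: "\<And>t. independent (B t)" "\<And>t. span (B t) = N t" by metis
  show ?thesis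
  proof (rule has_proj_resolution_transport[where Q = "\<lambda>i. family_module (resolution_space i)" and e = e
        and \<epsilon> = augmentation and \<delta> = "\<lambda>i \<phi> u. differential i (\<phi> u)"])
    show "right_module R M" by (rule M.right_module_axioms)
    show "right_module R (family_module (resolution_space i))" for i by (rule right_module_cmod[OF admissible_spc])
    show "projective_rmodule R (transport e (family_module (resolution_space i)))" for i
    proof -
      let ?X = "{(j, x). j \<in> resolution_index i \<and> x \<in> B (resolution_coeff i j)}"
      obtain f g where fg: "rlinear R (family_module (resolution_space i)) (free_rmodule R ?X) f"
        "rlinear R (free_rmodule R ?X) (family_module (resolution_space i)) g" "\<forall>\<phi>\<in>carrier (family_module (resolution_space i)). g (f \<phi>) = \<phi>"
        using ind_basis[where B = B and N = N and a = "resolution_coeff i" and b = fst, OF B finite_subset[OF idx_J[of i] finJ]]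
        unfolding resolution_space_def by blast
      define h :: "('w \<times> bool) \<times> ('m \<Rightarrow> 'k) \<Rightarrow> ('r, 'm) formal_comb"
        where "h = (\<lambda>(j, x). nest undefined (code' j) (Gen (\<tau> x)))"
      have "inj_on h ?X"
      proof (rule inj_onI)
        fix p p' assume p: "p \<in> ?X" "p' \<in> ?X" "h p = h p'"
        then have "code' (fst p) = code' (fst p')" "\<tau> (snd p) = \<tau> (snd p')"
          by (auto simp: h_def nest_Gen_inject)
        moreover have "snd p \<in> \<sigma> ` carrier M" "snd p' \<in> \<sigma> ` carrier M"
          using p(1,2) N_sub B(2) span_base by fastforce+
        moreover have "fst p \<in> ?J" "fst p' \<in> ?J" using p idx_J[of i] by auto
        ultimately show "p = p'" using tau_inj inj_onD[OF code'] by (metis prod.expand)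
      qed
      then show ?thesis
        using projective_transport[OF right_module_cmod[OF admissible_spc] e_inj _ fg(1,2)] fg(3) by blast
    qed
    show "carrier (family_module (resolution_space i)) = {\<zero>\<^bsub>family_module (resolution_space i)\<^esub>}" if "2 < i" for i
      using spc_big[OF that] by (auto simp: fun_eq_iff)
    show "rlinear R (family_module (resolution_space (Suc i))) (family_module (resolution_space i)) (\<lambda>\<phi> u. differential i (\<phi> u))" for i
      by (rule rlinear_cmod[OF admissible_spc bd_closed bd_add bd_scale])
  qed (rule e_inj rlinear_aug aug_surj aug_exact cmod_exact)+
qed

end

text \<open>The multiples of the identity matrix make every module a vector space; embedded into a function space, it
  has the resolution constructed above.\<close>

theorem incidence_gl_dim:
  fixes \<chi> :: "'r \<Rightarrow> 'w \<Rightarrow> 'w \<Rightarrow> 'k::field" and le :: "'w \<Rightarrow> 'w \<Rightarrow> bool"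
  assumes G: "grid_poset W z \<alpha> \<beta> le" and L: "W \<subseteq> L" "L \<subseteq> insert z W"
    and R: "ring R" and \<chi>: "\<chi> \<in> ring_iso R (inc_ring L le)"
  shows "gl_dim TYPE('m) R \<le> 2"
proof -
  interpret G: grid_poset W z \<alpha> \<beta> le by (rule G)
  have LT: "t \<in> G.T" if "t \<in> L" for t using that L by (auto simp: G.T_def)
  interpret finite_preorder L le
  proof
    show "finite L" using L(2) G.finite_W by (auto intro: finite_subset)
    show "le t t" if "t \<in> L" for t by (rule G.le_refl[OF LT[OF that]])
    show "le t r" if "t \<in> L" "s \<in> L" "r \<in> L" "le t s" "le s r" for t s r
      by (rule G.le_trans[OF LT[OF that(1)] LT[OF that(2)] LT[OF that(3)] that(4,5)])
  qed
  interpret I: incidence_iso L le R \<chi>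
    by (intro incidence_iso.intro incidence_iso_axioms.intro finite_preorder_axioms R \<chi>)
  have "proj_dim R M \<le> 2" if M: "right_module R M" for M :: "('r, 'm) module"
  proof -
    interpret M: right_module R M by (rule M)
    let ?const = "\<lambda>c :: 'k. (\<lambda>t s. if t = s \<and> t \<in> L then c else 0)"
    have const: "?const c \<in> Inc" for c by (auto simp: Inc_iff refl_L)
    have add: "?const (c + d) = ?const c + ?const d" for c d by (auto simp: fun_eq_iff)
    have mult: "?const (c * d) = ?const d \<otimes>\<^bsub>inc_ring L le\<^esub> ?const c" for c d
    proof (intro ext)
      fix t s
      have "(?const d \<otimes>\<^bsub>inc_ring L le\<^esub> ?const c) t s = (\<Sum>r\<in>L. if t = r then d * ?const c r s else 0)"
        unfolding inc_mult by (intro sum.cong) auto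
      then show "?const (c * d) t s = (?const d \<otimes>\<^bsub>inc_ring L le\<^esub> ?const c) t s"
        using finite_L by (simp add: sum.delta)
    qed
    have one: "I.\<psi> (?const 1) = \<one>\<^bsub>R\<^esub>"
      by (rule I.chi_inj) (auto simp: I.psi_closed[OF const] I.chi_psi[OF const] I.chi_one fun_eq_iff)
    obtain \<sigma> :: "'m \<Rightarrow> 'm \<Rightarrow> 'k" where \<sigma>: "inj_on \<sigma> (carrier M)"
      "\<And>x y. x \<in> carrier M \<Longrightarrow> y \<in> carrier M \<Longrightarrow> \<sigma> (x \<oplus>\<^bsub>M\<^esub> y) = \<sigma> x + \<sigma> y"
      "\<And>c x. x \<in> carrier M \<Longrightarrow> \<sigma> (I.\<psi> (?const c) \<odot>\<^bsub>M\<^esub> x) = fscale c (\<sigma> x)"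
    proof (rule embed_vector_space[OF M.M.abelian_group_axioms, of "\<lambda>c x. I.\<psi> (?const c) \<odot>\<^bsub>M\<^esub> x"])
      fix c d x assume x: "x \<in> carrier M"
      show "I.\<psi> (?const (c + d)) \<odot>\<^bsub>M\<^esub> x = I.\<psi> (?const c) \<odot>\<^bsub>M\<^esub> x \<oplus>\<^bsub>M\<^esub> I.\<psi> (?const d) \<odot>\<^bsub>M\<^esub> x"
        unfolding add I.psi_add[OF const const] by (intro M.act_add_scalar I.psi_closed const x)
      show "I.\<psi> (?const (c * d)) \<odot>\<^bsub>M\<^esub> x = I.\<psi> (?const c) \<odot>\<^bsub>M\<^esub> (I.\<psi> (?const d) \<odot>\<^bsub>M\<^esub> x)"
        unfolding mult I.psi_mult[OF const const] by (intro M.act_mult I.psi_closed const x)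
    qed (auto simp: one M.act_one M.act_add M.act_closed I.psi_closed[OF const])
    interpret vs: vector_space "fscale :: 'k \<Rightarrow> ('m \<Rightarrow> 'k) \<Rightarrow> _" by (rule vector_space_fscale)
    have "vs.subspace (\<sigma> ` carrier M)"
    proof (rule vs.subspaceI)
      have "\<sigma> \<zero>\<^bsub>M\<^esub> = 0" using \<sigma>(2)[of "\<zero>\<^bsub>M\<^esub>" "\<zero>\<^bsub>M\<^esub>"] by simp
      then show "0 \<in> \<sigma> ` carrier M" by (metis M.M.zero_closed image_eqI)
      show "x + y \<in> \<sigma> ` carrier M" if "x \<in> \<sigma> ` carrier M" "y \<in> \<sigma> ` carrier M" for x y
        using that \<sigma>(2)[symmetric] by auto
      show "fscale c x \<in> \<sigma> ` carrier M" if "x \<in> \<sigma> ` carrier M" for c x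
        using that \<sigma>(3)[symmetric] M.act_closed[OF I.psi_closed[OF const]] by auto
    qed
    then obtain \<gamma> where \<gamma>: "\<And>x y. \<gamma> (x + y) = \<gamma> x + \<gamma> y" "\<And>c x. \<gamma> (fscale c x) = fscale c (\<gamma> x)"
      "\<And>x. \<gamma> x \<in> \<sigma> ` carrier M" "\<And>x. x \<in> \<sigma> ` carrier M \<Longrightarrow> \<gamma> x = x"
      by (rule projection_onto_subspace) metis
    interpret incidence_grid L le R \<chi> M \<sigma> \<gamma> W z \<alpha> \<beta>
      by (intro incidence_grid.intro incidence_grid_axioms.intro embedded_module.intro
          embedded_module_axioms.intro I.incidence_iso_axioms M G L \<sigma> \<gamma>)
    show ?thesis using resolution unfolding proj_dim_def by (intro Inf_lower2[of "enat 2"]) (auto simp: numeral_eq_enat)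
  qed
  then show ?thesis unfolding gl_dim_def by (intro SUP_least) simp
qed

section \<open>The poset of the summands\<close>

locale cyclic_weights =
  fixes n :: nat and m :: "nat \<Rightarrow> nat"
  assumes n_pos: "n \<ge> 1" and m_nonzero: "\<exists>i<n. m i \<noteq> 0"
begin

abbreviation d :: "nat \<Rightarrow> nat \<Rightarrow> int" where "d \<equiv> cyc_exponent n m"
abbreviation \<nu> :: "nat \<Rightarrow> nat" where "\<nu> i \<equiv> if Suc i < n then Suc i else 0"

definition total :: int where "total = (\<Sum>l<n. int (m l))"

definition prev :: "nat \<Rightarrow> nat" where "prev i = (if i = 0 then n - 1 else i - 1)"

text \<open>The total shift after \<open>a\<close> cyclic steps backwards from \<open>i\<close>.\<close>

definition wt :: "nat \<Rightarrow> nat \<Rightarrow> int" where "wt i a = (\<Sum>c<a. int (m ((prev ^^ c) i)))"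

text \<open>The vertex \<open>Some (i, j)\<close> stands for the summand \<open>e\<^bsub>\<nu> i\<^esub>A(j)\<^sub>\<ge>\<^sub>0\<close>, and \<open>None\<close> for \<open>[R \<dots> R]\<close>. The bound is
  \<open>1 - p\<^sub>i = d(\<nu> i, i) = total - m i\<close>.\<close>

definition W :: "(nat \<times> int) option set"
  where "W = Some ` (SIGMA i:{..<n}. {1..<total - int (m i)})"

text \<open>Up to the shift by \<open>j\<close>, the summand \<open>t\<close> is the row module \<open>[R x\<^bsup>expo t 0\<^esup> \<dots> R x\<^bsup>expo t (n - 1)\<^esup>]\<close>: truncation replaces the negative exponents by zero.\<close>

definition expo :: "(nat \<times> int) option \<Rightarrow> nat \<Rightarrow> int"
  where "expo t l = (case t of None \<Rightarrow> 0 | Some (i, j) \<Rightarrow> max 0 (d (\<nu> i) l - j))"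

definition below :: "(nat \<times> int) option \<Rightarrow> (nat \<times> int) option \<Rightarrow> bool"
  where "below t u \<longleftrightarrow> (\<forall>l<n. expo t l \<le> expo u l)"

text \<open>The truncations with \<open>j \<ge> total - m i\<close> have only zero exponents; they all coincide with
  \<open>[R \<dots> R]\<close>.\<close>

definition normal :: "nat \<Rightarrow> int \<Rightarrow> (nat \<times> int) option"
  where "normal i j = (if j < total - int (m i) then Some (i, j) else None)"

definition \<alpha> :: "(nat \<times> int) option \<Rightarrow> (nat \<times> int) option"
  where "\<alpha> t = (case t of None \<Rightarrow> None | Some (i, j) \<Rightarrow> normal (prev i) (j + int (m i)))"

definition \<beta> :: "(nat \<times> int) option \<Rightarrow> (nat \<times> int) option"
  where "\<beta> t = (case t of None \<Rightarrow> None | Some (i, j) \<Rightarrow> normal i (j + 1))"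

lemma prev_less: "i < n \<Longrightarrow> prev i < n"
  using n_pos by (auto simp: prev_def)

lemma prev_pow_less: "i < n \<Longrightarrow> (prev ^^ a) i < n"
  by (induction a) (auto simp: prev_less)

lemma prev_pow: "i < n \<Longrightarrow> a \<le> n \<Longrightarrow> (prev ^^ a) i = (if a \<le> i then i - a else i + n - a)"
proof (induction a)
  case (Suc a)
  then have E: "(prev ^^ Suc a) i = prev (if a \<le> i then i - a else i + n - a)" by simp
  show ?case unfolding E using Suc.prems by (auto simp: prev_def)
qed simp

lemma prev_pow_n: "i < n \<Longrightarrow> (prev ^^ n) i = i"
  by (simp add: prev_pow)

lemma prev_pow_inj: "i < n \<Longrightarrow> inj_on (\<lambda>a. (prev ^^ a) i) {..<n}"
  by (rule inj_onI) (auto simp: prev_pow split: if_splits)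

lemma prev_pow_bij: "i < n \<Longrightarrow> bij_betw (\<lambda>a. (prev ^^ a) i) {..<n} {..<n}"
proof -
  assume i: "i < n"
  have "(\<lambda>a. (prev ^^ a) i) ` {..<n} = {..<n}"
    by (rule endo_inj_surj) (use prev_pow_less[OF i] prev_pow_inj[OF i] in auto)
  then show ?thesis using prev_pow_inj[OF i] by (simp add: bij_betw_def)
qed

lemma prev_pow_onto: "i < n \<Longrightarrow> l < n \<Longrightarrow> \<exists>a<n. l = (prev ^^ a) i"
proof -
  assume "i < n" "l < n"
  then have "l \<in> (\<lambda>a. (prev ^^ a) i) ` {..<n}" using prev_pow_bij[of i] by (simp add: bij_betw_def)
  then show ?thesis by auto
qed

lemma wt_n: "i < n \<Longrightarrow> wt i n = total"
  unfolding wt_def total_def by (rule sum.reindex_bij_betw[OF prev_pow_bij])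

lemma wt_add: "wt i (a + c) = wt i a + wt ((prev ^^ a) i) c"
proof (induction c)
  case (Suc c)
  have "(prev ^^ (a + c)) i = (prev ^^ c) ((prev ^^ a) i)" by (metis add.commute comp_apply funpow_add)
  then show ?case using Suc by (simp add: wt_def)
qed (simp add: wt_def)

lemma wt_Suc: "wt i (Suc a) = wt i a + int (m ((prev ^^ a) i))"
  by (simp add: wt_def)

lemma wt_0 [simp]: "wt i 0 = 0"
  by (simp add: wt_def)

lemma wt_nonneg: "wt i a \<ge> 0"
  by (simp add: wt_def sum_nonneg)

lemma wt_mono: "a \<le> b \<Longrightarrow> wt i a \<le> wt i b"
  using wt_add[of i a "b - a"] wt_nonneg[of "(prev ^^ a) i" "b - a"] by simp

lemma wt_ge_total: "i < n \<Longrightarrow> n \<le> a \<Longrightarrow> wt i a \<ge> total"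
  using wt_mono[of n a i] wt_n by simp

lemma d_step:
  assumes "i < n" "l < n" "i \<noteq> l"
  shows "d i l = d i (prev l) + int (m (prev l))"
proof -
  have p: "prev l < n" using assms prev_less by simp
  show ?thesis
  proof (cases l)
    case 0
    have "n = Suc (n - 1)" using n_pos by simp
    then have "(\<Sum>l<n. int (m l)) = (\<Sum>l<n - 1. int (m l)) + int (m (n - 1))" by (metis sum.lessThan_Suc)
    then show ?thesis
      using assms p 0 by (simp add: cyc_exponent_partial_sums prev_def)
  next
    case (Suc l')
    then show ?thesis
      using assms p by (auto simp: cyc_exponent_partial_sums prev_def)
  qed
qed

text \<open>Read backwards from \<open>i\<close>, the row \<open>\<nu> i\<close> of the exponent matrix decreases from \<open>total - m i\<close> to zero, with the
  differences given by the weights that are passed.\<close>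

lemma d_nu_prev:
  assumes i: "i < n" and c: "c < n"
  shows "d (\<nu> i) ((prev ^^ c) i) = total - wt i (Suc c)"
  using c
proof (induction c)
  case 0
  have "d (\<nu> i) i = total - int (m i)"
  proof (cases "Suc i < n")
    case True
    then show ?thesis using i by (simp add: cyc_exponent_partial_sums total_def)
  next
    case False
    then have "n = Suc i" using i by simp
    then show ?thesis unfolding total_def using i n_pos by (simp add: cyc_exponent_partial_sums)
  qed
  then show ?case by (simp add: wt_Suc)
next
  case (Suc c)
  have nu: "\<nu> i < n" using n_pos by simp
  have "(prev ^^ c) i \<noteq> \<nu> i" using Suc.prems i by (auto simp: prev_pow)
  then have "d (\<nu> i) ((prev ^^ c) i) = d (\<nu> i) ((prev ^^ Suc c) i) + int (m ((prev ^^ Suc c) i))"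
    using d_step[OF nu prev_pow_less[OF i, of c]] by auto
  then show ?case using Suc by (simp add: wt_Suc)
qed

lemma d_nu_self: "i < n \<Longrightarrow> d (\<nu> i) i = total - int (m i)"
  using d_nu_prev[of i 0] n_pos by (simp add: wt_Suc)

lemma Some_W: "Some (i, j) \<in> W \<longleftrightarrow> i < n \<and> 1 \<le> j \<and> j < total - int (m i)"
  by (auto simp: W_def)

lemma normal_W: "i < n \<Longrightarrow> 1 \<le> j \<Longrightarrow> normal i j \<in> insert None W"
  by (simp add: normal_def Some_W)

lemma expo_prev: "i < n \<Longrightarrow> c < n \<Longrightarrow> expo (Some (i, j)) ((prev ^^ c) i) = max 0 (total - wt i (Suc c) - j)"
  using d_nu_prev[of i c] by (simp add: expo_def)

lemma beta_normal: "\<beta> (normal i j) = normal i (j + 1)"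
  by (auto simp: \<beta>_def normal_def)

lemma alpha_normal: "\<alpha> (normal i j) = normal (prev i) (j + int (m i))"
  by (auto simp: \<alpha>_def normal_def)

lemma alpha_beta_pow: "(\<alpha> ^^ a) ((\<beta> ^^ b) (normal i j)) = normal ((prev ^^ a) i) (j + int b + wt i a)"
proof -
  have "(\<beta> ^^ b) (normal i j) = normal i (j + int b)"
    by (induction b) (auto simp: beta_normal algebra_simps)
  moreover have "(\<alpha> ^^ a) (normal i j) = normal ((prev ^^ a) i) (j + wt i a)" for j
    by (induction a) (auto simp: alpha_normal wt_Suc add.assoc)
  ultimately show ?thesis by simp
qed

lemma normal_Some: "Some (i, j) \<in> W \<Longrightarrow> Some (i, j) = normal i j"
  by (simp add: Some_W normal_def)

text \<open>The comparison of two rows of exponents is decided at the single column \<open>i'\<close>, where the lower row has its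
  largest exponent. Backwards from \<open>i'\<close> both rows decrease by the same weights until \<open>i\<close> is reached again; from there
  on the lower row is zero.\<close>

lemma below_Some:
  assumes i: "i < n" and j: "1 \<le> j" and t: "Some (i', j') \<in> W" and a: "a < n" "i' = (prev ^^ a) i"
  shows "below (Some (i', j')) (Some (i, j)) \<longleftrightarrow> j + wt i a \<le> j'"
proof
  have i': "i' < n" "1 \<le> j'" "j' < total - int (m i')" using t by (auto simp: Some_W)
  assume b: "below (Some (i', j')) (Some (i, j))"
  have "expo (Some (i', j')) i' = total - int (m i') - j'"
    using expo_prev[OF i'(1), of 0 j'] i' n_pos by (simp add: wt_Suc)
  moreover have "expo (Some (i, j)) i' = max 0 (total - wt i a - int (m i') - j)"
    using expo_prev[OF i a(1), of j] a by (simp add: wt_Suc algebra_simps)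
  ultimately show "j + wt i a \<le> j'" using b i' by (auto simp: below_def)
next
  have i': "i' < n" "1 \<le> j'" "j' < total - int (m i')" using t by (auto simp: Some_W)
  assume le: "j + wt i a \<le> j'"
  show "below (Some (i', j')) (Some (i, j))"
    unfolding below_def
  proof (intro allI impI)
    fix l assume "l < n"
    then obtain c where c: "c < n" "l = (prev ^^ c) i" using prev_pow_onto[OF i] by blast
    show "expo (Some (i', j')) l \<le> expo (Some (i, j)) l"
    proof (cases "a \<le> c")
      case True
      then have l: "l = (prev ^^ (c - a)) i'"
        using c a by (simp add: funpow_add[symmetric, THEN fun_cong, simplified])
      have "wt i (Suc c) = wt i a + wt i' (Suc (c - a))"
        using wt_add[of i a "Suc (c - a)"] True a by simp
      then show ?thesis
        using expo_prev[OF i c(1), of j] expo_prev[OF i'(1), of "c - a" j'] l c a le by auto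
    next
      case False
      then have ca: "c + n - a < n" using a by simp
      have "(prev ^^ (c + n - a)) i' = (prev ^^ (c + n - a + a)) i" by (simp add: funpow_add a)
      also have "\<dots> = (prev ^^ c) ((prev ^^ n) i)" using a(1) by (simp add: funpow_add)
      finally have l: "l = (prev ^^ (c + n - a)) i'" using c prev_pow_n[OF i] by simp
      have "wt i (n + Suc c) = total + wt i (Suc c)" using wt_add[of i n "Suc c"] wt_n[OF i] prev_pow_n[OF i] by simp
      moreover have "wt i (n + Suc c) = wt i a + wt i' (Suc (c + n - a))"
      proof -
        have "n + Suc c = a + Suc (c + n - a)" using a by simp
        then show ?thesis using wt_add[of i a "Suc (c + n - a)"] a by (simp only:)
      qed
      ultimately have "total - wt i' (Suc (c + n - a)) - j' \<le> 0"
        using le j wt_nonneg[of i "Suc c"] by linarith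
      then show ?thesis using expo_prev[OF i'(1) ca, of j'] l by (auto simp: expo_def split: option.splits)
    qed
  qed
qed

text \<open>The two elementary steps down are \<open>\<beta>\<close>, which raises the shift by one, and \<open>\<alpha>\<close>, which passes to the
  preceding row and raises the shift by the weight between them.\<close>

lemma below_iff:
  assumes t: "t \<in> insert None W" and u: "u \<in> insert None W"
  shows "below t u \<longleftrightarrow> (\<exists>a b. t = (\<alpha> ^^ a) ((\<beta> ^^ b) u))"
proof (cases u)
  case None
  have "(\<alpha> ^^ a) ((\<beta> ^^ b) None) = None" for a b
  proof -
    have "(\<beta> ^^ b) None = None" by (induction b) (auto simp: \<beta>_def)
    moreover have "(\<alpha> ^^ a) None = None" by (induction a) (auto simp: \<alpha>_def)
    ultimately show ?thesis by simp
  qed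
  moreover have "\<not> below (Some (i, j)) None" if "Some (i, j) \<in> W" for i j
  proof -
    have "i < n" "expo (Some (i, j)) i > 0"
      using that expo_prev[of i 0 j] n_pos by (auto simp: Some_W wt_Suc)
    then show ?thesis by (auto simp: below_def expo_def[of None])
  qed
  moreover have "below None None" by (simp add: below_def)
  ultimately show ?thesis using t None by (auto simp: W_def)
next
  case (Some p)
  then obtain i j where ij: "u = Some (i, j)" by (cases p) auto
  then have u': "i < n" "1 \<le> j" "u = normal i j" using u normal_Some by (auto simp: Some_W)
  show ?thesis
  proof (cases t)
    case None
    have "normal ((prev ^^ n) i) (j + int 0 + wt i n) = None"
      using u' wt_n by (simp add: normal_def prev_pow_n)
    then have "None = (\<alpha> ^^ n) ((\<beta> ^^ 0) u)" unfolding u'(3) alpha_beta_pow by simp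
    then have "\<exists>a b. None = (\<alpha> ^^ a) ((\<beta> ^^ b) u)" by (intro exI)
    moreover have "below None u" by (auto simp: below_def expo_def split: option.splits)
    ultimately show ?thesis unfolding None by simp
  next
    case (Some q)
    then obtain i' j' where t': "t = Some (i', j')" by (cases q) auto
    then have tW: "Some (i', j') \<in> W" using t by auto
    then obtain a where a: "a < n" "i' = (prev ^^ a) i" using prev_pow_onto[OF u'(1)] by (auto simp: Some_W)
    have "below t u \<longleftrightarrow> j + wt i a \<le> j'" unfolding t' ij by (rule below_Some[OF u'(1,2) tW a])
    also have "\<dots> \<longleftrightarrow> (\<exists>a b. t = (\<alpha> ^^ a) ((\<beta> ^^ b) u))"
    proof
      assume "j + wt i a \<le> j'"
      then have "t = (\<alpha> ^^ a) ((\<beta> ^^ nat (j' - j - wt i a)) u)"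
        using normal_Some[OF tW] a unfolding u'(3) alpha_beta_pow t' by simp
      then show "\<exists>a b. t = (\<alpha> ^^ a) ((\<beta> ^^ b) u)" by blast
    next
      assume "\<exists>a b. t = (\<alpha> ^^ a) ((\<beta> ^^ b) u)"
      then obtain a' b where ab: "Some (i', j') = normal ((prev ^^ a') i) (j + int b + wt i a')"
        unfolding t' u'(3) alpha_beta_pow by blast
      then have j': "j' = j + int b + wt i a'" "i' = (prev ^^ a') i" "j' < total"
        by (auto simp: normal_def split: if_splits)
      then have "a' < n" using wt_ge_total[OF u'(1), of a'] u'(2) by (cases "a' < n") auto
      then have "a' = a" using prev_pow_inj[OF u'(1)] a j'(2) by (auto simp: inj_on_def)
      then show "j + wt i a \<le> j'" using j' by simp
    qed
    finally show ?thesis .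
  qed
qed

sublocale grid_poset W None \<alpha> \<beta> below
proof
  show "finite W" by (auto simp: W_def)
  show "None \<notin> W" by (auto simp: W_def)
  show "\<alpha> q \<in> insert None W" "\<beta> q \<in> insert None W" if "q \<in> W" for q
  proof -
    obtain i j where q: "q = Some (i, j)" "i < n" "1 \<le> j" using \<open>q \<in> W\<close> by (auto simp: W_def)
    then show "\<alpha> q \<in> insert None W" "\<beta> q \<in> insert None W"
      using normal_W[OF prev_less[OF q(2)], of "j + int (m i)"] normal_W[OF q(2), of "j + 1"]
      by (simp_all add: \<alpha>_def \<beta>_def)
  qed
  show "\<alpha> None = None" "\<beta> None = None" by (auto simp: \<alpha>_def \<beta>_def)
  show "\<beta> (\<alpha> q) = \<alpha> (\<beta> q)" if "q \<in> W" for q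
    by (cases q) (auto simp: \<alpha>_def[of "Some _"] \<beta>_def[of "Some _"] alpha_normal beta_normal \<alpha>_def[of None] \<beta>_def[of None] ac_simps)
  show "below t u \<longleftrightarrow> (\<exists>a b. t = (\<alpha> ^^ a) ((\<beta> ^^ b) u))" if "t \<in> insert None W" "u \<in> insert None W" for t u
    by (rule below_iff[OF that])
  show "a = a' \<and> b = b'" if u: "u \<in> W" and W: "(\<alpha> ^^ a) ((\<beta> ^^ b) u) \<in> W"
    and eq: "(\<alpha> ^^ a) ((\<beta> ^^ b) u) = (\<alpha> ^^ a') ((\<beta> ^^ b') u)" for u a b a' b'
  proof -
    obtain i j where ij: "u = Some (i, j)" using u by (auto simp: W_def)
    then have u': "i < n" "1 \<le> j" "u = normal i j" using u normal_Some by (auto simp: Some_W)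
    have n1: "normal ((prev ^^ a) i) (j + int b + wt i a) \<noteq> None"
      using W unfolding u'(3) alpha_beta_pow by (auto simp: W_def)
    have n2: "normal ((prev ^^ a) i) (j + int b + wt i a) = normal ((prev ^^ a') i) (j + int b' + wt i a')"
      using eq unfolding u'(3) alpha_beta_pow .
    have "j + int b + wt i a < total" "j + int b' + wt i a' < total" and e: "(prev ^^ a) i = (prev ^^ a') i"
      "j + int b + wt i a = j + int b' + wt i a'"
      using n1 n2 by (auto simp: normal_def split: if_splits)
    then have "a < n" "a' < n" using wt_ge_total[OF u'(1), of a] wt_ge_total[OF u'(1), of a'] u'(2)
      by (cases "a < n"; cases "a' < n"; force)+
    then have "a = a'" using prev_pow_inj[OF u'(1)] e by (auto simp: inj_on_def)
    then show ?thesis using e by simp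
  qed
  show "\<exists>K. (\<alpha> ^^ K) u = None \<and> (\<beta> ^^ K) u = None" if u: "u \<in> W" for u
  proof -
    obtain i j where ij: "u = Some (i, j)" using u by (auto simp: W_def)
    then have u': "i < n" "1 \<le> j" "u = normal i j" using u normal_Some by (auto simp: Some_W)
    let ?K = "n + nat total"
    have "(\<alpha> ^^ ?K) u = None"
      using alpha_beta_pow[of ?K 0 i j] wt_ge_total[OF u'(1), of ?K] u' by (simp add: normal_def)
    moreover have "(\<beta> ^^ ?K) u = None"
      using alpha_beta_pow[of 0 ?K i j] u' by (simp add: normal_def)
    ultimately show ?thesis by blast
  qed
qed

end

section \<open>Coordinates on the summands\<close>

lemma lookup_sum_single: "(\<Sum>k\<in>Poly_Mapping.keys p. Poly_Mapping.single k (Poly_Mapping.lookup p k)) = p"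
proof (rule poly_mapping_eqI)
  fix j
  have "(\<Sum>k\<in>Poly_Mapping.keys p. Poly_Mapping.lookup p k when k = j) = Poly_Mapping.lookup p j"
    by (simp add: when_def sum.delta in_keys_iff)
  then show "Poly_Mapping.lookup (\<Sum>k\<in>Poly_Mapping.keys p. Poly_Mapping.single k (Poly_Mapping.lookup p k)) j
      = Poly_Mapping.lookup p j"
    by (simp add: lookup_sum lookup_single)
qed

lemma lookup_mult_monom:
  fixes p :: "'k::field laurent"
  shows "Poly_Mapping.lookup (p * Poly_Mapping.single a c) j = Poly_Mapping.lookup p (j - a) * c"
proof -
  have "p * Poly_Mapping.single a c = (\<Sum>k\<in>Poly_Mapping.keys p. Poly_Mapping.single (k + a) (Poly_Mapping.lookup p k * c))"
    by (subst lookup_sum_single[of p, symmetric]) (simp add: sum_distrib_right mult_single)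
  then have "Poly_Mapping.lookup (p * Poly_Mapping.single a c) j
      = (\<Sum>k\<in>Poly_Mapping.keys p. if k = j - a then Poly_Mapping.lookup p k * c else 0)"
    by (simp add: lookup_sum lookup_single when_def eq_diff_eq)
  then show ?thesis by (simp add: sum.delta in_keys_iff)
qed

lemma Rx_iff: "p \<in> Rx a \<longleftrightarrow> (\<forall>j<a. Poly_Mapping.lookup p j = 0)"
proof
  assume "p \<in> Rx a"
  then show "\<forall>j<a. Poly_Mapping.lookup p j = 0" by (auto simp: Rx_def polyR_def lookup_mult_monom)
next
  assume p: "\<forall>j<a. Poly_Mapping.lookup p j = 0"
  have "p = p * Poly_Mapping.single (- a) 1 * Poly_Mapping.single a 1"
    by (rule poly_mapping_eqI) (simp add: lookup_mult_monom)
  moreover have "p * Poly_Mapping.single (- a) 1 \<in> polyR" using p by (auto simp: polyR_def lookup_mult_monom)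
  ultimately show "p \<in> Rx a" unfolding Rx_def by (rule image_eqI)
qed

lemma polyR_Rx: "polyR = Rx 0"
  by (auto simp: polyR_def Rx_iff)

lemma Rx_0 [simp]: "0 \<in> Rx a" and Rx_add: "p \<in> Rx a \<Longrightarrow> q \<in> Rx a \<Longrightarrow> p + q \<in> Rx a"
  and Rx_uminus: "p \<in> Rx a \<Longrightarrow> - p \<in> Rx a"
  and Rx_mono: "p \<in> Rx a \<Longrightarrow> b \<le> a \<Longrightarrow> p \<in> Rx b"
  by (auto simp: Rx_iff lookup_add)

lemma Rx_sum: "(\<And>i. i \<in> I \<Longrightarrow> f i \<in> Rx a) \<Longrightarrow> sum f I \<in> Rx a"
  by (auto simp: Rx_iff lookup_sum)

lemma Rx_single: "Poly_Mapping.single e c \<in> Rx a \<longleftrightarrow> c = 0 \<or> a \<le> e"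
  by (auto simp: Rx_iff lookup_single when_def)

lemma Rx_mult_single: "p * Poly_Mapping.single e 1 \<in> Rx a \<longleftrightarrow> p \<in> Rx (a - e)"
  unfolding Rx_iff lookup_mult_monom
  by (auto simp: algebra_simps dest: spec[of _ "_ - e"])

lemma single_cancel: "p * Poly_Mapping.single (- e) 1 * Poly_Mapping.single e (1::'k::field) = p"
    "p * Poly_Mapping.single e 1 * Poly_Mapping.single (- e) (1::'k::field) = p"
  for e :: int
  by (simp_all add: mult.assoc mult_single)

lemma Rx_mult: "p \<in> Rx a \<Longrightarrow> q \<in> Rx b \<Longrightarrow> p * q \<in> Rx (a + b)"
proof -
  assume p: "p \<in> Rx a" and q: "q \<in> Rx b"
  have "p * Poly_Mapping.single k (Poly_Mapping.lookup q k) \<in> Rx (a + b)" for k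
    using p q by (auto simp: Rx_iff lookup_mult_monom) (metis add.commute add_diff_cancel_left' diff_less_eq linorder_not_less mult_eq_0_iff add_le_cancel_left less_diff_eq not_less_iff_gr_or_eq order_less_le_trans)
  then have "(\<Sum>k\<in>Poly_Mapping.keys q. p * Poly_Mapping.single k (Poly_Mapping.lookup q k)) \<in> Rx (a + b)"
    by (rule Rx_sum)
  then show ?thesis by (simp add: sum_distrib_left[symmetric] lookup_sum_single)
qed

lemma mat_comp_iff: "v \<in> mat_comp r c e \<longleftrightarrow> v \<in> carrier_mat r c \<and> (\<forall>i<r. \<forall>l<c. \<exists>a. v $$ (i, l) = Poly_Mapping.single e a)"
proof
  assume v: "v \<in> carrier_mat r c \<and> (\<forall>i<r. \<forall>l<c. \<exists>a. v $$ (i, l) = Poly_Mapping.single e a)"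
  have "v = map_mat (Poly_Mapping.single e) (mat r c (\<lambda>p. Poly_Mapping.lookup (v $$ p) e))"
    by (rule eq_matI) (use v in \<open>auto, metis lookup_single_eq\<close>)
  then show "v \<in> mat_comp r c e" unfolding mat_comp_def by auto
qed (auto simp: mat_comp_def)

lemma mult_mat_entry:
  assumes "v \<in> carrier_mat r n" "X \<in> carrier_mat n c" "i < r" "l < c"
  shows "(v * X) $$ (i, l) = (\<Sum>l'<n. v $$ (i, l') * X $$ (l', l))"
  using assms by (simp add: scalar_prod_def atLeast0LessThan)

context cyclic_weights
begin

definition row_index :: "(nat \<times> int) option \<Rightarrow> nat"
  where "row_index t = (case t of None \<Rightarrow> 0 | Some (i, j) \<Rightarrow> \<nu> i)"
definition nrows :: "(nat \<times> int) option \<Rightarrow> nat"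
  where "nrows t = (case t of None \<Rightarrow> 1 | Some _ \<Rightarrow> n)"
definition summand_shift :: "(nat \<times> int) option \<Rightarrow> int"
  where "summand_shift t = (case t of None \<Rightarrow> 0 | Some (i, j) \<Rightarrow> j)"

text \<open>The element of the summand \<open>t\<close> with given entries. In \<open>e\<^sub>kA(j)\<close> the entries are multiplied by \<open>x\<^sup>j\<close>, so that
  the degree of an element is the degree of its coordinates.\<close>

definition summand_element :: "(nat \<times> int) option \<Rightarrow> (nat \<Rightarrow> 'k::field laurent) \<Rightarrow> 'k laurent mat"
  where "summand_element t p = mat (nrows t) n (\<lambda>(r, l). if r = row_index t then p l * Poly_Mapping.single (summand_shift t) 1 else 0)"

definition summand_coord :: "(nat \<times> int) option \<Rightarrow> 'k::field laurent mat \<Rightarrow> nat \<Rightarrow> 'k laurent"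
  where "summand_coord t v l = v $$ (row_index t, l) * Poly_Mapping.single (- summand_shift t) 1"

definition summand :: "(nat \<times> int) option \<Rightarrow> ('k::field laurent mat, 'k laurent mat) graded_module"
  where "summand t = (case t of None \<Rightarrow> row_module n
     | Some (i, j) \<Rightarrow> gtrunc (gshift j (idem_proj n d (nakayama n d i))))"

lemma tilting_V_summand: "tilting_V n d = gdsum T summand"
proof -
  have nak: "nakayama n d i = \<nu> i" if "i < n" for i using nakayama_cyc_exponent[OF m_nonzero that] by simp
  have "{1..- gor_param n d i} = {1..<total - int (m i)}" if "i < n" for i
    using d_nu_self[OF that] nak[OF that] by (auto simp: gor_param_def)
  then have "(SIGMA i:{..<n}. {1..- gor_param n d i}) = (SIGMA i:{..<n}. {1..<total - int (m i)})"
    by (intro Sigma_cong) auto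
  then have "insert None (Some ` (SIGMA i:{..<n}. {1..- gor_param n d i})) = T"
    unfolding T_def unfolding W_def by (simp only:)
  then show ?thesis unfolding tilting_V_def summand_def[abs_def] by simp
qed

lemma row_less: "row_index t < nrows t"
  using n_pos by (auto simp: row_index_def nrows_def split: option.splits)

lemma mk_carrier [simp]: "summand_element t p \<in> carrier_mat (nrows t) n"
  by (simp add: summand_element_def)

lemma ent_mk [simp]: "l < n \<Longrightarrow> summand_coord t (summand_element t p) l = p l"
  using row_less[of t] by (simp add: summand_coord_def summand_element_def single_cancel)

lemma mk_cong: "(\<And>l. l < n \<Longrightarrow> p l = q l) \<Longrightarrow> summand_element t p = summand_element t q"
  by (rule eq_matI) (auto simp: summand_element_def)

lemma A_simps:
  "X \<in> carrier (tiled_order n d) \<longleftrightarrow> X \<in> carrier_mat n n \<and> (\<forall>i<n. \<forall>l<n. X $$ (i, l) \<in> Rx (d i l))"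
  "rcomp (tiled_order n d) e = carrier (tiled_order n d) \<inter> mat_comp n n e"
  "X \<otimes>\<^bsub>tiled_order n d\<^esub> Y = X * Y" "\<one>\<^bsub>tiled_order n d\<^esub> = 1\<^sub>m n" "\<zero>\<^bsub>tiled_order n d\<^esub> = 0\<^sub>m n n"
  "X \<oplus>\<^bsub>tiled_order n d\<^esub> Y = X + Y"
  by (auto simp: tiled_order_def Let_def)

definition diag_row :: "nat \<Rightarrow> 'k::field laurent mat set"
  where "diag_row r0 = {Y \<in> carrier_mat n n. (\<forall>r<n. \<forall>l<n. r \<noteq> r0 \<longrightarrow> Y $$ (r, l) = 0) \<and> (\<forall>l<n. Y $$ (r0, l) \<in> Rx (d r0 l))}"

lemma diag_unit_mult:
  assumes "X \<in> carrier_mat n n" "r < n" "l < n"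
  shows "(diag_unit n r0 * X) $$ (r, l) = (if r = r0 then X $$ (r, l) else 0)"
proof -
  have "(diag_unit n r0 * X) $$ (r, l) = (\<Sum>l'<n. diag_unit n r0 $$ (r, l') * X $$ (l', l))"
    using assms by (intro mult_mat_entry) (auto simp: diag_unit_def)
  also have "\<dots> = (\<Sum>l'<n. if l' = r then if r = r0 then X $$ (r, l) else 0 else 0)"
    using assms by (intro sum.cong refl) (auto simp: diag_unit_def)
  also have "\<dots> = (if r = r0 then X $$ (r, l) else 0)" using assms by (simp add: sum.delta)
  finally show ?thesis .
qed

lemma diag_row_subset: "diag_row r0 \<subseteq> carrier (tiled_order n d)"
proof
  fix Y :: "'k::field laurent mat" assume Y: "Y \<in> diag_row r0"
  show "Y \<in> carrier (tiled_order n d)"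
    unfolding A_simps
  proof (intro conjI allI impI)
    show "Y \<in> carrier_mat n n" using Y by (simp add: diag_row_def)
    show "Y $$ (i, l) \<in> Rx (d i l)" if "i < n" "l < n" for i l
      using Y that by (cases "i = r0") (auto simp: diag_row_def)
  qed
qed

lemma diag_row_image:
  assumes r0: "r0 < n"
  shows "(\<lambda>X. diag_unit n r0 * X) ` carrier (tiled_order n d) = diag_row r0"
proof (intro equalityI subsetI)
  fix Y assume "Y \<in> (\<lambda>X. diag_unit n r0 * X) ` carrier (tiled_order n d)"
  then obtain X where X: "X \<in> carrier (tiled_order n d)" "Y = diag_unit n r0 * X" by auto
  moreover have "Y \<in> carrier_mat n n" using X by (auto simp: A_simps diag_unit_def)
  ultimately show "Y \<in> diag_row r0" using r0 diag_unit_mult[of X] by (auto simp: diag_row_def A_simps)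
next
  fix Y assume Y: "Y \<in> diag_row r0"
  then have "Y = diag_unit n r0 * Y"
    using diag_unit_mult[of Y] by (intro eq_matI) (auto simp: diag_row_def diag_unit_def)
  moreover have "Y \<in> carrier (tiled_order n d)" using diag_row_subset Y by blast
  ultimately show "Y \<in> (\<lambda>X. diag_unit n r0 * X) ` carrier (tiled_order n d)" by blast
qed

lemma idem_proj_simps:
  assumes "r0 < n"
  shows "carrier (gshift j (idem_proj n d r0)) = diag_row r0"
    "mcomp (gshift j (idem_proj n d r0)) e = diag_row r0 \<inter> mat_comp n n (e + j)"
    "\<zero>\<^bsub>gshift j (idem_proj n d r0)\<^esub> = 0\<^sub>m n n"
    "X \<oplus>\<^bsub>gshift j (idem_proj n d r0)\<^esub> Y = X + Y"
    "X \<odot>\<^bsub>gshift j (idem_proj n d r0)\<^esub> Y = Y * X"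
proof -
  show "mcomp (gshift j (idem_proj n d r0)) e = diag_row r0 \<inter> mat_comp n n (e + j)"
    by (simp add: gshift_def idem_proj_def Let_def A_simps(2) diag_row_image[OF assms] Int_assoc[symmetric]
        Int_absorb2[OF diag_row_subset])
qed (simp_all add: gshift_def idem_proj_def Let_def regular_gmod_def A_simps(3-) diag_row_image[OF assms])

lemma finsum_diag_row:
  fixes f :: "int \<Rightarrow> 'k::field laurent mat"
  assumes r0: "r0 < n" and I: "finite I" and f: "\<And>e. e \<in> I \<Longrightarrow> f e \<in> diag_row r0"
  shows "finsum (gshift j (idem_proj n d r0)) f I
    = mat n n (\<lambda>(r, l). \<Sum>e\<in>I. f e $$ (r, l))"
    "mat n n (\<lambda>(r, l). \<Sum>e\<in>I. f e $$ (r, l)) \<in> diag_row r0"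
proof -
  let ?G = "gshift j (idem_proj n d r0) :: ('k laurent mat, 'k laurent mat) graded_module"
  note s = idem_proj_simps[OF r0, of j]
  interpret abelian_monoid ?G
  proof (rule abelian_monoidI)
    fix X Y Z assume "X \<in> carrier ?G" "Y \<in> carrier ?G" "Z \<in> carrier ?G"
    then show "X \<oplus>\<^bsub>?G\<^esub> Y \<oplus>\<^bsub>?G\<^esub> Z = X \<oplus>\<^bsub>?G\<^esub> (Y \<oplus>\<^bsub>?G\<^esub> Z)"
      unfolding s by (intro assoc_add_mat) (auto simp: diag_row_def)
  next
    fix X Y assume "X \<in> carrier ?G" "Y \<in> carrier ?G"
    then show "X \<oplus>\<^bsub>?G\<^esub> Y = Y \<oplus>\<^bsub>?G\<^esub> X" unfolding s by (intro comm_add_mat) (auto simp: diag_row_def)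
  qed (unfold s, auto simp: diag_row_def Rx_add r0)
  show "finsum ?G f I = mat n n (\<lambda>(r, l). \<Sum>e\<in>I. f e $$ (r, l))"
    using I f
  proof (induction I rule: finite_induct)
    case empty
    have "finsum ?G f {} = 0\<^sub>m n n" by (simp add: s)
    then show ?case by (auto intro: eq_matI)
  next
    case (insert e I)
    have "finsum ?G f (insert e I) = f e \<oplus>\<^bsub>?G\<^esub> finsum ?G f I"
      using insert by (intro finsum_insert) (auto simp: s)
    then show ?case using insert by (auto simp: s diag_row_def intro!: eq_matI)
  qed
  show "mat n n (\<lambda>(r, l). \<Sum>e\<in>I. f e $$ (r, l)) \<in> diag_row r0"
    using f r0 unfolding diag_row_def by (auto intro!: Rx_sum sum.neutral)
qed

text \<open>In these coordinates all summands look alike and are described by their exponents alone.\<close>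

lemma summand_carrier_mcomp:
  assumes t: "t \<in> T"
  shows "carrier (summand t :: ('k::field laurent mat, 'k laurent mat) graded_module) = {summand_element t p | p. \<forall>l<n. p l \<in> Rx (expo t l)}" (is ?A)
    "mcomp (summand t :: ('k laurent mat, 'k laurent mat) graded_module) e = {summand_element t p | p. \<forall>l<n. p l \<in> Rx (expo t l) \<and> (\<exists>c. p l = Poly_Mapping.single e c)}" (is ?B)
proof -
  show ?A
  proof (cases t)
    case None
    have mkv: "v = summand_element t (\<lambda>l. v $$ (0, l))" if "v \<in> carrier_mat 1 n" for v :: "'k laurent mat"
      using that None by (intro eq_matI) (auto simp: summand_element_def nrows_def row_index_def summand_shift_def)
    have mkp: "summand_element t p $$ (0, l) = p l" if "l < n" for p :: "nat \<Rightarrow> 'k laurent" and l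
      using that None by (simp add: summand_element_def nrows_def row_index_def summand_shift_def)
    have mkc: "summand_element t p \<in> carrier_mat 1 n" for p :: "nat \<Rightarrow> 'k laurent"
      using None by (simp add: summand_element_def nrows_def)
    have ex: "expo t l = 0" for l using None by (simp add: expo_def)
    have car: "carrier (summand t :: ('k laurent mat, 'k laurent mat) graded_module) = {v \<in> carrier_mat 1 n. \<forall>l<n. v $$ (0, l) \<in> Rx 0}"
      using None by (auto simp: summand_def row_module_def Let_def polyR_Rx)
    show ?thesis unfolding car
    proof (intro equalityI subsetI)
      fix v :: "'k laurent mat" assume v: "v \<in> {v \<in> carrier_mat 1 n. \<forall>l<n. v $$ (0, l) \<in> Rx 0}"
      then show "v \<in> {summand_element t p | p. \<forall>l<n. p l \<in> Rx (expo t l)}"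
        using mkv[of v] ex by (intro CollectI exI[of _ "\<lambda>l. v $$ (0, l)"]) auto
    next
      fix v :: "'k laurent mat" assume "v \<in> {summand_element t p | p. \<forall>l<n. p l \<in> Rx (expo t l)}"
      then obtain p where p: "v = summand_element t p" "\<forall>l<n. p l \<in> Rx (expo t l)" by blast
      show "v \<in> {v \<in> carrier_mat 1 n. \<forall>l<n. v $$ (0, l) \<in> Rx 0}"
        using p(2) mkc mkp ex unfolding p(1) by auto
    qed
  next
    case (Some q)
    then obtain i j where ij: "t = Some (i, j)" by (cases q) auto
    then have i: "i < n" using t by (auto simp: T_def Some_W)
    define k where "k = \<nu> i"
    have nu: "nakayama n d i = k" "k < n" using nakayama_cyc_exponent[OF m_nonzero i] n_pos by (auto simp: k_def)
    note s = idem_proj_simps[OF nu(2), of j]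
    have tt: "row_index t = k" "nrows t = n" "summand_shift t = j" "\<And>l. expo t l = max 0 (d k l - j)"
      using ij by (auto simp: row_index_def nrows_def summand_shift_def expo_def k_def)
    let ?G = "gshift j (idem_proj n d k) :: ('k laurent mat, 'k laurent mat) graded_module"
    have car: "carrier (summand t) = {finsum ?G f I | f I. finite I \<and> I \<subseteq> {0..} \<and> (\<forall>i\<in>I. f i \<in> mcomp ?G i)}"
      using ij nu by (simp add: summand_def gtrunc_def)
    show ?thesis unfolding car
    proof (intro equalityI subsetI)
      fix v :: "'k laurent mat" assume "v \<in> {finsum ?G f I | f I. finite I \<and> I \<subseteq> {0..} \<and> (\<forall>i\<in>I. f i \<in> mcomp ?G i)}"
      then obtain f I where f: "v = finsum ?G f I" "finite I" "I \<subseteq> {0..}" "\<And>e. e \<in> I \<Longrightarrow> f e \<in> diag_row k \<inter> mat_comp n n (e + j)"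
        unfolding s by auto
      have v: "v = mat n n (\<lambda>(r, l). \<Sum>e\<in>I. f e $$ (r, l))" "v \<in> diag_row k"
        using finsum_diag_row(1)[OF nu(2) f(2), of f j] finsum_diag_row(2)[OF nu(2) f(2), of f] f(1,4) by auto
      have "v = summand_element t (summand_coord t v)"
        using v(2) by (intro eq_matI) (auto simp: summand_element_def tt summand_coord_def diag_row_def single_cancel)
      moreover have "summand_coord t v l \<in> Rx (expo t l)" if l: "l < n" for l
      proof -
        have "v $$ (k, l) \<in> Rx (d k l)" using v(2) l by (simp add: diag_row_def)
        moreover have "f e $$ (k, l) \<in> Rx j" if "e \<in> I" for e
        proof -
          have "\<exists>c. f e $$ (k, l) = Poly_Mapping.single (e + j) c"
            using f(4)[OF that] l nu(2) by (auto simp: mat_comp_iff)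
          then show ?thesis using that f(3) by (auto simp: Rx_single)
        qed
        then have "v $$ (k, l) \<in> Rx j" unfolding v(1) using l nu(2) by (simp add: Rx_sum)
        ultimately show ?thesis unfolding summand_coord_def tt Rx_mult_single by (auto simp: max_def)
      qed
      ultimately show "v \<in> {summand_element t p | p. \<forall>l<n. p l \<in> Rx (expo t l)}" by blast
    next
      fix v :: "'k laurent mat" assume "v \<in> {summand_element t p | p. \<forall>l<n. p l \<in> Rx (expo t l)}"
      then obtain p where p: "v = summand_element t p" "\<And>l. l < n \<Longrightarrow> p l \<in> Rx (expo t l)" by blast
      define I where "I = (\<Union>l<n. Poly_Mapping.keys (p l))"
      define f where "f e = summand_element t (\<lambda>l. Poly_Mapping.single e (Poly_Mapping.lookup (p l) e))" for e
      have I: "finite I" by (simp add: I_def)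
      have "0 \<le> e" if "e \<in> I" for e
      proof (rule ccontr)
        assume "\<not> 0 \<le> e"
        then have "e < expo t l" for l using tt(4)[of l] by simp
        then show False using that p(2) by (auto simp: I_def Rx_iff in_keys_iff)
      qed
      then have I0: "I \<subseteq> {0..}" by auto
      have fe: "f e \<in> diag_row k \<inter> mat_comp n n (e + j)" if "e \<in> I" for e
      proof -
        have "Poly_Mapping.single (e + j) (Poly_Mapping.lookup (p l) e) \<in> Rx (d k l)" if "l < n" for l
          using p(2)[OF that] tt(4)[of l] unfolding Rx_single by (auto simp: Rx_iff)
        then show ?thesis
          by (auto simp: f_def summand_element_def tt diag_row_def mat_comp_iff mult_single nu intro: exI[of _ 0])
      qed
      have "v = mat n n (\<lambda>(r, l). \<Sum>e\<in>I. f e $$ (r, l))"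
      proof (rule eq_matI)
        fix r l assume "r < dim_row (mat n n (\<lambda>(r, l). \<Sum>e\<in>I. f e $$ (r, l)))"
          "l < dim_col (mat n n (\<lambda>(r, l). \<Sum>e\<in>I. f e $$ (r, l)))"
        then have rl: "r < n" "l < n" by auto
        have "p l = (\<Sum>e\<in>Poly_Mapping.keys (p l). Poly_Mapping.single e (Poly_Mapping.lookup (p l) e))"
          by (simp add: lookup_sum_single)
        also have "\<dots> = (\<Sum>e\<in>I. Poly_Mapping.single e (Poly_Mapping.lookup (p l) e))"
          using I rl by (intro sum.mono_neutral_left) (auto simp: I_def in_keys_iff)
        finally have "p l * Poly_Mapping.single j 1 = (\<Sum>e\<in>I. Poly_Mapping.single e (Poly_Mapping.lookup (p l) e) * Poly_Mapping.single j 1)"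
          by (metis sum_distrib_right)
        then show "v $$ (r, l) = mat n n (\<lambda>(r, l). \<Sum>e\<in>I. f e $$ (r, l)) $$ (r, l)"
          using rl by (auto simp: p f_def summand_element_def tt)
      qed (auto simp: p summand_element_def tt)
      then have "v = finsum ?G f I" using finsum_diag_row(1)[OF nu(2) I, of f j] fe by simp
      then show "v \<in> {finsum ?G f I | f I. finite I \<and> I \<subseteq> {0..} \<and> (\<forall>i\<in>I. f i \<in> mcomp ?G i)}"
        unfolding s using I I0 fe by blast
    qed
  qed
  show ?B
  proof (cases t)
    case None
    have mkv: "v = summand_element t (\<lambda>l. v $$ (0, l))" if "v \<in> carrier_mat 1 n" for v :: "'k laurent mat"
      using that None by (intro eq_matI) (auto simp: summand_element_def nrows_def row_index_def summand_shift_def)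
    have mkp: "summand_element t p $$ (0, l) = p l" if "l < n" for p :: "nat \<Rightarrow> 'k laurent" and l
      using that None by (simp add: summand_element_def nrows_def row_index_def summand_shift_def)
    have mkc: "summand_element t p \<in> carrier_mat 1 n" for p :: "nat \<Rightarrow> 'k laurent"
      using None by (simp add: summand_element_def nrows_def)
    have ex: "expo t l = 0" for l using None by (simp add: expo_def)
    have car: "mcomp (summand t :: ('k laurent mat, 'k laurent mat) graded_module) e = {v \<in> carrier_mat 1 n. \<forall>l<n. v $$ (0, l) \<in> Rx 0 \<and> (\<exists>c. v $$ (0, l) = Poly_Mapping.single e c)}"
      using None by (auto simp: summand_def row_module_def Let_def polyR_Rx mat_comp_iff)
    show ?thesis unfolding car
    proof (intro equalityI subsetI)
      fix v :: "'k laurent mat" assume v: "v \<in> {v \<in> carrier_mat 1 n. \<forall>l<n. v $$ (0, l) \<in> Rx 0 \<and> (\<exists>c. v $$ (0, l) = Poly_Mapping.single e c)}"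
      then show "v \<in> {summand_element t p | p. \<forall>l<n. p l \<in> Rx (expo t l) \<and> (\<exists>c. p l = Poly_Mapping.single e c)}"
        using mkv[of v] ex by (intro CollectI exI[of _ "\<lambda>l. v $$ (0, l)"]) auto
    next
      fix v :: "'k laurent mat" assume "v \<in> {summand_element t p | p. \<forall>l<n. p l \<in> Rx (expo t l) \<and> (\<exists>c. p l = Poly_Mapping.single e c)}"
      then obtain p where p: "v = summand_element t p" "\<forall>l<n. p l \<in> Rx (expo t l) \<and> (\<exists>c. p l = Poly_Mapping.single e c)" by blast
      show "v \<in> {v \<in> carrier_mat 1 n. \<forall>l<n. v $$ (0, l) \<in> Rx 0 \<and> (\<exists>c. v $$ (0, l) = Poly_Mapping.single e c)}"
        using p(2) mkc mkp ex unfolding p(1) by auto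
    qed
  next
    case (Some q)
    then obtain i j where ij: "t = Some (i, j)" by (cases q) auto
    then have i: "i < n" using t by (auto simp: T_def Some_W)
    define k where "k = \<nu> i"
    have nu: "nakayama n d i = k" "k < n" using nakayama_cyc_exponent[OF m_nonzero i] n_pos by (auto simp: k_def)
    note s = idem_proj_simps[OF nu(2), of j]
    have tt: "row_index t = k" "nrows t = n" "summand_shift t = j" "\<And>l. expo t l = max 0 (d k l - j)"
      using ij by (auto simp: row_index_def nrows_def summand_shift_def expo_def k_def)
    have mc: "mcomp (summand t :: ('k laurent mat, 'k laurent mat) graded_module) e = (if e \<ge> 0 then diag_row k \<inter> mat_comp n n (e + j) else {0\<^sub>m n n})"
      using ij nu by (simp add: summand_def gtrunc_def s(2,3))
    have zero: "summand_element t p = 0\<^sub>m n n" if "\<And>l. l < n \<Longrightarrow> p l = 0" for p :: "nat \<Rightarrow> 'k laurent"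
      using that by (intro eq_matI) (auto simp: summand_element_def tt)
    show ?thesis
    proof (cases "e \<ge> 0")
      case False
      have p0: "p l = 0" if "p l \<in> Rx (expo t l)" "p l = Poly_Mapping.single e c" for p :: "nat \<Rightarrow> 'k laurent" and l c
        using that False tt(4)[of l] by (auto simp: Rx_single)
      have "{summand_element t p | p :: nat \<Rightarrow> 'k laurent. \<forall>l<n. p l \<in> Rx (expo t l) \<and> (\<exists>c. p l = Poly_Mapping.single e c)} = {0\<^sub>m n n}"
      proof (intro equalityI subsetI)
        fix X :: "'k laurent mat"
        assume "X \<in> {summand_element t p | p :: nat \<Rightarrow> 'k laurent. \<forall>l<n. p l \<in> Rx (expo t l) \<and> (\<exists>c. p l = Poly_Mapping.single e c)}"
        then obtain p where p: "X = summand_element t p" "\<forall>l<n. p l \<in> Rx (expo t l) \<and> (\<exists>c. p l = Poly_Mapping.single e c)" by blast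
        have "p l = 0" if "l < n" for l using p(2) that p0 by blast
        then have "summand_element t p = 0\<^sub>m n n" by (rule zero)
        then show "X \<in> {0\<^sub>m n n}" unfolding p(1) by simp
      next
        fix X :: "'k laurent mat" assume "X \<in> {0\<^sub>m n n}"
        then have X: "X = summand_element t (\<lambda>_. 0)" using zero[of "\<lambda>_. 0"] by (simp only: singleton_iff)
        have "\<exists>c. (0 :: 'k laurent) = Poly_Mapping.single e c" by (intro exI[of _ 0]) simp
        then show "X \<in> {summand_element t p | p :: nat \<Rightarrow> 'k laurent. \<forall>l<n. p l \<in> Rx (expo t l) \<and> (\<exists>c. p l = Poly_Mapping.single e c)}"
          unfolding X by (intro CollectI exI[of _ "\<lambda>_. 0"]) (simp only: Rx_0 simp_thms)
      qed
      then show ?thesis using mc False by simp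
    next
      case True
      show ?thesis unfolding mc if_P[OF True]
      proof (intro equalityI subsetI)
        fix v :: "'k laurent mat" assume v: "v \<in> diag_row k \<inter> mat_comp n n (e + j)"
        have "v = summand_element t (summand_coord t v)"
          using v by (intro eq_matI) (auto simp: summand_element_def tt summand_coord_def diag_row_def single_cancel)
        moreover have "summand_coord t v l \<in> Rx (expo t l) \<and> (\<exists>c. summand_coord t v l = Poly_Mapping.single e c)" if l: "l < n" for l
        proof -
          have "\<exists>c. v $$ (k, l) = Poly_Mapping.single (e + j) c"
            using v l nu(2) unfolding Int_iff mat_comp_iff by blast
          moreover have "v $$ (k, l) \<in> Rx (d k l)" using v l by (simp add: diag_row_def)
          ultimately obtain c where c: "v $$ (k, l) = Poly_Mapping.single (e + j) c" "v $$ (k, l) \<in> Rx (d k l)"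
            by blast
          then have "summand_coord t v l = Poly_Mapping.single e c" by (simp add: summand_coord_def tt mult_single)
          then show ?thesis using c True tt(4)[of l] by (auto simp: Rx_single)
        qed
        ultimately show "v \<in> {summand_element t p | p. \<forall>l<n. p l \<in> Rx (expo t l) \<and> (\<exists>c. p l = Poly_Mapping.single e c)}" by blast
      next
        fix v :: "'k laurent mat" assume "v \<in> {summand_element t p | p. \<forall>l<n. p l \<in> Rx (expo t l) \<and> (\<exists>c. p l = Poly_Mapping.single e c)}"
        then obtain p where p: "v = summand_element t p" "\<And>l. l < n \<Longrightarrow> p l \<in> Rx (expo t l) \<and> (\<exists>c. p l = Poly_Mapping.single e c)" by blast
        have "p l * Poly_Mapping.single j 1 \<in> Rx (d k l) \<and> (\<exists>c. p l * Poly_Mapping.single j 1 = Poly_Mapping.single (e + j) c)" if l: "l < n" for l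
          using p(2)[OF l] tt(4)[of l] by (auto simp: Rx_single mult_single)
        then show "v \<in> diag_row k \<inter> mat_comp n n (e + j)"
          by (auto simp: p(1) summand_element_def tt diag_row_def mat_comp_iff nu intro: exI[of _ 0])
      qed
    qed
  qed
qed

lemma summand_ops:
  "\<zero>\<^bsub>summand t\<^esub> = 0\<^sub>m (nrows t) n" "X \<oplus>\<^bsub>summand t\<^esub> Y = X + Y" "X \<odot>\<^bsub>summand t\<^esub> Y = Y * X"
  by (auto simp: summand_def nrows_def row_module_def Let_def gtrunc_def gshift_def idem_proj_def regular_gmod_def A_simps
      split: option.splits)

end

section \<open>Endomorphisms of the direct sum\<close>

lemma single_sum: "Poly_Mapping.single e (\<Sum>i\<in>I. g i) = (\<Sum>i\<in>I. Poly_Mapping.single e (g i))"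
  by (induction I rule: infinite_finite_induct) (auto simp: single_add)

context cyclic_weights
begin

definition coords :: "((nat \<times> int) option \<Rightarrow> 'k::field laurent mat) \<Rightarrow> (nat \<times> int) option \<Rightarrow> nat \<Rightarrow> 'k laurent"
  where "coords f t l = summand_coord t (f t) l"

definition from_coords :: "((nat \<times> int) option \<Rightarrow> nat \<Rightarrow> 'k::field laurent) \<Rightarrow> (nat \<times> int) option \<Rightarrow> 'k laurent mat"
  where "from_coords p = (\<lambda>t\<in>T. summand_element t (p t))"

text \<open>The coordinates of the elements of \<open>V\<close>.\<close>

definition in_summands :: "((nat \<times> int) option \<Rightarrow> nat \<Rightarrow> 'k::field laurent) \<Rightarrow> bool"
  where "in_summands p \<longleftrightarrow> (\<forall>t\<in>T. \<forall>l<n. p t l \<in> Rx (expo t l))"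

definition homogeneous :: "int \<Rightarrow> ((nat \<times> int) option \<Rightarrow> nat \<Rightarrow> 'k::field laurent) \<Rightarrow> bool"
  where "homogeneous e p \<longleftrightarrow> (\<forall>t\<in>T. \<forall>l<n. \<exists>c. p t l = Poly_Mapping.single e c)"

abbreviation A :: "'k::field laurent mat graded_ring" where "A \<equiv> tiled_order n d"
abbreviation V :: "('k::field laurent mat, (nat \<times> int) option \<Rightarrow> 'k laurent mat) graded_module"
  where "V \<equiv> tilting_V n d"

lemma coords_fromc [simp]: "t \<in> T \<Longrightarrow> l < n \<Longrightarrow> coords (from_coords p) t l = p t l"
  by (simp add: coords_def from_coords_def)

lemma fromc_cong: "(\<And>t l. t \<in> T \<Longrightarrow> l < n \<Longrightarrow> p t l = q t l) \<Longrightarrow> from_coords p = from_coords q"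
  unfolding from_coords_def by (intro restrict_ext mk_cong)

lemma V_carrier: "f \<in> carrier V \<longleftrightarrow> (\<exists>p. in_summands p \<and> f = from_coords p)"
proof
  assume f: "f \<in> carrier V"
  then have f': "f \<in> (\<Pi>\<^sub>E t\<in>T. carrier (summand t))" by (simp add: tilting_V_summand gdsum_def)
  then have "\<forall>t\<in>T. \<exists>p. f t = summand_element t p \<and> (\<forall>l<n. p l \<in> Rx (expo t l))"
    using summand_carrier_mcomp(1) by (fastforce simp: PiE_iff)
  then obtain p where p: "\<forall>t\<in>T. f t = summand_element t (p t) \<and> (\<forall>l<n. p t l \<in> Rx (expo t l))" by metis
  have "f = from_coords p" using f' p by (auto simp: from_coords_def PiE_iff extensional_def fun_eq_iff)
  then show "\<exists>p. in_summands p \<and> f = from_coords p" using p by (auto simp: in_summands_def)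
next
  assume "\<exists>p. in_summands p \<and> f = from_coords p"
  then show "f \<in> carrier V"
    by (auto simp: tilting_V_summand gdsum_def from_coords_def in_summands_def summand_carrier_mcomp(1)) blast
qed

lemma V_mcomp: "f \<in> mcomp V e \<longleftrightarrow> (\<exists>p. in_summands p \<and> homogeneous e p \<and> f = from_coords p)"
proof
  assume f: "f \<in> mcomp V e"
  then have f': "f \<in> (\<Pi>\<^sub>E t\<in>T. mcomp (summand t) e)" by (simp add: tilting_V_summand gdsum_def)
  then have "\<forall>t\<in>T. \<exists>p. f t = summand_element t p \<and> (\<forall>l<n. p l \<in> Rx (expo t l) \<and> (\<exists>c. p l = Poly_Mapping.single e c))"
    using summand_carrier_mcomp(2) by (fastforce simp: PiE_iff)
  then obtain p where p: "\<forall>t\<in>T. f t = summand_element t (p t) \<and> (\<forall>l<n. p t l \<in> Rx (expo t l) \<and> (\<exists>c. p t l = Poly_Mapping.single e c))" by metis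
  have "f = from_coords p" using f' p by (auto simp: from_coords_def PiE_iff extensional_def fun_eq_iff)
  then show "\<exists>p. in_summands p \<and> homogeneous e p \<and> f = from_coords p" using p by (auto simp: in_summands_def homogeneous_def)
next
  assume "\<exists>p. in_summands p \<and> homogeneous e p \<and> f = from_coords p"
  then show "f \<in> mcomp V e"
    by (auto simp: tilting_V_summand gdsum_def from_coords_def in_summands_def homogeneous_def summand_carrier_mcomp(2)) blast
qed

lemma fromc_carrier: "in_summands p \<Longrightarrow> from_coords p \<in> carrier V"
  using V_carrier by blast

lemma coords_good: "f \<in> carrier V \<Longrightarrow> in_summands (coords f)"
  by (auto simp: V_carrier in_summands_def)

lemma coords_homog: "f \<in> mcomp V e \<Longrightarrow> homogeneous e (coords f)"
  by (auto simp: V_mcomp homogeneous_def)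

lemma mcomp_carrier: "f \<in> mcomp V e \<Longrightarrow> f \<in> carrier V"
  by (auto simp: V_mcomp V_carrier)

lemma mcompI: "in_summands p \<Longrightarrow> homogeneous e p \<Longrightarrow> from_coords p \<in> mcomp V e"
  using V_mcomp by blast

lemma fromc_coords: "f \<in> carrier V \<Longrightarrow> from_coords (coords f) = f"
  by (auto simp: V_carrier intro!: fromc_cong)

lemma coords_eqI:
  assumes "f \<in> carrier V" "g \<in> carrier V" "\<And>t l. t \<in> T \<Longrightarrow> l < n \<Longrightarrow> coords f t l = coords g t l"
  shows "f = g"
  using fromc_cong[of "coords f" "coords g"] fromc_coords assms by metis

lemma V_zero: "\<zero>\<^bsub>V\<^esub> = from_coords (\<lambda>t l. 0 :: 'k::field laurent)"
proof -
  have "summand_element t (\<lambda>l. 0 :: 'k laurent) = 0\<^sub>m (nrows t) n" for t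
    by (rule eq_matI) (auto simp: summand_element_def)
  then show ?thesis by (auto simp: tilting_V_summand gdsum_def summand_ops from_coords_def intro!: restrict_ext)
qed

lemma V_add:
  assumes "f \<in> carrier V" "g \<in> carrier V"
  shows "f \<oplus>\<^bsub>V\<^esub> g = from_coords (\<lambda>t l. coords f t l + coords g t l)"
proof -
  have "summand_element t p + summand_element t q = summand_element t (\<lambda>l. p l + q l)" for t and p q :: "nat \<Rightarrow> 'a laurent"
    by (rule eq_matI) (auto simp: summand_element_def distrib_right)
  moreover obtain p q where "f = from_coords p" "g = from_coords q" using assms by (auto simp: V_carrier)
  ultimately have "f \<oplus>\<^bsub>V\<^esub> g = from_coords (\<lambda>t l. p t l + q t l)" "f = from_coords p" "g = from_coords q"
    by (auto simp: tilting_V_summand gdsum_def summand_ops from_coords_def intro!: restrict_ext)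
  then show ?thesis by (auto intro!: fromc_cong)
qed

lemma V_smult:
  assumes f: "f \<in> carrier V" and X: "X \<in> carrier A"
  shows "X \<odot>\<^bsub>V\<^esub> f = from_coords (\<lambda>t l. \<Sum>l'<n. coords f t l' * X $$ (l', l))"
proof -
  have X': "X \<in> carrier_mat n n" using X by (simp add: A_simps)
  have "summand_element t p * X = summand_element t (\<lambda>l. \<Sum>l'<n. p l' * X $$ (l', l))" for t and p :: "nat \<Rightarrow> 'a laurent"
  proof (rule eq_matI)
    fix r l assume "r < dim_row (summand_element t (\<lambda>l. \<Sum>l'<n. p l' * X $$ (l', l)))"
      "l < dim_col (summand_element t (\<lambda>l. \<Sum>l'<n. p l' * X $$ (l', l)))"
    then have rl: "r < nrows t" "l < n" by (auto simp: summand_element_def)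
    have "(summand_element t p * X) $$ (r, l) = (\<Sum>l'<n. summand_element t p $$ (r, l') * X $$ (l', l))"
      by (rule mult_mat_entry[OF mk_carrier X' rl])
    also have "\<dots> = summand_element t (\<lambda>l. \<Sum>l'<n. p l' * X $$ (l', l)) $$ (r, l)"
      using rl by (auto simp: summand_element_def sum_distrib_left ac_simps)
    finally show "(summand_element t p * X) $$ (r, l) = summand_element t (\<lambda>l. \<Sum>l'<n. p l' * X $$ (l', l)) $$ (r, l)" .
  qed (use X' in \<open>auto simp: summand_element_def\<close>)
  moreover obtain p where "f = from_coords p" using f by (auto simp: V_carrier)
  ultimately have "X \<odot>\<^bsub>V\<^esub> f = from_coords (\<lambda>t l. \<Sum>l'<n. p t l' * X $$ (l', l))" "f = from_coords p"
    by (auto simp: tilting_V_summand gdsum_def summand_ops from_coords_def intro!: restrict_ext)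
  then show ?thesis by (auto intro!: fromc_cong)
qed

lemma expo_triangle: "t \<in> T \<Longrightarrow> l < n \<Longrightarrow> l' < n \<Longrightarrow> expo t l \<le> expo t l' + d l' l"
proof (cases t)
  case None
  then show ?thesis by (simp add: expo_def cyc_exponent_nonneg)
next
  case (Some q)
  assume l: "l < n" "l' < n"
  obtain i j where ij: "t = Some (i, j)" using Some by (cases q) auto
  have "d (\<nu> i) l' + d l' l \<ge> d (\<nu> i) l"
    using cyc_exponent_matrix[OF n_pos, of m] l n_pos unfolding exponent_matrix_def by auto
  then show ?thesis using ij cyc_exponent_nonneg[of n m l' l] by (simp add: expo_def)
qed

lemma smult_good:
  assumes "in_summands p" "X \<in> carrier A"
  shows "in_summands (\<lambda>t l. \<Sum>l'<n. p t l' * X $$ (l', l))"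
  unfolding in_summands_def
proof (intro ballI allI impI Rx_sum)
  fix t l l' assume t: "t \<in> T" "l < n" and l': "l' \<in> {..<n}"
  have "p t l' * X $$ (l', l) \<in> Rx (expo t l' + d l' l)"
    using assms t l' by (intro Rx_mult) (auto simp: in_summands_def A_simps)
  then show "p t l' * X $$ (l', l) \<in> Rx (expo t l)" using expo_triangle[OF t, of l'] l' by (auto intro: Rx_mono)
qed

lemma V_smult_closed: "f \<in> carrier V \<Longrightarrow> X \<in> carrier A \<Longrightarrow> X \<odot>\<^bsub>V\<^esub> f \<in> carrier V"
  by (simp add: V_smult fromc_carrier smult_good coords_good)

lemma V_add_closed: "f \<in> carrier V \<Longrightarrow> g \<in> carrier V \<Longrightarrow> f \<oplus>\<^bsub>V\<^esub> g \<in> carrier V"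
  using coords_good[of f] coords_good[of g] by (auto simp: V_add in_summands_def Rx_add intro!: fromc_carrier)

lemma coords_smult: "\<lbrakk>f \<in> carrier V; X \<in> carrier A; t \<in> T; l < n\<rbrakk>
    \<Longrightarrow> coords (X \<odot>\<^bsub>V\<^esub> f) t l = (\<Sum>l'<n. coords f t l' * X $$ (l', l))"
  by (simp add: V_smult)

lemma coords_add: "\<lbrakk>f \<in> carrier V; g \<in> carrier V; t \<in> T; l < n\<rbrakk>
    \<Longrightarrow> coords (f \<oplus>\<^bsub>V\<^esub> g) t l = coords f t l + coords g t l"
  by (simp add: V_add)

definition matrix_element :: "'k::field laurent \<Rightarrow> nat \<Rightarrow> nat \<Rightarrow> 'k laurent mat"
  where "matrix_element p a b = mat n n (\<lambda>(r, l). if r = a \<and> l = b then p else 0)"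

lemma elem_A: "p \<in> Rx (d a b) \<Longrightarrow> matrix_element p a b \<in> carrier A"
  by (auto simp: matrix_element_def A_simps)

lemma sum_elem: "a < n \<Longrightarrow> b < n \<Longrightarrow> l < n \<Longrightarrow> (\<Sum>l'<n. g l' * matrix_element p a b $$ (l', l)) = (if l = b then g a * p else 0)"
proof -
  assume *: "a < n" "b < n" "l < n"
  have "(\<Sum>l'<n. g l' * matrix_element p a b $$ (l', l)) = (\<Sum>l'<n. if l' = a then if l = b then g a * p else 0 else 0)"
    using * by (intro sum.cong refl) (auto simp: matrix_element_def)
  then show ?thesis using * by (simp add: sum.delta)
qed

lemma coords_elem:
  assumes "f \<in> carrier V" "p \<in> Rx (d a b)" "a < n" "b < n" "t \<in> T" "l < n"
  shows "coords (matrix_element p a b \<odot>\<^bsub>V\<^esub> f) t l = (if l = b then coords f t a * p else 0)"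
  using assms by (simp add: coords_smult elem_A sum_elem)

text \<open>The generator of the entry \<open>l\<close> of the summand \<open>s\<close>.\<close>

definition gen :: "(nat \<times> int) option \<Rightarrow> nat \<Rightarrow> (nat \<times> int) option \<Rightarrow> 'k::field laurent mat"
  where "gen s l = from_coords (\<lambda>t l'. if t = s \<and> l' = l then Poly_Mapping.single (expo s l) 1 else 0)"

lemma gen_mcomp: "gen s l \<in> mcomp V (expo s l)"
proof -
  have "\<exists>c. (0 :: 'k::field laurent) = Poly_Mapping.single (expo s l) c" by (intro exI[of _ 0]) simp
  then show ?thesis unfolding gen_def by (intro mcompI) (auto simp: in_summands_def homogeneous_def Rx_single)
qed

lemma gen_carrier: "gen s l \<in> carrier V"
  using gen_mcomp by (rule mcomp_carrier)

lemma coords_gen: "t \<in> T \<Longrightarrow> l' < n \<Longrightarrow> coords (gen s l) t l' = (if t = s \<and> l' = l then Poly_Mapping.single (expo s l) 1 else 0)"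
  by (simp add: gen_def)

lemma d_nonneg: "0 \<le> d a b"
  by (rule cyc_exponent_nonneg)

lemma expo_nonneg: "0 \<le> expo t l"
  by (auto simp: expo_def split: option.splits)

lemma d_self: "d a a = 0"
  by (simp add: cyc_exponent_def)

text \<open>Any two of these generators have a common nonzero multiple. A homomorphism is therefore determined on the
  whole summand as soon as it is known on one of them.\<close>

lemma gen_connect:
  assumes s: "s \<in> T" and l: "l < n" "l' < n"
  shows "matrix_element (Poly_Mapping.single (d l l' + expo s l') 1) l l' \<odot>\<^bsub>V\<^esub> (gen s l :: _ \<Rightarrow> 'k::field laurent mat)
    = matrix_element (Poly_Mapping.single (d l l' + expo s l) 1) l' l' \<odot>\<^bsub>V\<^esub> gen s l'"
proof -
  let ?x = "Poly_Mapping.single (d l l' + expo s l') (1 :: 'k)" and ?y = "Poly_Mapping.single (d l l' + expo s l) (1 :: 'k)"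
  have x: "?x \<in> Rx (d l l')" and y: "?y \<in> Rx (d l' l')"
    using expo_nonneg d_nonneg by (auto simp: Rx_single d_self)
  show ?thesis
  proof (rule coords_eqI)
    show "matrix_element ?x l l' \<odot>\<^bsub>V\<^esub> gen s l \<in> carrier V" by (intro V_smult_closed gen_carrier elem_A x)
    show "matrix_element ?y l' l' \<odot>\<^bsub>V\<^esub> gen s l' \<in> carrier V" by (intro V_smult_closed gen_carrier elem_A y)
    fix t a assume ta: "t \<in> T" "a < n"
    have "coords (matrix_element ?x l l' \<odot>\<^bsub>V\<^esub> gen s l) t a
        = (if a = l' \<and> t = s then Poly_Mapping.single (expo s l + (d l l' + expo s l')) 1 else 0)"
      using ta l s by (simp add: coords_elem[OF gen_carrier x] coords_gen mult_single)
    moreover have "coords (matrix_element ?y l' l' \<odot>\<^bsub>V\<^esub> gen s l') t a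
        = (if a = l' \<and> t = s then Poly_Mapping.single (expo s l' + (d l l' + expo s l)) 1 else 0)"
      using ta l s by (simp add: coords_elem[OF gen_carrier y] coords_gen mult_single)
    ultimately show "coords (matrix_element ?x l l' \<odot>\<^bsub>V\<^esub> gen s l) t a = coords (matrix_element ?y l' l' \<odot>\<^bsub>V\<^esub> gen s l') t a"
      by (simp add: algebra_simps)
  qed
qed

sublocale PT: finite_preorder T below
  by unfold_locales (auto intro: le_refl le_trans)

text \<open>The endomorphism with the scalar \<open>c t s\<close> as its component from the summand \<open>s\<close> to the summand \<open>t\<close>.\<close>

definition scalar_endo :: "((nat \<times> int) option \<Rightarrow> (nat \<times> int) option \<Rightarrow> 'k::field) \<Rightarrow>
    ((nat \<times> int) option \<Rightarrow> 'k laurent mat) \<Rightarrow> (nat \<times> int) option \<Rightarrow> 'k laurent mat"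
  where "scalar_endo c = (\<lambda>f\<in>carrier V. from_coords (\<lambda>t l. \<Sum>s\<in>T. Poly_Mapping.single 0 (c t s) * coords f s l))"

lemma Rx_scalar: "p \<in> Rx a \<Longrightarrow> Poly_Mapping.single 0 c * p \<in> Rx a"
  using Rx_mult[of "Poly_Mapping.single 0 c" 0 p a] by (simp add: Rx_single)

lemma scalar_endo_good:
  assumes c: "c \<in> PT.Inc" and p: "in_summands p"
  shows "in_summands (\<lambda>t l. \<Sum>s\<in>T. Poly_Mapping.single 0 (c t s) * p s l)"
  unfolding in_summands_def
proof (intro ballI allI impI Rx_sum)
  fix t l s assume *: "t \<in> T" "l < n" "s \<in> T"
  show "Poly_Mapping.single 0 (c t s) * p s l \<in> Rx (expo t l)"
  proof (cases "c t s = 0")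
    case False
    then have "expo t l \<le> expo s l" using c * by (auto simp: PT.Inc_iff below_def)
    moreover have "Poly_Mapping.single 0 (c t s) * p s l \<in> Rx (expo s l)"
      using p * by (intro Rx_scalar) (auto simp: in_summands_def)
    ultimately show ?thesis by (rule Rx_mono[rotated])
  qed simp
qed

lemma scalar_endo_closed: "c \<in> PT.Inc \<Longrightarrow> f \<in> carrier V \<Longrightarrow> scalar_endo c f \<in> carrier V"
  by (simp add: scalar_endo_def fromc_carrier scalar_endo_good coords_good)

lemma coords_scalar_endo: "\<lbrakk>f \<in> carrier V; t \<in> T; l < n\<rbrakk>
    \<Longrightarrow> coords (scalar_endo c f) t l = (\<Sum>s\<in>T. Poly_Mapping.single 0 (c t s) * coords f s l)"
  by (simp add: scalar_endo_def)

lemma scalar_endo_ghom: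
  fixes c :: "(nat \<times> int) option \<Rightarrow> (nat \<times> int) option \<Rightarrow> 'k::field"
  assumes c: "c \<in> PT.Inc"
  shows "scalar_endo c \<in> ghom A V V"
  unfolding ghom_def rhom_def
proof (intro CollectI conjI ballI allI)
  show "scalar_endo c \<in> carrier V \<rightarrow>\<^sub>E carrier V" using scalar_endo_closed[OF c] by (auto simp: scalar_endo_def)
  fix f g :: "(nat \<times> int) option \<Rightarrow> 'k laurent mat" assume fg: "f \<in> carrier V" "g \<in> carrier V"
  show "scalar_endo c (f \<oplus>\<^bsub>V\<^esub> g) = scalar_endo c f \<oplus>\<^bsub>V\<^esub> scalar_endo c g"
    by (rule coords_eqI) (auto simp: scalar_endo_closed[OF c] V_add_closed fg coords_scalar_endo coords_add distrib_left sum.distrib)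
next
  fix X :: "'k laurent mat" and f :: "(nat \<times> int) option \<Rightarrow> 'k laurent mat" assume X: "X \<in> carrier A" and f: "f \<in> carrier V"
  show "scalar_endo c (X \<odot>\<^bsub>V\<^esub> f) = X \<odot>\<^bsub>V\<^esub> scalar_endo c f"
  proof (rule coords_eqI)
    fix t l assume tl: "t \<in> T" "l < n"
    have "coords (scalar_endo c (X \<odot>\<^bsub>V\<^esub> f)) t l = (\<Sum>s\<in>T. \<Sum>l'<n. Poly_Mapping.single 0 (c t s) * coords f s l' * X $$ (l', l))"
      using tl X f by (simp add: coords_scalar_endo V_smult_closed coords_smult sum_distrib_left mult.assoc)
    also have "\<dots> = (\<Sum>l'<n. \<Sum>s\<in>T. Poly_Mapping.single 0 (c t s) * coords f s l' * X $$ (l', l))"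
      by (rule sum.swap)
    also have "\<dots> = coords (X \<odot>\<^bsub>V\<^esub> scalar_endo c f) t l"
      using tl X f by (simp add: coords_scalar_endo scalar_endo_closed[OF c] coords_smult sum_distrib_right)
    finally show "coords (scalar_endo c (X \<odot>\<^bsub>V\<^esub> f)) t l = coords (X \<odot>\<^bsub>V\<^esub> scalar_endo c f) t l" .
  qed (auto simp: scalar_endo_closed[OF c] V_smult_closed X f)
next
  fix e
  show "scalar_endo c ` mcomp V e \<subseteq> mcomp V e"
  proof
    fix g :: "(nat \<times> int) option \<Rightarrow> 'k laurent mat" assume "g \<in> scalar_endo c ` mcomp V e"
    then obtain f where f: "f \<in> mcomp V e" "g = scalar_endo c f" by auto
    have "homogeneous e (\<lambda>t l. \<Sum>s\<in>T. Poly_Mapping.single 0 (c t s) * coords f s l)"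
      unfolding homogeneous_def
    proof (intro ballI allI impI)
      fix t l assume "t \<in> T" "l < n"
      then have "\<exists>b. \<forall>s\<in>T. coords f s l = Poly_Mapping.single e (b s)"
        using coords_homog[OF f(1)] unfolding homogeneous_def by (intro bchoice) blast
      then obtain b where "\<forall>s\<in>T. coords f s l = Poly_Mapping.single e (b s)" by blast
      then have "(\<Sum>s\<in>T. Poly_Mapping.single 0 (c t s) * coords f s l) = (\<Sum>s\<in>T. Poly_Mapping.single e (c t s * b s))"
        by (intro sum.cong refl) (simp add: mult_single)
      also have "\<dots> = Poly_Mapping.single e (\<Sum>s\<in>T. c t s * b s)"
        by (simp add: single_sum)
      finally show "\<exists>c'. (\<Sum>s\<in>T. Poly_Mapping.single 0 (c t s) * coords f s l) = Poly_Mapping.single e c'" by blast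
    qed
    then show "g \<in> mcomp V e"
      using mcomp_carrier[OF f(1)] unfolding f(2) scalar_endo_def
      by (simp add: mcompI scalar_endo_good[OF c] coords_good)
  qed
qed

text \<open>The image of a generator is concentrated in the same column, since \<open>gen s l\<close> is fixed by \<open>e\<^sub>l\<close>, and it has the same degree.
  Hence its components are scalar multiples of one monomial, and by \<open>gen_connect\<close> these scalars
  do not depend on the column.\<close>

lemma gen_of_scalar:
  fixes f :: "((nat \<times> int) option \<Rightarrow> 'k::field laurent mat) \<Rightarrow> (nat \<times> int) option \<Rightarrow> 'k laurent mat"
  assumes f: "f \<in> ghom A V V" and s: "s \<in> T" and l: "l < n" and t: "t \<in> T" and l': "l' < n"
  shows "coords (f (gen s l)) t l' = (if l' = l then Poly_Mapping.single (expo s l) (Poly_Mapping.lookup (coords (f (gen s 0)) t 0) (expo s 0)) else 0)"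
proof -
  have fV: "f g \<in> carrier V" if "g \<in> carrier V" for g using f that by (auto simp: ghom_def rhom_def)
  have lin: "f (X \<odot>\<^bsub>V\<^esub> g) = X \<odot>\<^bsub>V\<^esub> f g" if "X \<in> carrier A" "g \<in> carrier V" for X g
    using f that by (auto simp: ghom_def rhom_def)
  have deg: "f (gen s l) \<in> mcomp V (expo s l)" for l using f gen_mcomp[of s l] unfolding ghom_def by blast
  have one: "(1 :: 'k laurent) \<in> Rx (d a a)" for a using Rx_single[of 0 1 0] by (simp add: d_self)
  have column: "coords (f (gen s l)) t l' = 0" if "l \<noteq> l'" "l < n" "l' < n" for l l'
  proof -
    have "matrix_element 1 l l \<odot>\<^bsub>V\<^esub> gen s l = (gen s l :: _ \<Rightarrow> 'k laurent mat)"
      by (rule coords_eqI) (auto simp: V_smult_closed elem_A one gen_carrier coords_elem[OF gen_carrier one] coords_gen that)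
    then have "f (gen s l) = matrix_element 1 l l \<odot>\<^bsub>V\<^esub> f (gen s l)"
      using lin[OF elem_A[OF one] gen_carrier] by metis
    then have "coords (f (gen s l)) t l' = coords (matrix_element 1 l l \<odot>\<^bsub>V\<^esub> f (gen s l)) t l'" by simp
    also have "\<dots> = 0" using that t by (simp add: coords_elem[OF fV[OF gen_carrier] one])
    finally show ?thesis .
  qed
  have mono: "\<exists>c. coords (f (gen s l)) t l = Poly_Mapping.single (expo s l) c" if l: "l < n" for l
    using coords_homog[OF deg[of l]] t l unfolding homogeneous_def by blast
  have n0: "0 < n" using n_pos by simp
  let ?x = "Poly_Mapping.single (d 0 l + expo s l) 1" and ?y = "Poly_Mapping.single (d 0 l + expo s 0) 1"
  have x: "?x \<in> Rx (d 0 l)" and y: "?y \<in> Rx (d l l)"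
    using expo_nonneg d_nonneg by (auto simp: Rx_single d_self)
  have "matrix_element ?x 0 l \<odot>\<^bsub>V\<^esub> f (gen s 0) = matrix_element ?y l l \<odot>\<^bsub>V\<^esub> f (gen s l)"
    using gen_connect[OF s n0 l] lin[OF elem_A[OF x] gen_carrier] lin[OF elem_A[OF y] gen_carrier] by metis
  then have "coords (matrix_element ?x 0 l \<odot>\<^bsub>V\<^esub> f (gen s 0)) t l = coords (matrix_element ?y l l \<odot>\<^bsub>V\<^esub> f (gen s l)) t l" by simp
  then have "coords (f (gen s 0)) t 0 * ?x = coords (f (gen s l)) t l * ?y"
    using n0 l t by (simp add: coords_elem[OF fV[OF gen_carrier] x] coords_elem[OF fV[OF gen_carrier] y])
  moreover obtain c0 cl where c: "coords (f (gen s 0)) t 0 = Poly_Mapping.single (expo s 0) c0"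
    "coords (f (gen s l)) t l = Poly_Mapping.single (expo s l) cl"
    using mono[OF n0] mono[OF l] by blast
  moreover have "expo s 0 + (d 0 l + expo s l) = expo s l + (d 0 l + expo s 0)" by simp
  ultimately have "c0 = cl" by (simp add: mult_single inj_eq[OF inj_single])
  then show ?thesis using c column[of l l'] l l' by auto
qed

lemma coords_gen_decomp:
  assumes f: "f \<in> carrier V" and l: "l < n" and s: "s \<in> T"
  shows "\<exists>q. q \<in> Rx 0 \<and> coords f s l = Poly_Mapping.single (expo s l) 1 * q"
proof -
  have "coords f s l \<in> Rx (expo s l)" using coords_good[OF f] l s by (simp add: in_summands_def)
  then obtain q where "q \<in> polyR" "coords f s l = q * Poly_Mapping.single (expo s l) 1" by (auto simp: Rx_def)
  then show ?thesis by (auto simp: polyR_Rx mult.commute)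
qed

lemma ghom_scalar_endo:
  fixes f :: "((nat \<times> int) option \<Rightarrow> 'k::field laurent mat) \<Rightarrow> (nat \<times> int) option \<Rightarrow> 'k laurent mat"
  assumes f: "f \<in> ghom A V V"
  shows "\<exists>c \<in> PT.Inc. f = scalar_endo c"
proof -
  define c where "c t s = (if t \<in> T \<and> s \<in> T then Poly_Mapping.lookup (coords (f (gen s 0)) t 0) (expo s 0) else 0)" for t s
  have fV: "f g \<in> carrier V" if "g \<in> carrier V" for g using f that by (auto simp: ghom_def rhom_def)
  have lin: "f (X \<odot>\<^bsub>V\<^esub> g) = X \<odot>\<^bsub>V\<^esub> f g" if "X \<in> carrier A" "g \<in> carrier V" for X g
    using f that by (auto simp: ghom_def rhom_def)
  have add: "f (g \<oplus>\<^bsub>V\<^esub> h) = f g \<oplus>\<^bsub>V\<^esub> f h" if "g \<in> carrier V" "h \<in> carrier V" for g h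
    using f that by (auto simp: ghom_def rhom_def)
  have fg: "coords (f (gen s l)) t l' = (if l' = l then Poly_Mapping.single (expo s l) (c t s) else 0)"
    if "s \<in> T" "l < n" "t \<in> T" "l' < n" for s t l l'
    using gen_of_scalar[OF f that] that by (simp add: c_def)
  have c: "c \<in> PT.Inc"
    unfolding PT.Inc_iff below_def
  proof (intro allI impI)
    fix t s assume nz: "c t s \<noteq> 0"
    then have ts: "t \<in> T" "s \<in> T" by (auto simp: c_def split: if_splits)
    have "expo t l \<le> expo s l" if "l < n" for l
    proof -
      have "coords (f (gen s l)) t l \<in> Rx (expo t l)"
        using coords_good[OF fV[OF gen_carrier]] ts that by (simp add: in_summands_def)
      then show ?thesis using fg[OF ts(2) that ts(1) that] nz by (simp add: Rx_single)
    qed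
    then show "t \<in> T \<and> s \<in> T \<and> (\<forall>l<n. expo t l \<le> expo s l)" using ts by blast
  qed
  have zero: "coords (f (from_coords (\<lambda>t l. 0))) t l = 0" if "t \<in> T" "l < n" for t l
  proof -
    let ?z = "from_coords (\<lambda>t l. 0) :: _ \<Rightarrow> 'k laurent mat"
    have z: "?z \<in> carrier V" by (auto intro: fromc_carrier simp: in_summands_def)
    have "?z \<oplus>\<^bsub>V\<^esub> ?z = ?z" using V_add[OF z z] by (auto intro!: fromc_cong)
    then have "f ?z \<oplus>\<^bsub>V\<^esub> f ?z = f ?z" using add[OF z z] by simp
    then have "coords (f ?z) t l + coords (f ?z) t l = coords (f ?z) t l"
      using coords_add[OF fV[OF z] fV[OF z] that] by simp
    then show ?thesis by (simp only: add_cancel_left_left)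
  qed
  have "f g = scalar_endo c g" if g: "g \<in> carrier V" for g
  proof (rule coords_eqI)
    fix t l assume tl: "t \<in> T" "l < n"
    define part where "part S = (from_coords (\<lambda>s a. if s \<in> S \<and> a = l then coords g s l else 0) :: _ \<Rightarrow> 'k laurent mat)" for S
    have part_good: "in_summands (\<lambda>s a. if s \<in> S \<and> a = l then coords g s l else 0)" for S
      using coords_good[OF g] tl by (auto simp: in_summands_def)
    have pV: "part S \<in> carrier V" for S unfolding part_def by (rule fromc_carrier[OF part_good])
    have coords_part: "coords (part S) s a = (if s \<in> S \<and> a = l then coords g s l else 0)" if "s \<in> T" "a < n" for S s a
      using that by (simp add: part_def)
    have "coords (f (part S)) t l = (\<Sum>s\<in>S. Poly_Mapping.single 0 (c t s) * coords g s l)" if "finite S" "S \<subseteq> T" for S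
      using that
    proof (induction S rule: finite_induct)
      case empty
      then show ?case using zero[OF tl] by (simp add: part_def)
    next
      case (insert s S)
      then have s: "s \<in> T" by auto
      obtain q where q: "q \<in> Rx 0" "coords g s l = Poly_Mapping.single (expo s l) 1 * q"
        using coords_gen_decomp[OF g tl(2) s] by blast
      have q': "q \<in> Rx (d l l)" using q by (simp add: d_self)
      let ?e = "matrix_element q l l \<odot>\<^bsub>V\<^esub> gen s l"
      have e: "?e \<in> carrier V" by (intro V_smult_closed gen_carrier elem_A q')
      have "part (insert s S) = part S \<oplus>\<^bsub>V\<^esub> ?e"
      proof (rule coords_eqI)
        fix t' a assume "t' \<in> T" "a < n"
        then show "coords (part (insert s S)) t' a = coords (part S \<oplus>\<^bsub>V\<^esub> ?e) t' a"
          using insert(2) tl(2) s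
          by (auto simp: coords_part coords_add pV e coords_elem[OF gen_carrier q'] coords_gen q(2))
      qed (auto intro: pV e V_add_closed)
      then have "f (part (insert s S)) = f (part S) \<oplus>\<^bsub>V\<^esub> matrix_element q l l \<odot>\<^bsub>V\<^esub> f (gen s l)"
        using add[OF pV e] lin[OF elem_A[OF q'] gen_carrier] by simp
      then have "coords (f (part (insert s S))) t l = coords (f (part S)) t l + coords (f (gen s l)) t l * q"
        using tl by (simp add: coords_add V_smult_closed elem_A q' fV pV gen_carrier coords_elem[OF fV[OF gen_carrier] q'])
      also have "coords (f (gen s l)) t l * q = Poly_Mapping.single 0 (c t s) * coords g s l"
        using fg[OF s tl(2) tl] q(2) by (simp add: mult_single mult.assoc[symmetric])
      finally show ?case using insert by (simp add: add.commute)
    qed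
    from this[of T] have A: "coords (f (part T)) t l = coords (scalar_endo c g) t l"
      using tl g by (simp add: coords_scalar_endo)
    have one: "(1 :: 'k laurent) \<in> Rx (d l l)" using Rx_single[of 0 1 0] by (simp add: d_self)
    have "part T = matrix_element 1 l l \<odot>\<^bsub>V\<^esub> g"
      by (rule coords_eqI) (auto simp: pV V_smult_closed elem_A one g coords_part coords_elem[OF g one] tl)
    then have "f (part T) = matrix_element 1 l l \<odot>\<^bsub>V\<^esub> f g" using lin[OF elem_A[OF one] g] by simp
    then have "coords (f (part T)) t l = coords (f g) t l"
      using tl by (simp add: coords_elem[OF fV[OF g] one])
    then show "coords (f g) t l = coords (scalar_endo c g) t l" using A by simp
  qed (auto simp: fV g scalar_endo_closed[OF c])
  moreover have "f \<in> extensional (carrier V)" using f by (auto simp: ghom_def rhom_def PiE_iff)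
  ultimately have "f = scalar_endo c" by (auto simp: scalar_endo_def extensional_def fun_eq_iff)
  then show ?thesis using c by blast
qed

lemma coords_scalar_endo_gen:
  assumes "t \<in> T" "s \<in> T" "l < n"
  shows "coords (scalar_endo c (gen s l)) t l = Poly_Mapping.single (expo s l) (c t s)"
proof -
  have "coords (scalar_endo c (gen s l)) t l = (\<Sum>r\<in>T. if r = s then Poly_Mapping.single (expo s l) (c t s) else 0)"
    using assms by (simp add: coords_scalar_endo gen_carrier coords_gen mult_single if_distrib cong: sum.cong if_cong)
  then show ?thesis using assms by (simp add: sum.delta)
qed

lemma scalar_endo_inj:
  fixes c c' :: "(nat \<times> int) option \<Rightarrow> (nat \<times> int) option \<Rightarrow> 'k::field"
  assumes "c \<in> PT.Inc" "c' \<in> PT.Inc" "scalar_endo c = scalar_endo c'"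
  shows "c = c'"
proof (intro ext)
  fix t s
  show "c t s = c' t s"
  proof (cases "t \<in> T \<and> s \<in> T")
    case True
    have n0: "0 < n" using n_pos by simp
    have "Poly_Mapping.single (expo s 0) (c t s) = Poly_Mapping.single (expo s 0) (c' t s)"
      using True assms(3) coords_scalar_endo_gen[of t s 0 c] coords_scalar_endo_gen[of t s 0 c'] n0 by simp
    then show ?thesis by (simp add: inj_eq[OF inj_single])
  next
    case False
    then show ?thesis using PT.Inc_outside[OF assms(1)] PT.Inc_outside[OF assms(2)] by metis
  qed
qed

text \<open>The component with scalar \<open>c t s \<noteq> 0\<close> exists if and only if \<open>expo t \<le> expo s\<close> entrywise. Hence the endomorphism
  ring is the incidence ring of the summands.\<close>

lemma scalar_endo_ring_iso: "scalar_endo \<in> ring_iso (inc_ring T below) (gEnd A (V :: ('k::field laurent mat, _) graded_module))"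
proof (rule ring_iso_memI)
  let ?I = "inc_ring T below :: ((nat \<times> int) option \<Rightarrow> _ \<Rightarrow> 'k) ring" and ?G = "gEnd A (V :: ('k laurent mat, _) graded_module)"
  have car: "carrier ?G = ghom A V V" by (simp add: gEnd_def)
  show "scalar_endo c \<in> carrier ?G" if "c \<in> carrier ?I" for c unfolding car by (rule scalar_endo_ghom[OF that])
  show "bij_betw scalar_endo (carrier ?I) (carrier ?G)"
    unfolding bij_betw_def car
  proof (intro conjI inj_onI equalityI subsetI)
    show "c = c'" if "c \<in> carrier ?I" "c' \<in> carrier ?I" "scalar_endo c = scalar_endo c'" for c c'
      by (rule scalar_endo_inj[OF that])
    show "f \<in> ghom A V V" if "f \<in> scalar_endo ` carrier ?I" for f using that by (auto intro: scalar_endo_ghom)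
    show "f \<in> scalar_endo ` carrier ?I" if "f \<in> ghom A V V" for f using ghom_scalar_endo[OF that] by blast
  qed
  show "scalar_endo (c \<otimes>\<^bsub>?I\<^esub> c') = scalar_endo c \<otimes>\<^bsub>?G\<^esub> scalar_endo c'" if c: "c \<in> carrier ?I" "c' \<in> carrier ?I" for c c'
  proof -
    have "scalar_endo (c \<otimes>\<^bsub>?I\<^esub> c') f = scalar_endo c (scalar_endo c' f)" if f: "f \<in> carrier V" for f
    proof (rule coords_eqI)
      fix t l assume tl: "t \<in> T" "l < n"
      have "coords (scalar_endo (c \<otimes>\<^bsub>?I\<^esub> c') f) t l = (\<Sum>s\<in>T. \<Sum>r\<in>T. Poly_Mapping.single 0 (c t r * c' r s) * coords f s l)"
        using tl f by (simp add: coords_scalar_endo PT.inc_mult single_sum sum_distrib_right)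
      also have "\<dots> = (\<Sum>r\<in>T. \<Sum>s\<in>T. Poly_Mapping.single 0 (c t r * c' r s) * coords f s l)" by (rule sum.swap)
      also have "\<dots> = (\<Sum>r\<in>T. \<Sum>s\<in>T. Poly_Mapping.single 0 (c t r) * (Poly_Mapping.single 0 (c' r s) * coords f s l))"
        by (intro sum.cong refl) (simp add: mult.assoc[symmetric] mult_single)
      also have "\<dots> = coords (scalar_endo c (scalar_endo c' f)) t l"
        using tl f c by (simp add: coords_scalar_endo scalar_endo_closed sum_distrib_left)
      finally show "coords (scalar_endo (c \<otimes>\<^bsub>?I\<^esub> c') f) t l = coords (scalar_endo c (scalar_endo c' f)) t l" .
    qed (use f c in \<open>auto intro!: scalar_endo_closed PT.inc_mult_closed\<close>)
    then show ?thesis by (auto simp: gEnd_def compose_def scalar_endo_def[of "c \<otimes>\<^bsub>?I\<^esub> c'"] fun_eq_iff)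
  qed
  show "scalar_endo (c \<oplus>\<^bsub>?I\<^esub> c') = scalar_endo c \<oplus>\<^bsub>?G\<^esub> scalar_endo c'" if c: "c \<in> carrier ?I" "c' \<in> carrier ?I" for c c'
  proof -
    have s: "c \<oplus>\<^bsub>?I\<^esub> c' = c + c'" by (simp add: inc_ring_def)
    have "scalar_endo (c + c') f = scalar_endo c f \<oplus>\<^bsub>V\<^esub> scalar_endo c' f" if f: "f \<in> carrier V" for f
      using f c PT.inc_add_closed[of c c']
      by (intro coords_eqI) (auto simp: scalar_endo_closed V_add_closed coords_scalar_endo coords_add single_add distrib_right sum.distrib)
    then show ?thesis unfolding s by (auto simp: gEnd_def scalar_endo_def[of "c + c'"] fun_eq_iff)
  qed
  show "scalar_endo \<one>\<^bsub>?I\<^esub> = \<one>\<^bsub>?G\<^esub>"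
  proof -
    have "scalar_endo \<one>\<^bsub>?I\<^esub> f = f" if f: "f \<in> carrier V" for f
    proof (rule coords_eqI)
      show "scalar_endo \<one>\<^bsub>?I\<^esub> f \<in> carrier V" using f ring.ring_simprules(6)[OF PT.ring_inc_ring] by (intro scalar_endo_closed)
      fix t l assume tl: "t \<in> T" "l < n"
      have "coords (scalar_endo \<one>\<^bsub>?I\<^esub> f) t l = (\<Sum>s\<in>T. Poly_Mapping.single 0 (if t = s \<and> t \<in> T then 1 else 0) * coords f s l)"
        using tl f by (simp add: coords_scalar_endo inc_ring_def)
      also have "\<dots> = (\<Sum>s\<in>T. if s = t then coords f s l else 0)"
        using tl by (intro sum.cong refl) auto
      finally have "coords (scalar_endo \<one>\<^bsub>?I\<^esub> f) t l = (\<Sum>s\<in>T. if s = t then coords f s l else 0)" .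
      then show "coords (scalar_endo \<one>\<^bsub>?I\<^esub> f) t l = coords f t l" using tl by (simp add: sum.delta)
    qed (rule f)
    then show ?thesis by (auto simp: gEnd_def scalar_endo_def fun_eq_iff)
  qed
qed

lemma scalar_endo_zero: "scalar_endo 0 = (\<lambda>f\<in>carrier V. \<zero>\<^bsub>V\<^esub>)"
  by (auto simp: scalar_endo_def V_zero)

lemma ring_gEnd: "ring (gEnd A (V :: ('k::field laurent mat, _) graded_module))"
proof -
  let ?I = "inc_ring T below :: ((nat \<times> int) option \<Rightarrow> _ \<Rightarrow> 'k) ring" and ?G = "gEnd A (V :: ('k laurent mat, _) graded_module)"
  have "\<zero>\<^bsub>?I\<^esub> = 0" by (simp add: inc_ring_def)
  then have "?G\<lparr>zero := scalar_endo \<zero>\<^bsub>?I\<^esub>\<rparr> = ?G" by (simp add: gEnd_def scalar_endo_zero)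
  then show ?thesis using ring.ring_iso_imp_img_ring[OF PT.ring_inc_ring scalar_endo_ring_iso] by metis
qed

end

section \<open>The indecomposable graded projectives\<close>

context cyclic_weights
begin

lemma A_mult_closed:
  assumes X: "X \<in> carrier A" and Y: "Y \<in> carrier A"
  shows "X * Y \<in> carrier A"
  unfolding A_simps
proof (intro conjI allI impI)
  have XY: "X \<in> carrier_mat n n" "Y \<in> carrier_mat n n" using X Y by (auto simp: A_simps)
  then show "X * Y \<in> carrier_mat n n" by simp
  fix i l assume il: "i < n" "l < n"
  have "X $$ (i, l') * Y $$ (l', l) \<in> Rx (d i l)" if "l' < n" for l'
  proof -
    have "X $$ (i, l') * Y $$ (l', l) \<in> Rx (d i l' + d l' l)"
      using X Y il that by (intro Rx_mult) (auto simp: A_simps)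
    moreover have "d i l' + d l' l \<ge> d i l"
      using cyc_exponent_matrix[OF n_pos, of m] il that unfolding exponent_matrix_def by auto
    ultimately show ?thesis by (rule Rx_mono)
  qed
  then show "(X * Y) $$ (i, l) \<in> Rx (d i l)"
    unfolding mult_mat_entry[OF XY il] by (intro Rx_sum) simp
qed

lemma one_Rx_0: "(1 :: 'k::field laurent) \<in> Rx 0"
  using Rx_single[of 0 1 0] by simp

lemma ring_A: "ring (A :: 'k::field laurent mat graded_ring)"
proof (rule ringI)
  have C: "X \<in> carrier_mat n n" if "X \<in> carrier (A :: 'k laurent mat graded_ring)" for X using that by (simp add: A_simps)
  show "abelian_group (A :: 'k laurent mat graded_ring)"
  proof (rule abelian_groupI)
    fix X :: "'k laurent mat" assume X: "X \<in> carrier A"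
    show "\<exists>Y\<in>carrier A. Y \<oplus>\<^bsub>A\<^esub> X = \<zero>\<^bsub>A\<^esub>"
      using X by (intro bexI[of _ "- X"]) (auto simp: A_simps Rx_uminus uminus_l_inv_mat)
  next
    show "\<And>X Y Z. X \<in> carrier A \<Longrightarrow> Y \<in> carrier A \<Longrightarrow> (Z :: 'k laurent mat) \<in> carrier A
        \<Longrightarrow> X \<oplus>\<^bsub>A\<^esub> Y \<oplus>\<^bsub>A\<^esub> Z = X \<oplus>\<^bsub>A\<^esub> (Y \<oplus>\<^bsub>A\<^esub> Z)"
      unfolding A_simps by (rule assoc_add_mat) auto
    show "\<And>X Y :: 'k laurent mat. X \<in> carrier A \<Longrightarrow> Y \<in> carrier A \<Longrightarrow> X \<oplus>\<^bsub>A\<^esub> Y = Y \<oplus>\<^bsub>A\<^esub> X"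
      unfolding A_simps by (rule comm_add_mat) auto
  qed (auto simp: A_simps Rx_add)
  show "Group.monoid (A :: 'k laurent mat graded_ring)"
  proof (rule monoidI)
    show "\<one>\<^bsub>A\<^esub> \<in> carrier (A :: 'k laurent mat graded_ring)" by (auto simp: A_simps d_self one_Rx_0)
  qed (auto simp: A_simps(3,4) A_mult_closed dest!: C intro: assoc_mult_mat)
  fix X Y Z :: "'k laurent mat" assume "X \<in> carrier A" "Y \<in> carrier A" "Z \<in> carrier A"
  then have "X \<in> carrier_mat n n" "Y \<in> carrier_mat n n" "Z \<in> carrier_mat n n" by (auto dest: C)
  then show "(X \<oplus>\<^bsub>A\<^esub> Y) \<otimes>\<^bsub>A\<^esub> Z = X \<otimes>\<^bsub>A\<^esub> Z \<oplus>\<^bsub>A\<^esub> Y \<otimes>\<^bsub>A\<^esub> Z"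
    "Z \<otimes>\<^bsub>A\<^esub> (X \<oplus>\<^bsub>A\<^esub> Y) = Z \<otimes>\<^bsub>A\<^esub> X \<oplus>\<^bsub>A\<^esub> Z \<otimes>\<^bsub>A\<^esub> Y"
    unfolding A_simps by (auto intro: add_mult_distrib_mat mult_add_distrib_mat)
qed

text \<open>Row vectors, as constant functions on the natural numbers: the projectives that occur in the definition of
  the stable category have elements in this function type.\<close>

definition row_vec :: "(nat \<Rightarrow> 'k::field laurent) \<Rightarrow> nat \<Rightarrow> 'k laurent mat"
  where "row_vec w = (\<lambda>_. mat 1 n (\<lambda>(_, l). w l))"

definition row_entry :: "(nat \<Rightarrow> 'k::field laurent mat) \<Rightarrow> nat \<Rightarrow> 'k laurent"
  where "row_entry f l = f 0 $$ (0, l)"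

lemma pe_vec [simp]: "l < n \<Longrightarrow> row_entry (row_vec w) l = w l"
  by (simp add: row_entry_def row_vec_def)

lemma vec_eq: "row_vec w = row_vec w' \<longleftrightarrow> (\<forall>l<n. w l = w' l)"
proof
  show "row_vec w = row_vec w' \<Longrightarrow> \<forall>l<n. w l = w' l" by (metis pe_vec)
  assume "\<forall>l<n. w l = w' l"
  then show "row_vec w = row_vec w'" unfolding row_vec_def by (intro ext eq_matI) auto
qed

text \<open>The projective \<open>e\<^sub>rA\<close>, realised by its only nonzero row.\<close>

definition row_projective :: "nat \<Rightarrow> ('k::field laurent mat, nat \<Rightarrow> 'k laurent mat) graded_module"
  where "row_projective r0 = \<lparr>carrier = {row_vec w | w. \<forall>l<n. w l \<in> Rx (d r0 l)}, mult = undefined, one = undefined,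
     zero = row_vec (\<lambda>_. 0), add = (\<lambda>f g. row_vec (\<lambda>l. row_entry f l + row_entry g l)),
     smult = (\<lambda>X f. row_vec (\<lambda>l. \<Sum>l'<n. row_entry f l' * X $$ (l', l))),
     mcomp = (\<lambda>e. {row_vec w | w. \<forall>l<n. w l \<in> Rx (d r0 l) \<and> (\<exists>c. w l = Poly_Mapping.single e c)})\<rparr>"

lemma prow_carrier: "f \<in> carrier (row_projective r0) \<longleftrightarrow> (\<exists>w. f = row_vec w \<and> (\<forall>l<n. w l \<in> Rx (d r0 l)))"
  by (simp add: row_projective_def)

lemma prow_mcomp: "f \<in> mcomp (row_projective r0) e \<longleftrightarrow> (\<exists>w. f = row_vec w \<and> (\<forall>l<n. w l \<in> Rx (d r0 l) \<and> (\<exists>c. w l = Poly_Mapping.single e c)))"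
  by (simp add: row_projective_def)

lemma prow_carrierI: "(\<And>l. l < n \<Longrightarrow> w l \<in> Rx (d r0 l)) \<Longrightarrow> row_vec w \<in> carrier (row_projective r0)"
  using prow_carrier by blast

lemma single_eq_0: "Poly_Mapping.single e c = 0 \<longleftrightarrow> c = 0"
  by (metis lookup_single_eq lookup_zero single_zero)

lemma prow_ops:
  "\<zero>\<^bsub>row_projective r0\<^esub> = row_vec (\<lambda>_. 0)" "row_vec v \<oplus>\<^bsub>row_projective r0\<^esub> row_vec w = row_vec (\<lambda>l. v l + w l)"
  "X \<odot>\<^bsub>row_projective r0\<^esub> row_vec w = row_vec (\<lambda>l. \<Sum>l'<n. w l' * X $$ (l', l))"
  by (auto simp: row_projective_def vec_eq)

lemma smult_Rx:
  assumes "X \<in> carrier A" "r0 < n" "l < n" "\<forall>l<n. w l \<in> Rx (d r0 l)"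
  shows "(\<Sum>l'<n. w l' * X $$ (l', l)) \<in> Rx (d r0 l)"
proof (rule Rx_sum)
  fix l' assume l': "l' \<in> {..<n}"
  have "w l' * X $$ (l', l) \<in> Rx (d r0 l' + d l' l)"
    using assms l' by (intro Rx_mult) (auto simp: A_simps)
  moreover have "d r0 l' + d l' l \<ge> d r0 l"
    using cyc_exponent_matrix[OF n_pos, of m] assms l' unfolding exponent_matrix_def by auto
  ultimately show "w l' * X $$ (l', l) \<in> Rx (d r0 l)" by (rule Rx_mono)
qed

lemma abelian_group_prow: "abelian_group (row_projective r0 :: ('k::field laurent mat, _) graded_module)"
proof (rule abelian_groupI)
  fix f :: "nat \<Rightarrow> 'k laurent mat" assume "f \<in> carrier (row_projective r0)"
  then obtain w where w: "f = row_vec w" "\<forall>l<n. w l \<in> Rx (d r0 l)" by (auto simp: prow_carrier)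
  then show "\<exists>g\<in>carrier (row_projective r0). g \<oplus>\<^bsub>row_projective r0\<^esub> f = \<zero>\<^bsub>row_projective r0\<^esub>"
    by (intro bexI[of _ "row_vec (\<lambda>l. - w l)"]) (auto simp: prow_carrier prow_ops vec_eq Rx_uminus)
next
  fix f g :: "nat \<Rightarrow> 'k laurent mat" assume "f \<in> carrier (row_projective r0)" "g \<in> carrier (row_projective r0)"
  then obtain v w where w: "f = row_vec v" "g = row_vec w" "\<forall>l<n. v l \<in> Rx (d r0 l)" "\<forall>l<n. w l \<in> Rx (d r0 l)"
    by (auto simp: prow_carrier)
  then show "f \<oplus>\<^bsub>row_projective r0\<^esub> g \<in> carrier (row_projective r0)"
    unfolding w(1,2) prow_ops prow_carrier by (intro exI[of _ "\<lambda>l. v l + w l"]) (auto simp: Rx_add)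
  show "f \<oplus>\<^bsub>row_projective r0\<^esub> g = g \<oplus>\<^bsub>row_projective r0\<^esub> f" unfolding w(1,2) prow_ops by (simp add: add.commute)
next
  show "\<zero>\<^bsub>row_projective r0\<^esub> \<in> carrier (row_projective r0 :: ('k laurent mat, _) graded_module)"
    unfolding prow_ops prow_carrier by (intro exI[of _ "\<lambda>_. 0"]) auto
next
  fix f g h :: "nat \<Rightarrow> 'k laurent mat"
  assume "f \<in> carrier (row_projective r0)" "g \<in> carrier (row_projective r0)" "h \<in> carrier (row_projective r0)"
  then show "f \<oplus>\<^bsub>row_projective r0\<^esub> g \<oplus>\<^bsub>row_projective r0\<^esub> h = f \<oplus>\<^bsub>row_projective r0\<^esub> (g \<oplus>\<^bsub>row_projective r0\<^esub> h)"
    by (auto simp: prow_carrier prow_ops add.assoc)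
next
  fix f :: "nat \<Rightarrow> 'k laurent mat" assume "f \<in> carrier (row_projective r0)"
  then show "\<zero>\<^bsub>row_projective r0\<^esub> \<oplus>\<^bsub>row_projective r0\<^esub> f = f" by (auto simp: prow_carrier prow_ops)
qed

lemma right_module_prow:
  assumes r0: "r0 < n"
  shows "right_module A (row_projective r0 :: ('k::field laurent mat, _) graded_module)"
proof (intro right_module.intro right_module_axioms.intro ring_A abelian_group_prow)
  fix X :: "'k laurent mat" and f :: "nat \<Rightarrow> 'k laurent mat" assume X: "X \<in> carrier A" and "f \<in> carrier (row_projective r0)"
  then obtain w where w: "f = row_vec w" "\<forall>l<n. w l \<in> Rx (d r0 l)" by (auto simp: prow_carrier)
  show "X \<odot>\<^bsub>row_projective r0\<^esub> f \<in> carrier (row_projective r0)"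
    unfolding w(1) prow_ops by (intro prow_carrierI smult_Rx[OF X r0 _ w(2)])
next
  fix X Y :: "'k laurent mat" and f :: "nat \<Rightarrow> 'k laurent mat" assume X: "X \<in> carrier A" "Y \<in> carrier A" and "f \<in> carrier (row_projective r0)"
  then obtain w where w: "f = row_vec w" by (auto simp: prow_carrier)
  have XY: "X \<in> carrier_mat n n" "Y \<in> carrier_mat n n" using X by (auto simp: A_simps)
  show "(X \<oplus>\<^bsub>A\<^esub> Y) \<odot>\<^bsub>row_projective r0\<^esub> f = X \<odot>\<^bsub>row_projective r0\<^esub> f \<oplus>\<^bsub>row_projective r0\<^esub> Y \<odot>\<^bsub>row_projective r0\<^esub> f"
    unfolding w prow_ops vec_eq A_simps using XY by (auto simp: distrib_left sum.distrib)
  have "(\<Sum>l'<n. w l' * (X * Y) $$ (l', l)) = (\<Sum>l''<n. (\<Sum>l'<n. w l' * X $$ (l', l'')) * Y $$ (l'', l))" if l: "l < n" for l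
  proof -
    have "(\<Sum>l'<n. w l' * (X * Y) $$ (l', l)) = (\<Sum>l'<n. \<Sum>l''<n. w l' * X $$ (l', l'') * Y $$ (l'', l))"
      using mult_mat_entry[OF XY _ l] by (intro sum.cong refl) (simp add: sum_distrib_left mult.assoc)
    also have "\<dots> = (\<Sum>l''<n. \<Sum>l'<n. w l' * X $$ (l', l'') * Y $$ (l'', l))" by (rule sum.swap)
    finally show ?thesis by (simp add: sum_distrib_right)
  qed
  then show "(X \<otimes>\<^bsub>A\<^esub> Y) \<odot>\<^bsub>row_projective r0\<^esub> f = Y \<odot>\<^bsub>row_projective r0\<^esub> (X \<odot>\<^bsub>row_projective r0\<^esub> f)"
    unfolding w prow_ops vec_eq A_simps by auto
next
  fix X :: "'k laurent mat" and f g :: "nat \<Rightarrow> 'k laurent mat" assume "f \<in> carrier (row_projective r0)" "g \<in> carrier (row_projective r0)"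
  then obtain v w where w: "f = row_vec v" "g = row_vec w" by (auto simp: prow_carrier)
  show "X \<odot>\<^bsub>row_projective r0\<^esub> (f \<oplus>\<^bsub>row_projective r0\<^esub> g) = X \<odot>\<^bsub>row_projective r0\<^esub> f \<oplus>\<^bsub>row_projective r0\<^esub> X \<odot>\<^bsub>row_projective r0\<^esub> g"
    unfolding w prow_ops vec_eq by (auto simp: distrib_right sum.distrib)
next
  fix f :: "nat \<Rightarrow> 'k laurent mat" assume "f \<in> carrier (row_projective r0)"
  then obtain w where w: "f = row_vec w" by (auto simp: prow_carrier)
  have "(\<Sum>l'<n. w l' * (1\<^sub>m n) $$ (l', l)) = w l" if l: "l < n" for l
  proof -
    have "(\<Sum>l'<n. w l' * (1\<^sub>m n) $$ (l', l)) = (\<Sum>l'<n. if l' = l then w l' else 0)"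
      using l by (intro sum.cong refl) auto
    then show ?thesis using l by (simp add: sum.delta)
  qed
  then show "\<one>\<^bsub>A\<^esub> \<odot>\<^bsub>row_projective r0\<^esub> f = f" unfolding w prow_ops vec_eq A_simps by auto
qed

lemma finsum_prow:
  fixes w :: "int \<Rightarrow> nat \<Rightarrow> 'k::field laurent"
  assumes "finite I" "\<And>e l. e \<in> I \<Longrightarrow> l < n \<Longrightarrow> w e l \<in> Rx (d r0 l)"
  shows "finsum (row_projective r0) (\<lambda>e. row_vec (w e)) I = row_vec (\<lambda>l. \<Sum>e\<in>I. w e l)"
  using assms
proof (induction I rule: finite_induct)
  interpret abelian_group "row_projective r0 :: ('k laurent mat, _) graded_module" by (rule abelian_group_prow)
  case empty
  then show ?case by (simp add: prow_ops)
next
  interpret abelian_group "row_projective r0 :: ('k laurent mat, _) graded_module" by (rule abelian_group_prow)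
  case (insert e I)
  have "finsum (row_projective r0) (\<lambda>e. row_vec (w e)) (insert e I) = row_vec (w e) \<oplus>\<^bsub>row_projective r0\<^esub> finsum (row_projective r0) (\<lambda>e. row_vec (w e)) I"
    using insert by (intro finsum_insert) (auto intro!: prow_carrierI)
  then show ?case using insert by (simp add: prow_ops)
qed

lemma graded_prow:
  assumes r0: "r0 < n"
  shows "graded_right_module A (row_projective r0 :: ('k::field laurent mat, _) graded_module)"
proof (intro graded_right_module.intro graded_right_module_axioms.intro right_module_prow[OF r0])
  let ?P = "row_projective r0 :: ('k laurent mat, _) graded_module"
  interpret abelian_group ?P by (rule abelian_group_prow)
  fix e :: int
  show "additive_subgroup (mcomp ?P e) ?P"
  proof (intro additive_subgroup.intro add.subgroupI)
    show "mcomp ?P e \<subseteq> carrier ?P" by (auto simp: prow_mcomp intro!: prow_carrierI)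
    have "row_vec (\<lambda>_. 0) \<in> mcomp ?P e"
      unfolding prow_mcomp by (intro exI[of _ "\<lambda>_. 0"]) (auto intro: exI[of _ 0])
    then show "mcomp ?P e \<noteq> {}" by blast
  next
    fix f assume "f \<in> mcomp ?P e"
    then obtain w where w: "f = row_vec w" "\<forall>l<n. w l \<in> Rx (d r0 l) \<and> (\<exists>c. w l = Poly_Mapping.single e c)" by (auto simp: prow_mcomp)
    have "row_vec (\<lambda>l. - w l) \<in> mcomp ?P e"
      unfolding prow_mcomp using w(2) by (intro exI[of _ "\<lambda>l. - w l"]) (metis Rx_uminus single_uminus)
    moreover have "row_vec (\<lambda>l. - w l) = \<ominus>\<^bsub>?P\<^esub> f"
      using w by (intro minus_equality[symmetric]) (auto simp: prow_carrier prow_ops vec_eq Rx_uminus)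
    ultimately show "\<ominus>\<^bsub>?P\<^esub> f \<in> mcomp ?P e" by simp
  next
    fix f g assume "f \<in> mcomp ?P e" "g \<in> mcomp ?P e"
    then obtain v w where w: "f = row_vec v" "g = row_vec w" "\<forall>l<n. v l \<in> Rx (d r0 l) \<and> (\<exists>c. v l = Poly_Mapping.single e c)"
      "\<forall>l<n. w l \<in> Rx (d r0 l) \<and> (\<exists>c. w l = Poly_Mapping.single e c)" by (auto simp: prow_mcomp)
    show "f \<oplus>\<^bsub>?P\<^esub> g \<in> mcomp ?P e"
      unfolding w(1,2) prow_ops prow_mcomp using w(3,4) by (intro exI[of _ "\<lambda>l. v l + w l"]) (metis Rx_add single_add)
  qed
next
  let ?P = "row_projective r0 :: ('k laurent mat, _) graded_module"
  fix f assume "f \<in> carrier ?P"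
  then obtain w where w: "f = row_vec w" "\<forall>l<n. w l \<in> Rx (d r0 l)" by (auto simp: prow_carrier)
  define u where "u e l = Poly_Mapping.single e (Poly_Mapping.lookup (w l) e)" for e l
  have uR: "u e l \<in> Rx (d r0 l)" if "l < n" for e l
  proof -
    have "Poly_Mapping.lookup (w l) e = 0 \<or> d r0 l \<le> e" using w(2) that by (auto simp: Rx_iff)
    then show ?thesis by (simp add: u_def Rx_single)
  qed
  have supp: "{e. row_vec (u e) \<noteq> \<zero>\<^bsub>?P\<^esub>} = (\<Union>l<n. Poly_Mapping.keys (w l))"
    by (auto simp: prow_ops vec_eq u_def in_keys_iff single_eq_0)
  show "\<exists>!g. (\<forall>i. g i \<in> mcomp ?P i) \<and> finite {i. g i \<noteq> \<zero>\<^bsub>?P\<^esub>} \<and> f = finsum ?P g {i. g i \<noteq> \<zero>\<^bsub>?P\<^esub>}"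
  proof (rule ex1I[of _ "\<lambda>e. row_vec (u e)"], intro conjI allI)
    show "row_vec (u e) \<in> mcomp ?P e" for e
      unfolding prow_mcomp using uR by (intro exI[of _ "u e"]) (auto simp: u_def)
    show fin: "finite {e. row_vec (u e) \<noteq> \<zero>\<^bsub>?P\<^esub>}" unfolding supp by simp
    have wsum: "w l = (\<Sum>e\<in>(\<Union>l<n. Poly_Mapping.keys (w l)). u e l)" if l: "l < n" for l
    proof -
      have "w l = (\<Sum>e\<in>Poly_Mapping.keys (w l). u e l)" by (simp add: u_def lookup_sum_single)
      also have "\<dots> = (\<Sum>e\<in>(\<Union>l<n. Poly_Mapping.keys (w l)). u e l)"
        using l by (intro sum.mono_neutral_left) (auto simp: u_def in_keys_iff)
      finally show ?thesis .
    qed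
    have "row_vec w = row_vec (\<lambda>l. \<Sum>e\<in>{e. row_vec (u e) \<noteq> \<zero>\<^bsub>?P\<^esub>}. u e l)"
      unfolding vec_eq supp by (intro allI impI wsum)
    then show "f = finsum ?P (\<lambda>e. row_vec (u e)) {e. row_vec (u e) \<noteq> \<zero>\<^bsub>?P\<^esub>}"
      unfolding w(1) by (subst finsum_prow[OF fin]) (auto intro: uR)
  next
    fix g assume g: "(\<forall>i. g i \<in> mcomp ?P i) \<and> finite {i. g i \<noteq> \<zero>\<^bsub>?P\<^esub>} \<and> f = finsum ?P g {i. g i \<noteq> \<zero>\<^bsub>?P\<^esub>}"
    then have "\<forall>e. \<exists>v. g e = row_vec v \<and> (\<forall>l<n. v l \<in> Rx (d r0 l) \<and> (\<exists>c. v l = Poly_Mapping.single e c))"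
      unfolding prow_mcomp by blast
    then obtain v where v: "\<And>e. g e = row_vec (v e)" "\<And>e l. l < n \<Longrightarrow> v e l \<in> Rx (d r0 l)"
      "\<And>e l. l < n \<Longrightarrow> \<exists>c. v e l = Poly_Mapping.single e c" by metis
    let ?S = "{i. g i \<noteq> \<zero>\<^bsub>?P\<^esub>}"
    have gv: "g = (\<lambda>e. row_vec (v e))" using v(1) by auto
    have "f = row_vec (\<lambda>l. \<Sum>e\<in>?S. v e l)" using g finsum_prow[of ?S v r0] v(2) unfolding gv by auto
    then have wl: "w l = (\<Sum>e\<in>?S. v e l)" if "l < n" for l using that by (simp add: w(1) vec_eq)
    have "v e l = u e l" if l: "l < n" for e l
    proof -
      have look: "Poly_Mapping.lookup (v e' l) e = (if e' = e then Poly_Mapping.lookup (v e l) e else 0)" for e'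
        using v(3)[OF l, of e'] by (auto simp: lookup_single when_def)
      have "Poly_Mapping.lookup (w l) e = (\<Sum>e'\<in>?S. if e' = e then Poly_Mapping.lookup (v e l) e else 0)"
        unfolding wl[OF l] lookup_sum by (intro sum.cong refl look)
      also have "\<dots> = Poly_Mapping.lookup (v e l) e"
      proof (cases "e \<in> ?S")
        case False
        then have "v e l = 0" using l v(1) by (simp add: prow_ops vec_eq)
        then show ?thesis using False g by (simp add: sum.delta')
      qed (use g in \<open>simp add: sum.delta'\<close>)
      finally show ?thesis using v(3)[OF l, of e] by (auto simp: u_def)
    qed
    then show "g = (\<lambda>e. row_vec (u e))" unfolding gv by (auto simp: vec_eq)
  qed
next
  let ?P = "row_projective r0 :: ('k laurent mat, _) graded_module"
  fix f i and X :: "'k laurent mat" and j assume f: "f \<in> mcomp ?P i" and X: "X \<in> rcomp A j"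
  obtain w where w: "f = row_vec w" "\<forall>l<n. w l \<in> Rx (d r0 l) \<and> (\<exists>c. w l = Poly_Mapping.single i c)"
    using f by (auto simp: prow_mcomp)
  have XA: "X \<in> carrier A" and Xe: "\<forall>a<n. \<forall>l<n. \<exists>c. X $$ (a, l) = Poly_Mapping.single j c"
    using X unfolding A_simps(2) by (auto simp: mat_comp_iff)
  have "\<exists>c. (\<Sum>l'<n. w l' * X $$ (l', l)) = Poly_Mapping.single (i + j) c" if l: "l < n" for l
  proof -
    have "\<forall>l'<n. \<exists>c. w l' * X $$ (l', l) = Poly_Mapping.single (i + j) c"
      using w(2) Xe l by (metis mult_single)
    then obtain c where "\<forall>l'<n. w l' * X $$ (l', l) = Poly_Mapping.single (i + j) (c l')" by metis
    then have "(\<Sum>l'<n. w l' * X $$ (l', l)) = Poly_Mapping.single (i + j) (\<Sum>l'<n. c l')" by (simp add: single_sum)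
    then show ?thesis by blast
  qed
  then show "X \<odot>\<^bsub>?P\<^esub> f \<in> mcomp ?P (i + j)"
    unfolding w(1) prow_ops prow_mcomp using smult_Rx[OF XA r0] w(2) by blast
qed

lemma fin_gen_prow:
  assumes r0: "r0 < n"
  shows "fin_gen A (row_projective r0 :: ('k::field laurent mat, _) graded_module)"
  unfolding fin_gen_def
proof (intro exI conjI ballI)
  let ?P = "row_projective r0 :: ('k laurent mat, _) graded_module"
  interpret right_module A ?P by (rule right_module_prow[OF r0])
  let ?e = "row_vec (\<lambda>l. if l = r0 then 1 else 0) :: nat \<Rightarrow> 'k laurent mat"
  have e: "?e \<in> carrier ?P"
    unfolding prow_carrier by (intro exI conjI refl) (auto simp: d_self one_Rx_0)
  then show "{?e} \<subseteq> carrier ?P" by simp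
  fix f assume "f \<in> carrier ?P"
  then obtain w where w: "f = row_vec w" "\<forall>l<n. w l \<in> Rx (d r0 l)" by (auto simp: prow_carrier)
  let ?X = "mat n n (\<lambda>(a, l). if a = r0 then w l else 0)"
  have X: "?X \<in> carrier A" using w(2) by (auto simp: A_simps)
  have "(\<Sum>l'<n. (if l' = r0 then 1 else 0) * ?X $$ (l', l)) = w l" if l: "l < n" for l
  proof -
    have "(\<Sum>l'<n. (if l' = r0 then 1 else 0) * ?X $$ (l', l)) = (\<Sum>l'<n. if l' = r0 then w l else 0)"
      using l by (intro sum.cong refl) auto
    then show ?thesis using r0 by (simp add: sum.delta')
  qed
  then have "f = ?X \<odot>\<^bsub>?P\<^esub> ?e" unfolding w(1) prow_ops vec_eq by auto
  then have "f = finsum ?P (\<lambda>s. (\<lambda>_. ?X) s \<odot>\<^bsub>?P\<^esub> s) {?e}"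
    using act_closed[OF X e] by simp
  then show "\<exists>c\<in>{?e} \<rightarrow> carrier A. f = finsum ?P (\<lambda>s. c s \<odot>\<^bsub>?P\<^esub> s) {?e}"
    using X by (intro bexI[of _ "\<lambda>_. ?X"]) auto
qed simp

end

lemma polyR_ring_simps:
  "carrier polyR_ring = Rx 0" "p \<otimes>\<^bsub>polyR_ring\<^esub> q = p * q" "\<one>\<^bsub>polyR_ring\<^esub> = 1" "\<zero>\<^bsub>polyR_ring\<^esub> = 0"
  "p \<oplus>\<^bsub>polyR_ring\<^esub> q = p + q"
  by (simp_all add: polyR_ring_def polyR_Rx)

lemma ring_polyR: "ring (polyR_ring :: 'k::field laurent ring)"
proof (rule ringI)
  show "abelian_group (polyR_ring :: 'k laurent ring)"
  proof (rule abelian_groupI)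
    fix p :: "'k laurent" assume "p \<in> carrier polyR_ring"
    then show "\<exists>q\<in>carrier polyR_ring. q \<oplus>\<^bsub>polyR_ring\<^esub> p = \<zero>\<^bsub>polyR_ring\<^esub>"
      by (intro bexI[of _ "- p"]) (auto simp: polyR_ring_simps Rx_uminus)
  qed (auto simp: polyR_ring_simps Rx_add ac_simps)
  show "Group.monoid (polyR_ring :: 'k laurent ring)"
  proof (rule monoidI)
    show "\<one>\<^bsub>polyR_ring\<^esub> \<in> carrier (polyR_ring :: 'k laurent ring)"
      using Rx_single[of 0 "1 :: 'k" 0] by (simp add: polyR_ring_simps)
    show "\<And>p q :: 'k laurent. p \<in> carrier polyR_ring \<Longrightarrow> q \<in> carrier polyR_ring \<Longrightarrow> p \<otimes>\<^bsub>polyR_ring\<^esub> q \<in> carrier polyR_ring"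
      using Rx_mult[of _ 0 _ 0] by (simp add: polyR_ring_simps)
  qed (auto simp: polyR_ring_simps mult.assoc)
qed (auto simp: polyR_ring_simps algebra_simps)

context cyclic_weights
begin

lemma scalar_action:
  "(p \<cdot>\<^sub>m 1\<^sub>m n) \<odot>\<^bsub>row_projective r0\<^esub> row_vec w = row_vec (\<lambda>l. w l * p)"
proof -
  have "(\<Sum>l'<n. w l' * (p \<cdot>\<^sub>m 1\<^sub>m n) $$ (l', l)) = w l * p" if l: "l < n" for l
  proof -
    have "(\<Sum>l'<n. w l' * (p \<cdot>\<^sub>m 1\<^sub>m n) $$ (l', l)) = (\<Sum>l'<n. if l' = l then w l * p else 0)"
      using l by (intro sum.cong refl) auto
    then show ?thesis using l by (simp add: sum.delta')
  qed
  then show ?thesis unfolding prow_ops vec_eq by blast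
qed

lemma restrict_prow:
  "carrier (restrict_R n (row_projective r0)) = carrier (row_projective r0)" "\<zero>\<^bsub>restrict_R n (row_projective r0)\<^esub> = \<zero>\<^bsub>row_projective r0\<^esub>"
  "f \<oplus>\<^bsub>restrict_R n (row_projective r0)\<^esub> g = f \<oplus>\<^bsub>row_projective r0\<^esub> g"
  "p \<odot>\<^bsub>restrict_R n (row_projective r0)\<^esub> row_vec w = row_vec (\<lambda>l. w l * p)"
  by (simp_all add: restrict_R_def scalar_action)

lemma right_module_restrict_prow:
  "right_module polyR_ring (restrict_R n (row_projective r0 :: ('k::field laurent mat, _) graded_module))"
proof (intro right_module.intro right_module_axioms.intro ring_polyR)
  let ?Q = "restrict_R n (row_projective r0 :: ('k laurent mat, _) graded_module)"
  show "abelian_group ?Q"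
  proof (rule abelian_groupI)
    interpret P: abelian_group "row_projective r0 :: ('k laurent mat, _) graded_module" by (rule abelian_group_prow)
    show "\<exists>g\<in>carrier ?Q. g \<oplus>\<^bsub>?Q\<^esub> f = \<zero>\<^bsub>?Q\<^esub>" if "f \<in> carrier ?Q" for f
      using that by (intro bexI[of _ "\<ominus>\<^bsub>row_projective r0\<^esub> f"]) (auto simp: restrict_prow P.l_neg)
    show "f \<oplus>\<^bsub>?Q\<^esub> g \<oplus>\<^bsub>?Q\<^esub> h = f \<oplus>\<^bsub>?Q\<^esub> (g \<oplus>\<^bsub>?Q\<^esub> h)"
      if "f \<in> carrier ?Q" "g \<in> carrier ?Q" "h \<in> carrier ?Q" for f g h
      using that by (simp add: restrict_prow P.a_assoc)
    show "f \<oplus>\<^bsub>?Q\<^esub> g = g \<oplus>\<^bsub>?Q\<^esub> f" if "f \<in> carrier ?Q" "g \<in> carrier ?Q" for f g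
      using that by (simp add: restrict_prow P.a_comm)
    show "f \<oplus>\<^bsub>?Q\<^esub> g \<in> carrier ?Q" if "f \<in> carrier ?Q" "g \<in> carrier ?Q" for f g
      using that by (simp add: restrict_prow)
    show "\<zero>\<^bsub>?Q\<^esub> \<in> carrier ?Q" by (simp add: restrict_prow)
    show "\<zero>\<^bsub>?Q\<^esub> \<oplus>\<^bsub>?Q\<^esub> f = f" if "f \<in> carrier ?Q" for f
      using that by (simp add: restrict_prow)
  qed
next
  let ?Q = "restrict_R n (row_projective r0 :: ('k laurent mat, _) graded_module)"
  fix a b :: "'k laurent" and f g assume ab: "a \<in> carrier polyR_ring" "b \<in> carrier polyR_ring"
    and "f \<in> carrier ?Q" "g \<in> carrier ?Q"
  then obtain v w where w: "f = row_vec v" "g = row_vec w" by (auto simp: restrict_prow prow_carrier)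
  show "a \<odot>\<^bsub>?Q\<^esub> (f \<oplus>\<^bsub>?Q\<^esub> g) = a \<odot>\<^bsub>?Q\<^esub> f \<oplus>\<^bsub>?Q\<^esub> a \<odot>\<^bsub>?Q\<^esub> g"
    unfolding w restrict_prow prow_ops by (simp add: distrib_right)
next
  let ?Q = "restrict_R n (row_projective r0 :: ('k laurent mat, _) graded_module)"
  fix a b :: "'k laurent" and f assume ab: "a \<in> carrier polyR_ring" "b \<in> carrier polyR_ring" and "f \<in> carrier ?Q"
  then obtain w where w: "f = row_vec w" "\<forall>l<n. w l \<in> Rx (d r0 l)" by (auto simp: restrict_prow prow_carrier)
  show "(a \<oplus>\<^bsub>polyR_ring\<^esub> b) \<odot>\<^bsub>?Q\<^esub> f = a \<odot>\<^bsub>?Q\<^esub> f \<oplus>\<^bsub>?Q\<^esub> b \<odot>\<^bsub>?Q\<^esub> f"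
    unfolding w restrict_prow prow_ops polyR_ring_simps by (simp add: distrib_left)
  show "(a \<otimes>\<^bsub>polyR_ring\<^esub> b) \<odot>\<^bsub>?Q\<^esub> f = b \<odot>\<^bsub>?Q\<^esub> (a \<odot>\<^bsub>?Q\<^esub> f)"
    unfolding w restrict_prow prow_ops polyR_ring_simps by (simp add: mult.assoc)
next
  let ?Q = "restrict_R n (row_projective r0 :: ('k laurent mat, _) graded_module)"
  fix a :: "'k laurent" and f assume a: "a \<in> carrier polyR_ring" and "f \<in> carrier ?Q"
  then obtain w where w: "f = row_vec w" "\<forall>l<n. w l \<in> Rx (d r0 l)" by (auto simp: restrict_prow prow_carrier)
  have "w l * a \<in> Rx (d r0 l)" if "l < n" for l
    using Rx_mult[of "w l" "d r0 l" a 0] w(2) a that by (simp add: polyR_ring_simps)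
  then show "a \<odot>\<^bsub>?Q\<^esub> f \<in> carrier ?Q" unfolding w(1) restrict_prow by (rule prow_carrierI)
next
  let ?Q = "restrict_R n (row_projective r0 :: ('k laurent mat, _) graded_module)"
  fix f assume "f \<in> carrier ?Q"
  then obtain w where w: "f = row_vec w" by (auto simp: restrict_prow prow_carrier)
  show "\<one>\<^bsub>polyR_ring\<^esub> \<odot>\<^bsub>?Q\<^esub> f = f" unfolding w restrict_prow polyR_ring_simps by simp
qed

lemma projective_restrict_prow:
  "projective_rmodule polyR_ring (restrict_R n (row_projective r0 :: ('k::field laurent mat, _) graded_module))"
proof -
  let ?R = "polyR_ring :: 'k laurent ring" and ?Q = "restrict_R n (row_projective r0 :: ('k laurent mat, _) graded_module)"
  define b :: "nat \<Rightarrow> nat \<Rightarrow> 'k laurent mat" where "b l = row_vec (\<lambda>l'. if l' = l then 1 else 0)" for l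
  have b_inj: "inj_on b {..<n}"
  proof (rule inj_onI)
    fix l l' assume "l \<in> {..<n}" "l' \<in> {..<n}" "b l = b l'"
    then have "(if l = l then 1 else 0 :: 'k laurent) = (if l = l' then 1 else 0)" unfolding b_def vec_eq by blast
    then show "l = l'" by (auto split: if_splits)
  qed
  let ?X = "b ` {..<n}" and ?ix = "inv_into {..<n} b"
  have ix: "?ix (b l) = l" if "l < n" for l using b_inj that by simp
  define i :: "(nat \<Rightarrow> 'k laurent mat) \<Rightarrow> (nat \<Rightarrow> 'k laurent mat) \<Rightarrow> 'k laurent"
    where "i f = (\<lambda>x. if x \<in> ?X then row_entry f (?ix x) * Poly_Mapping.single (- d r0 (?ix x)) 1 else 0)" for f
  define p :: "((nat \<Rightarrow> 'k laurent mat) \<Rightarrow> 'k laurent) \<Rightarrow> nat \<Rightarrow> 'k laurent mat"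
    where "p \<phi> = row_vec (\<lambda>l. \<phi> (b l) * Poly_Mapping.single (d r0 l) 1)" for \<phi>
  have ixn: "?ix x < n" if "x \<in> ?X" for x using that ix by auto
  have I: "rlinear ?R ?Q (free_rmodule ?R ?X) i"
    unfolding rlinear_def
  proof (intro conjI ballI Pi_I)
    fix f assume "f \<in> carrier ?Q"
    then obtain w where w: "f = row_vec w" "\<forall>l<n. w l \<in> Rx (d r0 l)" by (auto simp: restrict_prow prow_carrier)
    have "i f x \<in> Rx 0" for x using w ixn[of x] by (auto simp: i_def Rx_mult_single)
    moreover have "finite {x. i f x \<noteq> 0}" by (rule finite_subset[of _ ?X]) (auto simp: i_def)
    ultimately show "i f \<in> carrier (free_rmodule ?R ?X)" by (auto simp: free_rmodule_simps polyR_ring_simps i_def)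
  next
    fix f g assume "f \<in> carrier ?Q" "g \<in> carrier ?Q"
    then obtain v w where w: "f = row_vec v" "g = row_vec w" by (auto simp: restrict_prow prow_carrier)
    show "i (f \<oplus>\<^bsub>?Q\<^esub> g) = i f \<oplus>\<^bsub>free_rmodule ?R ?X\<^esub> i g"
      unfolding w restrict_prow prow_ops free_rmodule_simps polyR_ring_simps
      using ixn by (auto simp: i_def distrib_right)
  next
    fix a f assume "f \<in> carrier ?Q"
    then obtain w where w: "f = row_vec w" by (auto simp: restrict_prow prow_carrier)
    show "i (a \<odot>\<^bsub>?Q\<^esub> f) = a \<odot>\<^bsub>free_rmodule ?R ?X\<^esub> i f"
      unfolding w restrict_prow prow_ops free_rmodule_simps polyR_ring_simps
      using ixn by (auto simp: i_def ac_simps)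
  qed
  have P: "rlinear ?R (free_rmodule ?R ?X) ?Q p"
    unfolding rlinear_def
  proof (intro conjI ballI Pi_I)
    fix \<phi> assume \<phi>: "\<phi> \<in> carrier (free_rmodule ?R ?X)"
    show "p \<phi> \<in> carrier ?Q"
      unfolding p_def restrict_prow
      by (rule prow_carrierI) (use \<phi> in \<open>simp add: Rx_mult_single free_rmodule_simps polyR_ring_simps\<close>)
  qed (auto simp: p_def restrict_prow prow_ops free_rmodule_simps polyR_ring_simps vec_eq algebra_simps)
  show ?thesis
    unfolding projective_rmodule_def
  proof (intro conjI exI bexI ballI right_module_restrict_prow)
    show "restrict i (carrier ?Q) \<in> rhom ?R ?Q (free_rmodule ?R ?X)"
      by (rule restrict_rlinear[OF I right_module_restrict_prow])
    show "restrict p (carrier (free_rmodule ?R ?X)) \<in> rhom ?R (free_rmodule ?R ?X) ?Q"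
      by (rule ring.free_rmodule_rhom[OF ring_polyR P])
    fix f assume f: "f \<in> carrier ?Q"
    then obtain w where w: "f = row_vec w" by (auto simp: restrict_prow prow_carrier)
    have "i f \<in> carrier (free_rmodule ?R ?X)" using I f by (auto simp: rlinear_def)
    moreover have "p (i f) = f" unfolding w p_def vec_eq i_def using ix by (auto simp: single_cancel)
    ultimately show "restrict p (carrier (free_rmodule ?R ?X)) (restrict i (carrier ?Q) f) = f" using f by simp
  qed
qed

lemma CM_prow: "r0 < n \<Longrightarrow> CM n d (row_projective r0 :: ('k::field laurent mat, _) graded_module)"
  unfolding CM_def by (intro conjI graded_prow fin_gen_prow projective_restrict_prow)

definition free_gmod :: "nat \<Rightarrow> (nat \<Rightarrow> int) \<Rightarrow> ('k::field laurent mat, nat \<Rightarrow> 'k laurent mat) graded_module"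
  where "free_gmod r j = gdsum {..<r} (\<lambda>s. gshift (j s) (regular_gmod A))"

lemma free_gmod_simps:
  "carrier (free_gmod r j) = ({..<r} \<rightarrow>\<^sub>E carrier A)"
  "f \<oplus>\<^bsub>free_gmod r j\<^esub> g = (\<lambda>q\<in>{..<r}. f q + g q)"
  "X \<odot>\<^bsub>free_gmod r j\<^esub> f = (\<lambda>q\<in>{..<r}. f q * X)"
  "mcomp (free_gmod r j) e = (\<Pi>\<^sub>E q\<in>{..<r}. rcomp A (e + j q))"
  by (simp_all add: free_gmod_def gdsum_def gshift_def regular_gmod_def A_simps)

text \<open>The row \<open>r\<close> of a matrix is inserted into a matrix with zeros elsewhere, and read off again.\<close>

lemma graded_projective_prow:
  assumes r0: "r0 < n"
  shows "graded_projective A (row_projective r0 :: ('k::field laurent mat, _) graded_module)"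
  unfolding graded_projective_def Let_def
proof (intro conjI graded_prow[OF r0] exI)
  let ?P = "row_projective r0 :: ('k laurent mat, _) graded_module" and ?F = "free_gmod 1 (\<lambda>_. 0) :: ('k laurent mat, _) graded_module"
  define R :: "(nat \<Rightarrow> 'k laurent) \<Rightarrow> 'k laurent mat" where "R w = mat n n (\<lambda>(x, l). if x = r0 then w l else (0 :: 'k laurent))" for w
  define i :: "(nat \<Rightarrow> 'k laurent mat) \<Rightarrow> nat \<Rightarrow> 'k laurent mat" where "i = (\<lambda>f\<in>carrier ?P. \<lambda>q\<in>{..<1 :: nat}. R (row_entry f))"
  define p :: "(nat \<Rightarrow> 'k laurent mat) \<Rightarrow> nat \<Rightarrow> 'k laurent mat" where "p = (\<lambda>\<phi>\<in>carrier ?F. row_vec (\<lambda>l. \<phi> 0 $$ (r0, l)))"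
  have R_A: "R w \<in> carrier A" if "\<forall>l<n. w l \<in> Rx (d r0 l)" for w
    using that by (auto simp: R_def A_simps)
  have R_cong: "R v = R w" if "\<And>l. l < n \<Longrightarrow> v l = w l" for v w
    using that by (auto simp: R_def intro!: eq_matI)
  have i_vec: "i (row_vec w) = (\<lambda>q\<in>{..<1}. R w)" if "\<forall>l<n. w l \<in> Rx (d r0 l)" for w
    using that R_cong[of "row_entry (row_vec w)" w] by (auto simp: i_def prow_carrier)
  interpret right_module A ?P by (rule right_module_prow[OF r0])
  have I: "i \<in> ghom A ?P ?F"
    unfolding ghom_def rhom_def
  proof (intro CollectI conjI ballI allI)
    show "i \<in> carrier ?P \<rightarrow>\<^sub>E carrier ?F"
    proof (rule PiE_I)
      fix f assume "f \<in> carrier ?P"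
      then show "i f \<in> carrier ?F" using i_vec R_A by (auto simp: prow_carrier free_gmod_simps)
    qed (simp add: i_def)
    fix f g assume "f \<in> carrier ?P" "g \<in> carrier ?P"
    then obtain v w where w: "f = row_vec v" "g = row_vec w" "\<forall>l<n. v l \<in> Rx (d r0 l)" "\<forall>l<n. w l \<in> Rx (d r0 l)"
      by (auto simp: prow_carrier)
    have "R (\<lambda>l. v l + w l) = R v + R w" by (rule eq_matI) (auto simp: R_def)
    then show "i (f \<oplus>\<^bsub>?P\<^esub> g) = i f \<oplus>\<^bsub>?F\<^esub> i g"
      unfolding w(1,2) prow_ops free_gmod_simps using w(3,4) by (subst (1 2 3) i_vec) (auto simp: Rx_add)
  next
    fix X :: "'k laurent mat" and f assume X: "X \<in> carrier A" and "f \<in> carrier ?P"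
    then obtain w where w: "f = row_vec w" "\<forall>l<n. w l \<in> Rx (d r0 l)" by (auto simp: prow_carrier)
    have X': "X \<in> carrier_mat n n" using X by (simp add: A_simps)
    have "R (\<lambda>l. \<Sum>l'<n. w l' * X $$ (l', l)) = R w * X"
    proof (rule eq_matI)
      fix x l assume "x < dim_row (R w * X)" "l < dim_col (R w * X)"
      then have xl: "x < n" "l < n" using X' by (auto simp: R_def)
      have "(R w * X) $$ (x, l) = (\<Sum>l'<n. R w $$ (x, l') * X $$ (l', l))"
        using xl X' by (intro mult_mat_entry) (auto simp: R_def)
      then show "R (\<lambda>l. \<Sum>l'<n. w l' * X $$ (l', l)) $$ (x, l) = (R w * X) $$ (x, l)"
        using xl by (auto simp: R_def)
    qed (use X' in \<open>auto simp: R_def\<close>)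
    then show "i (X \<odot>\<^bsub>?P\<^esub> f) = X \<odot>\<^bsub>?F\<^esub> i f"
      unfolding w(1) prow_ops free_gmod_simps using w(2) smult_Rx[OF X r0 _ w(2)] by (subst (1 2) i_vec) auto
  next
    fix e
    show "i ` mcomp ?P e \<subseteq> mcomp ?F e"
    proof
      fix \<phi> assume "\<phi> \<in> i ` mcomp ?P e"
      then obtain w where w: "\<phi> = i (row_vec w)" "\<forall>l<n. w l \<in> Rx (d r0 l) \<and> (\<exists>c. w l = Poly_Mapping.single e c)"
        by (auto simp: prow_mcomp)
      have "R w \<in> mat_comp n n e" using w(2) by (auto simp: R_def mat_comp_iff intro: exI[of _ 0])
      then show "\<phi> \<in> mcomp ?F e" using w i_vec[of w] R_A[of w] by (auto simp: free_gmod_simps A_simps(2))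
    qed
  qed
  have P: "p \<in> ghom A ?F ?P"
    unfolding ghom_def rhom_def
  proof (intro CollectI conjI ballI allI)
    show "p \<in> carrier ?F \<rightarrow>\<^sub>E carrier ?P"
    proof (rule PiE_I)
      fix \<phi> assume \<phi>: "\<phi> \<in> carrier ?F"
      then have "\<phi> 0 \<in> carrier A" unfolding free_gmod_simps by auto
      then show "p \<phi> \<in> carrier ?P"
        using r0 \<phi> unfolding p_def by (simp, intro prow_carrierI) (simp add: A_simps(1))
    qed (simp add: p_def)
    fix f g assume fg: "f \<in> carrier ?F" "g \<in> carrier ?F"
    have fg0: "f 0 \<in> carrier A" "g 0 \<in> carrier A" using fg by (auto simp: free_gmod_simps)
    have "f 0 + g 0 \<in> carrier A" using ring.ring_simprules(1)[OF ring_A fg0] by (simp add: A_simps(6))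
    then have "f \<oplus>\<^bsub>?F\<^esub> g \<in> carrier ?F" by (auto simp: free_gmod_simps)
    then show "p (f \<oplus>\<^bsub>?F\<^esub> g) = p f \<oplus>\<^bsub>?P\<^esub> p g"
      using fg fg0 r0 by (simp add: p_def prow_ops vec_eq) (auto simp: free_gmod_simps A_simps(1))
  next
    fix X :: "'k laurent mat" and f assume X: "X \<in> carrier A" and f: "f \<in> carrier ?F"
    have f0: "f 0 \<in> carrier A" using f by (auto simp: free_gmod_simps)
    have "X \<odot>\<^bsub>?F\<^esub> f \<in> carrier ?F" using A_mult_closed[OF f0 X] by (auto simp: free_gmod_simps)
    moreover have "(f 0 * X) $$ (r0, l) = (\<Sum>l'<n. f 0 $$ (r0, l') * X $$ (l', l))" if "l < n" for l
      using X f0 r0 that by (intro mult_mat_entry) (auto simp: A_simps)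
    ultimately show "p (X \<odot>\<^bsub>?F\<^esub> f) = X \<odot>\<^bsub>?P\<^esub> p f"
      using f by (simp add: p_def prow_ops vec_eq) (simp add: free_gmod_simps)
  next
    fix e
    show "p ` mcomp ?F e \<subseteq> mcomp ?P e"
    proof
      fix g assume "g \<in> p ` mcomp ?F e"
      then obtain f where f: "f \<in> mcomp ?F e" "g = p f" by auto
      have f0: "f 0 \<in> carrier A" "f 0 \<in> mat_comp n n e" and fF: "f \<in> carrier ?F"
        using f(1) by (auto simp: free_gmod_simps A_simps(2) PiE_iff)
      then show "g \<in> mcomp ?P e"
        unfolding f(2) prow_mcomp p_def using r0
        by (intro exI[of _ "\<lambda>l. f 0 $$ (r0, l)"]) (auto simp: A_simps(1) mat_comp_iff)
    qed
  qed
  have pi: "p (i f) = f" if f: "f \<in> carrier ?P" for f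
  proof -
    obtain w where w: "f = row_vec w" "\<forall>l<n. w l \<in> Rx (d r0 l)" using f by (auto simp: prow_carrier)
    have "i f \<in> carrier ?F" using i_vec[OF w(2)] R_A[OF w(2)] unfolding w(1) by (auto simp: free_gmod_simps)
    then show ?thesis unfolding w(1) using i_vec[OF w(2)] r0 by (simp add: p_def vec_eq R_def)
  qed
  have F: "gdsum {..<1 :: nat} (\<lambda>s. gshift 0 (regular_gmod A)) = ?F"
    unfolding free_gmod_def ..
  show "\<exists>i\<in>ghom A ?P (gdsum {..<1 :: nat} (\<lambda>s. gshift ((\<lambda>_. 0) s) (regular_gmod A))).
      \<exists>p\<in>ghom A (gdsum {..<1 :: nat} (\<lambda>s. gshift ((\<lambda>_. 0) s) (regular_gmod A))) ?P. \<forall>m\<in>carrier ?P. p (i m) = m"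
    unfolding F by (intro bexI[OF _ I] bexI[OF _ P] ballI pi)
qed

end

section \<open>Endomorphisms that factor through a projective\<close>

context cyclic_weights
begin

text \<open>The condition that \<open>[R \<dots> R]\<close> is itself projective, namely equal to \<open>e\<^sub>rA\<close> for some \<open>r\<close>; in this case it becomes
  zero in the stable category.\<close>

definition row_module_projective :: bool where "row_module_projective \<longleftrightarrow> (\<exists>r<n. \<forall>l<n. d r l = 0)"

definition stable_indices :: "(nat \<times> int) option set" where "stable_indices = (if row_module_projective then W else T)"

lemma live_T: "stable_indices \<subseteq> T" "W \<subseteq> stable_indices" "T \<subseteq> insert None W"
  by (auto simp: stable_indices_def T_def)

lemma expo_zero_entry:
  assumes s: "s \<in> T"
  shows "\<exists>l<n. expo s l = 0"
proof (cases s)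
  case None
  then show ?thesis using n_pos by (intro exI[of _ 0]) (simp add: expo_def)
next
  case (Some q)
  obtain i j where q: "q = (i, j)" by (cases q)
  have "1 \<le> j" using s unfolding Some q T_def by (auto simp: Some_W)
  then have "expo s (\<nu> i) = 0" unfolding Some q expo_def option.case prod.case d_self by simp
  moreover have "\<nu> i < n" using n_pos by simp
  ultimately show ?thesis by blast
qed

lemma expo_zero:
  assumes t: "t \<in> T" and z: "\<And>l. l < n \<Longrightarrow> expo t l \<le> 0"
  shows "t = None"
proof (rule ccontr)
  assume "t \<noteq> None"
  then obtain i j where t': "t = Some (i, j)" by auto
  then have "i < n" "j < total - int (m i)" using t by (auto simp: T_def Some_W)
  then show False using z[of i] expo_prev[of i 0 j] n_pos by (simp add: t' wt_Suc)
qed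

lemma not_below_None: "t \<in> W \<Longrightarrow> \<not> below t None"
proof
  assume t: "t \<in> W" "below t None"
  then have "expo t l \<le> 0" if "l < n" for l using that by (simp add: below_def expo_def[of None])
  then have "t = None" using t by (intro expo_zero) (auto simp: T_def)
  then show False using t bot_notin by simp
qed

text \<open>The Gorenstein condition enters here: a projective \<open>e\<^sub>rA\<close> receives a nonzero map of degree zero
  from a summand only if it is equal to \<open>[R \<dots> R]\<close>. Write \<open>r = \<nu> l'\<close>. The entry \<open>l'\<close> of the row \<open>r\<close> is its
  maximum. At the column \<open>\<nu> i\<close> the summand has exponent zero, so \<open>d r (\<nu> i) = 0\<close>, and the Nakayama relation turns this
  into \<open>d r l' = d (\<nu> i) l'\<close>; as the shift \<open>j\<close> is positive, the exponent of the summand at \<open>l'\<close> can bound this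
  only if it is zero.\<close>

lemma row_below_summand:
  assumes r: "r < n" and s: "s \<in> T" and le: "\<And>l. l < n \<Longrightarrow> d r l \<le> expo s l" and l: "l < n"
  shows "d r l = 0"
proof (cases s)
  case None
  then show ?thesis using le[OF l] d_nonneg[of r l] by (simp add: expo_def)
next
  case (Some q)
  obtain i j where q: "q = (i, j)" by (cases q)
  have j: "1 \<le> j" using s unfolding Some q T_def by (auto simp: Some_W)
  have bij: "bij_betw (\<lambda>i. \<nu> i) {..<n} {..<n}" using cyc_exponent_nakayama[of n m] by (simp only: is_nakayama_def)
  have "r \<in> (\<lambda>i. \<nu> i) ` {..<n}" unfolding bij_betw_imp_surj_on[OF bij] using r by simp
  then obtain l' where "r = \<nu> l'" "l' \<in> {..<n}" by (rule imageE)
  then have l': "l' < n" "\<nu> l' = r" by simp_all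
  have "d (\<nu> l') a + d a l' = d (\<nu> l') l'" if "a < n" for a
    using cyc_exponent_nakayama[of n m] that l'(1) unfolding is_nakayama_def by blast
  then have key: "d r a + d a l' = d r l'" if "a < n" for a using that unfolding l'(2) by blast
  have k: "\<nu> i < n" using n_pos by simp
  have e: "expo s a = max 0 (d (\<nu> i) a - j)" for a unfolding Some q expo_def option.case prod.case ..
  have "expo s (\<nu> i) = 0" unfolding e d_self using j by simp
  then have "d r (\<nu> i) = 0" using le[OF k] d_nonneg[of r "\<nu> i"] by linarith
  then have "d (\<nu> i) l' = d r l'" using key[OF k] by linarith
  then have "d r l' \<le> 0" using le[OF l'(1)] j unfolding e by linarith
  then show ?thesis using key[OF l] d_nonneg[of r l] d_nonneg[of l l'] by linarith
qed

lemma mult_elem: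
  assumes "Y \<in> carrier A" "a < n" "b < n" "x < n" "l < n"
  shows "(Y * matrix_element p a b) $$ (x, l) = (if l = b then Y $$ (x, a) * p else 0)"
proof -
  have "(Y * matrix_element p a b) $$ (x, l) = (\<Sum>l'<n. Y $$ (x, l') * matrix_element p a b $$ (l', l))"
    using assms by (intro mult_mat_entry) (auto simp: A_simps matrix_element_def)
  then show ?thesis using assms by (simp add: sum_elem)
qed

lemma zero_A: "0\<^sub>m n n \<in> rcomp A e"
  unfolding A_simps(2) by (auto simp: A_simps(1) mat_comp_iff intro: exI[of _ 0])

text \<open>If a map between two summands with nonzero scalar factors through a free module, then some component through a single
  shifted projective \<open>e\<^sub>aA(j q)\<close> is nonzero. Comparing degrees in the second factor gives \<open>j q \<le> 0\<close>, and in the first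
  factor \<open>d a l \<le> expo s l + j q\<close> for all \<open>l\<close>. Since some exponent of \<open>s\<close> is zero, \<open>j q = 0\<close>, and
  \<open>row_below_summand\<close> shows that \<open>e\<^sub>aA\<close> is \<open>[R \<dots> R]\<close>; then \<open>t\<close> is \<open>[R \<dots> R]\<close> as well.\<close>

lemma factor_through_free:
  fixes G :: "((nat \<times> int) option \<Rightarrow> 'k::field laurent mat) \<Rightarrow> nat \<Rightarrow> 'k laurent mat"
    and H :: "(nat \<Rightarrow> 'k laurent mat) \<Rightarrow> (nat \<times> int) option \<Rightarrow> 'k laurent mat"
  defines "F r j \<equiv> free_gmod r j :: ('k laurent mat, _) graded_module"
  assumes GF: "\<And>v. v \<in> carrier V \<Longrightarrow> G v \<in> carrier (F r j)"
    and Glin: "\<And>X v. X \<in> carrier A \<Longrightarrow> v \<in> carrier V \<Longrightarrow> G (X \<odot>\<^bsub>V\<^esub> v) = X \<odot>\<^bsub>F r j\<^esub> G v"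
    and Gdeg: "\<And>v e. v \<in> mcomp V e \<Longrightarrow> G v \<in> mcomp (F r j) e"
    and HV: "\<And>f. f \<in> carrier (F r j) \<Longrightarrow> H f \<in> carrier V"
    and Hadd: "\<And>f g. f \<in> carrier (F r j) \<Longrightarrow> g \<in> carrier (F r j) \<Longrightarrow> H (f \<oplus>\<^bsub>F r j\<^esub> g) = H f \<oplus>\<^bsub>V\<^esub> H g"
    and Hlin: "\<And>X f. X \<in> carrier A \<Longrightarrow> f \<in> carrier (F r j) \<Longrightarrow> H (X \<odot>\<^bsub>F r j\<^esub> f) = X \<odot>\<^bsub>V\<^esub> H f"
    and Hdeg: "\<And>f e. f \<in> mcomp (F r j) e \<Longrightarrow> H f \<in> mcomp V e"
    and s: "s \<in> T" and t: "t \<in> T" and nz: "coords (H (G (gen s 0))) t 0 \<noteq> 0"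
  shows "row_module_projective \<and> t = None"
proof -
  have n0: "0 < n" using n_pos by simp
  have one: "(1 :: 'k laurent) \<in> Rx (d a a)" for a by (simp add: d_self one_Rx_0)
  define \<phi> where "\<phi> l = G (gen s l)" for l
  have \<phi>F: "\<phi> l \<in> carrier (F r j)" for l unfolding \<phi>_def by (rule GF[OF gen_carrier])
  have \<phi>A: "\<phi> l q \<in> carrier A" if "q < r" for l q
    using \<phi>F[of l] that by (auto simp: F_def free_gmod_simps)
  have \<phi>R: "\<phi> l q $$ (a, b) \<in> Rx (d a b)" if "q < r" "a < n" "b < n" for l q a b
    using \<phi>A[OF that(1), of l] that by (simp add: A_simps)
  \<comment> \<open>The idempotent \<open>e\<^sub>a\<close> in the summand number \<open>q\<close>; the column \<open>0\<close> of \<open>\<phi> 0\<close> is the combination of the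
    elements \<open>\<epsilon> q a\<close> with coefficients \<open>\<phi> 0 q $$ (a, 0)\<close>.\<close>
  define \<epsilon> :: "nat \<Rightarrow> nat \<Rightarrow> nat \<Rightarrow> 'k laurent mat"
    where "\<epsilon> q a = (\<lambda>q'\<in>{..<r}. if q' = q then matrix_element 1 a a else 0\<^sub>m n n)" for q a
  have eA: "matrix_element (1 :: 'k laurent) a a \<in> rcomp A 0" for a
  proof -
    have "\<exists>c. matrix_element (1 :: 'k laurent) a a $$ (x, l) = Poly_Mapping.single 0 c" if "x < n" "l < n" for x l
      using that by (cases "x = a \<and> l = a") (auto simp: matrix_element_def intro: exI[of _ 1] exI[of _ 0])
    then show ?thesis unfolding A_simps(2) using elem_A[OF one, of a] by (auto simp: mat_comp_iff A_simps(1))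
  qed
  have zA: "(0\<^sub>m n n :: 'k laurent mat) \<in> rcomp A e" for e by (rule zero_A)
  have \<epsilon>: "\<epsilon> q a \<in> mcomp (F r j) (- j q)" "\<epsilon> q a \<in> carrier (F r j)" for q a
    using eA[of a] zA unfolding \<epsilon>_def F_def free_gmod_simps by (auto simp: A_simps(2))
  define part :: "(nat \<times> nat) set \<Rightarrow> nat \<Rightarrow> 'k laurent mat"
    where "part S = (\<lambda>q\<in>{..<r}. mat n n (\<lambda>(a, l). if (q, a) \<in> S \<and> l = 0 then \<phi> 0 q $$ (a, 0) else 0))" for S
  have partA: "mat n n (\<lambda>(a, l). if (q, a) \<in> S \<and> l = 0 then \<phi> 0 q $$ (a, 0) else 0) \<in> carrier A"
    if "q < r" for q S using \<phi>R[OF that] by (auto simp: A_simps(1))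
  have partF: "part S \<in> carrier (F r j)" for S
    using partA unfolding part_def F_def free_gmod_simps by auto
  have expand: "coords (H (part S)) t 0 = (\<Sum>(q, a)\<in>S. coords (H (\<epsilon> q a)) t a * \<phi> 0 q $$ (a, 0))"
    if "finite S" "S \<subseteq> {..<r} \<times> {..<n}" for S
    using that
  proof (induction S rule: finite_induct)
    case empty
    have "part {} \<oplus>\<^bsub>F r j\<^esub> part {} = part {}"
      unfolding part_def F_def free_gmod_simps by (intro restrict_ext) (auto intro!: eq_matI)
    then have "H (part {}) \<oplus>\<^bsub>V\<^esub> H (part {}) = H (part {})" using Hadd[OF partF partF] by metis
    then have "coords (H (part {})) t 0 + coords (H (part {})) t 0 = coords (H (part {})) t 0"
      using coords_add[OF HV[OF partF] HV[OF partF] t n0] by metis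
    then have "coords (H (part {})) t 0 = 0" by (simp only: add_cancel_left_left)
    then show ?case by simp
  next
    case (insert qa S)
    obtain q a where qa: "qa = (q, a)" by (cases qa)
    have q: "q < r" "a < n" using insert.prems qa by auto
    let ?X = "matrix_element (\<phi> 0 q $$ (a, 0)) a 0"
    have x: "\<phi> 0 q $$ (a, 0) \<in> Rx (d a 0)" by (rule \<phi>R[OF q n0])
    have X: "?X \<in> carrier A" by (rule elem_A[OF x])
    have XF: "?X \<odot>\<^bsub>F r j\<^esub> \<epsilon> q a \<in> carrier (F r j)"
      using A_mult_closed[OF _ X] \<epsilon>(2)[of q a] unfolding F_def free_gmod_simps by auto
    have "part (insert qa S) q' = (part S \<oplus>\<^bsub>F r j\<^esub> (?X \<odot>\<^bsub>F r j\<^esub> \<epsilon> q a)) q'" if q': "q' < r" for q'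
    proof (rule eq_matI)
      have A: "\<epsilon> q a q' \<in> carrier A" using \<epsilon>(2)[of q a] q' unfolding F_def free_gmod_simps by auto
      have C: "\<epsilon> q a q' * ?X \<in> carrier_mat n n" using A_mult_closed[OF A X] by (simp add: A_simps(1))
      have E: "(part S \<oplus>\<^bsub>F r j\<^esub> (?X \<odot>\<^bsub>F r j\<^esub> \<epsilon> q a)) q' = part S q' + \<epsilon> q a q' * ?X"
        using q' unfolding F_def free_gmod_simps by simp
      show "dim_row (part (insert qa S) q') = dim_row ((part S \<oplus>\<^bsub>F r j\<^esub> (?X \<odot>\<^bsub>F r j\<^esub> \<epsilon> q a)) q')"
        "dim_col (part (insert qa S) q') = dim_col ((part S \<oplus>\<^bsub>F r j\<^esub> (?X \<odot>\<^bsub>F r j\<^esub> \<epsilon> q a)) q')"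
        unfolding E using C q' by (auto simp: part_def)
      fix b l assume "b < dim_row ((part S \<oplus>\<^bsub>F r j\<^esub> (?X \<odot>\<^bsub>F r j\<^esub> \<epsilon> q a)) q')"
        "l < dim_col ((part S \<oplus>\<^bsub>F r j\<^esub> (?X \<odot>\<^bsub>F r j\<^esub> \<epsilon> q a)) q')"
      then have bl: "b < n" "l < n" unfolding E using C by auto
      have "(\<epsilon> q a q' * ?X) $$ (b, l) = (if l = 0 then \<epsilon> q a q' $$ (b, a) * \<phi> 0 q $$ (a, 0) else 0)"
        by (rule mult_elem[OF A q(2) n0 bl])
      also have "\<dots> = (if q' = q \<and> b = a \<and> l = 0 then \<phi> 0 q $$ (a, 0) else 0)"
        using q q' bl by (auto simp: \<epsilon>_def matrix_element_def)
      finally have M: "(\<epsilon> q a q' * ?X) $$ (b, l) = (if q' = q \<and> b = a \<and> l = 0 then \<phi> 0 q $$ (a, 0) else 0)" .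
      have "(part S q' + \<epsilon> q a q' * ?X) $$ (b, l) = part S q' $$ (b, l) + (\<epsilon> q a q' * ?X) $$ (b, l)"
        using C bl by (intro index_add_mat) auto
      then show "part (insert qa S) q' $$ (b, l) = (part S \<oplus>\<^bsub>F r j\<^esub> (?X \<odot>\<^bsub>F r j\<^esub> \<epsilon> q a)) q' $$ (b, l)"
        unfolding E M using bl q' insert.hyps(2) by (auto simp: part_def qa)
    qed
    then have "part (insert qa S) = part S \<oplus>\<^bsub>F r j\<^esub> (?X \<odot>\<^bsub>F r j\<^esub> \<epsilon> q a)"
      unfolding part_def F_def free_gmod_simps by (auto simp: fun_eq_iff)
    then have "H (part (insert qa S)) = H (part S) \<oplus>\<^bsub>V\<^esub> ?X \<odot>\<^bsub>V\<^esub> H (\<epsilon> q a)"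
      using Hadd[OF partF XF] Hlin[OF X \<epsilon>(2)] by metis
    then have "coords (H (part (insert qa S))) t 0 = coords (H (part S)) t 0 + coords (H (\<epsilon> q a)) t a * \<phi> 0 q $$ (a, 0)"
      using coords_add[OF HV[OF partF] V_smult_closed[OF HV[OF \<epsilon>(2)] X] t n0, of S q a]
        coords_elem[OF HV[OF \<epsilon>(2)] x q(2) n0 t n0, of q a] by simp
    then show ?case using insert by (simp add: qa add.commute)
  qed
  have full: "part ({..<r} \<times> {..<n}) = matrix_element 1 0 0 \<odot>\<^bsub>F r j\<^esub> \<phi> 0"
  proof
    fix q
    show "part ({..<r} \<times> {..<n}) q = (matrix_element 1 0 0 \<odot>\<^bsub>F r j\<^esub> \<phi> 0) q"
    proof (cases "q < r")
      case True
      have C: "\<phi> 0 q * matrix_element 1 0 0 \<in> carrier_mat n n"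
        using A_mult_closed[OF \<phi>A[OF True] elem_A[OF one]] by (simp add: A_simps(1))
      have "mat n n (\<lambda>(a, l). if (q, a) \<in> {..<r} \<times> {..<n} \<and> l = 0 then \<phi> 0 q $$ (a, 0) else 0) = \<phi> 0 q * matrix_element 1 0 0"
      proof (rule eq_matI)
        fix a l assume "a < dim_row (\<phi> 0 q * matrix_element 1 0 0)" "l < dim_col (\<phi> 0 q * matrix_element 1 0 0)"
        then have al: "a < n" "l < n" using C by auto
        show "mat n n (\<lambda>(a, l). if (q, a) \<in> {..<r} \<times> {..<n} \<and> l = 0 then \<phi> 0 q $$ (a, 0) else 0) $$ (a, l)
            = (\<phi> 0 q * matrix_element 1 0 0) $$ (a, l)"
          unfolding mult_elem[OF \<phi>A[OF True] n0 n0 al] using True al by simp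
      qed (unfold carrier_matD[OF C], simp_all)
      then show ?thesis using True unfolding part_def F_def free_gmod_simps by simp
    qed (simp add: part_def F_def free_gmod_simps)
  qed
  have "coords (H (part ({..<r} \<times> {..<n}))) t 0 = coords (H (\<phi> 0)) t 0"
    unfolding full Hlin[OF elem_A[OF one] \<phi>F] using coords_elem[OF HV[OF \<phi>F] one n0 n0 t n0] by simp
  then have "(\<Sum>(q, a)\<in>{..<r} \<times> {..<n}. coords (H (\<epsilon> q a)) t a * \<phi> 0 q $$ (a, 0)) \<noteq> 0"
    using expand[of "{..<r} \<times> {..<n}"] nz by (simp add: \<phi>_def)
  then obtain qa where "qa \<in> {..<r} \<times> {..<n}" "(case qa of (q, a) \<Rightarrow> coords (H (\<epsilon> q a)) t a * \<phi> 0 q $$ (a, 0)) \<noteq> 0"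
    by (meson sum.neutral)
  then obtain q a where q: "q < r" "a < n" and nzH: "coords (H (\<epsilon> q a)) t a \<noteq> 0" and nz\<phi>: "\<phi> 0 q $$ (a, 0) \<noteq> 0"
    by (cases qa) auto
  have "expo t a \<le> - j q"
  proof -
    obtain c where "coords (H (\<epsilon> q a)) t a = Poly_Mapping.single (- j q) c"
      using coords_homog[OF Hdeg[OF \<epsilon>(1)]] t q(2) unfolding homogeneous_def by blast
    moreover have "coords (H (\<epsilon> q a)) t a \<in> Rx (expo t a)"
      using coords_good[OF HV[OF \<epsilon>(2)]] t q(2) unfolding in_summands_def by blast
    ultimately show ?thesis using nzH by (auto simp: Rx_single single_eq_0)
  qed
  then have expo_t: "expo t l \<le> - j q + d a l" if "l < n" for l
    using expo_triangle[OF t that q(2)] by linarith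
  \<comment> \<open>By \<open>gen_connect\<close> the entry \<open>(a, l)\<close> of \<open>\<phi> l q\<close> is nonzero for every \<open>l\<close>; it is homogeneous of degree \<open>expo s l + j q\<close>.\<close>
  have expo_s: "d a l \<le> expo s l + j q" if l: "l < n" for l
  proof -
    let ?x = "Poly_Mapping.single (d 0 l + expo s l) (1 :: 'k)" and ?y = "Poly_Mapping.single (d 0 l + expo s 0) (1 :: 'k)"
    have x: "?x \<in> Rx (d 0 l)" and y: "?y \<in> Rx (d l l)"
      using expo_nonneg d_nonneg by (auto simp: Rx_single d_self)
    have "matrix_element ?x 0 l \<odot>\<^bsub>F r j\<^esub> \<phi> 0 = matrix_element ?y l l \<odot>\<^bsub>F r j\<^esub> \<phi> l"
      unfolding \<phi>_def using gen_connect[OF s n0 l] Glin[OF elem_A[OF x] gen_carrier] Glin[OF elem_A[OF y] gen_carrier] by metis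
    then have "(matrix_element ?x 0 l \<odot>\<^bsub>F r j\<^esub> \<phi> 0) q $$ (a, l) = (matrix_element ?y l l \<odot>\<^bsub>F r j\<^esub> \<phi> l) q $$ (a, l)" by simp
    then have "(\<phi> 0 q * matrix_element ?x 0 l) $$ (a, l) = (\<phi> l q * matrix_element ?y l l) $$ (a, l)"
      using q unfolding F_def free_gmod_simps by simp
    then have "\<phi> 0 q $$ (a, 0) * ?x = \<phi> l q $$ (a, l) * ?y"
      using mult_elem[OF \<phi>A[OF q(1)] n0 l q(2) l] mult_elem[OF \<phi>A[OF q(1)] l l q(2) l] by simp
    moreover have "\<phi> 0 q $$ (a, 0) * ?x \<noteq> 0"
      using nz\<phi> single_cancel(2)[of "\<phi> 0 q $$ (a, 0)" "d 0 l + expo s l"] by auto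
    ultimately have nzl: "\<phi> l q $$ (a, l) \<noteq> 0" by auto
    have "\<phi> l \<in> mcomp (F r j) (expo s l)" unfolding \<phi>_def by (rule Gdeg[OF gen_mcomp])
    then have "\<phi> l q \<in> mat_comp n n (expo s l + j q)"
      using q(1) unfolding F_def free_gmod_simps by (auto simp: A_simps(2))
    then obtain c where "\<phi> l q $$ (a, l) = Poly_Mapping.single (expo s l + j q) c"
      using q(2) l unfolding mat_comp_iff by blast
    then show ?thesis using nzl \<phi>R[OF q l, of l] by (auto simp: Rx_single single_eq_0)
  qed
  have "j q \<le> 0" using \<open>expo t a \<le> - j q\<close> expo_nonneg[of t a] by linarith
  moreover obtain l0 where "l0 < n" "expo s l0 = 0" using expo_zero_entry[OF s] by blast
  then have "0 \<le> j q" using expo_s[of l0] d_nonneg[of a l0] by linarith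
  ultimately have j0: "j q = 0" by linarith
  have a0: "d a l = 0" if "l < n" for l
    using row_below_summand[OF q(2) s _ that] expo_s j0 by simp
  have "t = None" using expo_zero[OF t] expo_t a0 j0 by simp
  then show ?thesis using a0 q(2) unfolding row_module_projective_def by blast
qed

end

context cyclic_weights
begin

lemma proj_null_zero:
  fixes c :: "(nat \<times> int) option \<Rightarrow> (nat \<times> int) option \<Rightarrow> 'k::field"
  assumes null: "scalar_endo c \<in> proj_null n d V" and s: "s \<in> stable_indices" and t: "t \<in> stable_indices"
  shows "c t s = 0"
proof (rule ccontr)
  assume nz: "c t s \<noteq> 0"
  have ts: "t \<in> T" "s \<in> T" using s t live_T by auto
  have n0: "0 < n" using n_pos by simp
  obtain P :: "('k laurent mat, nat \<Rightarrow> 'k laurent mat) graded_module" and g h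
    where gp: "graded_projective A P" and g: "g \<in> ghom A V P" and h: "h \<in> ghom A P V"
      and f: "scalar_endo c = compose (carrier V) h g"
    using null unfolding proj_null_def by blast
  obtain r j where "\<exists>i\<in>ghom A P (free_gmod r j). \<exists>p\<in>ghom A (free_gmod r j) P. \<forall>m\<in>carrier P. p (i m) = m"
    using gp unfolding graded_projective_def Let_def free_gmod_def by blast
  then obtain i p where i: "i \<in> ghom A P (free_gmod r j)" and p: "p \<in> ghom A (free_gmod r j) P"
    and pi: "\<And>m. m \<in> carrier P \<Longrightarrow> p (i m) = m" by blast
  have gE: "v \<in> carrier V \<Longrightarrow> g v \<in> carrier P" for v using g by (auto simp: ghom_def rhom_def)
  have iE: "v \<in> carrier P \<Longrightarrow> i v \<in> carrier (free_gmod r j)" for v using i by (auto simp: ghom_def rhom_def)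
  have pE: "v \<in> carrier (free_gmod r j) \<Longrightarrow> p v \<in> carrier P" for v using p by (auto simp: ghom_def rhom_def)
  have "(gen s 0 :: _ \<Rightarrow> 'k laurent mat) \<in> carrier V" by (rule gen_carrier)
  then have "h (p (i (g (gen s 0)))) = scalar_endo c (gen s 0)"
    unfolding f using pi[OF gE] by (simp add: compose_def)
  moreover have "coords (scalar_endo c (gen s 0)) t 0 = Poly_Mapping.single (expo s 0) (c t s)"
    by (rule coords_scalar_endo_gen[OF ts n0])
  ultimately have "coords (h (p (i (g (gen s 0))))) t 0 \<noteq> 0" using nz by (simp add: single_eq_0)
  moreover have "i (g v) \<in> mcomp (free_gmod r j) e" if v: "v \<in> mcomp V e" for v e
  proof -
    have "g v \<in> mcomp P e" using g v unfolding ghom_def by blast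
    then show ?thesis using i unfolding ghom_def by blast
  qed
  moreover have "h (p v) \<in> mcomp V e" if v: "v \<in> mcomp (free_gmod r j) e" for v e
  proof -
    have "p v \<in> mcomp P e" using p v unfolding ghom_def by blast
    then show ?thesis using h unfolding ghom_def by blast
  qed
  moreover have "i (g v) \<in> carrier (free_gmod r j)" if "v \<in> carrier V" for v by (rule iE[OF gE[OF that]])
  moreover have "i (g (X \<odot>\<^bsub>V\<^esub> v)) = X \<odot>\<^bsub>free_gmod r j\<^esub> i (g v)" if "X \<in> carrier A" "v \<in> carrier V" for X v
    using g i gE that by (simp add: ghom_def rhom_def)
  moreover have "h (p v) \<in> carrier V" if v: "v \<in> carrier (free_gmod r j)" for v
    using h pE[OF v] by (auto simp: ghom_def rhom_def)
  moreover have "h (p (v \<oplus>\<^bsub>free_gmod r j\<^esub> w)) = h (p v) \<oplus>\<^bsub>V\<^esub> h (p w)"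
    if "v \<in> carrier (free_gmod r j)" "w \<in> carrier (free_gmod r j)" for v w
    using h p pE that by (simp add: ghom_def rhom_def)
  moreover have "h (p (X \<odot>\<^bsub>free_gmod r j\<^esub> v)) = X \<odot>\<^bsub>V\<^esub> h (p v)"
    if "X \<in> carrier A" "v \<in> carrier (free_gmod r j)" for X v
    using h p pE that by (simp add: ghom_def rhom_def)
  ultimately have "row_module_projective \<and> t = None"
    using factor_through_free[where G = "\<lambda>v. i (g v)" and H = "\<lambda>v. h (p v)", OF _ _ _ _ _ _ _ ts(2,1)] by blast
  then show False using t by (simp add: stable_indices_def W_def)
qed

text \<open>If \<open>[R \<dots> R]\<close> is projective, the only components left are those from some summand \<open>s\<close> to \<open>None\<close>, and they
  factor through \<open>[R \<dots> R] = e\<^sub>rA\<close>. Otherwise the endomorphism is zero, and any projective will do.\<close>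

lemma zero_proj_null:
  fixes c :: "(nat \<times> int) option \<Rightarrow> (nat \<times> int) option \<Rightarrow> 'k::field"
  assumes c: "c \<in> PT.Inc" and z: "\<And>t s. t \<in> stable_indices \<Longrightarrow> s \<in> stable_indices \<Longrightarrow> c t s = 0"
  shows "scalar_endo c \<in> proj_null n d V"
proof -
  have "\<exists>r<n. row_module_projective \<longrightarrow> (\<forall>l<n. d r l = 0)" using n_pos by (auto simp: row_module_projective_def Suc_le_eq)
  then obtain r0 where r0: "r0 < n" "row_module_projective \<Longrightarrow> \<forall>l<n. d r0 l = 0" by blast
  let ?P = "row_projective r0 :: ('k laurent mat, _) graded_module"
  have N: "None \<in> T" by (simp add: T_def)
  have cz: "c t s = 0" if "t \<noteq> None" for t s
  proof (cases "t \<in> T \<and> s \<in> T")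
    case True
    then have t: "t \<in> W" using live_T(3) that by auto
    show ?thesis
    proof (cases "s = None")
      case True
      then show ?thesis using not_below_None[OF t] PT.Inc_outside[OF c] by blast
    next
      case False
      then have "s \<in> W" using live_T(3) True by auto
      then show ?thesis using z t live_T(2) by blast
    qed
  qed (use PT.Inc_outside[OF c] in blast)
  have PV: "scalar_endo c v \<in> carrier V" if "v \<in> carrier V" for v by (rule scalar_endo_closed[OF c that])
  have PH: "scalar_endo c \<in> ghom A V V" by (rule scalar_endo_ghom[OF c])
  have Rx_N: "coords (scalar_endo c v) None l \<in> Rx (d r0 l)" if v: "v \<in> carrier V" and l: "l < n" for v l
  proof (cases row_module_projective)
    case True
    have "coords (scalar_endo c v) None l \<in> Rx (expo None l)" using coords_good[OF PV[OF v]] N l unfolding in_summands_def by blast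
    then show ?thesis using r0(2)[OF True] l by (simp add: expo_def)
  next
    case False
    then have "stable_indices = T" by (simp add: stable_indices_def)
    then have "coords (scalar_endo c v) None l = 0" using z N by (simp add: coords_scalar_endo[OF v N l])
    then show ?thesis by simp
  qed
  define g where "g = (\<lambda>v\<in>carrier V. row_vec (coords (scalar_endo c v) None))"
  define h where "h = (\<lambda>f\<in>carrier ?P. from_coords (\<lambda>t l. if t = None then row_entry f l else 0))"
  have gP: "g v \<in> carrier ?P" if v: "v \<in> carrier V" for v
    unfolding g_def using v Rx_N by (simp add: prow_carrierI)
  have g: "g \<in> ghom A V ?P"
    unfolding ghom_def rhom_def
  proof (intro CollectI conjI ballI allI)
    show "g \<in> carrier V \<rightarrow>\<^sub>E carrier ?P" by (rule PiE_I[OF gP]) (simp_all add: g_def)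
    fix v w :: "(nat \<times> int) option \<Rightarrow> 'k laurent mat" assume vw: "v \<in> carrier V" "w \<in> carrier V"
    have "scalar_endo c (v \<oplus>\<^bsub>V\<^esub> w) = scalar_endo c v \<oplus>\<^bsub>V\<^esub> scalar_endo c w" using PH vw by (simp add: ghom_def rhom_def)
    then show "g (v \<oplus>\<^bsub>V\<^esub> w) = g v \<oplus>\<^bsub>?P\<^esub> g w"
      using vw V_add_closed[OF vw] coords_add[OF PV PV N] unfolding g_def by (simp add: prow_ops vec_eq)
  next
    fix X :: "'k laurent mat" and v :: "(nat \<times> int) option \<Rightarrow> 'k laurent mat"
    assume X: "X \<in> carrier A" and v: "v \<in> carrier V"
    have "scalar_endo c (X \<odot>\<^bsub>V\<^esub> v) = X \<odot>\<^bsub>V\<^esub> scalar_endo c v" using PH X v by (simp add: ghom_def rhom_def)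
    then show "g (X \<odot>\<^bsub>V\<^esub> v) = X \<odot>\<^bsub>?P\<^esub> g v"
      using V_smult_closed[OF v X] coords_smult[OF PV[OF v] X N] v unfolding g_def by (simp add: prow_ops vec_eq)
  next
    fix e
    show "g ` mcomp V e \<subseteq> mcomp ?P e"
    proof
      fix f assume "f \<in> g ` mcomp V e"
      then obtain v where v: "v \<in> mcomp V e" "f = g v" by auto
      have vV: "v \<in> carrier V" by (rule mcomp_carrier[OF v(1)])
      have "scalar_endo c v \<in> mcomp V e" using PH v(1) unfolding ghom_def by blast
      then have "\<exists>a. coords (scalar_endo c v) None l = Poly_Mapping.single e a" if "l < n" for l
        using coords_homog N that unfolding homogeneous_def by blast
      then show "f \<in> mcomp ?P e"
        using vV Rx_N[OF vV] unfolding v(2) g_def prow_mcomp by auto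
    qed
  qed
  have hgood: "in_summands (\<lambda>t l. if t = None then w l else 0)" if w: "\<forall>l<n. w l \<in> Rx (d r0 l)" for w :: "nat \<Rightarrow> 'k laurent"
    using w d_nonneg[of r0] by (auto simp: in_summands_def expo_def intro: Rx_mono)
  have h_vec: "h (row_vec w) = from_coords (\<lambda>t l. if t = None then w l else 0)" if w: "\<forall>l<n. w l \<in> Rx (d r0 l)" for w
    unfolding h_def using w by (auto simp: prow_carrierI intro!: fromc_cong)
  have hV: "h f \<in> carrier V" if "f \<in> carrier ?P" for f
    using that hgood h_vec by (auto simp: prow_carrier fromc_carrier)
  interpret P: right_module A ?P by (rule right_module_prow[OF r0(1)])
  have h: "h \<in> ghom A ?P V"
    unfolding ghom_def rhom_def
  proof (intro CollectI conjI ballI allI)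
    show "h \<in> carrier ?P \<rightarrow>\<^sub>E carrier V" by (rule PiE_I[OF hV]) (simp_all add: h_def)
    fix f f' assume ff: "f \<in> carrier ?P" "f' \<in> carrier ?P"
    then obtain v w where w: "f = row_vec v" "f' = row_vec w" "\<forall>l<n. v l \<in> Rx (d r0 l)" "\<forall>l<n. w l \<in> Rx (d r0 l)"
      by (auto simp: prow_carrier)
    have vw: "\<forall>l<n. v l + w l \<in> Rx (d r0 l)" using w by (auto simp: Rx_add)
    show "h (f \<oplus>\<^bsub>?P\<^esub> f') = h f \<oplus>\<^bsub>V\<^esub> h f'"
      unfolding w(1,2) prow_ops h_vec[OF vw] h_vec[OF w(3)] h_vec[OF w(4)]
      using fromc_carrier[OF hgood[OF w(3)]] fromc_carrier[OF hgood[OF w(4)]]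
      by (subst V_add) (auto intro!: fromc_cong)
  next
    fix X :: "'k laurent mat" and f assume X: "X \<in> carrier A" and "f \<in> carrier ?P"
    then obtain w where w: "f = row_vec w" "\<forall>l<n. w l \<in> Rx (d r0 l)" by (auto simp: prow_carrier)
    have Xw: "\<forall>l<n. (\<Sum>l'<n. w l' * X $$ (l', l)) \<in> Rx (d r0 l)" using smult_Rx[OF X r0(1) _ w(2)] by blast
    show "h (X \<odot>\<^bsub>?P\<^esub> f) = X \<odot>\<^bsub>V\<^esub> h f"
      unfolding w(1) prow_ops h_vec[OF Xw] h_vec[OF w(2)] V_smult[OF fromc_carrier[OF hgood[OF w(2)]] X]
      by (auto intro!: fromc_cong)
  next
    fix e
    show "h ` mcomp ?P e \<subseteq> mcomp V e"
    proof
      fix f assume "f \<in> h ` mcomp ?P e"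
      then obtain w where w: "f = h (row_vec w)" "\<forall>l<n. w l \<in> Rx (d r0 l)" "\<forall>l<n. \<exists>c. w l = Poly_Mapping.single e c"
        by (auto simp: prow_mcomp)
      have "homogeneous e (\<lambda>t l. if t = None then w l else 0)"
        using w(3) by (auto simp: homogeneous_def intro: exI[of _ 0])
      then show "f \<in> mcomp V e" unfolding w(1) h_vec[OF w(2)] using hgood[OF w(2)] by (simp add: mcompI)
    qed
  qed
  have "scalar_endo c v = h (g v)" if v: "v \<in> carrier V" for v
  proof (rule coords_eqI[OF PV[OF v] hV[OF gP[OF v]]])
    fix t l assume tl: "t \<in> T" "l < n"
    have "h (g v) = from_coords (\<lambda>t l. if t = None then coords (scalar_endo c v) None l else 0)"
      using v Rx_N[OF v] unfolding g_def by (simp add: h_vec)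
    moreover have "coords (scalar_endo c v) t l = 0" if "t \<noteq> None"
      using cz[OF that] by (simp add: coords_scalar_endo[OF v tl])
    ultimately show "coords (scalar_endo c v) t l = coords (h (g v)) t l" using tl by simp
  qed
  then have "scalar_endo c = compose (carrier V) h g"
    by (auto simp: compose_def scalar_endo_def[of c] fun_eq_iff)
  then show ?thesis
    unfolding proj_null_def using g h PH CM_prow[OF r0(1)] graded_projective_prow[OF r0(1)] by blast
qed

interpretation LV: finite_preorder stable_indices below
proof
  show "finite stable_indices" by (rule finite_subset[OF live_T(1) PT.finite_L])
  show "below t t" if "t \<in> stable_indices" for t by (simp add: below_def)
  show "below t r" if "below t s" "below s r" for t s r using that by (force simp: below_def)
qed

definition restrict_stable :: "((nat \<times> int) option \<Rightarrow> (nat \<times> int) option \<Rightarrow> 'k::field) \<Rightarrow> (nat \<times> int) option \<Rightarrow> (nat \<times> int) option \<Rightarrow> 'k"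
  where "restrict_stable c t s = (if t \<in> stable_indices \<and> s \<in> stable_indices then c t s else 0)"

text \<open>Deleting the bottom element is multiplicative: a product passing through \<open>None\<close> would need a nonzero component
  from \<open>None\<close> to a summand that is not below it.\<close>

lemma res_hom: "restrict_stable \<in> ring_hom (inc_ring T below) (inc_ring stable_indices below :: (_ \<Rightarrow> _ \<Rightarrow> 'k::field) ring)"
proof (rule ring_hom_memI)
  let ?I = "inc_ring T below :: ((nat \<times> int) option \<Rightarrow> _ \<Rightarrow> 'k) ring" and ?J = "inc_ring stable_indices below :: ((nat \<times> int) option \<Rightarrow> _ \<Rightarrow> 'k) ring"
  fix c c' assume c: "c \<in> carrier ?I" and c': "c' \<in> carrier ?I"
  show "restrict_stable c \<in> carrier ?J" using c by (auto simp: LV.Inc_iff PT.Inc_iff restrict_stable_def)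
  show "restrict_stable (c \<oplus>\<^bsub>?I\<^esub> c') = restrict_stable c \<oplus>\<^bsub>?J\<^esub> restrict_stable c'" by (auto simp: restrict_stable_def inc_ring_def fun_eq_iff)
  have "(\<Sum>r\<in>T. c t r * c' r s) = (\<Sum>r\<in>stable_indices. c t r * c' r s)" if ts: "t \<in> stable_indices" "s \<in> stable_indices" for t s
  proof (rule sum.mono_neutral_right[OF PT.finite_L live_T(1)], intro ballI)
    fix r assume r: "r \<in> T - stable_indices"
    then have "stable_indices = W" "r = None" using live_T(3) by (auto simp: stable_indices_def split: if_splits)
    then have "c t r = 0" using not_below_None[of t] PT.Inc_outside[OF c, of t r] ts by auto
    then show "c t r * c' r s = 0" by simp
  qed
  then show "restrict_stable (c \<otimes>\<^bsub>?I\<^esub> c') = restrict_stable c \<otimes>\<^bsub>?J\<^esub> restrict_stable c'"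
    unfolding PT.inc_mult LV.inc_mult by (auto simp: restrict_stable_def fun_eq_iff)
next
  show "restrict_stable \<one>\<^bsub>inc_ring T below\<^esub> = \<one>\<^bsub>inc_ring stable_indices below\<^esub>"
    using live_T(1) by (auto simp: restrict_stable_def inc_ring_def fun_eq_iff)
qed

text \<open>Restriction of the scalars to the stable indices is a surjective ring homomorphism, and its kernel
  consists of the endomorphisms that factor through a projective.\<close>

lemma stable_End_iso:
  "ring (stable_End n d (V :: ('k::field laurent mat, _) graded_module))"
  "\<exists>\<chi>. \<chi> \<in> ring_iso (stable_End n d (V :: ('k laurent mat, _) graded_module)) (inc_ring stable_indices below :: (_ \<Rightarrow> _ \<Rightarrow> 'k) ring)"
proof -
  let ?I = "inc_ring T below :: ((nat \<times> int) option \<Rightarrow> _ \<Rightarrow> 'k) ring" and ?J = "inc_ring stable_indices below :: ((nat \<times> int) option \<Rightarrow> _ \<Rightarrow> 'k) ring"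
  let ?G = "gEnd A (V :: ('k laurent mat, _) graded_module)"
  define \<theta> where "\<theta> = restrict_stable \<circ> inv_into (carrier ?I) scalar_endo"
  have "inv_into (carrier ?I) scalar_endo \<in> ring_iso ?G ?I"
    by (rule ring_iso_set_sym[OF PT.ring_inc_ring scalar_endo_ring_iso])
  then have "inv_into (carrier ?I) scalar_endo \<in> ring_hom ?G ?I" by (simp add: ring_iso_def)
  then have \<theta>: "\<theta> \<in> ring_hom ?G ?J" unfolding \<theta>_def by (rule ring_hom_trans[OF _ res_hom])
  have inj: "inj_on scalar_endo (carrier ?I)" by (intro inj_onI scalar_endo_inj)
  have \<theta>_scalar_endo: "\<theta> (scalar_endo c) = restrict_stable c" if "c \<in> carrier ?I" for c
    by (simp add: \<theta>_def inv_into_f_f[OF inj that])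
  interpret h: ring_hom_ring ?G ?J \<theta> by (rule ring_hom_ringI2[OF ring_gEnd LV.ring_inc_ring \<theta>])
  have ex: "\<exists>c\<in>carrier ?I. f = scalar_endo c" if "f \<in> carrier ?G" for f
    using that ghom_scalar_endo[of f] by (simp add: gEnd_def)
  have kernel: "a_kernel ?G ?J \<theta> = proj_null n d V"
  proof (intro equalityI subsetI)
    fix f assume "f \<in> a_kernel ?G ?J \<theta>"
    then have f: "f \<in> carrier ?G" "\<theta> f = \<zero>\<^bsub>?J\<^esub>" unfolding a_kernel_def' by blast+
    obtain c where c: "c \<in> carrier ?I" "f = scalar_endo c" using ex[OF f(1)] by blast
    have z: "restrict_stable c = 0" using f(2) unfolding c(2) \<theta>_scalar_endo[OF c(1)] by (simp only: inc_ring_def ring.simps)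
    have "c t s = 0" if "t \<in> stable_indices" "s \<in> stable_indices" for t s
      using fun_cong[OF fun_cong[OF z, of t], of s] that by (simp add: restrict_stable_def)
    then show "f \<in> proj_null n d V" unfolding c(2) by (rule zero_proj_null[OF c(1)])
  next
    fix f assume f: "f \<in> proj_null n d (V :: ('k laurent mat, _) graded_module)"
    have "f \<in> ghom A V V" using f unfolding proj_null_def by blast
    then have fG: "f \<in> carrier ?G" by (simp only: gEnd_def partial_object.simps)
    obtain c where c: "c \<in> carrier ?I" "f = scalar_endo c" using ex[OF fG] by blast
    have "restrict_stable c = 0"
      using proj_null_zero[of c] f unfolding c(2) by (auto simp: restrict_stable_def fun_eq_iff)
    then have "\<theta> f = \<zero>\<^bsub>?J\<^esub>" unfolding c(2) \<theta>_scalar_endo[OF c(1)] by (simp only: inc_ring_def ring.simps)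
    then show "f \<in> a_kernel ?G ?J \<theta>" using fG unfolding a_kernel_def' by blast
  qed
  have surj: "\<theta> ` carrier ?G = carrier ?J"
  proof (intro equalityI subsetI)
    fix c assume c: "c \<in> carrier ?J"
    then have cI: "c \<in> carrier ?I" using live_T(1) by (auto simp: LV.Inc_iff PT.Inc_iff)
    have "restrict_stable c = c" using LV.Inc_outside[OF c] by (auto simp: restrict_stable_def fun_eq_iff)
    then have "c = \<theta> (scalar_endo c)" unfolding \<theta>_scalar_endo[OF cI] by (rule sym)
    moreover have "scalar_endo c \<in> carrier ?G" using scalar_endo_ghom[OF cI] by (simp only: gEnd_def partial_object.simps)
    ultimately show "c \<in> \<theta> ` carrier ?G" by (rule image_eqI)
  next
    fix c assume "c \<in> \<theta> ` carrier ?G"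
    then show "c \<in> carrier ?J" using ring_hom_closed[OF \<theta>] by blast
  qed
  have S: "stable_End n d V = ?G Quot a_kernel ?G ?J \<theta>" unfolding stable_End_def kernel ..
  show "ring (stable_End n d (V :: ('k laurent mat, _) graded_module))"
    unfolding S by (rule ideal.quotient_is_ring[OF h.kernel_is_ideal])
  show "\<exists>\<chi>. \<chi> \<in> ring_iso (stable_End n d (V :: ('k laurent mat, _) graded_module)) ?J"
    unfolding S using h.FactRing_iso_set[OF surj] by blast
qed

theorem stable_End_gl_dim:
  "gl_dim TYPE('m) (stable_End n d (V :: ('k::field laurent mat, _) graded_module)) \<le> 2"
proof -
  obtain \<chi> where \<chi>: "\<chi> \<in> ring_iso (stable_End n d (V :: ('k laurent mat, _) graded_module)) (inc_ring stable_indices below :: (_ \<Rightarrow> _ \<Rightarrow> 'k) ring)"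
    using stable_End_iso(2) by blast
  show ?thesis
    by (rule incidence_gl_dim[OF grid_poset_axioms _ _ stable_End_iso(1) \<chi>]) (use live_T in auto)
qed

end

theorem proposition5p8:
  fixes n :: nat and m :: "nat \<Rightarrow> nat"
  assumes "n \<ge> 1" and "\<exists>i<n. m i \<noteq> 0"
  shows "ring (Gamma_alg TYPE('k::field) n (cyc_exponent n m)) \<and>
    gl_dim TYPE('m) (Gamma_alg TYPE('k) n (cyc_exponent n m)) \<le> 2"
proof -
  interpret cyclic_weights n m by (rule cyclic_weights.intro[OF assms])
  show ?thesis
    unfolding Gamma_alg_def using stable_End_iso(1) stable_End_gl_dim by blast
qed

end
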